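(* Let $0<\alpha<1$, let $\nu\in\mathcal G_\alpha$ and let $(a_n)_{n\ge1}$ be a normalizing sequence that is regularly varying of index $\alpha$. Then there exist a (topologically mixing) countable Markov shift $(\Omega,T)$ endowed with a null recurrent potential $\phi$ satisfying Walters' condition and $P_G(\phi)<+\infty$, whose associated invariant measure $\mu$ makes $(\Omega,T,\mu)$ pointwise dual ergodic with normalizing sequence $(a_n)$, and a point $x\in\Omega$ with $|\mathcal O(x)\cap[x_0]|<+\infty$ such that, with $B_n:=[x_0^{n-1}]$ for $n\ge1$ and $j_{x_0}:=\max\{k\ge0:T^kx\in[x_0]\}$, $$\gamma(\mu(B_n))\,r_{[x_0]}\circ T^{j_{x_0}}$$ converges in law under $\mu_{B_n}$, as $n\to+\infty$, to a random variable $W$ of law $\nu$.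
   Context: $\mathcal G_\alpha$ is the set of probability measures $\nu$ on $\mathbb R_+=[0,\infty)$ such that for all $s>t>0$, $$\nu((t,+\infty))\le1\wedge\frac{\sin(\pi\alpha)}{\pi\alpha}t^{-\alpha}\quad\text{and}\quad\nu((t,s])\le\frac{\sin(\pi\alpha)}{\pi\alpha}\big(t^{-\alpha}-s^{-\alpha}\big).$$ Topological Markov shifts. Let $V$ be an at most countable alphabet and $A:V\times V\to\{0,1\}$ a transition matrix. $\Omega=\{x=(x_n)_{n\ge0}\in V^{\mathbb N}: A(x_n,x_{n+1})=1\ \forall n\ge0\}$, $T$ is the left shift, topology given by $d(x,y)=\eta^{\min\{n\ge0:x_n\ne y_n\}}$, $\eta\in(0,1)$ fixed; this is a countable Markov shift (CMS) when $V$ is infinite. A word $v_0^{n-1}=(v_0,\dots,v_{n-1})$ is admissible if $A(v_i,v_{i+1})=1$ for all $i$; $[v_0^{n-1}]=\{x\in\Omega:x_i=v_i,\ 0\le i<n\}$. Topologically mixing: for all $v,w\in V$ there is $N$ such that for all $n\ge N$ there is an admissible path of $n$ steps from $v$ to $w$. $|\mathcal O(x)\cap[v]|$ denotes the number of visits $\#\{k\ge0:T^kx\in[v]\}$. Potentials. $\phi:\Omega\to\mathbb R$ is measurable, $S_n\phi=\sum_{k=0}^{n-1}\phi\circ T^k$, $\mathrm{var}_n(\phi)=\sup\{|\phi(x)-\phi(y)|:x_0^{n-1}=y_0^{n-1}\}$. Walters' condition: for all $k\ge1$, $W_k(\phi):=\sup_{n\ge1}\mathrm{var}_{n+k}(S_n\phi)<\infty$,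 and $W_k(\phi)\to0$ as $k\to\infty$. For measurable $B$, $r_B(x)=\inf\{n\ge1:T^nx\in B\}$. $Z_n(\phi,v)=\sum_{T^nx=x}e^{S_n\phi(x)}\mathbf 1_{[v]}(x)$, $Z_n^*(\phi,v)=\sum_{T^nx=x}e^{S_n\phi(x)}\mathbf 1_{\{r_{[v]}=n\}}(x)\mathbf 1_{[v]}(x)$. $P_G(\phi)=\lim_n\frac1n\log Z_n(\phi,v)$ (independent of $v$), $\lambda_\phi=e^{P_G(\phi)}$. $\phi$ is null recurrent if $\sum_n\lambda_\phi^{-n}Z_n(\phi,v)=\infty$ and $\sum_n n\lambda_\phi^{-n}Z_n^*(\phi,v)=\infty$ for some (all) $v$. Then, with $L_\phi f(x)=\sum_{Ty=x}e^{\phi(y)}f(y)$, there are a continuous $h_\phi>0$ and a conservative measure $\nu_\phi$, finite on cylinders, with $L_\phi h_\phi=\lambda_\phi h_\phi$, $L_\phi^*\nu_\phi=\lambda_\phi\nu_\phi$, $\int h_\phi\,d\nu_\phi=+\infty$; $\mu=h_\phi\nu_\phi$ (unique up to a positive multiple) is a conservative ergodic shift-invariant $\sigma$-finite infinite measure. Pointwise dual ergodic with normalizing sequence $(a_n)$: with $\widehat T$ the transfer operator ($\int f\cdot g\circ T\,d\mu=\int(\widehat Tf)g\,d\mu$), $\frac1{a_n}\sum_{k=0}^{n-1}\widehat T^kf\to\int f\,d\mu$ $\mu$-a.e. for all $f\in L^1(\mu)$. Scaling. With $a(s)=a_{\lfloor s\rfloor}$ and $a^{\leftarrow}(y)=\inf\{s\ge0:a(s)>y\}$,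 put $\gamma(s)=1/a^{\leftarrow}(1/s)$. $\mu_B=\mu(\cdot\cap B)/\mu(B)$. *)

theory Defs
  imports "HOL-Probability.Probability"
begin

section \<open>Measure-preserving systems with infinite measure\<close>

text \<open>Wandering sets are those whose preimages under the iterates are pairwise disjoint.\<close>

definition conservative :: "'a measure \<Rightarrow> ('a \<Rightarrow> 'a) \<Rightarrow> bool" where
  "conservative M T \<longleftrightarrow>
     (\<forall>A\<in>sets M. disjoint_family (\<lambda>n. (T ^^ n) -` A \<inter> space M) \<longrightarrow> emeasure M A = 0)"

definition ergodic :: "'a measure \<Rightarrow> ('a \<Rightarrow> 'a) \<Rightarrow> bool" where
  "ergodic M T \<longleftrightarrow>
     (\<forall>A\<in>sets M. T -` A \<inter> space M = A \<longrightarrow> emeasure M A = 0 \<or> emeasure M (space M - A) = 0)"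

definition measure_preserving_map :: "'a measure \<Rightarrow> ('a \<Rightarrow> 'a) \<Rightarrow> bool" where
  "measure_preserving_map M T \<longleftrightarrow> T \<in> measurable M M \<and> distr M M T = M"

text \<open>On a \<open>\<sigma>\<close>-finite space, duality determines the transfer operator only up to null sets;
  a version is chosen for each integrable function.\<close>

definition transfer_operator :: "'a measure \<Rightarrow> ('a \<Rightarrow> 'a) \<Rightarrow> ('a \<Rightarrow> real) \<Rightarrow> 'a \<Rightarrow> real" where
  "transfer_operator M T f =
     (SOME g. integrable M g \<and>
        (\<forall>u\<in>borel_measurable M. (\<exists>C. \<forall>x\<in>space M. \<bar>u x\<bar> \<le> C) \<longrightarrow>
           (LINT x|M. f x * u (T x)) = (LINT x|M. g x * u x)))"

definition pointwise_dual_ergodic :: "'a measure \<Rightarrow> ('a \<Rightarrow> 'a) \<Rightarrow> (nat \<Rightarrow> real) \<Rightarrow> bool" where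
  "pointwise_dual_ergodic M T a \<longleftrightarrow>
     sigma_finite_measure M \<and> measure_preserving_map M T \<and> conservative M T \<and> ergodic M T \<and>
     (\<forall>f. integrable M f \<longrightarrow>
        (AE x in M. (\<lambda>n. (\<Sum>k<n. (transfer_operator M T ^^ k) f x) / a n)
                      \<longlonglongrightarrow> (LINT y|M. f y)))"

definition return_time :: "('a \<Rightarrow> 'a) \<Rightarrow> 'a set \<Rightarrow> 'a \<Rightarrow> enat" where
  "return_time T B x = Inf {enat n |n. n \<ge> 1 \<and> (T ^^ n) x \<in> B}"

section \<open>Topological Markov shifts\<close>

text \<open>A transition matrix with entries in \<open>{0, 1}\<close> over the alphabet \<open>V\<close> is represented by the
  predicate \<open>A v w\<close>, expressing that the entry at \<open>(v, w)\<close> is 1.\<close>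

definition shift_space :: "'v set \<Rightarrow> ('v \<Rightarrow> 'v \<Rightarrow> bool) \<Rightarrow> (nat \<Rightarrow> 'v) set" where
  "shift_space V A = {x. \<forall>n. x n \<in> V \<and> A (x n) (x (Suc n))}"

definition left_shift :: "(nat \<Rightarrow> 'v) \<Rightarrow> nat \<Rightarrow> 'v" where
  "left_shift x = (\<lambda>n. x (Suc n))"

text \<open>An \<open>n\<close>-fold relational power is the existence of an admissible path of \<open>n\<close> steps.\<close>

definition topologically_mixing :: "'v set \<Rightarrow> ('v \<Rightarrow> 'v \<Rightarrow> bool) \<Rightarrow> bool" where
  "topologically_mixing V A \<longleftrightarrow>
     (\<forall>v\<in>V. \<forall>w\<in>V. \<exists>N. \<forall>n\<ge>N. (v, w) \<in> {(b, c). b \<in> V \<and> c \<in> V \<and> A b c} ^^ n)"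

definition seq_dist :: "real \<Rightarrow> (nat \<Rightarrow> 'v) \<Rightarrow> (nat \<Rightarrow> 'v) \<Rightarrow> real" where
  "seq_dist \<eta> x y = (if x = y then 0 else \<eta> ^ (LEAST n. x n \<noteq> y n))"

lemma Metric_space_seq_dist:
  assumes "0 < \<eta>" "\<eta> < 1"
  shows "Metric_space \<Omega> (seq_dist \<eta>)"
proof
  fix x y z :: "nat \<Rightarrow> 'a"
  have nonneg: "0 \<le> seq_dist \<eta> u v" for u v :: "nat \<Rightarrow> 'a"
    using assms by (simp add: seq_dist_def)
  have lower: "\<eta> ^ n \<le> seq_dist \<eta> u v" if "u n \<noteq> v n" for u v :: "nat \<Rightarrow> 'a" and n
  proof -
    have "(LEAST n. u n \<noteq> v n) \<le> n" using that by (rule Least_le)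
    moreover have "u \<noteq> v" using that by blast
    ultimately show ?thesis
      using assms by (simp add: seq_dist_def power_decreasing)
  qed
  show "0 \<le> seq_dist \<eta> x y" by (rule nonneg)
  show "seq_dist \<eta> x y = seq_dist \<eta> y x"
  proof -
    have "(\<lambda>n. x n \<noteq> y n) = (\<lambda>n. y n \<noteq> x n)" by (intro ext iffI) (erule not_sym)+
    then show ?thesis by (simp only: seq_dist_def eq_commute[of x y])
  qed
  show "seq_dist \<eta> x y = 0 \<longleftrightarrow> x = y"
    using assms by (simp add: seq_dist_def)
  show "seq_dist \<eta> x z \<le> seq_dist \<eta> x y + seq_dist \<eta> y z"
  proof (cases "x = z")
    case True
    then show ?thesis using nonneg[of x y] nonneg[of y z] by (simp add: seq_dist_def)
  next
    case False
    define n where "n = (LEAST n. x n \<noteq> z n)"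
    have "\<exists>n. x n \<noteq> z n"
      using False by (simp add: fun_eq_iff)
    then have "x n \<noteq> z n"
      unfolding n_def by (rule LeastI_ex)
    then have "x n \<noteq> y n \<or> y n \<noteq> z n" by auto
    then have "\<eta> ^ n \<le> seq_dist \<eta> x y \<or> \<eta> ^ n \<le> seq_dist \<eta> y z"
      using lower by blast
    moreover have "seq_dist \<eta> x z = \<eta> ^ n"
      using False by (simp add: seq_dist_def n_def)
    ultimately show ?thesis using nonneg[of x y] nonneg[of y z] by linarith
  qed
qed

abbreviation shift_topology :: "real \<Rightarrow> (nat \<Rightarrow> 'v) set \<Rightarrow> (nat \<Rightarrow> 'v) topology" where
  "shift_topology \<eta> \<Omega> \<equiv> Metric_space.mtopology \<Omega> (seq_dist \<eta>)"

definition shift_borel :: "real \<Rightarrow> (nat \<Rightarrow> 'v) set \<Rightarrow> (nat \<Rightarrow> 'v) measure" where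
  "shift_borel \<eta> \<Omega> = sigma \<Omega> {U. openin (shift_topology \<eta> \<Omega>) U}"

definition cylinder :: "(nat \<Rightarrow> 'v) set \<Rightarrow> 'v list \<Rightarrow> (nat \<Rightarrow> 'v) set" where
  "cylinder \<Omega> w = {x\<in>\<Omega>. \<forall>i<length w. x i = w ! i}"

section \<open>Potentials\<close>

definition birkhoff_sum :: "nat \<Rightarrow> ((nat \<Rightarrow> 'v) \<Rightarrow> real) \<Rightarrow> (nat \<Rightarrow> 'v) \<Rightarrow> real" where
  "birkhoff_sum n \<phi> x = (\<Sum>k<n. \<phi> ((left_shift ^^ k) x))"

definition variation :: "(nat \<Rightarrow> 'v) set \<Rightarrow> nat \<Rightarrow> ((nat \<Rightarrow> 'v) \<Rightarrow> real) \<Rightarrow> ennreal" where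
  "variation \<Omega> n \<phi> =
     (SUP (x, y)\<in>{(x, y). x \<in> \<Omega> \<and> y \<in> \<Omega> \<and> (\<forall>i<n. x i = y i)}. ennreal \<bar>\<phi> x - \<phi> y\<bar>)"

definition walters_constant :: "(nat \<Rightarrow> 'v) set \<Rightarrow> ((nat \<Rightarrow> 'v) \<Rightarrow> real) \<Rightarrow> nat \<Rightarrow> ennreal" where
  "walters_constant \<Omega> \<phi> k = (SUP n\<in>{1..}. variation \<Omega> (n + k) (birkhoff_sum n \<phi>))"

definition walters :: "(nat \<Rightarrow> 'v) set \<Rightarrow> ((nat \<Rightarrow> 'v) \<Rightarrow> real) \<Rightarrow> bool" where
  "walters \<Omega> \<phi> \<longleftrightarrow>
     (\<forall>k\<ge>1. walters_constant \<Omega> \<phi> k < \<infinity>) \<and> walters_constant \<Omega> \<phi> \<longlonglongrightarrow> 0"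

definition partition_sum ::
    "(nat \<Rightarrow> 'v) set \<Rightarrow> ((nat \<Rightarrow> 'v) \<Rightarrow> real) \<Rightarrow> nat \<Rightarrow> 'v \<Rightarrow> ennreal" where
  "partition_sum \<Omega> \<phi> n v =
     (\<Sum>\<^sub>\<infinity>x\<in>{x \<in> cylinder \<Omega> [v]. (left_shift ^^ n) x = x}. ennreal (exp (birkhoff_sum n \<phi> x)))"

definition first_return_sum ::
    "(nat \<Rightarrow> 'v) set \<Rightarrow> ((nat \<Rightarrow> 'v) \<Rightarrow> real) \<Rightarrow> nat \<Rightarrow> 'v \<Rightarrow> ennreal" where
  "first_return_sum \<Omega> \<phi> n v =
     (\<Sum>\<^sub>\<infinity>x\<in>{x \<in> cylinder \<Omega> [v]. (left_shift ^^ n) x = x \<and>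
                 return_time left_shift (cylinder \<Omega> [v]) x = enat n}.
        ennreal (exp (birkhoff_sum n \<phi> x)))"

text \<open>The natural logarithm on \<open>[0, \<infinity>]\<close>; partition sums may vanish or be infinite.\<close>

definition ext_ln :: "ennreal \<Rightarrow> ereal" where
  "ext_ln z = (if z = 0 then -\<infinity> else if z = \<infinity> then \<infinity> else ereal (ln (enn2real z)))"

definition has_gurevich_pressure ::
    "'v set \<Rightarrow> (nat \<Rightarrow> 'v) set \<Rightarrow> ((nat \<Rightarrow> 'v) \<Rightarrow> real) \<Rightarrow> ereal \<Rightarrow> bool" where
  "has_gurevich_pressure V \<Omega> \<phi> P \<longleftrightarrow>
     (\<forall>v\<in>V. (\<lambda>n. ext_ln (partition_sum \<Omega> \<phi> n v) / ereal (real n)) \<longlonglongrightarrow> P)"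

definition gurevich_pressure ::
    "'v set \<Rightarrow> (nat \<Rightarrow> 'v) set \<Rightarrow> ((nat \<Rightarrow> 'v) \<Rightarrow> real) \<Rightarrow> ereal" where
  "gurevich_pressure V \<Omega> \<phi> = (THE P. has_gurevich_pressure V \<Omega> \<phi> P)"

text \<open>Only meaningful when the pressure is finite.\<close>

definition growth_rate ::
    "'v set \<Rightarrow> (nat \<Rightarrow> 'v) set \<Rightarrow> ((nat \<Rightarrow> 'v) \<Rightarrow> real) \<Rightarrow> real" where
  "growth_rate V \<Omega> \<phi> = exp (real_of_ereal (gurevich_pressure V \<Omega> \<phi>))"

text \<open>Both series start at \<open>n = 1\<close>: every point satisfies \<open>T\<^sup>0 x = x\<close>.\<close>

definition null_recurrent ::
    "'v set \<Rightarrow> (nat \<Rightarrow> 'v) set \<Rightarrow> ((nat \<Rightarrow> 'v) \<Rightarrow> real) \<Rightarrow> bool" where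
  "null_recurrent V \<Omega> \<phi> \<longleftrightarrow>
     (let \<Lambda> = growth_rate V \<Omega> \<phi> in
      \<exists>v\<in>V. (\<Sum>n. ennreal (1 / \<Lambda> ^ Suc n) * partition_sum \<Omega> \<phi> (Suc n) v) = \<infinity> \<and>
            (\<Sum>n. ennreal (real (Suc n) / \<Lambda> ^ Suc n) * first_return_sum \<Omega> \<phi> (Suc n) v) = \<infinity>)"

definition ruelle_operator ::
    "(nat \<Rightarrow> 'v) set \<Rightarrow> ((nat \<Rightarrow> 'v) \<Rightarrow> real) \<Rightarrow>
     ((nat \<Rightarrow> 'v) \<Rightarrow> ennreal) \<Rightarrow> (nat \<Rightarrow> 'v) \<Rightarrow> ennreal" where
  "ruelle_operator \<Omega> \<phi> f x =
     (\<Sum>\<^sub>\<infinity>y\<in>{y\<in>\<Omega>. left_shift y = x}. ennreal (exp (\<phi> y)) * f y)"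

text \<open>A pair \<open>(h, m)\<close> consisting of an eigenfunction and an eigenmeasure as in the generalised
  Ruelle--Perron--Frobenius theorem for null recurrent potentials.  The identity
  \<open>L\<^sup>* m = \<Lambda> m\<close> is tested on nonnegative measurable functions.\<close>

definition null_recurrent_rpf ::
    "real \<Rightarrow> 'v set \<Rightarrow> (nat \<Rightarrow> 'v) set \<Rightarrow> ((nat \<Rightarrow> 'v) \<Rightarrow> real) \<Rightarrow>
     ((nat \<Rightarrow> 'v) \<Rightarrow> real) \<Rightarrow> (nat \<Rightarrow> 'v) measure \<Rightarrow> bool" where
  "null_recurrent_rpf \<eta> V \<Omega> \<phi> h m \<longleftrightarrow>
     (let \<Lambda> = growth_rate V \<Omega> \<phi> in
      continuous_map (shift_topology \<eta> \<Omega>) euclideanreal h \<and>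
      (\<forall>x\<in>\<Omega>. h x > 0) \<and>
      space m = \<Omega> \<and> sets m = sets (shift_borel \<eta> \<Omega>) \<and>
      conservative m left_shift \<and>
      (\<forall>w. w \<noteq> [] \<longrightarrow> emeasure m (cylinder \<Omega> w) < \<infinity>) \<and>
      (\<forall>x\<in>\<Omega>. ruelle_operator \<Omega> \<phi> (\<lambda>y. ennreal (h y)) x = ennreal (\<Lambda> * h x)) \<and>
      (\<forall>f\<in>borel_measurable m.
         (\<integral>\<^sup>+x. ruelle_operator \<Omega> \<phi> f x \<partial>m) = ennreal \<Lambda> * (\<integral>\<^sup>+x. f x \<partial>m)) \<and>
      (\<integral>\<^sup>+x. ennreal (h x) \<partial>m) = \<infinity>)"

section \<open>Scaling and the admissible limit laws\<close>

definition step_extension :: "(nat \<Rightarrow> real) \<Rightarrow> real \<Rightarrow> real" where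
  "step_extension a s = a (nat \<lfloor>s\<rfloor>)"

definition regularly_varying :: "real \<Rightarrow> (real \<Rightarrow> real) \<Rightarrow> bool" where
  "regularly_varying \<alpha> f \<longleftrightarrow> (\<forall>c>0. ((\<lambda>s. f (c * s) / f s) \<longlongrightarrow> c powr \<alpha>) at_top)"

text \<open>The value \<open>a 0\<close> affects \<open>scaling a s\<close> only for \<open>s\<close> bounded away from 0.\<close>

definition scaling :: "(nat \<Rightarrow> real) \<Rightarrow> real \<Rightarrow> real" where
  "scaling a s = 1 / Inf {u. u \<ge> 0 \<and> step_extension a u > 1 / s}"

text \<open>Probability measures on \<open>[0, \<infinity>)\<close> are represented as probability measures on the real line
  carried by \<open>[0, \<infinity>)\<close>.\<close>

definition limit_laws :: "real \<Rightarrow> real measure set" where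
  "limit_laws \<alpha> =
     {\<nu>. real_distribution \<nu> \<and> measure \<nu> {0..} = 1 \<and>
        (\<forall>t>0. measure \<nu> {t<..} \<le> min 1 (sin (pi * \<alpha>) / (pi * \<alpha>) * t powr (-\<alpha>))) \<and>
        (\<forall>t>0. \<forall>s>t. measure \<nu> {t<..s} \<le>
            sin (pi * \<alpha>) / (pi * \<alpha>) * (t powr (-\<alpha>) - s powr (-\<alpha>)))}"

end

theory Submission
  imports Defs
begin

text \<open>The shift codes the excursions of a null recurrent Markov chain away from a state \<open>0\<close>. From \<open>0\<close> the
  chain climbs the ray \<open>x = (S 0, S 1, \<dots>)\<close>, leaves it at \<open>S K\<close> for a state \<open>D M\<close>, and then descends
  deterministically to \<open>0\<close>. With \<open>\<phi>\<close> the logarithm of the backward transition probabilities one has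
  \<open>L\<^sub>\<phi> 1 = 1\<close>, and \<open>\<mu>\<close> is the stationary Markov measure, so that \<open>\<mu> [x\<^sub>0, \<dots>, x\<^sub>n] = P (K \<ge> n)\<close> and, under the
  normalized restriction of \<open>\<mu>\<close> to this cylinder, the return time to \<open>0\<close> has the law of \<open>R = K + M + 1\<close> given
  \<open>K \<ge> n\<close>.

  It remains to choose the joint law of \<open>K\<close> and \<open>R\<close>. The conditional laws of \<open>R\<close> given \<open>K = k\<close> are rescalings
  of \<open>\<nu>\<close> by lengths that grow so fast that given \<open>K \<ge> n\<close> a single \<open>k\<close> dominates; the scaling by
  \<open>\<gamma>\<close> then yields the limit law \<open>\<nu>\<close>. The marginal law of \<open>R\<close> must have tail asymptotic to
  \<open>sin (\<pi> \<alpha>) / (\<pi> \<alpha> a\<^sub>n)\<close>; it is split among the values of \<open>K\<close>, which is possible because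
  \<open>\<nu> \<in> \<G>\<^sub>\<alpha>\<close> says that the rescaled \<open>\<nu>\<close> is dominated by that tail.

  For the renewal sequence \<open>u\<close> of \<open>R\<close>, \<open>u\<^sub>0 + \<dots> + u\<^sub>n\<^sub>-\<^sub>1\<close> is asymptotic to \<open>a\<^sub>n\<close>, because a regularly varying
  sequence \<open>v\<close> whose convolution with the tail of \<open>R\<close> tends to \<open>1\<close> has the same partial sums up to a factor tending
  to \<open>1\<close>. This is dual ergodicity for the indicator of \<open>[0]\<close>, and a maximal inequality carries it over to
  all of \<open>L\<^sup>1 (\<mu>)\<close>.\<close>

section \<open>Regular variation\<close>

text \<open>The sequence \<open>a\<close> is only regularly varying, so neither its increments nor
  single terms of the renewal sequence are controlled; the estimates concern partial sums, which is
  what dual ergodicity asks for. Regular variation is uniform only on compact ranges of ratios,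
  while \<nu> may put mass near 0 and at infinity. Hence \<nu> is copied only on the window of
  ratios from 1 / (k + 1) to k + 1: the mass below is moved to one short return time, the mass above
  is dropped, and both changes are invisible in the limit. The weight of the event K = k + 1 has to
  be about 1 / a (l k), since the scaling must turn l k into 1. With this weight the increment bound
  in \<open>limit_laws\<close> says, up to an error factor close to 1, that the window mass is
  dominated by the density c * \<alpha> / (i * a i), where c = sin (pi * \<alpha>) / (pi *
  \<alpha>). The factor 1 - 1 / (k + 2) in the weight pays for this error and makes the domination
  strict, so that direct exits from state 0 to all far descent states keep positive probability and
  every state is accessible.\<close>

text \<open>The mean of \<open>|k (x + u) - k x|\<close> can be compared along two sequences of base points by the triangle
  inequality, and each mean vanishes by dominated convergence.\<close>

lemma tendsto_shift_diff_uniform: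
  fixes k :: "real \<Rightarrow> real"
  assumes [measurable]: "k \<in> borel_measurable borel"
    and lim: "\<And>u. ((\<lambda>x. k (x + u) - k x) \<longlongrightarrow> 0) at_top"
    and "\<epsilon> > 0"
  shows "\<exists>X. \<forall>x\<ge>X. \<forall>u\<in>{0..1}. \<bar>k (x + u) - k x\<bar> \<le> \<epsilon>"
proof (rule ccontr)
  assume neg: "\<not> ?thesis"
  have "\<forall>n::nat. \<exists>x u. real n \<le> x \<and> u \<in> {0..1} \<and> \<epsilon> < \<bar>k (x + u) - k x\<bar>"
  proof
    fix n :: nat
    from neg have "\<not> (\<forall>x\<ge>real n. \<forall>u\<in>{0..1}. \<bar>k (x + u) - k x\<bar> \<le> \<epsilon>)" by blast
    then show "\<exists>x u. real n \<le> x \<and> u \<in> {0..1} \<and> \<epsilon> < \<bar>k (x + u) - k x\<bar>"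
      by (meson not_le)
  qed
  then obtain x u where xu: "\<And>n. real n \<le> x n" "\<And>n. u n \<in> {0..1}"
    "\<And>n. \<epsilon> < \<bar>k (x n + u n) - k (x n)\<bar>" by metis
  \<comment> \<open>Truncation at 1 makes the indicator of [0, 2] a dominating function; the length
    2 leaves room for u + w with u and w in [0, 1].\<close>
  define \<phi> where "\<phi> y w = min 1 \<bar>k (y + w) - k y\<bar>" for y w
  define J where "J y = (\<integral>\<^sup>+w. ennreal (\<phi> y w) * indicator {0..2} w \<partial>lborel)" for y
  have [measurable]: "\<phi> y \<in> borel_measurable borel" for y unfolding \<phi>_def by measurable
  have J0: "(\<lambda>n. J (y n)) \<longlonglongrightarrow> 0" if y: "filterlim y at_top sequentially" for y :: "nat \<Rightarrow> real"
  proof -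
    have "(\<lambda>n. J (y n)) \<longlonglongrightarrow> (\<integral>\<^sup>+w. 0 \<partial>(lborel :: real measure))"
      unfolding J_def
    proof (rule nn_integral_dominated_convergence)
      show "AE w in lborel. ennreal (\<phi> (y j) w) * indicator {0..2} w \<le> indicator {0..2} w" for j
        by (auto simp: \<phi>_def indicator_def ennreal_le_1)
      show "(\<integral>\<^sup>+w. indicator {0..2} w \<partial>(lborel::real measure)) < \<infinity>" by simp
      show "AE w in lborel. (\<lambda>i. ennreal (\<phi> (y i) w) * indicator {0..2} w) \<longlonglongrightarrow> 0"
      proof (rule AE_I2)
        fix w
        have "(\<lambda>i. k (y i + w) - k (y i)) \<longlonglongrightarrow> 0"
          using filterlim_compose[OF lim y] .
        then have "(\<lambda>i. min 1 \<bar>k (y i + w) - k (y i)\<bar>) \<longlonglongrightarrow> min 1 \<bar>0\<bar>"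
          by (intro tendsto_intros)
        then have "(\<lambda>i. ennreal (\<phi> (y i) w)) \<longlonglongrightarrow> ennreal 0"
          unfolding \<phi>_def by (intro tendsto_ennrealI) simp
        then have "(\<lambda>i. ennreal (\<phi> (y i) w) * indicator {0..2} w) \<longlonglongrightarrow> ennreal 0 * indicator {0..2} w"
          by (cases "w \<in> {0..2}") auto
        then show "(\<lambda>i. ennreal (\<phi> (y i) w) * indicator {0..2} w) \<longlonglongrightarrow> 0" by simp
      qed
    qed measurable
    then show ?thesis by simp
  qed
  \<comment> \<open>For each w in [0, 1] the value k (x + u + w) is compared with both base points x
    + u and x, whose values differ by more than \<epsilon>, so the two truncated differences add up
    to at least min 1 \<epsilon>. The factor \<open>1 *\<close> fits the affine change of
    variables.\<close>
  have key: "ennreal (min 1 \<epsilon>) \<le> J (x n + u n) + J (x n)" for n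
  proof -
    have "ennreal (min 1 \<epsilon>) = (\<integral>\<^sup>+w. ennreal (min 1 \<epsilon>) * indicator {0..1} w \<partial>(lborel::real measure))"
      by (simp add: nn_integral_cmult_indicator)
    also have "\<dots> \<le> (\<integral>\<^sup>+w. ennreal (\<phi> (x n + u n) w) * indicator {0..2} w
         + ennreal (\<phi> (x n) (u n + 1 * w)) * indicator {0..2} (u n + 1 * w) \<partial>lborel)"
    proof (rule nn_integral_mono)
      fix w :: real
      show "ennreal (min 1 \<epsilon>) * indicator {0..1} w \<le> ennreal (\<phi> (x n + u n) w) * indicator {0..2} w
         + ennreal (\<phi> (x n) (u n + 1 * w)) * indicator {0..2} (u n + 1 * w)"
      proof (cases "w \<in> {0..1}")
        case True
        have "min 1 \<epsilon> \<le> \<phi> (x n + u n) w + \<phi> (x n) (u n + w)"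
          using xu(3)[of n] by (auto simp: \<phi>_def min_def add.assoc)
        then have "ennreal (min 1 \<epsilon>) \<le> ennreal (\<phi> (x n + u n) w) + ennreal (\<phi> (x n) (u n + w))"
          by (subst ennreal_plus[symmetric]) (auto simp: \<phi>_def intro!: ennreal_leI simp del: ennreal_plus)
        moreover have "w \<in> {0..2}" "u n + w \<in> {0..2}" using True xu(2)[of n] by auto
        ultimately show ?thesis using True by simp
      qed simp
    qed
    also have "\<dots> = J (x n + u n)
        + (\<integral>\<^sup>+w. ennreal (\<phi> (x n) (u n + 1 * w)) * indicator {0..2} (u n + 1 * w) \<partial>lborel)"
      unfolding J_def by (rule nn_integral_add) measurable
    also have "(\<integral>\<^sup>+w. ennreal (\<phi> (x n) (u n + 1 * w)) * indicator {0..2} (u n + 1 * w) \<partial>lborel) = J (x n)"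
      unfolding J_def
      using nn_integral_real_affine[of "\<lambda>w. ennreal (\<phi> (x n) w) * indicator {0..2} w" 1 "u n"] by simp
    finally show ?thesis .
  qed
  have xt: "filterlim x at_top sequentially"
    by (rule filterlim_at_top_mono[OF filterlim_real_sequentially]) (use xu(1) in auto)
  have yt: "filterlim (\<lambda>n. x n + u n) at_top sequentially"
    by (rule filterlim_at_top_mono[OF xt]) (use xu(2) in auto)
  have "(\<lambda>n. J (x n + u n) + J (x n)) \<longlonglongrightarrow> 0 + 0"
    by (intro tendsto_add J0 xt yt)
  then have "ennreal (min 1 \<epsilon>) \<le> 0 + 0"
    by (rule LIMSEQ_le_const) (use key in blast)
  then show False using \<open>\<epsilon> > 0\<close> by (simp add: ennreal_eq_0_iff min_def split: if_splits)
qed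

section \<open>Potter bounds for regularly varying sequences\<close>

locale regularly_varying_seq =
  fixes a :: "nat \<Rightarrow> real" and \<alpha> :: real
  assumes alpha: "0 < \<alpha>" "\<alpha> < 1"
    and a_pos: "\<And>n. n \<ge> 1 \<Longrightarrow> a n > 0"
    and rv: "regularly_varying \<alpha> (step_extension a)"
begin

lemma step_pos: "s \<ge> 1 \<Longrightarrow> step_extension a s > 0"
  unfolding step_extension_def by (rule a_pos) (simp add: le_nat_iff)

lemma step_real [simp]: "step_extension a (real n) = a n"
  by (simp add: step_extension_def)

lemma step_measurable [measurable]: "step_extension a \<in> borel_measurable borel"
proof -
  have "(\<lambda>s::real. nat \<lfloor>s\<rfloor>) \<in> borel \<rightarrow>\<^sub>M count_space UNIV" by measurable
  then show ?thesis unfolding step_extension_def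
    by (rule measurable_compose) simp
qed

text \<open>In logarithmic coordinates regular variation says that increments of \<open>k\<close>
  over fixed lengths tend to 0. Uniformity over lengths in [0, 1] bounds one unit step by \<delta>,
  and chaining unit steps bounds a long increment by \<delta> times its length plus one further
  \<delta>.\<close>

lemma potter_step:
  assumes "\<delta> > 0"
  shows "\<exists>X\<ge>1. \<forall>s\<ge>X. \<forall>t\<ge>X.
    \<bar>ln (step_extension a t) - ln (step_extension a s) - \<alpha> * (ln t - ln s)\<bar> \<le> \<delta> * \<bar>ln t - ln s\<bar> + \<delta>"
proof -
  let ?f = "step_extension a"
  define k where "k x = ln (?f (exp x)) - \<alpha> * x" for x
  have [measurable]: "k \<in> borel_measurable borel" unfolding k_def by measurable
  have lim: "((\<lambda>x. k (x + u) - k x) \<longlongrightarrow> 0) at_top" for u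
  proof -
    have "((\<lambda>s. ?f (exp u * s) / ?f s) \<longlongrightarrow> exp u powr \<alpha>) at_top"
      using rv unfolding regularly_varying_def by simp
    from filterlim_compose[OF this exp_at_top]
    have "((\<lambda>x. ?f (exp u * exp x) / ?f (exp x)) \<longlongrightarrow> exp u powr \<alpha>) at_top" .
    then have "((\<lambda>x. ln (?f (exp u * exp x) / ?f (exp x)) - \<alpha> * u) \<longlongrightarrow> ln (exp u powr \<alpha>) - \<alpha> * u) at_top"
      by (intro tendsto_intros) auto
    then have "((\<lambda>x. ln (?f (exp u * exp x) / ?f (exp x)) - \<alpha> * u) \<longlongrightarrow> 0) at_top"
      by (simp add: ln_powr)
    moreover have "\<forall>\<^sub>F x in at_top. ln (?f (exp u * exp x) / ?f (exp x)) - \<alpha> * u = k (x + u) - k x"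
      using eventually_ge_at_top[of "max 0 (- u)"]
    proof eventually_elim
      case (elim x)
      then have "?f (exp x) > 0" "?f (exp (x + u)) > 0" by (auto intro!: step_pos)
      then show ?case by (simp add: k_def exp_add mult.commute ln_div algebra_simps)
    qed
    ultimately show ?thesis by (rule Lim_transform_eventually)
  qed
  have "\<exists>X. \<forall>x\<ge>X. \<forall>u\<in>{0..1}. \<bar>k (x + u) - k x\<bar> \<le> \<delta>"
    by (rule tendsto_shift_diff_uniform[OF _ lim assms]) measurable
  then obtain X where X: "\<And>x u. x \<ge> X \<Longrightarrow> u \<in> {0..1} \<Longrightarrow> \<bar>k (x + u) - k x\<bar> \<le> \<delta>"
    by blast
  have iter: "\<bar>k (x + u) - k x\<bar> \<le> \<delta> * real n" if "x \<ge> X" "0 \<le> u" "u \<le> real n" for x u n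
    using that
  proof (induction n arbitrary: u)
    case (Suc n)
    show ?case
    proof (cases "u \<le> 1")
      case True
      then have "\<bar>k (x + u) - k x\<bar> \<le> \<delta> * 1" using X Suc.prems by auto
      also have "\<dots> \<le> \<delta> * real (Suc n)" using assms by (intro mult_left_mono) auto
      finally show ?thesis .
    next
      case False
      have "\<bar>k (x + (u - 1)) - k x\<bar> \<le> \<delta> * real n" using False Suc by auto
      moreover have "\<bar>k (x + (u - 1) + 1) - k (x + (u - 1))\<bar> \<le> \<delta>"
        by (rule X) (use False Suc.prems in auto)
      ultimately show ?thesis by (auto simp: algebra_simps)
    qed
  qed simp
  have up: "\<bar>k y - k x\<bar> \<le> \<delta> * \<bar>y - x\<bar> + \<delta>" if "X \<le> x" "x \<le> y" for x y
  proof -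
    have "\<bar>k (x + (y - x)) - k x\<bar> \<le> \<delta> * real (nat \<lceil>y - x\<rceil>)"
      by (rule iter) (use that in linarith)+
    also have "\<dots> \<le> \<delta> * ((y - x) + 1)" using that assms by (intro mult_left_mono) linarith+
    finally show ?thesis using that by (simp add: algebra_simps)
  qed
  have both: "\<bar>k y - k x\<bar> \<le> \<delta> * \<bar>y - x\<bar> + \<delta>" if "X \<le> x" "X \<le> y" for x y
    using up[of x y] up[of y x] that by (cases "x \<le> y") (auto simp: abs_minus_commute)
  show ?thesis
  proof (intro exI[of _ "exp (max X 0)"] conjI allI impI)
    show "1 \<le> exp (max X 0)" by simp
    fix s t assume st: "exp (max X 0) \<le> s" "exp (max X 0) \<le> t"
    then have p: "s > 0" "t > 0" using exp_gt_zero[of "max X 0"] by linarith+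
    have "max X 0 \<le> ln s" "max X 0 \<le> ln t" using st p by (simp_all only: ln_ge_iff)
    then have "\<bar>k (ln t) - k (ln s)\<bar> \<le> \<delta> * \<bar>ln t - ln s\<bar> + \<delta>" by (intro both) auto
    then show "\<bar>ln (?f t) - ln (?f s) - \<alpha> * (ln t - ln s)\<bar> \<le> \<delta> * \<bar>ln t - ln s\<bar> + \<delta>"
      using p by (simp add: k_def algebra_simps)
  qed
qed

lemma potter:
  assumes "\<delta> > 0"
  obtains N where "N \<ge> 1" "\<And>m n. m \<ge> N \<Longrightarrow> n \<ge> N \<Longrightarrow>
    \<bar>ln (a m) - ln (a n) - \<alpha> * (ln m - ln n)\<bar> \<le> \<delta> * \<bar>ln (real m) - ln (real n)\<bar> + \<delta>"
proof -
  obtain X where X: "X \<ge> 1" "\<And>s t. s \<ge> X \<Longrightarrow> t \<ge> X \<Longrightarrow>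
    \<bar>ln (step_extension a t) - ln (step_extension a s) - \<alpha> * (ln t - ln s)\<bar> \<le> \<delta> * \<bar>ln t - ln s\<bar> + \<delta>"
    using potter_step[OF assms] by blast
  show thesis
  proof (rule that[of "nat \<lceil>X\<rceil>"])
    show "nat \<lceil>X\<rceil> \<ge> 1" using X(1) by linarith
    fix m n assume "m \<ge> nat \<lceil>X\<rceil>" "n \<ge> nat \<lceil>X\<rceil>"
    then have "real m \<ge> X" "real n \<ge> X" by linarith+
    from X(2)[OF this(2,1)]
    show "\<bar>ln (a m) - ln (a n) - \<alpha> * (ln m - ln n)\<bar> \<le> \<delta> * \<bar>ln (real m) - ln (real n)\<bar> + \<delta>" by simp
  qed
qed

text \<open>The first form dominates integrands near 0 and at infinity. The second assumes only an
  upper bound R on n / m and no order of m and n, because it is applied to an index that may lie on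
  either side of n.\<close>

lemma potter_powr:
  assumes "0 < \<delta>" "\<delta> < \<alpha>"
  obtains N where "N \<ge> 1"
    "\<And>m n. N \<le> m \<Longrightarrow> m \<le> n \<Longrightarrow> a m / a n \<le> exp \<delta> * (real m / real n) powr (\<alpha> - \<delta>)"
    "\<And>m n R. N \<le> m \<Longrightarrow> N \<le> n \<Longrightarrow> R \<ge> 1 \<Longrightarrow> real n / real m \<le> R \<Longrightarrow> a n / a m \<le> exp \<delta> * R powr (\<alpha> + \<delta>)"
proof -
  obtain N where N: "N \<ge> 1" "\<And>m n. m \<ge> N \<Longrightarrow> n \<ge> N \<Longrightarrow>
    \<bar>ln (a m) - ln (a n) - \<alpha> * (ln m - ln n)\<bar> \<le> \<delta> * \<bar>ln (real m) - ln (real n)\<bar> + \<delta>"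
    using potter[OF assms(1)] by blast
  have P: "a m > 0" "real m > 0" if "m \<ge> N" for m using that N(1) a_pos[of m] by auto
  show thesis
  proof (rule that[OF N(1)])
    fix m n assume mn: "N \<le> m" "m \<le> n"
    have p: "a m > 0" "a n > 0" "real m > 0" "real n > 0" using P mn by auto
    have "ln (real m) \<le> ln (real n)" using p mn by simp
    then have "ln (a m / a n) \<le> \<delta> + (\<alpha> - \<delta>) * ln (real m / real n)"
      using N(2)[of m n] mn p by (simp add: ln_div algebra_simps abs_if split: if_splits)
    then have "exp (ln (a m / a n)) \<le> exp (\<delta> + (\<alpha> - \<delta>) * ln (real m / real n))" by simp
    then show "a m / a n \<le> exp \<delta> * (real m / real n) powr (\<alpha> - \<delta>)"
      using p by (simp add: powr_def exp_add)
  next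
    fix m n R assume mn: "N \<le> m" "N \<le> n" and R: "(R::real) \<ge> 1" "real n / real m \<le> R"
    have p: "a m > 0" "a n > 0" "real m > 0" "real n > 0" using P mn by auto
    have lR: "ln (real n / real m) \<le> ln R" "0 \<le> ln R" using p R by (auto intro: ln_mono)
    have "ln (a n / a m) \<le> \<delta> + (\<alpha> + \<delta>) * ln R"
    proof (cases "ln (real m) \<le> ln (real n)")
      case True
      have "ln (a n / a m) \<le> \<delta> + (\<alpha> + \<delta>) * ln (real n / real m)"
        using N(2)[of n m] mn p True by (simp add: ln_div algebra_simps abs_if split: if_splits)
      also have "\<dots> \<le> \<delta> + (\<alpha> + \<delta>) * ln R" using lR assms by (intro add_left_mono mult_left_mono) auto
      finally show ?thesis .
    next
      case False
      have "ln (a n / a m) \<le> \<delta> + (\<alpha> - \<delta>) * (ln (real n) - ln (real m))"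
        using N(2)[of n m] mn p False by (simp add: ln_div algebra_simps abs_if split: if_splits)
      also have "(\<alpha> - \<delta>) * (ln (real n) - ln (real m)) \<le> 0"
        using False assms by (intro mult_nonneg_nonpos) auto
      also have "0 \<le> (\<alpha> + \<delta>) * ln R" using lR assms by (intro mult_nonneg_nonneg) auto
      finally show ?thesis by simp
    qed
    then have "exp (ln (a n / a m)) \<le> exp (\<delta> + (\<alpha> + \<delta>) * ln R)" by simp
    then show "a n / a m \<le> exp \<delta> * R powr (\<alpha> + \<delta>)"
      using p R by (simp add: powr_def exp_add)
  qed
qed

text \<open>Regular variation concerns a fixed multiple c * s; here the multiple varies with n and
  only converges. Potter's bound is applied with arbitrarily small \<delta> while the logarithm of
  the ratio stays within |ln x| + 1, which explains the choice of \<delta>.\<close>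

lemma tendsto_ratio:
  assumes k: "(\<lambda>n. real (k n) / real n) \<longlonglongrightarrow> x" and "x > 0"
  shows "(\<lambda>n. a (k n) / a n) \<longlonglongrightarrow> x powr \<alpha>"
proof -
  let ?D = "\<lambda>n. ln (a (k n)) - ln (a n) - \<alpha> * (ln (real (k n)) - ln (real n))"
  have kinf: "filterlim (\<lambda>n. real (k n)) at_top sequentially"
  proof -
    have *: "filterlim (\<lambda>n. (real (k n) / real n) * real n) at_top sequentially"
      by (rule filterlim_tendsto_pos_mult_at_top[OF k \<open>x > 0\<close> filterlim_real_sequentially])
    have "\<forall>\<^sub>F n in sequentially. (real (k n) / real n) * real n = real (k n)"
      using eventually_ge_at_top[of 1] by eventually_elim auto
    from filterlim_cong[OF refl refl this, THEN iffD1, OF *] show ?thesis .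
  qed
  have kge: "\<forall>\<^sub>F n in sequentially. k n \<ge> N" for N
  proof -
    have "\<forall>\<^sub>F n in sequentially. real N \<le> real (k n)"
      using kinf unfolding filterlim_at_top by blast
    then show ?thesis by simp
  qed
  have lnr: "(\<lambda>n. ln (real (k n) / real n)) \<longlonglongrightarrow> ln x"
    using k \<open>x > 0\<close> by (intro tendsto_ln) auto
  have eqr: "\<forall>\<^sub>F n in sequentially. ln (real (k n) / real n) = ln (real (k n)) - ln (real n)"
    using kge[of 1] eventually_ge_at_top[of 1] by eventually_elim (simp add: ln_div)
  have lnd: "(\<lambda>n. ln (real (k n)) - ln (real n)) \<longlonglongrightarrow> ln x"
    by (rule Lim_transform_eventually[OF lnr eqr])
  have "?D \<longlonglongrightarrow> 0"
  proof (rule LIMSEQ_I)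
    fix r :: real assume "0 < r"
    define \<delta> where "\<delta> = r / (2 * (\<bar>ln x\<bar> + 2))"
    have d: "\<delta> > 0" using \<open>0 < r\<close> by (simp add: \<delta>_def)
    obtain N where N: "\<And>m n. m \<ge> N \<Longrightarrow> n \<ge> N \<Longrightarrow>
      \<bar>ln (a m) - ln (a n) - \<alpha> * (ln m - ln n)\<bar> \<le> \<delta> * \<bar>ln (real m) - ln (real n)\<bar> + \<delta>"
      using potter[OF d] by blast
    have "\<forall>\<^sub>F n in sequentially. \<bar>ln (real (k n)) - ln (real n)\<bar> < \<bar>ln x\<bar> + 1"
      by (rule order_tendstoD(2)[OF tendsto_rabs[OF lnd]]) simp
    then have "\<forall>\<^sub>F n in sequentially. norm (?D n - 0) < r"
      using kge[of N] eventually_ge_at_top[of N]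
    proof eventually_elim
      case (elim n)
      have "\<bar>?D n\<bar> \<le> \<delta> * \<bar>ln (real (k n)) - ln (real n)\<bar> + \<delta>" using N elim by auto
      also have "\<dots> \<le> \<delta> * (\<bar>ln x\<bar> + 1) + \<delta>" using elim d by (intro add_right_mono mult_left_mono) auto
      also have "\<dots> = \<delta> * (\<bar>ln x\<bar> + 2)" by (simp add: algebra_simps)
      also have "\<dots> = r / 2" by (simp add: \<delta>_def field_simps)
      also have "\<dots> < r" using \<open>0 < r\<close> by simp
      finally show ?case by simp
    qed
    then show "\<exists>no. \<forall>n\<ge>no. norm (?D n - 0) < r" by (simp add: eventually_sequentially)
  qed
  then have "(\<lambda>n. exp (?D n + \<alpha> * (ln (real (k n)) - ln (real n)))) \<longlonglongrightarrow> exp (0 + \<alpha> * ln x)"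
    by (intro tendsto_intros lnd)
  moreover have "\<forall>\<^sub>F n in sequentially. exp (?D n + \<alpha> * (ln (real (k n)) - ln (real n))) = a (k n) / a n"
    using kge[of 1] eventually_ge_at_top[of 1]
  proof eventually_elim
    case (elim n)
    then have "a (k n) > 0" "a n > 0" using a_pos by auto
    then show ?case by (simp add: exp_diff)
  qed
  ultimately show ?thesis using \<open>x > 0\<close>
    by (auto simp: powr_def mult.commute intro: Lim_transform_eventually)
qed

text \<open>Potter's bound with \<delta> = \<alpha> / 2 leaves a positive exponent: a n is at least
  a constant times n powr (\<alpha> / 2).\<close>

lemma filterlim_a: "filterlim a at_top sequentially"
proof -
  have d: "0 < \<alpha>/2" "\<alpha>/2 < \<alpha>" using alpha by auto
  obtain N where N: "N \<ge> 1"
    "\<And>m n. N \<le> m \<Longrightarrow> m \<le> n \<Longrightarrow> a m / a n \<le> exp (\<alpha>/2) * (real m / real n) powr (\<alpha> - \<alpha>/2)"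
    using potter_powr[OF d] by metis
  define C where "C = a N / (exp (\<alpha>/2) * real N powr (\<alpha>/2))"
  have Np: "a N > 0" "real N > 0" using N(1) a_pos by auto
  have C: "C > 0" using Np by (simp add: C_def)
  have le: "C * exp (\<alpha>/2 * ln (real n)) \<le> a n" if "n \<ge> N" for n
  proof -
    have p: "a n > 0" "real n > 0" using that N(1) a_pos[of n] by auto
    have "a N / a n \<le> exp (\<alpha>/2) * (real N powr (\<alpha>/2) / real n powr (\<alpha>/2))"
      using N(2)[OF order_refl that] by (simp add: powr_divide)
    then have "C * real n powr (\<alpha>/2) \<le> a n" using p Np by (simp add: C_def field_simps)
    then show ?thesis using p by (simp add: powr_def)
  qed
  have "filterlim (\<lambda>n. C * exp (\<alpha>/2 * ln (real n))) at_top sequentially"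
    by (intro filterlim_tendsto_pos_mult_at_top[OF tendsto_const C]
        filterlim_tendsto_pos_mult_at_top[OF tendsto_const d(1)]
        filterlim_compose[OF exp_at_top] filterlim_compose[OF ln_at_top filterlim_real_sequentially])
  then show ?thesis
  proof (rule filterlim_at_top_mono)
    show "\<forall>\<^sub>F n in sequentially. C * exp (\<alpha>/2 * ln (real n)) \<le> a n"
      using eventually_ge_at_top[of N] by eventually_elim (rule le)
  qed
qed

text \<open>Because \<alpha> < 1, some \<delta> keeps the exponent \<alpha> + \<delta> - 1 negative.
  The limit later yields the lower bound of order 1 / n^2 for return probabilities and the infinite
  total mass.\<close>

lemma a_over_n_tendsto_0: "(\<lambda>n. a n / real n) \<longlonglongrightarrow> 0"
proof -
  define \<delta> where "\<delta> = min (\<alpha>/2) ((1 - \<alpha>)/2)"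
  have d: "0 < \<delta>" "\<delta> < \<alpha>" "\<alpha> + \<delta> - 1 < 0" using alpha by (auto simp: \<delta>_def min_def field_simps)
  obtain N where N: "N \<ge> 1"
    "\<And>m n R. N \<le> m \<Longrightarrow> N \<le> n \<Longrightarrow> R \<ge> 1 \<Longrightarrow> real n / real m \<le> R \<Longrightarrow> a n / a m \<le> exp \<delta> * R powr (\<alpha> + \<delta>)"
    using potter_powr[OF d(1,2)] by metis
  have Np: "a N > 0" "real N > 0" using N(1) a_pos by auto
  have le: "a n / real n \<le> a N * exp \<delta> * real n powr (\<alpha> + \<delta> - 1)" if "n \<ge> N" for n
  proof -
    have p: "a n > 0" "real n > 0" using that N(1) a_pos[of n] by auto
    have "a n / a N \<le> exp \<delta> * real n powr (\<alpha> + \<delta>)"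
    proof (rule N(2)[OF order_refl that])
      show "1 \<le> real n" using that N(1) by simp
      have "real n * 1 \<le> real n * real N" using N(1) by (intro mult_left_mono) auto
      then show "real n / real N \<le> real n" using Np by (simp add: field_simps)
    qed
    then show ?thesis using p Np by (simp add: field_simps powr_diff)
  qed
  have "(\<lambda>n. a N * exp \<delta> * real n powr (\<alpha> + \<delta> - 1)) \<longlonglongrightarrow> a N * exp \<delta> * 0"
    by (intro tendsto_intros tendsto_neg_powr[OF d(3)] filterlim_real_sequentially)
  then have lim: "(\<lambda>n. a N * exp \<delta> * real n powr (\<alpha> + \<delta> - 1)) \<longlonglongrightarrow> 0" by simp
  show ?thesis
  proof (rule tendsto_sandwich[OF _ _ tendsto_const lim])
    show "\<forall>\<^sub>F n in sequentially. 0 \<le> a n / real n"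
      using eventually_ge_at_top[of 1] by eventually_elim (simp add: a_pos less_imp_le)
    show "\<forall>\<^sub>F n in sequentially. a n / real n \<le> a N * exp \<delta> * real n powr (\<alpha> + \<delta> - 1)"
      using eventually_ge_at_top[of N] by eventually_elim (rule le)
  qed
qed

end

section \<open>Sums as integrals of rescaled step functions, and Karamata asymptotics\<close>

lemma tendsto_nat_ceiling_mult:
  fixes x :: real
  assumes "0 < x"
  shows "(\<lambda>n. real (nat \<lceil>real n * x\<rceil>) / real n) \<longlonglongrightarrow> x"
proof (rule tendsto_sandwich[where f = "\<lambda>n. x" and h = "\<lambda>n. x + 1 / real n"])
  show "\<forall>\<^sub>F n in sequentially. x \<le> real (nat \<lceil>real n * x\<rceil>) / real n"
    using eventually_gt_at_top[of 0]
  proof eventually_elim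
    case (elim n)
    have "real n * x \<le> real (nat \<lceil>real n * x\<rceil>)" by linarith
    then show ?case using elim by (simp add: field_simps)
  qed
  show "\<forall>\<^sub>F n in sequentially. real (nat \<lceil>real n * x\<rceil>) / real n \<le> x + 1 / real n"
    using eventually_gt_at_top[of 0]
  proof eventually_elim
    case (elim n)
    have "0 \<le> real n * x" using assms by simp
    then have "real (nat \<lceil>real n * x\<rceil>) \<le> real n * x + 1" by linarith
    then show ?case using elim by (simp add: field_simps)
  qed
  have "(\<lambda>n. x + 1 / real n) \<longlonglongrightarrow> x + 0" by (intro tendsto_add tendsto_const lim_1_over_n)
  then show "(\<lambda>n. x + 1 / real n) \<longlonglongrightarrow> x" by simp
qed (rule tendsto_const)

text \<open>The sum over \<open>k\<close> is the integral of the step function \<open>x \<mapsto> n * G n \<lceil>n x\<rceil>\<close>.\<close>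

lemma tendsto_suminf_rescaled:
  fixes G :: "nat \<Rightarrow> nat \<Rightarrow> real" and g D :: "real \<Rightarrow> real"
  assumes [measurable]: "g \<in> borel_measurable borel" "D \<in> borel_measurable borel"
    and G0: "\<And>n k. 0 \<le> G n k"
    and bound: "\<And>n x. N \<le> n \<Longrightarrow> 0 < x \<Longrightarrow> x \<noteq> 1 \<Longrightarrow> real n * G n (nat \<lceil>real n * x\<rceil>) \<le> D x"
    and D: "(\<integral>\<^sup>+x. ennreal (D x) * indicator {0<..} x \<partial>lborel) < \<infinity>"
    and lim: "\<And>x. 0 < x \<Longrightarrow> x \<noteq> 1 \<Longrightarrow> (\<lambda>n. real n * G n (nat \<lceil>real n * x\<rceil>)) \<longlonglongrightarrow> g x"
  shows "(\<lambda>n. \<Sum>k. ennreal (G n (Suc k))) \<longlonglongrightarrow> (\<integral>\<^sup>+x. ennreal (g x) * indicator {0<..} x \<partial>lborel)"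
proof -
  let ?F = "\<lambda>n x. ennreal (real n * G n (nat \<lceil>real n * x\<rceil>)) * indicator {0<..} x"
  have [measurable]: "(\<lambda>x. G n (nat \<lceil>real n * x\<rceil>)) \<in> borel_measurable borel" for n
  proof -
    have "(\<lambda>x::real. nat \<lceil>real n * x\<rceil>) \<in> borel \<rightarrow>\<^sub>M count_space UNIV" by measurable
    then show ?thesis by (rule measurable_compose) simp
  qed
  have sum_eq: "(\<integral>\<^sup>+x. ?F n x \<partial>lborel) = (\<Sum>k. ennreal (G n (Suc k)))" if "n \<ge> 1" for n
  proof -
    let ?A = "\<lambda>k. {real k / real n <.. real (Suc k) / real n}"
    have np: "real n > 0" using that by simp
    have disj: "disjoint_family ?A"
      unfolding disjoint_family_on_def
    proof (intro ballI impI)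
      fix i j :: nat assume "i \<noteq> j"
      then have "Suc i \<le> j \<or> Suc j \<le> i" by linarith
      then have "real (Suc i) / real n \<le> real j / real n \<or> real (Suc j) / real n \<le> real i / real n"
        using np by (metis divide_right_mono of_nat_le_iff less_imp_le)
      then show "?A i \<inter> ?A j = {}" by auto
    qed
    have "?F n x = (\<Sum>k. ennreal (real n * G n (Suc k)) * indicator (?A k) x)" for x
    proof (cases "x > 0")
      case True
      define k where "k = nat \<lceil>real n * x\<rceil> - 1"
      have "0 < real n * x" using True np by simp
      then have k: "nat \<lceil>real n * x\<rceil> = Suc k" "real k < real n * x" "real n * x \<le> real (Suc k)"
        unfolding k_def by linarith+
      then have "x \<in> ?A k" using np by (simp add: field_simps)
      then show ?thesis using suminf_cmult_indicator[OF disj, of x k "\<lambda>k. ennreal (real n * G n (Suc k))"] True k(1)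
        by simp
    next
      case False
      have "x \<notin> ?A k" for k
      proof
        assume "x \<in> ?A k"
        moreover have "0 \<le> real k / real n" by simp
        ultimately show False using False by auto
      qed
      then show ?thesis using False by simp
    qed
    then have "(\<integral>\<^sup>+x. ?F n x \<partial>lborel)
        = (\<integral>\<^sup>+x. (\<Sum>k. ennreal (real n * G n (Suc k)) * indicator (?A k) x) \<partial>lborel)" by simp
    also have "\<dots> = (\<Sum>k. \<integral>\<^sup>+x. ennreal (real n * G n (Suc k)) * indicator (?A k) x \<partial>lborel)"
      by (rule nn_integral_suminf) measurable
    also have "\<dots> = (\<Sum>k. ennreal (G n (Suc k)))"
    proof (rule arg_cong[where f = suminf], rule ext)
      fix k
      have le: "real k / real n \<le> real (Suc k) / real n" using np by (intro divide_right_mono) auto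
      have "(\<integral>\<^sup>+x. ennreal (real n * G n (Suc k)) * indicator (?A k) x \<partial>lborel)
          = ennreal (real n * G n (Suc k)) * ennreal (real (Suc k) / real n - real k / real n)"
        using le by (simp add: nn_integral_cmult_indicator)
      also have "\<dots> = ennreal ((real n * G n (Suc k)) * (real (Suc k) / real n - real k / real n))"
        using le G0 by (intro ennreal_mult[symmetric]) auto
      also have "(real n * G n (Suc k)) * (real (Suc k) / real n - real k / real n) = G n (Suc k)"
        using np by (simp add: field_simps)
      finally show "(\<integral>\<^sup>+x. ennreal (real n * G n (Suc k)) * indicator (?A k) x \<partial>lborel) = ennreal (G n (Suc k))" .
    qed
    finally show ?thesis .
  qed
  have "(\<lambda>n. \<integral>\<^sup>+x. ?F (n + N) x \<partial>lborel) \<longlonglongrightarrow> (\<integral>\<^sup>+x. ennreal (g x) * indicator {0<..} x \<partial>lborel)"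
  proof (rule nn_integral_dominated_convergence[where w = "\<lambda>x. ennreal (D x) * indicator {0<..} x"])
    \<comment> \<open>At x = 1 the limit functions of the applications jump or blow up; this point
      is a null set.\<close>
    have ne: "AE x::real in lborel. x \<noteq> 1" by (rule AE_lborel_singleton)
    show "AE x in lborel. ?F (n + N) x \<le> ennreal (D x) * indicator {0<..} x" for n
      using ne
    proof eventually_elim
      case (elim x)
      then show ?case using bound[of "n + N" x]
        by (cases "x > 0") (auto intro: ennreal_leI)
    qed
    show "AE x in lborel. (\<lambda>n. ?F (n + N) x) \<longlonglongrightarrow> ennreal (g x) * indicator {0<..} x"
      using ne
    proof eventually_elim
      case (elim x)
      then show ?case
      proof (cases "x > 0")
        case True
        then have "(\<lambda>n. ennreal (real n * G n (nat \<lceil>real n * x\<rceil>))) \<longlonglongrightarrow> ennreal (g x)"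
          using lim elim by (intro tendsto_ennrealI) auto
        from LIMSEQ_ignore_initial_segment[OF this, of N] show ?thesis using True by simp
      qed simp
    qed
  qed (use D in \<open>simp_all\<close>)
  then have "(\<lambda>n. \<integral>\<^sup>+x. ?F n x \<partial>lborel) \<longlonglongrightarrow> (\<integral>\<^sup>+x. ennreal (g x) * indicator {0<..} x \<partial>lborel)"
    by (rule LIMSEQ_offset)
  moreover have "\<forall>\<^sub>F n in sequentially. (\<integral>\<^sup>+x. ?F n x \<partial>lborel) = (\<Sum>k. ennreal (G n (Suc k)))"
    using eventually_ge_at_top[of 1] by eventually_elim (rule sum_eq)
  ultimately show ?thesis by (rule Lim_transform_eventually)
qed

text \<open>Origin of the constant sin (pi * \<alpha>) / (pi * \<alpha>): a sequence asymptotic to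
  \<alpha> * a k / k, convolved with a tail asymptotic to c / a n, tends to c * \<alpha> times this
  Beta value, and the product has to be 1.\<close>

lemma Beta_reflection_real:
  fixes \<alpha> :: real
  assumes "0 < \<alpha>" "\<alpha> < 1"
  shows "Beta \<alpha> (1 - \<alpha>) = pi / sin (pi * \<alpha>)"
proof -
  have "complex_of_real (Gamma \<alpha> * Gamma (1 - \<alpha>)) = Gamma (of_real \<alpha>) * Gamma (1 - of_real \<alpha>)"
    using Gamma_complex_of_real[of "1 - \<alpha>"] by (simp add: Gamma_complex_of_real)
  also have "\<dots> = of_real pi / sin (of_real pi * of_real \<alpha>)" by (rule Gamma_reflection_complex)
  also have "\<dots> = complex_of_real (pi / sin (pi * \<alpha>))" by (simp flip: sin_of_real)
  finally have "Gamma \<alpha> * Gamma (1 - \<alpha>) = pi / sin (pi * \<alpha>)" by (simp only: of_real_eq_iff)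
  then show ?thesis by (simp add: Beta_def)
qed

context regularly_varying_seq
begin

text \<open>Karamata's theorem for the tail sums of \<alpha> / (k * a k): after rescaling the limit
  is the integral of \<alpha> * x powr (- 1 - \<alpha>) over x > 1. The sum is taken in
  [0, \<infinity>], so that summability can be a consequence. The guard 1 \<le> n is there because
  nothing is assumed about a 0.\<close>

lemma tail_density_aux:
  "(\<lambda>n. \<Sum>k. ennreal (if 1 \<le> n \<and> n < Suc k then a n * (\<alpha> / (real (Suc k) * a (Suc k))) else 0)) \<longlonglongrightarrow> 1"
proof -
  define G where "G n k = (if 1 \<le> n \<and> n < k then a n * (\<alpha> / (real k * a k)) else 0)" for n k
  define \<delta> where "\<delta> = \<alpha> / 2"
  have d: "0 < \<delta>" "\<delta> < \<alpha>" "\<alpha> - \<delta> = \<delta>" using alpha by (auto simp: \<delta>_def)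
  obtain N where N: "N \<ge> 1"
    "\<And>m n. N \<le> m \<Longrightarrow> m \<le> n \<Longrightarrow> a m / a n \<le> exp \<delta> * (real m / real n) powr (\<alpha> - \<delta>)"
    using potter_powr[OF d(1,2)] by metis
  define D where "D x = \<alpha> * exp \<delta> * (x powr (- (1 + \<delta>)) * indicator {1..} x)" for x :: real
  define g where "g x = \<alpha> * (x powr (- (1 + \<alpha>)) * indicator {1..} x)" for x :: real
  have int: "(\<integral>\<^sup>+x. ennreal (c * (x powr (- (1 + e)) * indicator {1..} x)) * indicator {0<..} x \<partial>lborel)
      = ennreal (c / e)" if "e > 0" "c \<ge> 0" for c e :: real
  proof -
    have "((\<lambda>x. c * x powr (- (1 + e))) has_integral c * (- (1 powr (- (1 + e) + 1)) / (- (1 + e) + 1))) {1..}"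
      by (intro has_integral_mult_right has_integral_powr_to_inf) (use that in auto)
    then have "((\<lambda>x. c * x powr (- (1 + e))) has_integral c / e) {1..}" by simp
    from nn_integral_has_integral_lebesgue'[OF _ this]
    have "(\<integral>\<^sup>+x. ennreal (c * x powr (- (1 + e))) * indicator {1..} x \<partial>lborel) = ennreal (c / e)"
      using that by simp
    moreover have "(\<integral>\<^sup>+x. ennreal (c * (x powr (- (1 + e)) * indicator {1..} x)) * indicator {0<..} x \<partial>lborel)
        = (\<integral>\<^sup>+x. ennreal (c * x powr (- (1 + e))) * indicator {1..} x \<partial>lborel)"
      by (intro nn_integral_cong) (auto simp: indicator_def)
    ultimately show ?thesis by simp
  qed
  have "(\<lambda>n. \<Sum>k. ennreal (G n (Suc k))) \<longlonglongrightarrow> (\<integral>\<^sup>+x. ennreal (g x) * indicator {0<..} x \<partial>lborel)"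
  proof (rule tendsto_suminf_rescaled[where D = D and N = N])
    show "0 \<le> G n k" for n k
      using a_pos[of n] a_pos[of k] alpha by (auto simp: G_def intro!: mult_nonneg_nonneg divide_nonneg_nonneg)
    show "(\<integral>\<^sup>+x. ennreal (D x) * indicator {0<..} x \<partial>lborel) < \<infinity>"
      using int[of \<delta> "\<alpha> * exp \<delta>"] d alpha by (simp add: D_def)
    fix x :: real assume x: "0 < x" "x \<noteq> 1"
    show "real n * G n (nat \<lceil>real n * x\<rceil>) \<le> D x" if "N \<le> n" for n
    proof (cases "1 \<le> n \<and> n < nat \<lceil>real n * x\<rceil>")
      case False
      then have "G n (nat \<lceil>real n * x\<rceil>) = 0" unfolding G_def by (rule if_not_P)
      then show ?thesis using alpha by (simp add: D_def)
    next
      case True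
      define k where "k = nat \<lceil>real n * x\<rceil>"
      have kn: "n < k" "1 \<le> n" using True by (auto simp: k_def)
      have "real n < real n * x" using kn unfolding k_def by linarith
      then have x1: "1 < x" using kn by simp
      have "real n * x \<le> real k" unfolding k_def by linarith
      then have kx: "real n / real k \<le> 1 / x" using kn x by (simp add: field_simps)
      have P: "a n > 0" "a k > 0" using kn a_pos by auto
      have "real n * G n k = \<alpha> * ((real n / real k) * (a n / a k))"
        using kn by (simp add: G_def)
      also have "\<dots> \<le> \<alpha> * ((real n / real k) * (exp \<delta> * (real n / real k) powr \<delta>))"
        using N(2)[of n k] that kn alpha d P by (intro mult_left_mono) auto
      also have "\<dots> \<le> \<alpha> * ((1 / x) * (exp \<delta> * (1 / x) powr \<delta>))"
        using kx alpha d x by (intro mult_left_mono mult_mono powr_mono2) auto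
      also have "\<dots> = D x"
        unfolding D_def powr_minus powr_add using x x1 by (simp add: powr_divide field_simps)
      finally show ?thesis by (simp add: k_def)
    qed
    let ?k = "\<lambda>n. nat \<lceil>real n * x\<rceil>"
    have kx: "(\<lambda>n. real (?k n) / real n) \<longlonglongrightarrow> x" by (rule tendsto_nat_ceiling_mult[OF x(1)])
    show "(\<lambda>n. real n * G n (?k n)) \<longlonglongrightarrow> g x"
    proof (cases "x < 1")
      case True
      have "\<forall>\<^sub>F n in sequentially. real n * G n (?k n) = 0"
        using order_tendstoD(2)[OF kx True] eventually_ge_at_top[of 1]
        by eventually_elim (auto simp: G_def field_simps)
      then show ?thesis using True by (simp add: g_def tendsto_eventually)
    next
      case False
      then have x1: "1 < x" using x by simp
      have "(\<lambda>n. \<alpha> * (inverse (real (?k n) / real n) * inverse (a (?k n) / a n))) \<longlonglongrightarrow> \<alpha> * (inverse x * inverse (x powr \<alpha>))"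
        using x by (intro tendsto_intros kx tendsto_ratio) auto
      moreover have "\<forall>\<^sub>F n in sequentially. \<alpha> * (inverse (real (?k n) / real n) * inverse (a (?k n) / a n)) = real n * G n (?k n)"
        using order_tendstoD(1)[OF kx x1] eventually_ge_at_top[of 1]
      proof eventually_elim
        case (elim n)
        then have "n < ?k n" by (auto simp: field_simps)
        then show ?case using elim by (simp add: G_def field_simps)
      qed
      ultimately have "(\<lambda>n. real n * G n (?k n)) \<longlonglongrightarrow> \<alpha> * (inverse x * inverse (x powr \<alpha>))"
        by (rule Lim_transform_eventually)
      also have "\<alpha> * (inverse x * inverse (x powr \<alpha>)) = g x"
        unfolding g_def powr_minus powr_add using x x1 by simp
      finally show ?thesis .
    qed
  qed (simp_all add: D_def[abs_def] g_def[abs_def])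
  then show ?thesis using int[of \<alpha> \<alpha>] alpha by (simp add: G_def g_def del: of_nat_Suc)
qed

text \<open>Finiteness of the extended sum at one large n already gives summability, and only then
  can the limit be read over the reals.\<close>

lemma summable_tail_density: "summable (\<lambda>k. \<alpha> / (real (Suc k) * a (Suc k)))"
  and tail_density: "(\<lambda>n. a n * (\<Sum>k. \<alpha> / (real (Suc (k + n)) * a (Suc (k + n))))) \<longlonglongrightarrow> 1"
proof -
  define f where "f k = \<alpha> / (real (Suc k) * a (Suc k))" for k
  have f0: "0 \<le> f k" for k
    using alpha a_pos[of "Suc k"] by (auto simp: f_def intro!: divide_nonneg_nonneg mult_nonneg_nonneg)
  let ?T = "\<lambda>n. \<Sum>k. ennreal (if 1 \<le> n \<and> n < Suc k then a n * f k else 0)"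
  have T: "?T \<longlonglongrightarrow> 1" using tail_density_aux unfolding f_def .
  have "\<forall>\<^sub>F n in sequentially. ?T n < 2" by (rule order_tendstoD(2)[OF T]) simp
  moreover have "\<forall>\<^sub>F n in sequentially. n \<ge> (1::nat)" by (rule eventually_ge_at_top)
  ultimately have "\<forall>\<^sub>F n in sequentially. ?T n < 2 \<and> n \<ge> 1" by (rule eventually_conj)
  then obtain n where n: "?T n < 2" "n \<ge> 1" unfolding eventually_sequentially by blast
  have an: "a n > 0" using n a_pos by auto
  have "?T n < \<top>" using n(1) by (rule order.strict_trans) simp
  then have "summable (\<lambda>k. if 1 \<le> n \<and> n < Suc k then a n * f k else 0)"
    by (intro summable_suminf_not_top) (use f0 an in \<open>auto simp: less_top\<close>)
  then have "summable (\<lambda>k. if 1 \<le> n \<and> n < Suc (k + n) then a n * f (k + n) else 0)"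
    by (subst summable_iff_shift) auto
  then have "summable (\<lambda>k. a n * f (k + n))" using n by simp
  then have "summable (\<lambda>k. f (k + n))" using an by (simp add: summable_cmult_iff)
  then have sf: "summable f" by (simp add: summable_iff_shift)
  then show "summable (\<lambda>k. \<alpha> / (real (Suc k) * a (Suc k)))" by (simp add: f_def[abs_def])
  have T_eq: "?T n = ennreal (a n * (\<Sum>k. f (k + n)))" if "n \<ge> 1" for n
  proof -
    let ?h = "\<lambda>k. if 1 \<le> n \<and> n < Suc k then a n * f k else 0"
    have an: "a n > 0" using that a_pos by auto
    have h0: "0 \<le> ?h k" for k using an f0[of k] by auto
    have sh: "summable ?h"
      by (rule summable_comparison_test'[OF summable_mult[OF sf, of "a n"], of 0])
        (use an f0 in auto)
    have "?T n = ennreal (\<Sum>k. ?h k)" by (rule suminf_ennreal2[OF h0 sh])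
    also have "(\<Sum>k. ?h k) = (\<Sum>k. ?h (k + n)) + (\<Sum>k<n. ?h k)" by (rule suminf_split_initial_segment[OF sh])
    also have "\<dots> = (\<Sum>k. a n * f (k + n))" using that by (simp add: less_Suc_eq_le)
    also have "\<dots> = a n * (\<Sum>k. f (k + n))"
      using sf by (intro suminf_mult) (simp add: summable_iff_shift)
    finally show ?thesis .
  qed
  have "\<forall>\<^sub>F n in sequentially. ?T n = ennreal (a n * (\<Sum>k. f (k + n)))"
    using eventually_ge_at_top[of 1] by eventually_elim (rule T_eq)
  from Lim_transform_eventually[OF T this]
  have "(\<lambda>n. ennreal (a n * (\<Sum>k. f (k + n)))) \<longlonglongrightarrow> ennreal 1" by simp
  moreover have "\<forall>\<^sub>F n in sequentially. 0 \<le> a n * (\<Sum>k. f (k + n))"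
    using eventually_ge_at_top[of 1]
  proof eventually_elim
    case (elim n)
    then show ?case using a_pos[of n] f0 sf
      by (intro mult_nonneg_nonneg suminf_nonneg) (auto simp: summable_iff_shift)
  qed
  ultimately have "(\<lambda>n. a n * (\<Sum>k. f (k + n))) \<longlonglongrightarrow> 1"
    by (subst (asm) tendsto_ennreal_iff) auto
  then show "(\<lambda>n. a n * (\<Sum>k. \<alpha> / (real (Suc (k + n)) * a (Suc (k + n))))) \<longlonglongrightarrow> 1"
    by (simp add: f_def del: of_nat_Suc)
qed

text \<open>The witness is v k = \<alpha> * a k / k, the formal derivative of \<open>a\<close>. Its
  partial sums rescale to the integral of \<alpha> * x powr (\<alpha> - 1) over [0, 1], and its
  convolution with F to a Beta integral. It is cut to 0 below N so that Potter's bounds hold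
  wherever v is nonzero.\<close>

lemma exists_renewal_density:
  assumes F0: "\<And>n. 0 \<le> F n" and F: "(\<lambda>n. a n * F n) \<longlonglongrightarrow> sin (pi * \<alpha>) / (pi * \<alpha>)"
  shows "\<exists>v. (\<lambda>n. (\<Sum>k\<le>n. v k) / a n) \<longlonglongrightarrow> 1 \<and> (\<lambda>n. \<Sum>k\<le>n. v k * F (n - k)) \<longlonglongrightarrow> 1"
proof -
  define c where "c = sin (pi * \<alpha>) / (pi * \<alpha>)"
  \<comment> \<open>Both singularities of the dominating function, with exponent \<alpha> - \<delta>
    - 1 at 0 and - \<alpha> - \<delta> at 1, must stay integrable.\<close>
  define \<delta> where "\<delta> = min \<alpha> (1 - \<alpha>) / 2"
  have d: "0 < \<delta>" "\<delta> < \<alpha>" "\<alpha> + \<delta> < 1" using alpha by (auto simp: \<delta>_def min_def field_simps)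
  obtain N where N: "N \<ge> 1"
    "\<And>m n. N \<le> m \<Longrightarrow> m \<le> n \<Longrightarrow> a m / a n \<le> exp \<delta> * (real m / real n) powr (\<alpha> - \<delta>)"
    "\<And>m n R. N \<le> m \<Longrightarrow> N \<le> n \<Longrightarrow> R \<ge> 1 \<Longrightarrow> real n / real m \<le> R \<Longrightarrow> a n / a m \<le> exp \<delta> * R powr (\<alpha> + \<delta>)"
    using potter_powr[OF d(1,2)] by metis
  define v where "v k = (if k < N then 0 else \<alpha> * a k / real k)" for k
  have v0: "0 \<le> v k" for k
    using a_pos[of k] N(1) alpha by (auto simp: v_def intro!: divide_nonneg_nonneg mult_nonneg_nonneg)
  have v00: "v 0 = 0" using N(1) by (simp add: v_def)
  have fin: "(\<Sum>k. ennreal (if Suc k \<le> n then h (Suc k) else 0)) = ennreal (\<Sum>k\<le>n. h k)"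
    if "\<And>k. k \<le> n \<Longrightarrow> 0 \<le> h k" "h 0 = 0" for h :: "nat \<Rightarrow> real" and n
  proof -
    have "(\<Sum>k. ennreal (if Suc k \<le> n then h (Suc k) else 0)) = (\<Sum>k<n. ennreal (if Suc k \<le> n then h (Suc k) else 0))"
      by (rule suminf_finite) auto
    also have "\<dots> = (\<Sum>k<n. ennreal (h (Suc k)))" by (intro sum.cong) auto
    also have "\<dots> = ennreal (\<Sum>k<n. h (Suc k))" using that by (intro sum_ennreal) auto
    also have "(\<Sum>k<n. h (Suc k)) = (\<Sum>k<Suc n. h k)" using that by (simp only: sum.lessThan_Suc_shift)
    finally show ?thesis by (simp add: lessThan_Suc_atMost)
  qed
  have kn_bound: "real n * (v k / a n) \<le> \<alpha> * exp \<delta> * x powr (\<alpha> - \<delta> - 1)"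
    if "N \<le> n" "N \<le> k" "k \<le> n" "0 < x" "real n * x \<le> real k" for n k x
  proof -
    have P: "a n > 0" "a k > 0" "real n > 0" "real k > 0" using that N(1) a_pos by auto
    have "real n * (v k / a n) = \<alpha> * ((real n / real k) * (a k / a n))"
      using that by (simp add: v_def)
    also have "\<dots> \<le> \<alpha> * ((real n / real k) * (exp \<delta> * (real k / real n) powr (\<alpha> - \<delta>)))"
      using N(2)[of k n] that alpha P by (intro mult_left_mono) auto
    also have "\<dots> = \<alpha> * exp \<delta> * (real k / real n) powr (\<alpha> - \<delta> - 1)"
      unfolding powr_diff using P by (simp add: field_simps)
    also have "\<dots> \<le> \<alpha> * exp \<delta> * x powr (\<alpha> - \<delta> - 1)"
      using alpha d that P by (intro mult_left_mono powr_mono2') (auto simp: field_simps)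
    finally show ?thesis .
  qed
  let ?k = "\<lambda>x n. nat \<lceil>real n * x\<rceil>"
  have kx: "(\<lambda>n. real (?k x n) / real n) \<longlonglongrightarrow> x" if "0 < x" for x by (rule tendsto_nat_ceiling_mult[OF that])
  have klarge: "\<forall>\<^sub>F n in sequentially. N \<le> ?k x n" if "0 < x" for x
  proof -
    have "\<forall>\<^sub>F n in sequentially. n \<ge> nat \<lceil>real N / x\<rceil>" by (rule eventually_ge_at_top)
    then show ?thesis
    proof eventually_elim
      case (elim n)
      then have "real N / x \<le> real n" by linarith
      then have "real N \<le> real n * x" using that by (simp add: field_simps)
      then show ?case by linarith
    qed
  qed
  have v_lim: "(\<lambda>n. real n * (v (?k x n) / a n)) \<longlonglongrightarrow> \<alpha> * x powr (\<alpha> - 1)" if "0 < x" for x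
  proof -
    have "(\<lambda>n. \<alpha> * (inverse (real (?k x n) / real n) * (a (?k x n) / a n))) \<longlonglongrightarrow> \<alpha> * (inverse x * x powr \<alpha>)"
      using that by (intro tendsto_intros kx tendsto_ratio) auto
    moreover have "\<forall>\<^sub>F n in sequentially. \<alpha> * (inverse (real (?k x n) / real n) * (a (?k x n) / a n))
        = real n * (v (?k x n) / a n)"
      using klarge[OF that] by eventually_elim (simp add: v_def field_simps)
    ultimately have "(\<lambda>n. real n * (v (?k x n) / a n)) \<longlonglongrightarrow> \<alpha> * (inverse x * x powr \<alpha>)"
      by (rule Lim_transform_eventually)
    also have "\<alpha> * (inverse x * x powr \<alpha>) = \<alpha> * x powr (\<alpha> - 1)"
      using that by (simp add: powr_diff field_simps)
    finally show ?thesis .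
  qed
  have small: "\<forall>\<^sub>F n in sequentially. ?k x n \<le> n" if "x \<le> 1" for x
  proof (rule always_eventually, rule allI)
    fix n :: nat
    have "real n * x \<le> real n * 1" using that by (intro mult_left_mono) auto
    then show "?k x n \<le> n" by linarith
  qed
  have big: "\<forall>\<^sub>F n in sequentially. \<not> ?k x n \<le> n" if "1 < x" for x
  proof -
    have "0 < x" using that by simp
    from order_tendstoD(1)[OF kx[OF this] that] eventually_ge_at_top[of 1]
    show ?thesis by eventually_elim (use that in \<open>auto simp: field_simps\<close>)
  qed
  have x_le_1: "x \<le> 1" "real n * x \<le> real (?k x n)" if "?k x n \<le> n" "1 \<le> n" for x n
  proof -
    show *: "real n * x \<le> real (?k x n)" by linarith
    have "real (?k x n) \<le> real n" using that by simp
    with * have "real n * x \<le> real n * 1" by linarith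
    then show "x \<le> 1" using that by (subst (asm) mult_le_cancel_left_pos) auto
  qed
  have "(\<lambda>n. (\<Sum>k\<le>n. v k) / a n) \<longlonglongrightarrow> 1"
  proof -
    \<comment> \<open>The absolute value keeps G nonnegative at n = 0, where the sign of a 0 is
      unknown.\<close>
    define G where "G n k = (if k \<le> n then v k * (1 / \<bar>a n\<bar>) else 0)" for n k
    define g where "g x = \<alpha> * x powr (\<alpha> - 1) * indicator {..1} x" for x :: real
    define D where "D x = \<alpha> * exp \<delta> * x powr (\<alpha> - \<delta> - 1) * indicator {..1} x" for x :: real
    have int: "(\<integral>\<^sup>+x. ennreal (C * x powr (e - 1) * indicator {..1} x) * indicator {0<..} x \<partial>lborel) = ennreal (C / e)"
      if "C \<ge> 0" "e > 0" for C e :: real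
    proof -
      have "((\<lambda>x. C * x powr (e - 1)) has_integral C * (1 powr (e - 1 + 1) / (e - 1 + 1))) {0..1}"
        by (intro has_integral_mult_right has_integral_powr_from_0) (use that in auto)
      then have "((\<lambda>x. C * x powr (e - 1)) has_integral C / e) {0..1}" by simp
      from nn_integral_has_integral_lebesgue'[OF _ this]
      have "(\<integral>\<^sup>+x. ennreal (C * x powr (e - 1)) * indicator {0..1} x \<partial>lborel) = ennreal (C / e)"
        using that by simp
      moreover have "(\<integral>\<^sup>+x. ennreal (C * x powr (e - 1) * indicator {..1} x) * indicator {0<..} x \<partial>lborel)
          = (\<integral>\<^sup>+x. ennreal (C * x powr (e - 1)) * indicator {0..1} x \<partial>lborel)"
        by (intro nn_integral_cong) (auto simp: indicator_def)
      ultimately show ?thesis by simp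
    qed
    have "(\<lambda>n. \<Sum>k. ennreal (G n (Suc k))) \<longlonglongrightarrow> (\<integral>\<^sup>+x. ennreal (g x) * indicator {0<..} x \<partial>lborel)"
    proof (rule tendsto_suminf_rescaled[where D = D and N = N])
      show "0 \<le> G n k" for n k using v0 by (auto simp: G_def)
      show "(\<integral>\<^sup>+x. ennreal (D x) * indicator {0<..} x \<partial>lborel) < \<infinity>"
        unfolding D_def using int[of "\<alpha> * exp \<delta>" "\<alpha> - \<delta>"] d alpha by simp
      fix x :: real assume x: "0 < x" "x \<noteq> 1"
      show "real n * G n (?k x n) \<le> D x" if "N \<le> n" for n
      proof (cases "?k x n \<le> n \<and> N \<le> ?k x n")
        case True
        have P: "a n > 0" using that N(1) a_pos by auto
        have "x \<le> 1" "real n * x \<le> real (?k x n)" using x_le_1[of n x] True that N(1) by auto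
        then show ?thesis using kn_bound[of n "?k x n" x] True that x P by (simp add: G_def D_def)
      next
        case False
        then have "G n (?k x n) = 0" by (auto simp: G_def v_def)
        then show ?thesis using alpha by (simp add: D_def)
      qed
      show "(\<lambda>n. real n * G n (?k x n)) \<longlonglongrightarrow> g x"
      proof (cases "x < 1")
        case True
        have "\<forall>\<^sub>F n in sequentially. real n * (v (?k x n) / a n) = real n * G n (?k x n)"
          using small[OF less_imp_le[OF True]] eventually_ge_at_top[of 1]
        proof eventually_elim
          case (elim n)
          then show ?case using a_pos[of n] by (simp add: G_def)
        qed
        from Lim_transform_eventually[OF v_lim[OF x(1)] this] show ?thesis using True by (simp add: g_def)
      next
        case False
        then have "\<forall>\<^sub>F n in sequentially. real n * G n (?k x n) = 0"
          using big[of x] x by (auto simp: G_def elim: eventually_mono)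
        then show ?thesis using False x by (simp add: g_def tendsto_eventually)
      qed
    qed (simp_all add: D_def[abs_def] g_def[abs_def])
    moreover have "(\<integral>\<^sup>+x. ennreal (g x) * indicator {0<..} x \<partial>lborel) = 1"
      unfolding g_def using int[of \<alpha> \<alpha>] alpha by simp
    moreover have "(\<Sum>k. ennreal (G n (Suc k))) = ennreal ((\<Sum>k\<le>n. v k) * (1 / \<bar>a n\<bar>))" for n
      unfolding G_def sum_distrib_right using v0 v00 by (intro fin) auto
    ultimately have "(\<lambda>n. ennreal ((\<Sum>k\<le>n. v k) * (1 / \<bar>a n\<bar>))) \<longlonglongrightarrow> ennreal 1" by simp
    then have "(\<lambda>n. (\<Sum>k\<le>n. v k) * (1 / \<bar>a n\<bar>)) \<longlonglongrightarrow> 1"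
      by (subst (asm) tendsto_ennreal_iff) (auto intro!: always_eventually mult_nonneg_nonneg sum_nonneg v0)
    moreover have "\<forall>\<^sub>F n in sequentially. (\<Sum>k\<le>n. v k) * (1 / \<bar>a n\<bar>) = (\<Sum>k\<le>n. v k) / a n"
      using eventually_ge_at_top[of 1]
    proof eventually_elim
      case (elim n)
      then show ?case using a_pos[of n] by simp
    qed
    ultimately show ?thesis by (rule Lim_transform_eventually)
  qed
  moreover have "(\<lambda>n. \<Sum>k\<le>n. v k * F (n - k)) \<longlonglongrightarrow> 1"
  proof -
    \<comment> \<open>The index j = n - k can be too small for Potter's bound, so F j is measured
      against a (j + N) instead of a j. The shifted product converges, hence is bounded, and a n / a
      (j + N) is controlled for every j because j + N \<ge> n * (1 - x).\<close>
    have shift: "(\<lambda>j. a (j + N) / a j) \<longlonglongrightarrow> 1 powr \<alpha>"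
    proof (rule tendsto_ratio)
      have "(\<lambda>n. 1 + real N / real n) \<longlonglongrightarrow> 1 + 0"
        by (intro tendsto_add tendsto_const lim_const_over_n)
      moreover have "\<forall>\<^sub>F n in sequentially. 1 + real N / real n = real (n + N) / real n"
        using eventually_ge_at_top[of 1] by eventually_elim (simp add: field_simps)
      ultimately show "(\<lambda>n. real (n + N) / real n) \<longlonglongrightarrow> 1"
        using Lim_transform_eventually by fastforce
    qed simp
    have "(\<lambda>j. (a (j + N) / a j) * (a j * F j)) \<longlonglongrightarrow> 1 powr \<alpha> * c"
      by (intro tendsto_mult shift F[folded c_def])
    moreover have "\<forall>\<^sub>F j in sequentially. (a (j + N) / a j) * (a j * F j) = a (j + N) * F j"
      using eventually_ge_at_top[of 1]
    proof eventually_elim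
      case (elim n)
      then show ?case using a_pos[of n] by simp
    qed
    ultimately have "(\<lambda>j. a (j + N) * F j) \<longlonglongrightarrow> 1 powr \<alpha> * c" by (rule Lim_transform_eventually)
    then have "Bseq (\<lambda>j. a (j + N) * F j)" by (intro convergent_imp_Bseq convergentI)
    then obtain C where C: "C > 0" "\<And>j. \<bar>a (j + N) * F j\<bar> \<le> C"
      unfolding Bseq_def by auto
    define G where "G n k = (if k \<le> n then v k * F (n - k) else 0)" for n k
    define g where "g x = (\<alpha> * c) * (x powr (\<alpha> - 1) * (1 - x) powr (1 - \<alpha> - 1)) * indicator {0..1} x" for x :: real
    define D where "D x = (\<alpha> * exp \<delta> * exp \<delta> * C) * (x powr (\<alpha> - \<delta> - 1) * (1 - x) powr (1 - \<alpha> - \<delta> - 1)) * indicator {0..1} x"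
      for x :: real
    have int: "(\<integral>\<^sup>+x. ennreal (K * (x powr (e - 1) * (1 - x) powr (e' - 1)) * indicator {0..1} x) * indicator {0<..} x \<partial>lborel)
        = ennreal (K * Beta e e')" if "K \<ge> 0" "e > 0" "e' > 0" for K e e' :: real
    proof -
      have "((\<lambda>x. K * (x powr (e - 1) * (1 - x) powr (e' - 1))) has_integral K * Beta e e') {0..1}"
        by (intro has_integral_mult_right has_integral_Beta_real that)
      from nn_integral_has_integral_lebesgue'[OF _ this]
      have "(\<integral>\<^sup>+x. ennreal (K * (x powr (e - 1) * (1 - x) powr (e' - 1))) * indicator {0..1} x \<partial>lborel) = ennreal (K * Beta e e')"
        using that by simp
      moreover have "(\<integral>\<^sup>+x. ennreal (K * (x powr (e - 1) * (1 - x) powr (e' - 1)) * indicator {0..1} x) * indicator {0<..} x \<partial>lborel)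
          = (\<integral>\<^sup>+x. ennreal (K * (x powr (e - 1) * (1 - x) powr (e' - 1))) * indicator {0..1} x \<partial>lborel)"
        by (intro nn_integral_cong) (auto simp: indicator_def)
      ultimately show ?thesis by simp
    qed
    have c0: "c > 0" using alpha by (auto simp: c_def intro!: divide_pos_pos sin_gt_zero)
    have "(\<lambda>n. \<Sum>k. ennreal (G n (Suc k))) \<longlonglongrightarrow> (\<integral>\<^sup>+x. ennreal (g x) * indicator {0<..} x \<partial>lborel)"
    proof (rule tendsto_suminf_rescaled[where D = D and N = N])
      show "0 \<le> G n k" for n k using v0 F0 by (auto simp: G_def)
      show "(\<integral>\<^sup>+x. ennreal (D x) * indicator {0<..} x \<partial>lborel) < \<infinity>"
        unfolding D_def using int[of "\<alpha> * exp \<delta> * exp \<delta> * C" "\<alpha> - \<delta>" "1 - \<alpha> - \<delta>"] d alpha C by simp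
      fix x :: real assume x: "0 < x" "x \<noteq> 1"
      show "real n * G n (?k x n) \<le> D x" if "N \<le> n" for n
      proof (cases "?k x n \<le> n \<and> N \<le> ?k x n")
        case True
        let ?K = "?k x n"
        have P: "a n > 0" using that N(1) a_pos by auto
        have le: "x \<le> 1" "real n * x \<le> real ?K" using x_le_1[of n x] True that N(1) by auto
        then have x1: "x < 1" using x by simp
        define j where "j = n - ?K"
        have "0 < real n * x" using x that N(1) by simp
        then have "real ?K < real n * x + 1" by linarith
        then have jn: "real n * (1 - x) \<le> real (j + N)" using True N(1) by (simp add: j_def algebra_simps of_nat_diff)
        have aj: "a (j + N) > 0" using N(1) a_pos by auto
        have aF: "a n * F j \<le> exp \<delta> * (1 / (1 - x)) powr (\<alpha> + \<delta>) * C"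
        proof -
          have "a n * F j = (a n / a (j + N)) * (a (j + N) * F j)" using aj by simp
          also have "\<dots> \<le> (exp \<delta> * (1 / (1 - x)) powr (\<alpha> + \<delta>)) * C"
          proof (rule mult_mono)
            show "a n / a (j + N) \<le> exp \<delta> * (1 / (1 - x)) powr (\<alpha> + \<delta>)"
              by (rule N(3)) (use that x1 x jn N(1) in \<open>auto simp: field_simps\<close>)
            show "a (j + N) * F j \<le> C" using C(2)[of j] by linarith
          qed (use aj F0 in auto)
          finally show ?thesis .
        qed
        have "real n * G n ?K = (real n * (v ?K / a n)) * (a n * F j)" using True P by (simp add: G_def j_def)
        also have "\<dots> \<le> (\<alpha> * exp \<delta> * x powr (\<alpha> - \<delta> - 1)) * (exp \<delta> * (1 / (1 - x)) powr (\<alpha> + \<delta>) * C)"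
        proof (rule mult_mono)
          show "real n * (v ?K / a n) \<le> \<alpha> * exp \<delta> * x powr (\<alpha> - \<delta> - 1)"
            using kn_bound[of n ?K x] True that x le by blast
        qed (use alpha aF P F0 in auto)
        also have "\<dots> = D x"
        proof -
          have "(1 / (1 - x)) powr (\<alpha> + \<delta>) = (1 - x) powr (- (\<alpha> + \<delta>))"
            using x1 by (simp only: powr_minus) (simp add: powr_divide field_simps)
          also have "- (\<alpha> + \<delta>) = 1 - \<alpha> - \<delta> - 1" by simp
          finally show ?thesis using x x1 by (simp add: D_def)
        qed
        finally show ?thesis .
      next
        case False
        then have "G n (?k x n) = 0" by (auto simp: G_def v_def)
        then show ?thesis using alpha C by (simp add: D_def)
      qed
      show "(\<lambda>n. real n * G n (?k x n)) \<longlonglongrightarrow> g x"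
      proof (cases "x < 1")
        case True
        let ?j = "\<lambda>n. n - ?k x n"
        have le: "\<forall>\<^sub>F n in sequentially. ?k x n \<le> n" using small True by simp
        have jx: "(\<lambda>n. real (?j n) / real n) \<longlonglongrightarrow> 1 - x"
        proof -
          have "(\<lambda>n. 1 - real (?k x n) / real n) \<longlonglongrightarrow> 1 - x" by (intro tendsto_diff tendsto_const kx x)
          moreover have "\<forall>\<^sub>F n in sequentially. 1 - real (?k x n) / real n = real (?j n) / real n"
            using le eventually_ge_at_top[of 1] by eventually_elim (simp add: of_nat_diff field_simps)
          ultimately show ?thesis by (rule Lim_transform_eventually)
        qed
        have jinf: "filterlim ?j at_top sequentially"
        proof -
          have *: "filterlim (\<lambda>n. (real (?j n) / real n) * real n) at_top sequentially"
            using True by (intro filterlim_tendsto_pos_mult_at_top[OF jx _ filterlim_real_sequentially]) simp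
          have "\<forall>\<^sub>F n in sequentially. (real (?j n) / real n) * real n = real (?j n)"
            using eventually_ge_at_top[of 1] by eventually_elim auto
          from filterlim_cong[OF refl refl this, THEN iffD1, OF *]
          have "filterlim (\<lambda>n. real (?j n)) at_top sequentially" .
          then show ?thesis by (simp only: filterlim_sequentially_iff_filterlim_real)
        qed
        have "(\<lambda>n. real n * (v (?k x n) / a n) * (inverse (a (?j n) / a n) * (a (?j n) * F (?j n))))
            \<longlonglongrightarrow> \<alpha> * x powr (\<alpha> - 1) * (inverse ((1 - x) powr \<alpha>) * c)"
          using True x by (intro tendsto_mult v_lim tendsto_inverse tendsto_ratio jx
              filterlim_compose[OF F[folded c_def] jinf]) auto
        moreover have "\<forall>\<^sub>F n in sequentially. real n * (v (?k x n) / a n) * (inverse (a (?j n) / a n) * (a (?j n) * F (?j n)))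
            = real n * G n (?k x n)"
          using le eventually_ge_at_top[of 1] jinf[unfolded filterlim_at_top, rule_format, of 1]
        proof eventually_elim
          case (elim n)
          then show ?case using a_pos[of n] a_pos[of "?j n"] by (simp add: G_def field_simps)
        qed
        ultimately have "(\<lambda>n. real n * G n (?k x n)) \<longlonglongrightarrow> \<alpha> * x powr (\<alpha> - 1) * (inverse ((1 - x) powr \<alpha>) * c)"
          by (rule Lim_transform_eventually)
        also have "\<alpha> * x powr (\<alpha> - 1) * (inverse ((1 - x) powr \<alpha>) * c) = g x"
          using x True by (simp add: g_def powr_minus)
        finally show ?thesis .
      next
        case False
        then have "\<forall>\<^sub>F n in sequentially. real n * G n (?k x n) = 0"
          using big[of x] x by (auto simp: G_def elim: eventually_mono)
        then show ?thesis using False x by (simp add: g_def tendsto_eventually)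
      qed
    qed (simp_all add: D_def[abs_def] g_def[abs_def])
    moreover have "(\<integral>\<^sup>+x. ennreal (g x) * indicator {0<..} x \<partial>lborel) = ennreal (\<alpha> * c * Beta \<alpha> (1 - \<alpha>))"
      unfolding g_def using int[of "\<alpha> * c" \<alpha> "1 - \<alpha>"] alpha c0 by simp
    moreover have "\<alpha> * c * Beta \<alpha> (1 - \<alpha>) = 1"
    proof -
      have "sin (pi * \<alpha>) > 0" using alpha by (intro sin_gt_zero) auto
      then show ?thesis using alpha by (simp add: Beta_reflection_real c_def)
    qed
    moreover have "(\<Sum>k. ennreal (G n (Suc k))) = ennreal (\<Sum>k\<le>n. v k * F (n - k))" for n
      unfolding G_def using v0 F0 v00 by (intro fin) auto
    ultimately have "(\<lambda>n. ennreal (\<Sum>k\<le>n. v k * F (n - k))) \<longlonglongrightarrow> ennreal 1" by simp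
    then show ?thesis
      by (subst (asm) tendsto_ennreal_iff) (auto intro!: always_eventually mult_nonneg_nonneg sum_nonneg v0 F0)
  qed
  ultimately show ?thesis by blast
qed

text \<open>Convolving the asymptotic identity \<open>v * F = 1 + o(1)\<close> with \<open>u\<close>, for which \<open>u * F = 1\<close> exactly,
  compares the partial sums of \<open>u\<close> with those of the explicit sequence \<open>v\<close>: no Tauberian theorem is needed.\<close>

theorem renewal_partial_sums:
  assumes F0: "\<And>n. 0 \<le> F n" and F: "(\<lambda>n. a n * F n) \<longlonglongrightarrow> sin (pi * \<alpha>) / (pi * \<alpha>)"
    and u0: "\<And>n. 0 \<le> u n" "\<And>n. u n \<le> 1"
    and conv: "\<And>n. (\<Sum>k\<le>n. u k * F (n - k)) = 1"
  shows "(\<lambda>n. (\<Sum>k\<le>n. u k) / a n) \<longlonglongrightarrow> 1"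
proof -
  obtain v where v: "(\<lambda>n. (\<Sum>k\<le>n. v k) / a n) \<longlonglongrightarrow> 1" "(\<lambda>n. \<Sum>k\<le>n. v k * F (n - k)) \<longlonglongrightarrow> 1"
    using exists_renewal_density[OF F0 F] by blast
  define \<epsilon> where "\<epsilon> n = (\<Sum>k\<le>n. v k * F (n - k)) - 1" for n
  define U where "U n = (\<Sum>k\<le>n. u k)" for n
  define V where "V n = (\<Sum>k\<le>n. v k)" for n
  have U0: "0 \<le> U n" for n unfolding U_def by (intro sum_nonneg u0)
  \<comment> \<open>Associativity of convolution is borrowed from formal power series: v * 1 = v *
    (u * F) = (v * F) * u = (1 + \<epsilon>) * u, where 1 stands for the constant sequence.\<close>
  have VU: "V n = U n + (\<Sum>j\<le>n. \<epsilon> j * u (n - j))" and Urev: "(\<Sum>j\<le>n. u (n - j)) = U n" for n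
  proof -
    let ?J = "Abs_fps (\<lambda>_. 1 :: real)"
    have nth: "fps_nth (Abs_fps f * Abs_fps g) n = (\<Sum>k\<le>n. f k * g (n - k))" for f g :: "nat \<Rightarrow> real" and n
      by (simp add: fps_mult_nth atLeast0AtMost)
    have uF: "Abs_fps u * Abs_fps F = ?J" by (rule fps_ext) (simp only: nth conv fps_nth_Abs_fps)
    have vF: "Abs_fps v * Abs_fps F = ?J + Abs_fps \<epsilon>"
      by (rule fps_ext) (simp add: nth \<epsilon>_def del: fps_mult_nth)
    have "Abs_fps v * ?J = Abs_fps u * ?J + Abs_fps \<epsilon> * Abs_fps u"
    proof -
      have "Abs_fps v * ?J = Abs_fps v * (Abs_fps u * Abs_fps F)" by (simp only: uF)
      also have "\<dots> = (Abs_fps v * Abs_fps F) * Abs_fps u" by (simp only: mult_ac)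
      also have "\<dots> = Abs_fps u * ?J + Abs_fps \<epsilon> * Abs_fps u"
        by (simp only: vF distrib_right mult.commute[of ?J])
      finally show ?thesis .
    qed
    from arg_cong[OF this, of "\<lambda>f. fps_nth f n"] show "V n = U n + (\<Sum>j\<le>n. \<epsilon> j * u (n - j))"
      by (simp only: fps_add_nth nth U_def V_def) simp
    have "fps_nth (?J * Abs_fps u) n = fps_nth (Abs_fps u * ?J) n" by (simp add: mult.commute)
    then show "(\<Sum>j\<le>n. u (n - j)) = U n" by (simp only: nth U_def) simp
  qed
  have \<epsilon>lim: "\<epsilon> \<longlonglongrightarrow> 0"
    using tendsto_diff[OF v(2) tendsto_const[of 1]] by (simp add: \<epsilon>_def[abs_def])
  then have "Bseq \<epsilon>" by (intro convergent_imp_Bseq convergentI)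
  then obtain E where E: "E > 0" "\<And>j. \<bar>\<epsilon> j\<bar> \<le> E"
    unfolding Bseq_def by auto
  \<comment> \<open>Indices with |\<epsilon> j| \<le> \<delta> contribute at most \<delta> * U n.
    The M exceptional ones contribute at most E each, since u \<le> 1, and this constant is
    negligible against a n.\<close>
  have bound: "\<exists>K. \<forall>n. \<bar>V n - U n\<bar> \<le> \<delta> * U n + K" if d: "\<delta> > 0" for \<delta>
  proof -
    obtain M where M: "\<And>j. j \<ge> M \<Longrightarrow> \<bar>\<epsilon> j\<bar> \<le> \<delta>"
      using LIMSEQ_D[OF \<epsilon>lim d] by (auto intro: less_imp_le)
    have "\<bar>V n - U n\<bar> \<le> \<delta> * U n + E * real M" for n
    proof -
      have "\<bar>V n - U n\<bar> \<le> (\<Sum>j\<le>n. \<bar>\<epsilon> j * u (n - j)\<bar>)" by (simp add: VU)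
      also have "\<dots> \<le> (\<Sum>j\<le>n. \<delta> * u (n - j) + (if j < M then E else 0))"
      proof (rule sum_mono)
        fix j
        show "\<bar>\<epsilon> j * u (n - j)\<bar> \<le> \<delta> * u (n - j) + (if j < M then E else 0)"
        proof (cases "j < M")
          case True
          have "\<bar>\<epsilon> j * u (n - j)\<bar> \<le> E * 1" using E u0 by (simp only: abs_mult) (intro mult_mono, auto)
          moreover have "0 \<le> \<delta> * u (n - j)" using that u0 by simp
          ultimately show ?thesis using True by simp
        next
          case False
          then show ?thesis using M[of j] u0 by (auto simp: abs_mult intro: mult_right_mono)
        qed
      qed
      also have "\<dots> = \<delta> * U n + (\<Sum>j\<le>n. if j < M then E else 0)"
        by (simp add: sum.distrib sum_distrib_left[symmetric] Urev)
      also have "(\<Sum>j\<le>n. if j < M then E else 0) \<le> (\<Sum>j<M. E)"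
      proof -
        have "(\<Sum>j\<le>n. if j < M then E else 0) = (\<Sum>j\<in>{..n} \<inter> {..<M}. E)"
          by (simp only: sum.inter_restrict finite_atMost lessThan_iff)
        also have "\<dots> \<le> (\<Sum>j<M. E)" using E by (intro sum_mono2) auto
        finally show ?thesis .
      qed
      finally show ?thesis by (simp add: mult.commute)
    qed
    then show ?thesis by blast
  qed
  have apos: "\<forall>\<^sub>F n in sequentially. a n > 0"
    using eventually_ge_at_top[of 1] by eventually_elim (rule a_pos)
  have "(\<lambda>n. U n / a n) \<longlonglongrightarrow> 1"
  proof (rule order_tendstoI)
    fix r :: real assume "r < 1"
    define \<delta> where "\<delta> = (1 - r) / 2"
    have "1 - r * (1 + \<delta>) = (1 - r) * (2 - r) / 2" by (simp add: \<delta>_def field_simps)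
    moreover have "(1 - r) * (2 - r) / 2 > 0" using \<open>r < 1\<close> by simp
    ultimately have d: "r * (1 + \<delta>) < 1" "\<delta> > 0"
      using \<open>r < 1\<close> by (linarith, simp add: \<delta>_def)
    obtain K where K: "\<And>n. \<bar>V n - U n\<bar> \<le> \<delta> * U n + K" using bound[OF d(2)] by blast
    have "(\<lambda>n. V n / a n - K * inverse (a n)) \<longlonglongrightarrow> 1 - K * 0"
      unfolding V_def by (intro tendsto_intros v filterlim_compose[OF tendsto_inverse_0_at_top filterlim_a] tendsto_inverse_0_at_top filterlim_a)
    then have "\<forall>\<^sub>F n in sequentially. r * (1 + \<delta>) < V n / a n - K * inverse (a n)"
      by (rule order_tendstoD(1)) (use d in simp)
    then show "\<forall>\<^sub>F n in sequentially. r < U n / a n"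
      using apos
    proof eventually_elim
      case (elim n)
      have "V n - K \<le> (1 + \<delta>) * U n" using K[of n] by (auto simp: algebra_simps)
      then have "(V n - K) / a n \<le> (1 + \<delta>) * U n / a n" using elim by (intro divide_right_mono) auto
      moreover have "(V n - K) / a n = V n / a n - K * inverse (a n)"
        by (simp add: divide_inverse left_diff_distrib)
      moreover have "(1 + \<delta>) * U n / a n = (U n / a n) * (1 + \<delta>)" by simp
      ultimately have "r * (1 + \<delta>) < (U n / a n) * (1 + \<delta>)" using elim by linarith
      then show ?case by (rule mult_right_less_imp_less) (use d in simp)
    qed
  next
    fix r :: real assume "1 < r"
    define \<delta> where "\<delta> = (r - 1) / (2 * r)"
    have d: "\<delta> > 0" "\<delta> < 1" "1 < r * (1 - \<delta>)"
      using \<open>1 < r\<close> by (auto simp: \<delta>_def field_simps)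
    obtain K where K: "\<And>n. \<bar>V n - U n\<bar> \<le> \<delta> * U n + K" using bound[OF d(1)] by blast
    have "(\<lambda>n. V n / a n + K * inverse (a n)) \<longlonglongrightarrow> 1 + K * 0"
      unfolding V_def by (intro tendsto_intros v tendsto_inverse_0_at_top filterlim_a)
    then have "\<forall>\<^sub>F n in sequentially. V n / a n + K * inverse (a n) < r * (1 - \<delta>)"
      by (rule order_tendstoD(2)) (use d in simp)
    then show "\<forall>\<^sub>F n in sequentially. U n / a n < r"
      using apos
    proof eventually_elim
      case (elim n)
      have "(1 - \<delta>) * U n \<le> V n + K" using K[of n] by (auto simp: algebra_simps)
      then have "(1 - \<delta>) * U n / a n \<le> (V n + K) / a n" using elim by (intro divide_right_mono) auto
      moreover have "(V n + K) / a n = V n / a n + K * inverse (a n)"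
        by (simp add: divide_inverse distrib_right)
      moreover have "(1 - \<delta>) * U n / a n = (U n / a n) * (1 - \<delta>)" by simp
      ultimately have "(U n / a n) * (1 - \<delta>) < r * (1 - \<delta>)" using elim by linarith
      then show ?case by (rule mult_right_less_imp_less) (use d in simp)
    qed
  qed
  then show ?thesis by (simp add: U_def)
qed

end

section \<open>The joint law of the exit index and the return time\<close>

context regularly_varying_seq
begin

text \<open>\<open>scaling\<close> inverts \<open>a\<close> through the infimum of a superlevel set,
  and a regularly varying function of positive index has an asymptotic inverse: if b k is about 1 /
  a (l k), that infimum is about l k.\<close>

lemma scaling_asymp:
  fixes l :: "nat \<Rightarrow> nat" and b :: "nat \<Rightarrow> real"
  assumes l: "filterlim l at_top sequentially" and b_pos: "\<And>k. b k > 0"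
    and ab: "(\<lambda>k. a (l k) * b k) \<longlonglongrightarrow> 1"
  shows "(\<lambda>k. scaling a (b k) * real (l k)) \<longlonglongrightarrow> 1"
proof -
  define I where "I k = Inf {u. u \<ge> 0 \<and> step_extension a u > 1 / b k}" for k
  have l1: "\<forall>\<^sub>F k in sequentially. M \<le> l k" for M
    using l unfolding filterlim_at_top by blast
  have al: "filterlim (\<lambda>k. a (l k)) at_top sequentially" by (rule filterlim_compose[OF filterlim_a l])
  have inv_b: "filterlim (\<lambda>k. 1 / b k) at_top sequentially"
  proof -
    have "filterlim (\<lambda>k. inverse (a (l k) * b k) * a (l k)) at_top sequentially"
      by (rule filterlim_tendsto_pos_mult_at_top[OF tendsto_inverse[OF ab] _ al]) auto
    moreover have "\<forall>\<^sub>F k in sequentially. inverse (a (l k) * b k) * a (l k) = 1 / b k"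
      using l1[of 1] by eventually_elim (use a_pos b_pos in \<open>auto simp: field_simps less_imp_neq[THEN not_sym]\<close>)
    ultimately show ?thesis by (simp cong: filterlim_cong)
  qed
  have upper: "\<forall>\<^sub>F k in sequentially. I k \<le> (1 + \<epsilon>) * real (l k) \<and>
      {u. u \<ge> 0 \<and> step_extension a u > 1 / b k} \<noteq> {}" if "\<epsilon> > 0" for \<epsilon>
  proof -
    \<comment> \<open>Subtracting 1 from the ceiling gives an integer that is at most (1 +
      \<epsilon>) * n, as needed to bound the infimum from above.\<close>
    have "(\<lambda>n. real (nat \<lceil>real n * (1 + \<epsilon>)\<rceil> - 1) / real n) \<longlonglongrightarrow> 1 + \<epsilon>"
    proof -
      have "(\<lambda>n. real (nat \<lceil>real n * (1 + \<epsilon>)\<rceil>) / real n - 1 / real n) \<longlonglongrightarrow> (1 + \<epsilon>) - 0"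
        by (intro tendsto_diff tendsto_nat_ceiling_mult lim_1_over_n) (use that in simp)
      moreover have "\<forall>\<^sub>F n in sequentially. real (nat \<lceil>real n * (1 + \<epsilon>)\<rceil>) / real n - 1 / real n
          = real (nat \<lceil>real n * (1 + \<epsilon>)\<rceil> - 1) / real n"
        using eventually_ge_at_top[of 1]
      proof eventually_elim
        case (elim n)
        have "0 < real n * (1 + \<epsilon>)" using elim that by simp
        then have "nat \<lceil>real n * (1 + \<epsilon>)\<rceil> \<ge> 1" by linarith
        then show ?case by (simp add: of_nat_diff diff_divide_distrib)
      qed
      ultimately show ?thesis using Lim_transform_eventually by fastforce
    qed
    from tendsto_ratio[OF this] have "(\<lambda>n. a (nat \<lceil>real n * (1 + \<epsilon>)\<rceil> - 1) / a n) \<longlonglongrightarrow> (1 + \<epsilon>) powr \<alpha>"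
      using that by simp
    from tendsto_mult[OF filterlim_compose[OF this l] ab]
    have lim: "(\<lambda>k. (a (nat \<lceil>real (l k) * (1 + \<epsilon>)\<rceil> - 1) / a (l k)) * (a (l k) * b k)) \<longlonglongrightarrow> (1 + \<epsilon>) powr \<alpha> * 1" .
    have "1 powr \<alpha> < (1 + \<epsilon>) powr \<alpha>" using alpha that by (intro powr_less_mono2) auto
    then have "1 < (1 + \<epsilon>) powr \<alpha> * 1" by simp
    from order_tendstoD(1)[OF lim this] show ?thesis
      using l1[of 1]
    proof eventually_elim
      case (elim k)
      let ?n = "nat \<lceil>real (l k) * (1 + \<epsilon>)\<rceil> - 1"
      have "a (l k) > 0" using elim a_pos by auto
      then have "1 < a ?n * b k" using elim by (simp add: field_simps)
      then have "step_extension a (real ?n) > 1 / b k" using b_pos[of k] by (simp add: field_simps)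
      then have mem: "real ?n \<in> {u. u \<ge> 0 \<and> step_extension a u > 1 / b k}" by simp
      then have "I k \<le> real ?n" unfolding I_def by (intro cInf_lower bdd_belowI[of _ 0]) auto
      moreover have "real ?n \<le> real (l k) * (1 + \<epsilon>)"
      proof -
        have "0 \<le> real (l k) * (1 + \<epsilon>)" using that by simp
        then show ?thesis by linarith
      qed
      ultimately have "I k \<le> (1 + \<epsilon>) * real (l k)" by (simp add: mult.commute)
      then show ?case using mem by blast
    qed
  qed
  have lower: "\<forall>\<^sub>F k in sequentially. (1 - \<epsilon>) * real (l k) \<le> I k" if e: "0 < \<epsilon>" "\<epsilon> < 1" for \<epsilon>
  proof -
    \<comment> \<open>Chosen so that exp \<delta> * (1 - \<epsilon>) powr (\<alpha> / 2) is at most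
      (1 - \<epsilon>) powr (\<alpha> / 4), the number \<kappa> below, which is less than 1.\<close>
    define \<delta> where "\<delta> = min (\<alpha>/2) (- (\<alpha>/4) * ln (1 - \<epsilon>))"
    have lneg: "ln (1 - \<epsilon>) < 0" using e by simp
    have d: "0 < \<delta>" "\<delta> < \<alpha>" "\<alpha>/2 \<le> \<alpha> - \<delta>" "\<delta> \<le> - (\<alpha>/4) * ln (1 - \<epsilon>)"
      using alpha lneg by (auto simp: \<delta>_def mult_pos_neg)
    obtain N where N: "N \<ge> 1"
      "\<And>m n. N \<le> m \<Longrightarrow> m \<le> n \<Longrightarrow> a m / a n \<le> exp \<delta> * (real m / real n) powr (\<alpha> - \<delta>)"
      using potter_powr[OF d(1,2)] by metis
    define \<kappa> where "\<kappa> = exp ((\<alpha>/4) * ln (1 - \<epsilon>))"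
    have k1: "0 < \<kappa>" "\<kappa> < 1" using alpha lneg by (auto simp: \<kappa>_def mult_pos_neg)
    have "\<forall>\<^sub>F k in sequentially. a (l k) * b k < 1 / \<kappa>"
      by (rule order_tendstoD(2)[OF ab]) (use k1 in \<open>simp add: field_simps\<close>)
    \<comment> \<open>Potter's bound says nothing about indices below N; their finitely many values
      are beaten by 1 / b k, which tends to infinity.\<close>
    moreover have "\<forall>\<^sub>F k in sequentially. (\<Sum>i<N. \<bar>a i\<bar>) \<le> 1 / b k"
      using inv_b unfolding filterlim_at_top by blast
    ultimately show ?thesis using upper[OF e(1)] l1[of N]
    proof eventually_elim
      case (elim k)
      have alk: "a (l k) > 0" "real (l k) > 0" using elim N(1) a_pos by auto
      show ?case
        unfolding I_def
      proof (rule cInf_greatest)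
        show "{u. 0 \<le> u \<and> 1 / b k < step_extension a u} \<noteq> {}" using elim by blast
        fix u assume "u \<in> {u. 0 \<le> u \<and> 1 / b k < step_extension a u}"
        then have u: "0 \<le> u" "1 / b k < step_extension a u" by auto
        show "(1 - \<epsilon>) * real (l k) \<le> u"
        proof (rule ccontr)
          assume "\<not> (1 - \<epsilon>) * real (l k) \<le> u"
          then have less: "u < (1 - \<epsilon>) * real (l k)" by simp
          define n where "n = nat \<lfloor>u\<rfloor>"
          have nu: "real n \<le> u" using u unfolding n_def by linarith
          have fu: "step_extension a u = a n" by (simp add: step_extension_def n_def)
          show False
          proof (cases "n < N")
            case True
            then have "\<bar>a n\<bar> \<le> (\<Sum>i<N. \<bar>a i\<bar>)" by (intro member_le_sum) auto
            then show False using u fu elim by linarith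
          next
            case False
            have nl: "real n < (1 - \<epsilon>) * real (l k)" using nu less by linarith
            also have "\<dots> \<le> 1 * real (l k)" using e by (intro mult_right_mono) auto
            finally have "n \<le> l k" by simp
            then have "a n / a (l k) \<le> exp \<delta> * (real n / real (l k)) powr (\<alpha> - \<delta>)"
              using N(2) False by auto
            also have "\<dots> \<le> exp \<delta> * (1 - \<epsilon>) powr (\<alpha> - \<delta>)"
              using nl alk d by (intro mult_left_mono powr_mono2) (auto simp: field_simps)
            also have "\<dots> \<le> exp \<delta> * (1 - \<epsilon>) powr (\<alpha>/2)"
              using d e by (intro mult_left_mono powr_mono') auto
            also have "\<dots> = exp (\<delta> + (\<alpha>/2) * ln (1 - \<epsilon>))" using e by (simp add: powr_def exp_add)
            also have "\<dots> \<le> \<kappa>" using d(4) unfolding \<kappa>_def exp_le_cancel_iff by (simp add: field_simps)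
            finally have "a n \<le> \<kappa> * a (l k)" using alk by (simp add: field_simps)
            also have "\<dots> \<le> 1 / b k" using elim k1 b_pos[of k] by (simp add: field_simps)
            finally show False using u fu by simp
          qed
        qed
      qed
    qed
  qed
  have "(\<lambda>k. I k / real (l k)) \<longlonglongrightarrow> 1"
  proof (rule order_tendstoI)
    fix r :: real assume "r < 1"
    define \<epsilon> where "\<epsilon> = min (1/2) ((1 - r) / 2)"
    have e: "0 < \<epsilon>" "\<epsilon> < 1" "r < 1 - \<epsilon>" using \<open>r < 1\<close> by (auto simp: \<epsilon>_def min_def field_simps)
    show "\<forall>\<^sub>F k in sequentially. r < I k / real (l k)"
      using lower[OF e(1,2)] l1[of 1]
    proof eventually_elim
      case (elim k)
      then have "1 - \<epsilon> \<le> I k / real (l k)" by (simp add: field_simps)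
      then show ?case using e by linarith
    qed
  next
    fix r :: real assume "1 < r"
    define \<epsilon> where "\<epsilon> = (r - 1) / 2"
    have e: "0 < \<epsilon>" "1 + \<epsilon> < r" using \<open>1 < r\<close> by (auto simp: \<epsilon>_def field_simps)
    show "\<forall>\<^sub>F k in sequentially. I k / real (l k) < r"
      using upper[OF e(1)] l1[of 1]
    proof eventually_elim
      case (elim k)
      then have "I k / real (l k) \<le> 1 + \<epsilon>" by (simp add: field_simps)
      then show ?case using e by linarith
    qed
  qed
  then have "(\<lambda>k. inverse (I k / real (l k))) \<longlonglongrightarrow> inverse 1" by (intro tendsto_inverse) auto
  then show ?thesis by (simp add: scaling_def I_def)
qed

text \<open>Here the increment bound on \<nu> meets the density of the return time. With L = (k + 1)
  * p it bounds the mass of one lattice cell by about c * \<alpha> * L powr \<alpha> * i powr (-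
  \<alpha> - 1), and over the window a i / a L is about (i / L) powr \<alpha>. For fixed k and large
  p both approximations are uniform, and the factor 1 - 1 / (k + 2) absorbs their errors.\<close>

lemma window_eventually:
  fixes \<nu> :: "real measure" and k :: nat
  assumes \<nu>: "\<And>t s. 0 < t \<Longrightarrow> t < s \<Longrightarrow> measure \<nu> {t<..s} \<le> c * (t powr (-\<alpha>) - s powr (-\<alpha>))"
    and c: "c > 0"
  shows "\<forall>\<^sub>F p in sequentially. \<forall>i. p < i \<and> i \<le> (k + 1) * ((k + 1) * p) \<longrightarrow>
    (1 - 1 / real (k + 2)) / a ((k + 1) * p) *
      measure \<nu> {real (i - 1) / real ((k + 1) * p)<..real i / real ((k + 1) * p)} < c * \<alpha> / (real i * a i)"
proof -
  define \<kappa> where "\<kappa> = 1 - 1 / real (k + 2)"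
  \<comment> \<open>M bounds |ln i - ln L| + 1 on the window, where i / L lies between 1 / (k + 1)
    and k + 1. With the next choice, \<kappa> * exp (\<delta> * M) is the square root of
    \<kappa>.\<close>
  define M where "M = ln (real (k + 1)) + 1"
  define \<delta> where "\<delta> = - ln \<kappa> / (2 * M)"
  have kap: "0 < \<kappa>" "\<kappa> < 1" by (auto simp: \<kappa>_def field_simps)
  have M: "M > 0" unfolding M_def by (intro add_nonneg_pos) auto
  have d: "\<delta> > 0" using kap M by (auto simp: \<delta>_def intro!: divide_neg_pos ln_less_zero)
  have "\<delta> * M = - ln \<kappa> / 2" using M by (simp add: \<delta>_def)
  then have "\<kappa> * exp (\<delta> * M) = exp (ln \<kappa> / 2)"
    using kap exp_add[of "ln \<kappa>" "- ln \<kappa> / 2"] by simp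
  moreover have "exp (ln \<kappa> / 2) < 1" using kap by simp
  ultimately have sq: "\<kappa> * exp (\<delta> * M) < 1" by simp
  obtain N where N: "N \<ge> 1" "\<And>m n. m \<ge> N \<Longrightarrow> n \<ge> N \<Longrightarrow>
    \<bar>ln (a m) - ln (a n) - \<alpha> * (ln m - ln n)\<bar> \<le> \<delta> * \<bar>ln (real m) - ln (real n)\<bar> + \<delta>"
    using potter[OF d] by blast
  have "(\<lambda>p. \<kappa> * exp (\<delta> * M) * (1 + 1 / real p)\<^sup>2) \<longlonglongrightarrow> \<kappa> * exp (\<delta> * M) * (1 + 0)\<^sup>2"
    by (intro tendsto_intros lim_1_over_n)
  then have "\<forall>\<^sub>F p in sequentially. \<kappa> * exp (\<delta> * M) * (1 + 1 / real p)\<^sup>2 < 1"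
    by (rule order_tendstoD(2)) (use sq in simp)
  then show ?thesis
    using eventually_ge_at_top[of N]
  proof eventually_elim
    case (elim p)
    show ?case
    proof (intro allI impI, elim conjE)
      fix i assume i: "p < i" "i \<le> (k + 1) * ((k + 1) * p)"
      define L where "L = (k + 1) * p"
      have p1: "p \<ge> 1" "p \<ge> N" using elim N(1) by auto
      have "p \<le> L" by (simp add: L_def)
      then have NL: "L \<ge> N" "i \<ge> N" using p1 i by auto
      have P: "a L > 0" "a i > 0" "real L > 0" "real i > 0" using NL N(1) a_pos by auto
      have iL: "real i \<le> real (k + 1) * real L" "real L \<le> real (k + 1) * real i"
      proof -
        have "real i \<le> real ((k + 1) * L)" using i(2) unfolding L_def of_nat_le_iff .
        then show "real i \<le> real (k + 1) * real L" by (simp add: distrib_right)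
        have "L \<le> (k + 1) * i" unfolding L_def using i by (intro mult_le_mono) auto
        then have "real L \<le> real ((k + 1) * i)" unfolding of_nat_le_iff .
        then show "real L \<le> real (k + 1) * real i" by (simp add: distrib_right)
      qed
      have "\<bar>ln (real i) - ln (real L)\<bar> \<le> ln (real (k + 1))"
      proof -
        have "ln (real i) \<le> ln (real (k + 1) * real L)" "ln (real L) \<le> ln (real (k + 1) * real i)"
          using iL P by (auto intro!: ln_mono simp del: of_nat_add of_nat_Suc)
        then show ?thesis using P by (simp add: ln_mult abs_le_iff del: of_nat_add of_nat_Suc)
      qed
      then have "\<delta> * \<bar>ln (real i) - ln (real L)\<bar> + \<delta> \<le> \<delta> * M"
        using d by (simp add: M_def distrib_left)
      then have "ln (a i) - ln (a L) - \<alpha> * (ln (real i) - ln (real L)) \<le> \<delta> * M"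
        using N(2)[OF NL(2,1)] by linarith
      then have "ln (a i) - ln (a L) \<le> \<alpha> * (ln (real i) - ln (real L)) + \<delta> * M" by linarith
      then have "exp (ln (a i) - ln (a L)) \<le> exp (\<alpha> * (ln (real i) - ln (real L)) + \<delta> * M)" by simp
      then have ai: "a i / a L \<le> (real i / real L) powr \<alpha> * exp (\<delta> * M)"
        using P by (simp add: exp_diff exp_add powr_def ln_div)
      have i1: "real (i - 1) = real i - 1" "real (i - 1) \<ge> real p" "real p \<ge> 1" using i p1 by auto
      have mvt: "real (i - 1) powr (-\<alpha>) - real i powr (-\<alpha>) \<le> \<alpha> * real (i - 1) powr (-\<alpha> - 1)"
      proof -
        have der: "((\<lambda>x. x powr (-\<alpha>)) has_real_derivative - \<alpha> * x powr (-\<alpha> - 1)) (at x)" if "x > 0" for x :: real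
          using that by (auto intro!: derivative_eq_intros)
        have "real (i - 1) < real i" using i1 by simp
        from MVT2[OF this, of "\<lambda>x. x powr (-\<alpha>)" "\<lambda>x. - \<alpha> * x powr (-\<alpha> - 1)"] der i1
        obtain z where z: "real (i - 1) < z" "z < real i"
          "real i powr (-\<alpha>) - real (i - 1) powr (-\<alpha>) = (real i - real (i - 1)) * (- \<alpha> * z powr (-\<alpha> - 1))"
          by (smt (verit, best))
        have "z powr (-\<alpha> - 1) \<le> real (i - 1) powr (-\<alpha> - 1)"
          using z i1 alpha by (intro powr_mono2') auto
        then have "\<alpha> * z powr (-\<alpha> - 1) \<le> \<alpha> * real (i - 1) powr (-\<alpha> - 1)" using alpha by simp
        then show ?thesis using z(3) i1 by simp
      qed
      \<comment> \<open>Passing from i - 1 to i in the exponent - \<alpha> - 1 costs a power of i /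
        (i - 1) \<le> 1 + 1 / p; as \<alpha> + 1 \<le> 2, the square suffices.\<close>
      have ratio: "real (i - 1) powr (-\<alpha> - 1) \<le> real i powr (-\<alpha> - 1) * (1 + 1 / real p)\<^sup>2"
      proof -
        have ri: "real i / real (i - 1) \<le> 1 + 1 / real p" "1 \<le> real i / real (i - 1)"
        proof -
          have "real i = real (i - 1) + 1" using i1 by simp
          then have "real i / real (i - 1) = 1 + 1 / real (i - 1)" using i1 by (simp add: field_simps)
          moreover have "1 / real (i - 1) \<le> 1 / real p" using i1 by (intro divide_left_mono) auto
          ultimately show "real i / real (i - 1) \<le> 1 + 1 / real p" "1 \<le> real i / real (i - 1)" by auto
        qed
        have "real (i - 1) powr (-\<alpha> - 1) = real i powr (-\<alpha> - 1) * (real i / real (i - 1)) powr (\<alpha> + 1)"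
        proof -
          have e: "-\<alpha> - 1 = - (\<alpha> + 1)" by simp
          show ?thesis unfolding e powr_minus using i1 P by (simp add: powr_divide field_simps)
        qed
        also have "(real i / real (i - 1)) powr (\<alpha> + 1) \<le> (real i / real (i - 1)) powr 2"
          using ri alpha by (intro powr_mono) auto
        also have "\<dots> = (real i / real (i - 1))\<^sup>2" using ri by (simp add: powr_numeral)
        also have "\<dots> \<le> (1 + 1 / real p)\<^sup>2" using ri by (intro power_mono) auto
        finally show ?thesis by (simp add: mult_left_mono)
      qed
      have "measure \<nu> {real (i - 1) / real L<..real i / real L}
          \<le> c * ((real (i - 1) / real L) powr (-\<alpha>) - (real i / real L) powr (-\<alpha>))"
        using i1 P by (intro \<nu>) (auto simp: field_simps)
      also have "\<dots> = c * real L powr \<alpha> * (real (i - 1) powr (-\<alpha>) - real i powr (-\<alpha>))"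
        unfolding powr_minus using P i1 by (simp add: powr_divide field_simps)
      also have "\<dots> \<le> c * real L powr \<alpha> * (\<alpha> * (real i powr (-\<alpha> - 1) * (1 + 1 / real p)\<^sup>2))"
        using mvt ratio c alpha by (intro mult_left_mono order_trans[OF mvt]) auto
      finally have m: "measure \<nu> {real (i - 1) / real L<..real i / real L}
          \<le> c * real L powr \<alpha> * (\<alpha> * (real i powr (-\<alpha> - 1) * (1 + 1 / real p)\<^sup>2))" .
      have "\<kappa> / a L * measure \<nu> {real (i - 1) / real L<..real i / real L}
          \<le> \<kappa> / a L * (c * real L powr \<alpha> * (\<alpha> * (real i powr (-\<alpha> - 1) * (1 + 1 / real p)\<^sup>2)))"
        using kap P by (intro mult_left_mono m) auto
      also have "\<dots> = c * \<alpha> / (real i * a i) * (\<kappa> * (a i / a L / (real i / real L) powr \<alpha>) * (1 + 1 / real p)\<^sup>2)"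
        unfolding powr_diff powr_minus using P by (simp add: powr_divide field_simps)
      also have "\<dots> \<le> c * \<alpha> / (real i * a i) * (\<kappa> * exp (\<delta> * M) * (1 + 1 / real p)\<^sup>2)"
      proof -
        have "a i / a L / (real i / real L) powr \<alpha> \<le> exp (\<delta> * M)"
          using ai P by (simp add: divide_le_eq mult_ac)
        then show ?thesis using c alpha P kap by (intro mult_left_mono mult_right_mono) auto
      qed
      also have "\<dots> < c * \<alpha> / (real i * a i) * 1"
        using elim c alpha P by (intro mult_strict_left_mono) auto
      finally show "(1 - 1 / real (k + 2)) / a ((k + 1) * p) *
        measure \<nu> {real (i - 1) / real ((k + 1) * p)<..real i / real ((k + 1) * p)} < c * \<alpha> / (real i * a i)"
        by (simp only: \<kappa>_def L_def mult_1_right)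
    qed
  qed
qed

end

text \<open>The law of the pair (exit index \<open>K\<close>, remaining descent \<open>M\<close>); the return time is \<open>K + M + 1\<close>.
  For \<open>K = k + 1\<close> the return time follows \<open>\<nu>\<close> rescaled by \<open>l k\<close>, restricted to the window
  \<open>(p k, q k]\<close>; this mass is taken away from \<open>K = 0\<close>, so that the law of the return time keeps the density \<open>base\<close>
  up to a negligible part, the mass \<open>low\<close> of \<open>\<nu>\<close> below the window.\<close>

locale excursion_weights = regularly_varying_seq a \<alpha> + real_distribution \<nu>
  for a :: "nat \<Rightarrow> real" and \<alpha> :: real and \<nu> :: "real measure" +
  fixes i0 :: nat and p :: "nat \<Rightarrow> nat" and c :: real and l q :: "nat \<Rightarrow> nat" and \<beta> :: "nat \<Rightarrow> real"
    and base :: "nat \<Rightarrow> real"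
  assumes nu_pos: "measure \<nu> {0..} = 1"
    and c_pos: "c > 0"
    and l_def: "l = (\<lambda>k. (k + 1) * p k)" and q_def: "q = (\<lambda>k. (k + 1) * l k)"
    and \<beta>_def: "\<beta> = (\<lambda>k. (1 - 1 / real (k + 2)) / a (l k))"
    and base_def: "base = (\<lambda>i. if i \<ge> i0 then c * \<alpha> / (real i * a i) else 0)"
    and i0: "i0 \<ge> 2" "(\<Sum>i. base i) \<le> 1 / 2"
    and p_ge: "\<And>k. p k \<ge> k + 2" "\<And>k. p k \<ge> i0"
    and p_step: "\<And>k. p (Suc k) \<ge> q k"
    and window: "\<And>k i. p k < i \<Longrightarrow> i \<le> q k \<Longrightarrow>
      \<beta> k * measure \<nu> {real (i - 1) / real (l k)<..real i / real (l k)} < base i"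
    and \<beta>_small: "\<And>k. \<beta> k \<le> (1/2) ^ (k + 3) / (1 + (\<Sum>j\<le>k + 3. \<bar>a j\<bar>))"
    and \<beta>_step: "\<And>k. \<beta> (Suc k) \<le> \<beta> k / (2 * real (k + 2))"
begin

definition "Nu x = measure \<nu> {..x}"
definition "win k i = (if p k < i \<and> i \<le> q k then \<beta> k * (Nu (real i / real (l k)) - Nu (real (i - 1) / real (l k))) else 0)"
definition "low k = \<beta> k * Nu (real (p k) / real (l k))"
text \<open>The mass left for the return time 1, that is for K = 0 and M = 0; it makes the total
  equal to 1.\<close>

definition "rest = 1 - (\<Sum>i. base (i + 2) + low i)"
text \<open>Since R = K + M + 1, the pair (Suc k, m) has R = m + k + 2 and the pair (0, Suc m) has R
  = m + 2. The displaced mass \<open>low k\<close> sits at M = 0, that is at R = k + 2, which is not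
  above p k and so lies outside the window. The sum over k < m + 2 already contains every window
  that meets R = m + 2, because p k \<ge> k + 2.\<close>

definition "\<theta> k m = (case k of 0 \<Rightarrow> (case m of 0 \<Rightarrow> rest | Suc m \<Rightarrow> base (m + 2) - (\<Sum>k<m + 2. win k (m + 2)))
    | Suc k \<Rightarrow> win k (m + k + 2) + (if m = 0 then low k else 0))"
definition "rlaw n = (if n = 0 then 0 else if n = 1 then rest else base n + low (n - 2))"

lemma Nu_mono: "x \<le> y \<Longrightarrow> Nu x \<le> Nu y"
  unfolding Nu_def by (intro finite_measure_mono) auto

lemma Nu_bounds: "0 \<le> Nu x" "Nu x \<le> 1"
  unfolding Nu_def by auto

lemma Nu_diff: "x \<le> y \<Longrightarrow> measure \<nu> {x<..y} = Nu y - Nu x"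
proof -
  assume "x \<le> y"
  then have "measure \<nu> ({..y} - {..x}) = Nu y - Nu x"
    unfolding Nu_def by (intro finite_measure_Diff) auto
  moreover have "{..y} - {..x} = {x<..y}" by auto
  ultimately show ?thesis by simp
qed

lemma Nu_tendsto_1: "(\<lambda>k. Nu (real k)) \<longlonglongrightarrow> 1"
  using filterlim_compose[OF cdf_lim_at_top_prob filterlim_real_sequentially] by (simp add: Nu_def cdf_def)

lemma Nu_neg: "x < 0 \<Longrightarrow> Nu x = 0"
proof -
  assume "x < 0"
  then have "{..x} \<subseteq> UNIV - {0..}" by auto
  then have "Nu x \<le> measure \<nu> (space \<nu> - {0..})" unfolding Nu_def by (intro finite_measure_mono) auto
  also have "\<dots> = 0" using nu_pos by (subst prob_compl) auto
  finally show ?thesis using Nu_bounds[of x] by simp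
qed

lemma l_pos: "l k > 0" and l_ge: "p k \<le> l k" "l k \<le> q k" "p k \<ge> 1"
  using p_ge(1)[of k] by (auto simp: l_def q_def)

lemma \<beta>_pos: "\<beta> k > 0"
proof -
  have "0 < 1 - 1 / real (k + 2)" "0 < a (l k)" using l_pos[of k] a_pos[of "l k"] by auto
  then show ?thesis unfolding \<beta>_def by (rule divide_pos_pos)
qed

lemma base_nonneg: "0 \<le> base i"
  using i0 a_pos[of i] alpha c_pos by (auto simp: base_def intro!: divide_nonneg_nonneg mult_nonneg_nonneg)

lemma base_pos: "i \<ge> i0 \<Longrightarrow> 0 < base i"
  using i0 a_pos[of i] alpha c_pos by (auto simp: base_def)

lemma win_nonneg: "0 \<le> win k i"
  using \<beta>_pos[of k] by (auto simp: win_def intro!: mult_nonneg_nonneg Nu_mono divide_right_mono)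

lemma win_less_base: "p k < i \<Longrightarrow> i \<le> q k \<Longrightarrow> win k i < base i"
  using window[of k i] Nu_diff[of "real (i - 1) / real (l k)" "real i / real (l k)"]
  by (simp add: win_def divide_right_mono)

lemma low_bounds: "0 \<le> low k" "low k \<le> \<beta> k"
  using \<beta>_pos[of k] Nu_bounds by (auto simp: low_def mult_left_le intro!: mult_nonneg_nonneg less_imp_le)

lemma summable_base: "summable base"
proof -
  have "summable (\<lambda>k. c * (\<alpha> / (real (Suc k) * a (Suc k))))"
    by (intro summable_mult summable_tail_density)
  then have "summable (\<lambda>k. base (Suc k))"
  proof (rule summable_comparison_test'[where N = 0])
    show "norm (base (Suc k)) \<le> c * (\<alpha> / (real (Suc k) * a (Suc k)))" for k
      using a_pos[of "Suc k"] alpha c_pos by (simp add: base_def)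
  qed
  then show ?thesis by (simp add: summable_Suc_iff)
qed

lemma \<beta>_le: "\<beta> k \<le> (1/2) ^ (k + 3)"
proof -
  have "0 \<le> (\<Sum>j\<le>k + 3. \<bar>a j\<bar>)" by (intro sum_nonneg) auto
  then have "(1/2::real) ^ (k + 3) / (1 + (\<Sum>j\<le>k + 3. \<bar>a j\<bar>)) \<le> (1/2) ^ (k + 3) / 1"
    by (intro divide_left_mono) (auto intro!: mult_pos_pos add_pos_nonneg)
  then show ?thesis using \<beta>_small[of k] by simp
qed

text \<open>The denominator in the bound on \<beta> was chosen for this: the displaced masses of all
  late indices are geometrically small even after multiplication by a n.\<close>

lemma a_\<beta>_le:
  assumes "n \<le> k + 3" "n \<ge> 1"
  shows "a n * \<beta> k \<le> (1/2) ^ k"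
proof -
  have "\<bar>a n\<bar> \<le> (\<Sum>j\<le>k + 3. \<bar>a j\<bar>)" using assms by (intro member_le_sum) auto
  then have le: "a n \<le> 1 + (\<Sum>j\<le>k + 3. \<bar>a j\<bar>)" "0 < 1 + (\<Sum>j\<le>k + 3. \<bar>a j\<bar>)" by auto
  have "a n * \<beta> k \<le> (1 + (\<Sum>j\<le>k + 3. \<bar>a j\<bar>)) * ((1/2) ^ (k + 3) / (1 + (\<Sum>j\<le>k + 3. \<bar>a j\<bar>)))"
    using le \<beta>_small[of k] \<beta>_pos[of k] by (intro mult_mono) auto
  also have "\<dots> = (1/2) ^ (k + 3)" using le by simp
  also have "\<dots> \<le> (1/2) ^ k" by (intro power_decreasing) auto
  finally show ?thesis .
qed

lemma summable_half_pow: "summable (\<lambda>k. (1/2 :: real) ^ (k + j))"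
  by (subst summable_iff_shift) (rule summable_geometric, simp)

lemma suminf_half_pow: "(\<Sum>k. (1/2 :: real) ^ (k + j)) = 2 * (1/2) ^ j"
proof -
  have "(\<Sum>k. (1/2 :: real) ^ (k + j)) = (\<Sum>k. (1/2) ^ j * (1/2) ^ k)" by (simp add: power_add mult.commute)
  also have "\<dots> = (1/2) ^ j * (\<Sum>k. (1/2) ^ k)" by (intro suminf_mult summable_geometric) simp
  also have "(\<Sum>k. (1/2 :: real) ^ k) = 2" by (subst suminf_geometric) auto
  finally show ?thesis by simp
qed

lemma summable_low: "summable low"
proof (rule summable_comparison_test'[where N = 0])
  show "summable (\<lambda>k. (1/2 :: real) ^ (k + 3))" by (rule summable_half_pow)
  show "norm (low k) \<le> (1/2) ^ (k + 3)" for k using low_bounds[of k] \<beta>_le[of k] by simp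
qed

lemma summable_base_low: "summable (\<lambda>i. base (i + 2) + low i)"
  by (intro summable_add summable_ignore_initial_segment summable_base summable_low)

text \<open>Mass budget: \<open>base\<close> takes at most 1 / 2 and the displaced masses at most 1
  / 4, the sum of the powers of 1 / 2 from the third on.\<close>

lemma rest_nonneg: "0 \<le> rest"
proof -
  have "(\<Sum>i. base (i + 2) + low i) = (\<Sum>i. base (i + 2)) + (\<Sum>i. low i)"
    by (intro suminf_add[symmetric] summable_ignore_initial_segment summable_base summable_low)
  also have "(\<Sum>i. base (i + 2)) \<le> (\<Sum>i. base i)"
    using suminf_split_initial_segment[OF summable_base, of 2] base_nonneg by (simp add: sum_nonneg)
  also have "(\<Sum>i. low i) \<le> (\<Sum>i. (1/2) ^ (i + 3))"
    by (intro suminf_le summable_low summable_half_pow order_trans[OF low_bounds(2) \<beta>_le])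
  also have "\<dots> = 1/4" by (subst suminf_half_pow) (simp add: power3_eq_cube)
  finally show ?thesis using i0 by (simp add: rest_def)
qed

lemma rlaw_nonneg: "0 \<le> rlaw n"
  using rest_nonneg base_nonneg low_bounds by (simp add: rlaw_def)

lemma rlaw_sums: "(\<lambda>n. rlaw (Suc n)) sums 1"
proof -
  have "(\<lambda>n. rlaw (Suc (Suc n))) sums (\<Sum>i. base (i + 2) + low i)"
    using summable_sums[OF summable_base_low] by (simp add: rlaw_def)
  then have "(\<lambda>n. rlaw (Suc n)) sums ((\<Sum>i. base (i + 2) + low i) + rlaw (Suc 0))"
    by (subst (asm) sums_Suc_iff)
  then show ?thesis by (simp add: rlaw_def rest_def)
qed

lemma q_le_p: "k < k' \<Longrightarrow> q k \<le> p k'"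
proof (induction k')
  case (Suc k')
  show ?case
  proof (cases "k = k'")
    case True
    then show ?thesis using p_step by simp
  next
    case False
    then have "q k \<le> p k'" using Suc by simp
    also have "\<dots> \<le> q k'" using l_ge[of k'] by linarith
    also have "\<dots> \<le> p (Suc k')" by (rule p_step)
    finally show ?thesis .
  qed
qed simp

text \<open>The windows are disjoint, so the sum has at most one nonzero term. The strict form is
  what keeps the jumps from state 0 possible.\<close>

lemma win_sum_le: "(\<Sum>k<n. win k i) \<le> base i" and win_sum_less: "i \<ge> i0 \<Longrightarrow> (\<Sum>k<n. win k i) < base i"
proof -
  have "(\<Sum>k<n. win k i) \<le> base i \<and> (i \<ge> i0 \<longrightarrow> (\<Sum>k<n. win k i) < base i)"
  proof (cases "\<exists>k<n. p k < i \<and> i \<le> q k")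
    case True
    then obtain k where k: "k < n" "p k < i" "i \<le> q k" by blast
    have "win k' i = 0" if "k' \<noteq> k" for k'
    proof -
      from that consider "k < k'" | "k' < k" by linarith
      then have "\<not> (p k' < i \<and> i \<le> q k')"
      proof cases
        case 1
        then show ?thesis using q_le_p[of k k'] k by linarith
      next
        case 2
        then show ?thesis using q_le_p[of k' k] k by linarith
      qed
      then show ?thesis by (auto simp: win_def)
    qed
    then have "(\<Sum>k'<n. win k' i) = (\<Sum>k'<n. if k' = k then win k i else 0)" by (intro sum.cong) auto
    also have "\<dots> = win k i" using k by simp
    finally show ?thesis using win_less_base[OF k(2,3)] by simp
  next
    case False
    then have "(\<Sum>k<n. win k i) = 0" by (intro sum.neutral) (auto simp: win_def)
    then show ?thesis using base_nonneg base_pos by auto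
  qed
  then show "(\<Sum>k<n. win k i) \<le> base i" "i \<ge> i0 \<Longrightarrow> (\<Sum>k<n. win k i) < base i" by auto
qed

lemma \<theta>_nonneg: "0 \<le> \<theta> k m"
proof (cases k)
  case 0
  show ?thesis
  proof (cases m)
    case (Suc m')
    then show ?thesis using 0 win_sum_le[of "m' + 2" "m' + 2"] by (simp add: \<theta>_def)
  qed (use 0 rest_nonneg in \<open>simp add: \<theta>_def\<close>)
next
  case (Suc k')
  then show ?thesis using win_nonneg low_bounds by (simp add: \<theta>_def)
qed

lemma \<theta>_0_pos: "m \<ge> 1 \<Longrightarrow> m + 1 \<ge> i0 \<Longrightarrow> 0 < \<theta> 0 m"
  using win_sum_less[of "m + 1" "m + 1"] by (cases m) (simp_all add: \<theta>_def)

text \<open>Whatever a window gives to some K > 0 was subtracted at K = 0 for the same return time.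
  Beyond the return time 1, everything on an antidiagonal therefore cancels except
  \<open>base\<close> and \<open>low\<close>.\<close>

lemma \<theta>_diagonal: "(\<Sum>k\<le>n. \<theta> k (n - k)) = rlaw (Suc n)"
proof (cases n)
  case 0
  then show ?thesis by (simp add: \<theta>_def rlaw_def)
next
  case (Suc m)
  have "(\<Sum>k\<le>n. \<theta> k (n - k)) = \<theta> 0 (Suc m) + (\<Sum>k\<le>m. \<theta> (Suc k) (m - k))"
    unfolding Suc by (subst sum.atMost_Suc_shift) simp
  also have "(\<Sum>k\<le>m. \<theta> (Suc k) (m - k)) = (\<Sum>k\<le>m. win k (m + 2) + (if k = m then low k else 0))"
    by (intro sum.cong) (auto simp: \<theta>_def)
  also have "\<dots> = (\<Sum>k\<le>m. win k (m + 2)) + low m" by (simp add: sum.distrib)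
  also have "(\<Sum>k\<le>m. win k (m + 2)) = (\<Sum>k<m + 2. win k (m + 2))"
  proof -
    have "win (Suc m) (m + 2) = 0" using p_ge(1)[of "Suc m"] by (auto simp: win_def)
    then show ?thesis by (simp add: lessThan_Suc_atMost)
  qed
  finally show ?thesis by (simp add: \<theta>_def rlaw_def Suc)
qed

definition law :: "(nat \<times> nat) pmf" where "law = embed_pmf (\<lambda>(k, m). \<theta> k m)"

lemma \<theta>_total: "(\<integral>\<^sup>+x. ennreal (case x of (k, m) \<Rightarrow> \<theta> k m) \<partial>count_space UNIV) = 1"
proof -
  let ?\<theta> = "\<lambda>x. ennreal (case x of (k, m) \<Rightarrow> \<theta> k m)"
  let ?D = "density (count_space UNIV) ?\<theta>"
  let ?A = "\<lambda>n. {(k, m). k + m = n} :: (nat \<times> nat) set"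
  have A: "?A n = (\<lambda>k. (k, n - k)) ` {..n}" for n by auto
  have e: "emeasure ?D (?A n) = ennreal (rlaw (Suc n))" for n
  proof -
    have "emeasure ?D (?A n) = (\<integral>\<^sup>+x. ?\<theta> x * indicator (?A n) x \<partial>count_space UNIV)"
      by (subst emeasure_density) auto
    also have "\<dots> = (\<Sum>x\<in>?A n. ?\<theta> x * indicator (?A n) x)"
      unfolding A by (intro nn_integral_count_space') auto
    also have "\<dots> = (\<Sum>k\<le>n. ennreal (\<theta> k (n - k)))"
      unfolding A by (subst sum.reindex) (auto simp: inj_on_def)
    also have "\<dots> = ennreal (\<Sum>k\<le>n. \<theta> k (n - k))" by (intro sum_ennreal \<theta>_nonneg)
    finally show ?thesis by (simp only: \<theta>_diagonal)
  qed
  have U: "(\<Union>n. ?A n) = UNIV" by auto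
  have "(\<integral>\<^sup>+x. ?\<theta> x \<partial>count_space UNIV) = emeasure ?D (\<Union>n. ?A n)"
    unfolding U by (subst emeasure_density) auto
  also have "\<dots> = (\<Sum>n. emeasure ?D (?A n))"
    by (intro suminf_emeasure[symmetric]) (auto simp: disjoint_family_on_def)
  also have "\<dots> = (\<Sum>n. ennreal (rlaw (Suc n)))" by (simp only: e)
  also have "\<dots> = ennreal 1" by (rule suminf_ennreal_eq[of "\<lambda>n. rlaw (Suc n)", OF rlaw_nonneg rlaw_sums])
  finally show ?thesis by simp
qed

lemma pmf_law: "pmf law (k, m) = \<theta> k m"
  unfolding law_def by (subst pmf_embed_pmf) (auto simp: \<theta>_nonneg \<theta>_total)

lemma law_return: "measure law {(k, m). k + m + 1 = n} = rlaw n"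
proof (cases n)
  case 0
  then show ?thesis by (simp add: rlaw_def)
next
  case (Suc n')
  have A: "{(k, m). k + m + 1 = n} = (\<lambda>k. (k, n' - k)) ` {..n'}" using Suc by auto
  have "measure law {(k, m). k + m + 1 = n} = (\<Sum>k\<le>n'. \<theta> k (n' - k))"
    unfolding A by (subst measure_measure_pmf_finite) (auto simp: sum.reindex inj_on_def pmf_law)
  then show ?thesis by (simp only: \<theta>_diagonal Suc)
qed

lemma law_return_tail: "measure law {(k, m). n < k + m + 1} = (\<Sum>j. rlaw (Suc (j + n)))"
proof -
  have "{(k, m). n < k + m + 1} = (\<Union>j. {(k, m). k + m + 1 = Suc (j + n)})" (is "_ = (\<Union>j. ?A j)")
    by (auto intro: exI[of _ "k + m - n" for k m] simp: less_iff_Suc_add)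
  moreover have "(\<lambda>j. measure law (?A j)) sums measure law (\<Union>j. ?A j)"
    by (intro measure_pmf.finite_measure_UNION) (auto simp: disjoint_family_on_def)
  ultimately show ?thesis by (simp only: law_return sums_unique)
qed

text \<open>The tail of \<open>base\<close> contributes c by Karamata's theorem; the displaced
  masses add at most a geometric term, so they do not change the constant.\<close>

lemma return_tail_asymp: "(\<lambda>n. a n * measure law {(k, m). n < k + m + 1}) \<longlonglongrightarrow> c"
proof -
  have "(\<lambda>n. c * (a n * (\<Sum>k. \<alpha> / (real (Suc (k + n)) * a (Suc (k + n)))))) \<longlonglongrightarrow> c * 1"
    by (intro tendsto_mult tendsto_const tail_density)
  moreover have "(\<lambda>n. a n * (\<Sum>j. low (j + n - 1))) \<longlonglongrightarrow> 0"
  proof (rule tendsto_sandwich[of "\<lambda>_. 0" _ _ "\<lambda>n. 2 * (1/2) ^ (n - 1)"])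
    have sl: "summable (\<lambda>j. low (j + n - 1))" if "n \<ge> 1" for n
    proof -
      have "summable (\<lambda>j. low (j + (n - 1)))" using summable_low by (simp add: summable_iff_shift)
      then show ?thesis using that by simp
    qed
    show "\<forall>\<^sub>F n in sequentially. 0 \<le> a n * (\<Sum>j. low (j + n - 1))"
      using eventually_ge_at_top[of 1]
      by eventually_elim (intro mult_nonneg_nonneg suminf_nonneg sl low_bounds less_imp_le[OF a_pos])
    show "\<forall>\<^sub>F n in sequentially. a n * (\<Sum>j. low (j + n - 1)) \<le> 2 * (1/2) ^ (n - 1)"
      using eventually_ge_at_top[of 1]
    proof eventually_elim
      case (elim n)
      have "a n * (\<Sum>j. low (j + n - 1)) = (\<Sum>j. a n * low (j + n - 1))"
        by (rule suminf_mult[symmetric, OF sl[OF elim]])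
      also have "\<dots> \<le> (\<Sum>j. (1/2) ^ (j + (n - 1)))"
      proof (rule suminf_le[OF _ summable_mult[OF sl[OF elim]] summable_half_pow])
        fix j
        have "a n * low (j + n - 1) \<le> a n * \<beta> (j + n - 1)"
          using elim a_pos low_bounds by (intro mult_left_mono) (auto intro: less_imp_le)
        also have "\<dots> \<le> (1/2) ^ (j + n - 1)" using elim by (intro a_\<beta>_le) auto
        finally show "a n * low (j + n - 1) \<le> (1/2) ^ (j + (n - 1))" using elim by simp
      qed
      finally show ?case by (simp only: suminf_half_pow)
    qed
    have "(\<lambda>n. 2 * (1/2 :: real) ^ n) \<longlonglongrightarrow> 2 * 0"
      by (intro tendsto_mult tendsto_const LIMSEQ_power_zero) simp
    then have "(\<lambda>n. 2 * (1/2 :: real) ^ (Suc n - 1)) \<longlonglongrightarrow> 0" by simp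
    then show "(\<lambda>n. 2 * (1/2 :: real) ^ (n - 1)) \<longlonglongrightarrow> 0" by (rule LIMSEQ_imp_Suc)
  qed simp
  ultimately have "(\<lambda>n. c * (a n * (\<Sum>k. \<alpha> / (real (Suc (k + n)) * a (Suc (k + n))))) + a n * (\<Sum>j. low (j + n - 1)))
      \<longlonglongrightarrow> c * 1 + 0" by (rule tendsto_add)
  moreover have "\<forall>\<^sub>F n in sequentially. c * (a n * (\<Sum>k. \<alpha> / (real (Suc (k + n)) * a (Suc (k + n)))))
      + a n * (\<Sum>j. low (j + n - 1)) = a n * measure law {(k, m). n < k + m + 1}"
    using eventually_ge_at_top[of i0]
  proof eventually_elim
    case (elim n)
    then have n2: "n \<ge> 2" using i0 by simp
    have rl: "rlaw (Suc (j + n)) = base (Suc (j + n)) + low (j + n - 1)" for j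
      using n2 by (simp add: rlaw_def)
    have "summable (\<lambda>j. low (j + (n - 1)))" "summable (\<lambda>j. base (j + Suc n))"
      using summable_low summable_base by (simp_all only: summable_iff_shift)
    then have s: "summable (\<lambda>j. low (j + n - 1))" "summable (\<lambda>j. base (Suc (j + n)))" using n2 by simp_all
    have "(\<Sum>j. rlaw (Suc (j + n))) = (\<Sum>j. base (Suc (j + n))) + (\<Sum>j. low (j + n - 1))"
      by (simp only: rl suminf_add[OF s(2,1)])
    also have "(\<Sum>j. base (Suc (j + n))) = (\<Sum>k. c * (\<alpha> / (real (Suc (k + n)) * a (Suc (k + n)))))"
      using elim by (simp add: base_def)
    also have "\<dots> = c * (\<Sum>k. \<alpha> / (real (Suc (k + n)) * a (Suc (k + n))))"
      by (rule suminf_mult) (subst summable_iff_shift[where f = "\<lambda>k. \<alpha> / (real (Suc k) * a (Suc k))"], rule summable_tail_density)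
    finally show ?case
      unfolding law_return_tail by (simp only: distrib_left mult.left_commute)
  qed
  ultimately show ?thesis using Lim_transform_eventually by fastforce
qed

text \<open>The increments of \<nu> telescope and \<open>low\<close> supplies the starting value, so
  inside the window the distribution function of R on the event K = Suc k is an exact multiple of
  that of \<nu>.\<close>

lemma law_window:
  assumes "p k \<le> i" "i \<le> q k"
  shows "measure law {(k', m). k' = Suc k \<and> k' + m + 1 \<le> i} = \<beta> k * Nu (real i / real (l k))"
proof -
  have "{(k', m). k' = Suc k \<and> k' + m + 1 \<le> i} = (\<lambda>m. (Suc k, m)) ` {..i - (k + 2)}"
    using assms(1) p_ge(1)[of k] by auto
  then have "measure law {(k', m). k' = Suc k \<and> k' + m + 1 \<le> i} = (\<Sum>m\<le>i - (k + 2). \<theta> (Suc k) m)"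
    by (simp add: measure_measure_pmf_finite sum.reindex inj_on_def pmf_law)
  also have "\<dots> = \<beta> k * Nu (real i / real (l k))"
    using assms
  proof (induction i rule: dec_induct)
    case base
    have "(\<Sum>m\<le>p k - (k + 2). \<theta> (Suc k) m) = (\<Sum>m\<le>p k - (k + 2). if m = 0 then low k else 0)"
      using p_ge(1)[of k] by (intro sum.cong) (auto simp: \<theta>_def win_def)
    then show ?case by (simp add: low_def)
  next
    case (step i)
    have e: "Suc i - (k + 2) = Suc (i - (k + 2))" using step p_ge(1)[of k] by simp
    have "Suc (i - (k + 2)) + k + 2 = Suc i" using step p_ge(1)[of k] by simp
    moreover have "\<theta> (Suc k) (Suc m) = win k (Suc m + k + 2)" for m by (simp add: \<theta>_def)
    ultimately have w: "\<theta> (Suc k) (Suc (i - (k + 2))) = win k (Suc i)" by metis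
    have "(\<Sum>m\<le>Suc i - (k + 2). \<theta> (Suc k) m) = \<beta> k * Nu (real i / real (l k)) + win k (Suc i)"
      unfolding e sum.atMost_Suc w using step by simp
    also have "win k (Suc i) = \<beta> k * (Nu (real (Suc i) / real (l k)) - Nu (real i / real (l k)))"
      using step by (simp add: win_def)
    finally show ?case by (simp add: algebra_simps)
  qed
  finally show ?thesis .
qed

text \<open>All return times with this exit index are at most q k, and q k / l k = k + 1. The part
  of \<nu> beyond k + 1 is lost, which is harmless as Nu (k + 1) tends to 1.\<close>

lemma law_exit: "measure law {(k', m). k' = Suc k} = \<beta> k * Nu (real (k + 1))"
proof -
  have "Suc k + m + 1 \<le> q k" if "(Suc k, m) \<in> set_pmf law" for m
  proof (rule ccontr)
    assume "\<not> Suc k + m + 1 \<le> q k"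
    then have "\<theta> (Suc k) m = 0"
      using p_ge(1)[of k] l_ge[of k] by (auto simp: \<theta>_def win_def)
    then show False using that by (simp add: set_pmf_iff pmf_law)
  qed
  then have "{(k', m). k' = Suc k} \<inter> set_pmf law = {(k', m). k' = Suc k \<and> k' + m + 1 \<le> q k} \<inter> set_pmf law"
    by auto
  from arg_cong[OF this, of "measure law"]
  have "measure law {(k', m). k' = Suc k} = measure law {(k', m). k' = Suc k \<and> k' + m + 1 \<le> q k}"
    by (simp only: measure_Int_set_pmf)
  also have "\<dots> = \<beta> k * Nu (real (q k) / real (l k))" using l_ge[of k] by (intro law_window) auto
  also have "real (q k) / real (l k) = real (k + 1)" using l_pos[of k] by (simp add: q_def field_simps)
  finally show ?thesis .
qed

definition "tail n = measure law {(k, m). n \<le> k}"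

lemma tail_rec: "tail (Suc k) = \<beta> k * Nu (real (k + 1)) + tail (Suc (Suc k))"
proof -
  have "{(k', m). Suc k \<le> k'} = {(k', m). k' = Suc k} \<union> {(k', m::nat). Suc (Suc k) \<le> k'}" by auto
  then have "tail (Suc k) = measure law {(k', m). k' = Suc k} + measure law {(k', m::nat). Suc (Suc k) \<le> k'}"
    unfolding tail_def by (simp only:) (intro measure_pmf.finite_measure_Union, auto)
  then show ?thesis by (simp add: law_exit tail_def)
qed

lemma \<beta>_geometric: "\<beta> (j + k) \<le> (1/2) ^ j * \<beta> k"
proof (induction j)
  case (Suc j)
  have "\<beta> (Suc j + k) \<le> \<beta> (j + k) / (2 * real (j + k + 2))" using \<beta>_step[of "j + k"] by (simp only: add_Suc)
  also have "\<dots> \<le> \<beta> (j + k) / 2" using \<beta>_pos[of "j + k"] by (intro divide_left_mono) auto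
  also have "\<dots> \<le> (1/2) ^ j * \<beta> k / 2" using Suc by simp
  finally show ?case by simp
qed simp

text \<open>The geometric decay of \<beta> sums to a factor 2, which cancels the 2 in the bound on
  \<beta> (Suc k). Later exit indices are thus negligible against k + 1, and conditioning on K \<ge>
  k + 1 asymptotically amounts to K = k + 1.\<close>

lemma tail_le: "tail (Suc (Suc k)) \<le> \<beta> k / real (k + 2)"
proof -
  let ?A = "\<lambda>j. {(k', m::nat). k' = Suc (j + Suc k)}"
  have "{(k', m). Suc (Suc k) \<le> k'} = (\<Union>j. ?A j)"
    by (auto simp: le_iff_add)
  moreover have "(\<lambda>j. measure law (?A j)) sums measure law (\<Union>j. ?A j)"
    by (intro measure_pmf.finite_measure_UNION) (auto simp: disjoint_family_on_def)
  ultimately have s: "(\<lambda>j. measure law (?A j)) sums tail (Suc (Suc k))" by (simp add: tail_def)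
  have "tail (Suc (Suc k)) \<le> (\<Sum>j. \<beta> (Suc k) * (1/2) ^ j)"
    unfolding sums_unique[OF s]
  proof (rule suminf_le)
    fix j
    have "measure law (?A j) = \<beta> (j + Suc k) * Nu (real (j + Suc k + 1))" by (rule law_exit)
    also have "\<dots> \<le> \<beta> (j + Suc k)" using \<beta>_pos[of "j + Suc k"] Nu_bounds by (intro mult_left_le) auto
    also have "\<dots> \<le> \<beta> (Suc k) * (1/2) ^ j" using \<beta>_geometric[of j "Suc k"] by (simp only: mult.commute)
    finally show "measure law (?A j) \<le> \<beta> (Suc k) * (1/2) ^ j" .
  qed (use s in \<open>auto simp: sums_iff intro!: summable_mult summable_geometric\<close>)
  also have "\<dots> = \<beta> (Suc k) * 2" by (subst suminf_mult) (auto simp: summable_geometric suminf_geometric)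
  also have "\<dots> \<le> \<beta> k / real (k + 2)" using \<beta>_step[of k] by (simp add: field_simps)
  finally show ?thesis .
qed

lemma tail_pos: "tail n > 0"
proof -
  have "\<forall>\<^sub>F k in sequentially. 0 < Nu (real k)" by (rule order_tendstoD(1)[OF Nu_tendsto_1]) simp
  then have "\<forall>\<^sub>F k in sequentially. 0 < Nu (real k) \<and> k \<ge> n + 1"
    using eventually_ge_at_top by (rule eventually_conj)
  then obtain k where k: "0 < Nu (real k)" "k \<ge> n + 1" unfolding eventually_sequentially by blast
  then obtain j where j: "k = j + 1" by (cases k) auto
  have "0 < \<beta> j * Nu (real (j + 1))" using k(1) j \<beta>_pos[of j] by simp
  also have "\<dots> = measure law {(k', m). k' = Suc j}" by (simp only: law_exit)
  also have "\<dots> \<le> tail n" unfolding tail_def by (intro measure_pmf.finite_measure_mono) (use k j in auto)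
  finally show ?thesis .
qed

lemma tail_over_\<beta>: "(\<lambda>k. tail (Suc k) / \<beta> k) \<longlonglongrightarrow> 1"
proof (rule tendsto_sandwich[of "\<lambda>k. Nu (real (k + 1))" _ _ "\<lambda>k. Nu (real (k + 1)) + 1 / real (k + 2)"])
  show "\<forall>\<^sub>F k in sequentially. Nu (real (k + 1)) \<le> tail (Suc k) / \<beta> k"
  proof (intro always_eventually allI)
    fix k
    have "0 \<le> tail (Suc (Suc k))" by (simp add: tail_def)
    then have "\<beta> k * Nu (real (k + 1)) \<le> tail (Suc k)" using tail_rec[of k] by linarith
    then show "Nu (real (k + 1)) \<le> tail (Suc k) / \<beta> k"
      using \<beta>_pos[of k] by (simp add: pos_le_divide_eq mult.commute)
  qed
  show "\<forall>\<^sub>F k in sequentially. tail (Suc k) / \<beta> k \<le> Nu (real (k + 1)) + 1 / real (k + 2)"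
  proof (intro always_eventually allI)
    fix k
    have "tail (Suc k) \<le> \<beta> k * (Nu (real (k + 1)) + 1 / real (k + 2))"
      using tail_rec[of k] tail_le[of k] by (simp add: distrib_left)
    then show "tail (Suc k) / \<beta> k \<le> Nu (real (k + 1)) + 1 / real (k + 2)"
      using \<beta>_pos[of k] by (simp add: pos_divide_le_eq mult.commute)
  qed
  show lim: "(\<lambda>k. Nu (real (k + 1))) \<longlonglongrightarrow> 1" using LIMSEQ_ignore_initial_segment[OF Nu_tendsto_1] .
  have "(\<lambda>k. 1 / real (k + 2)) \<longlonglongrightarrow> 0" using LIMSEQ_ignore_initial_segment[OF lim_1_over_n] .
  from tendsto_add[OF lim this] show "(\<lambda>k. Nu (real (k + 1)) + 1 / real (k + 2)) \<longlonglongrightarrow> 1" by simp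
qed

lemma l_at_top: "filterlim l at_top sequentially"
proof (rule filterlim_at_top_mono[OF filterlim_ident])
  show "\<forall>\<^sub>F k in sequentially. k \<le> l k"
  proof (intro always_eventually allI)
    fix k
    show "k \<le> l k" using p_ge(1)[of k] l_ge(1)[of k] by linarith
  qed
qed

text \<open>Through \<open>scaling_asymp\<close> this makes l k the length that the scaling function
  attaches to the probability of K \<ge> k + 1.\<close>

lemma a_l_tail: "(\<lambda>k. a (l k) * tail (Suc k)) \<longlonglongrightarrow> 1"
proof -
  have "(\<lambda>k. 1 / real (k + 2)) \<longlonglongrightarrow> 0" using LIMSEQ_ignore_initial_segment[OF lim_1_over_n] .
  from tendsto_mult[OF tendsto_diff[OF tendsto_const[of 1] this] tail_over_\<beta>]
  have "(\<lambda>k. (1 - 1 / real (k + 2)) * (tail (Suc k) / \<beta> k)) \<longlonglongrightarrow> 1" by simp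
  moreover have "(1 - 1 / real (k + 2)) * (tail (Suc k) / \<beta> k) = a (l k) * tail (Suc k)" for k
  proof -
    have "1 - 1 / real (k + 2) = \<beta> k * a (l k)"
      unfolding \<beta>_def using l_pos[of k] a_pos[of "l k"] by simp
    then show ?thesis using \<beta>_pos[of k] by simp
  qed
  ultimately show ?thesis by simp
qed

text \<open>The condition on R reads R \<le> i for an integer i with i / l k tending to x.
  Eventually i lies in the k-th window, where the distribution function is exact, and continuity of
  the limit at x does the rest.\<close>

lemma conditional_law:
  assumes x: "isCont (cdf \<nu>) x"
  shows "(\<lambda>n. measure law {(k, m). n \<le> k \<and> scaling a (tail n) * real (k + m + 1) \<le> x} / tail n) \<longlonglongrightarrow> cdf \<nu> x"
proof (rule LIMSEQ_imp_Suc)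
  define \<gamma> where "\<gamma> k = scaling a (tail (Suc k))" for k
  define H where "H k = measure law {(k', m). Suc k \<le> k' \<and> \<gamma> k * real (k' + m + 1) \<le> x}" for k
  have cdfNu: "cdf \<nu> = Nu" by (auto simp: cdf_def Nu_def)
  have \<gamma>l: "(\<lambda>k. \<gamma> k * real (l k)) \<longlonglongrightarrow> 1"
    unfolding \<gamma>_def by (rule scaling_asymp[OF l_at_top tail_pos a_l_tail])
  have \<gamma>pos: "\<forall>\<^sub>F k in sequentially. \<gamma> k > 0"
    using order_tendstoD(1)[OF \<gamma>l, of 0] l_pos by (auto elim!: eventually_mono simp: zero_less_mult_iff)
  have "(\<lambda>k. H k / tail (Suc k)) \<longlonglongrightarrow> Nu x"
  \<comment> \<open>R is at least 1, so nothing lies below x \<le> 0. At x = 0 the continuity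
    assumption excludes an atom of \<nu>, so the limit is 0 as well.\<close>
  proof (cases "x \<le> 0")
    case True
    have "Nu x = 0"
    proof (cases "x < 0")
      case True
      then show ?thesis by (rule Nu_neg)
    next
      case False
      then have x0: "x = 0" using True by simp
      have "(\<lambda>n. - (1 / real (Suc n))) \<longlonglongrightarrow> - 0"
        by (intro tendsto_minus LIMSEQ_Suc lim_1_over_n)
      then have "(\<lambda>n. - (1 / real (Suc n))) \<longlonglongrightarrow> x" using x0 by simp
      from isCont_tendsto_compose[OF x this] have "(\<lambda>n. Nu (- (1 / real (Suc n)))) \<longlonglongrightarrow> Nu x" by (simp add: cdfNu)
      moreover have "Nu (- (1 / real (Suc n))) = 0" for n by (rule Nu_neg) simp
      ultimately show ?thesis by (simp add: LIMSEQ_const_iff)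
    qed
    moreover have "\<forall>\<^sub>F k in sequentially. H k / tail (Suc k) = 0"
      using \<gamma>pos
    proof eventually_elim
      case (elim k)
      have "\<not> \<gamma> k * real (k' + m + 1) \<le> x" for k' m
      proof -
        have "0 < \<gamma> k * real (k' + m + 1)" using elim by (intro mult_pos_pos) auto
        then show ?thesis using True by linarith
      qed
      then have "{(k', m). Suc k \<le> k' \<and> \<gamma> k * real (k' + m + 1) \<le> x} = {}" by blast
      then have "H k = 0" unfolding H_def by (simp only: measure_empty)
      then show ?case by simp
    qed
    ultimately show ?thesis by (simp add: tendsto_eventually)
  next
    case False
    then have xp: "x > 0" by simp
    define i where "i k = nat \<lfloor>x / \<gamma> k\<rfloor>" for k
    have quot: "(\<lambda>k. x / \<gamma> k / real (l k)) \<longlonglongrightarrow> x"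
    proof -
      have "(\<lambda>k. x * inverse (\<gamma> k * real (l k))) \<longlonglongrightarrow> x * inverse 1"
        by (intro tendsto_intros \<gamma>l) simp
      then show ?thesis by (simp add: divide_inverse mult_ac)
    qed
    have linf: "(\<lambda>k. 1 / real (l k)) \<longlonglongrightarrow> 0" by (rule filterlim_compose[OF lim_1_over_n l_at_top])
    have il: "(\<lambda>k. real (i k) / real (l k)) \<longlonglongrightarrow> x"
    proof (rule tendsto_sandwich[of "\<lambda>k. x / \<gamma> k / real (l k) - 1 / real (l k)" _ _ "\<lambda>k. x / \<gamma> k / real (l k)"])
      show "\<forall>\<^sub>F k in sequentially. x / \<gamma> k / real (l k) - 1 / real (l k) \<le> real (i k) / real (l k)"
      proof (intro always_eventually allI)
        fix k
        have "x / \<gamma> k - 1 \<le> real (i k)" unfolding i_def by linarith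
        then have "(x / \<gamma> k - 1) / real (l k) \<le> real (i k) / real (l k)" by (intro divide_right_mono) auto
        then show "x / \<gamma> k / real (l k) - 1 / real (l k) \<le> real (i k) / real (l k)" by (simp add: diff_divide_distrib)
      qed
      show "\<forall>\<^sub>F k in sequentially. real (i k) / real (l k) \<le> x / \<gamma> k / real (l k)"
        using \<gamma>pos
      proof eventually_elim
        case (elim k)
        have "0 \<le> x / \<gamma> k" using xp elim by simp
        then have "real (i k) \<le> x / \<gamma> k" unfolding i_def by linarith
        then show ?case by (intro divide_right_mono) auto
      qed
      show "(\<lambda>k. x / \<gamma> k / real (l k) - 1 / real (l k)) \<longlonglongrightarrow> x"
        using tendsto_diff[OF quot linf] by simp
    qed (rule quot)
    have Nulim: "(\<lambda>k. Nu (real (i k) / real (l k))) \<longlonglongrightarrow> Nu x"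
      using isCont_tendsto_compose[OF x il] by (simp add: cdfNu)
    have inv: "(\<lambda>k. \<beta> k / tail (Suc k)) \<longlonglongrightarrow> 1"
      using tendsto_inverse[OF tail_over_\<beta>] by simp
    \<comment> \<open>The window reaches from l k / (k + 1) to (k + 1) * l k, so it captures l k * x
      for every fixed x > 0 once k is large.\<close>
    have inwin: "\<forall>\<^sub>F k in sequentially. p k \<le> i k \<and> i k \<le> q k"
    proof -
      have "(\<lambda>k. 1 / real (k + 1)) \<longlonglongrightarrow> 0" using LIMSEQ_ignore_initial_segment[OF lim_1_over_n] .
      then have e1: "\<forall>\<^sub>F k in sequentially. 1 / real (k + 1) < x / 2" by (rule order_tendstoD(2)) (use xp in simp)
      have e2: "\<forall>\<^sub>F k in sequentially. x / 2 < real (i k) / real (l k)"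
        by (rule order_tendstoD(1)[OF il]) (use xp in simp)
      have e3: "\<forall>\<^sub>F k in sequentially. real (i k) / real (l k) < x + 1"
        by (rule order_tendstoD(2)[OF il]) simp
      have e4: "\<forall>\<^sub>F k in sequentially. x + 1 \<le> real (k + 1)"
      proof -
        have "\<forall>\<^sub>F k in sequentially. k \<ge> nat \<lceil>x\<rceil>" by (rule eventually_ge_at_top)
        then show ?thesis by eventually_elim linarith
      qed
      show ?thesis using e1 e2 e3 e4
      proof eventually_elim
        case (elim k)
        have lp: "real (l k) > 0" using l_pos by simp
        have "1 / real (k + 1) < real (i k) / real (l k)" using elim by linarith
        then have "real (l k) < real (k + 1) * real (i k)" using lp by (simp add: field_simps)
        then have "real ((k + 1) * p k) < real ((k + 1) * i k)" unfolding l_def by (simp add: distrib_right)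
        then have "p k < i k" unfolding of_nat_less_iff mult_less_cancel1 by blast
        moreover have "real (i k) / real (l k) < real (k + 1)" using elim by linarith
        then have "real (i k) < real ((k + 1) * l k)" using lp by (simp add: field_simps)
        then have "i k < q k" unfolding q_def of_nat_less_iff .
        ultimately show ?case by simp
      qed
    qed
    have HK: "\<forall>\<^sub>F k in sequentially. \<beta> k * Nu (real (i k) / real (l k)) \<le> H k \<and>
        H k \<le> \<beta> k * Nu (real (i k) / real (l k)) + \<beta> k / real (k + 2)"
      using inwin \<gamma>pos
    proof eventually_elim
      case (elim k)
      have iff: "\<gamma> k * real n \<le> x \<longleftrightarrow> n \<le> i k" for n
      proof -
        have "\<gamma> k * real n \<le> x \<longleftrightarrow> real n \<le> x / \<gamma> k" using elim by (simp add: field_simps)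
        also have "\<dots> \<longleftrightarrow> n \<le> i k" unfolding i_def using xp elim by (simp add: le_nat_iff le_floor_iff)
        finally show ?thesis .
      qed
      have w: "measure law {(k', m). k' = Suc k \<and> k' + m + 1 \<le> i k} = \<beta> k * Nu (real (i k) / real (l k))"
        using elim by (intro law_window) auto
      have "measure law {(k', m). k' = Suc k \<and> k' + m + 1 \<le> i k} \<le> H k"
        unfolding H_def iff by (intro measure_pmf.finite_measure_mono) auto
      moreover have "H k \<le> measure law ({(k', m). k' = Suc k \<and> k' + m + 1 \<le> i k} \<union> {(k', m). Suc (Suc k) \<le> k'})"
        unfolding H_def iff by (intro measure_pmf.finite_measure_mono) auto
      moreover have "\<dots> \<le> measure law {(k', m). k' = Suc k \<and> k' + m + 1 \<le> i k} + tail (Suc (Suc k))"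
        unfolding tail_def by (intro measure_Un_le) auto
      ultimately show ?case using tail_le[of k] unfolding w by linarith
    qed
    have lo: "(\<lambda>k. (\<beta> k / tail (Suc k)) * Nu (real (i k) / real (l k))) \<longlonglongrightarrow> 1 * Nu x"
      by (intro tendsto_mult inv Nulim)
    have "(\<lambda>k. 1 / real (k + 2)) \<longlonglongrightarrow> 0" using LIMSEQ_ignore_initial_segment[OF lim_1_over_n] .
    then have hi: "(\<lambda>k. (\<beta> k / tail (Suc k)) * (Nu (real (i k) / real (l k)) + 1 / real (k + 2))) \<longlonglongrightarrow> 1 * (Nu x + 0)"
      by (intro tendsto_mult tendsto_add inv Nulim)
    show ?thesis
    proof (rule tendsto_sandwich[OF _ _ lo[unfolded mult_1] hi[unfolded mult_1 add_0_right]])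
      show "\<forall>\<^sub>F k in sequentially. (\<beta> k / tail (Suc k)) * Nu (real (i k) / real (l k)) \<le> H k / tail (Suc k)"
        using HK
      proof eventually_elim
        case (elim k)
        then have "\<beta> k * Nu (real (i k) / real (l k)) / tail (Suc k) \<le> H k / tail (Suc k)"
          using tail_pos[of "Suc k"] by (intro divide_right_mono) auto
        then show ?case by simp
      qed
      show "\<forall>\<^sub>F k in sequentially. H k / tail (Suc k) \<le> (\<beta> k / tail (Suc k)) * (Nu (real (i k) / real (l k)) + 1 / real (k + 2))"
        using HK
      proof eventually_elim
        case (elim k)
        then have "H k / tail (Suc k) \<le> (\<beta> k * Nu (real (i k) / real (l k)) + \<beta> k / real (k + 2)) / tail (Suc k)"
          using tail_pos[of "Suc k"] by (intro divide_right_mono) auto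
        then show ?case by (simp add: field_simps)
      qed
    qed
  qed
  then show "(\<lambda>n. measure law {(k, m). Suc n \<le> k \<and> scaling a (tail (Suc n)) * real (k + m + 1) \<le> x} / tail (Suc n)) \<longlonglongrightarrow> cdf \<nu> x"
    by (simp only: H_def \<gamma>_def cdfNu)
qed

end

text \<open>Every requirement on the next p k holds for all large values, so the sequence can be
  chosen recursively. Of the conclusions, the first keeps the ray infinite, the second makes all
  descent states accessible, the third gives pressure zero, mixing and an infinite mean return time,
  the fourth feeds the renewal theorem, and the last becomes the convergence in law.\<close>

theorem (in regularly_varying_seq) exists_excursion_law:
  assumes \<nu>: "\<nu> \<in> limit_laws \<alpha>"
  obtains w :: "(nat \<times> nat) pmf" where
    "\<And>n. measure w {(k, m). n \<le> k} > 0"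
    "\<exists>m0. \<forall>m\<ge>m0. pmf w (0, m) > 0"
    "\<exists>\<kappa>>0. \<exists>N. \<forall>n\<ge>N. \<kappa> / (real n)\<^sup>2 \<le> measure w {(k, m). k + m + 1 = n}"
    "(\<lambda>n. a n * measure w {(k, m). n < k + m + 1}) \<longlonglongrightarrow> sin (pi * \<alpha>) / (pi * \<alpha>)"
    "\<And>x. isCont (cdf \<nu>) x \<Longrightarrow> (\<lambda>n. measure w {(k, m). n \<le> k \<and>
        scaling a (measure w {(k, m). n \<le> k}) * real (k + m + 1) \<le> x} / measure w {(k, m). n \<le> k}) \<longlonglongrightarrow> cdf \<nu> x"
proof -
  define c where "c = sin (pi * \<alpha>) / (pi * \<alpha>)"
  have c: "c > 0" using alpha by (auto simp: c_def intro!: divide_pos_pos sin_gt_zero)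
  have nu: "real_distribution \<nu>" "measure \<nu> {0..} = 1"
    "\<And>t s. 0 < t \<Longrightarrow> t < s \<Longrightarrow> measure \<nu> {t<..s} \<le> c * (t powr (-\<alpha>) - s powr (-\<alpha>))"
    using \<nu> by (auto simp: limit_laws_def c_def)
  define f where "f k = c * (\<alpha> / (real (Suc k) * a (Suc k)))" for k
  have sf: "summable f" unfolding f_def by (intro summable_mult summable_tail_density)
  have "0 < (1/2 :: real)" by simp
  from suminf_exist_split[OF this sf] obtain M where M: "\<And>n. n \<ge> M \<Longrightarrow> norm (\<Sum>i. f (i + n)) < 1/2"
    by blast
  \<comment> \<open>The density starts so late that it sums to at most 1 / 2; adding 2 also keeps it
    off the return time 1.\<close>
  define i0 where "i0 = M + 2"
  define base where "base i = (if i \<ge> i0 then c * \<alpha> / (real i * a i) else 0)" for i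
  have base_f: "base (k + i0) = f (k + (M + 1))" for k by (simp add: base_def f_def i0_def)
  have "summable (\<lambda>k. base (k + i0))" unfolding base_f by (rule summable_ignore_initial_segment[OF sf])
  then have sb: "summable base" by (simp only: summable_iff_shift)
  have "(\<Sum>i. base i) = (\<Sum>k. base (k + i0)) + (\<Sum>i<i0. base i)" by (rule suminf_split_initial_segment[OF sb])
  also have "(\<Sum>i<i0. base i) = 0" by (simp add: base_def)
  also have "(\<Sum>k. base (k + i0)) + 0 \<le> 1/2" unfolding base_f using M[of "M + 1"] by simp
  finally have base_sum: "(\<Sum>i. base i) \<le> 1/2" .
  define B where "B k p = (1 - 1 / real (k + 2)) / a ((k + 1) * p)" for k p
  have B_pos: "B k p > 0" if "p \<ge> 1" for k p
  proof -
    have "0 < 1 - 1 / real (k + 2)" "0 < a ((k + 1) * p)" using that a_pos[of "(k + 1) * p"] by auto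
    then show ?thesis unfolding B_def by (rule divide_pos_pos)
  qed
  have B_lim: "\<forall>\<^sub>F p in sequentially. B k p \<le> r" if "r > 0" for k r
  proof -
    have "filterlim (\<lambda>p. (k + 1) * p) at_top sequentially"
    proof (rule filterlim_at_top_mono[OF filterlim_ident])
      show "\<forall>\<^sub>F p in sequentially. p \<le> (k + 1) * p" by (intro always_eventually) simp
    qed
    from filterlim_compose[OF filterlim_a this]
    have "(\<lambda>p. (1 - 1 / real (k + 2)) / a ((k + 1) * p)) \<longlonglongrightarrow> 0"
      by (intro tendsto_divide_0[OF tendsto_const] filterlim_at_top_imp_at_infinity)
    then have "\<forall>\<^sub>F p in sequentially. B k p < r" unfolding B_def[symmetric] using that by (rule order_tendstoD(2))
    then show ?thesis by (rule eventually_mono) simp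
  qed
  define \<rho> where "\<rho> k = (1/2) ^ (k + 3) / (1 + (\<Sum>j\<le>k + 3. \<bar>a j\<bar>))" for k
  have \<rho>: "\<rho> k > 0" for k
  proof -
    have "0 \<le> (\<Sum>j\<le>k + 3. \<bar>a j\<bar>)" by (intro sum_nonneg) auto
    then show ?thesis unfolding \<rho>_def by (intro divide_pos_pos add_pos_nonneg) auto
  qed
  define P where "P k p \<longleftrightarrow> p \<ge> k + 2 \<and> p \<ge> i0 \<and> B k p \<le> \<rho> k \<and>
    (\<forall>i. p < i \<and> i \<le> (k + 1) * ((k + 1) * p) \<longrightarrow> B k p *
      measure \<nu> {real (i - 1) / real ((k + 1) * p)<..real i / real ((k + 1) * p)} < c * \<alpha> / (real i * a i))" for k p
  have evP: "\<forall>\<^sub>F p in sequentially. P k p" for k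
    unfolding P_def B_def
    by (intro eventually_conj eventually_ge_at_top B_lim[OF \<rho>, unfolded B_def] window_eventually nu c)
  have "\<exists>p. \<forall>k. P k (p k) \<and> (p (Suc k) \<ge> (k + 1) * ((k + 1) * p k) \<and> B (Suc k) (p (Suc k)) \<le> B k (p k) / (2 * real (k + 2)))"
  proof (rule dependent_nat_choice)
    show "\<exists>p. P 0 p" using evP[of 0] unfolding eventually_sequentially by blast
    fix p k assume "P k p"
    then have "p \<ge> 1" by (simp add: P_def)
    then have "0 < B k p / (2 * real (k + 2))" using B_pos by (intro divide_pos_pos) auto
    then have "\<forall>\<^sub>F p' in sequentially. P (Suc k) p' \<and> (p' \<ge> (k + 1) * ((k + 1) * p) \<and> B (Suc k) p' \<le> B k p / (2 * real (k + 2)))"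
      by (intro eventually_conj evP eventually_ge_at_top B_lim)
    then show "\<exists>p'. P (Suc k) p' \<and> (p' \<ge> (k + 1) * ((k + 1) * p) \<and> B (Suc k) p' \<le> B k p / (2 * real (k + 2)))"
      unfolding eventually_sequentially by blast
  qed
  then obtain p where p: "\<And>k. P k (p k)" "\<And>k. p (Suc k) \<ge> (k + 1) * ((k + 1) * p k)"
    "\<And>k. B (Suc k) (p (Suc k)) \<le> B k (p k) / (2 * real (k + 2))" by blast
  define l where "l k = (k + 1) * p k" for k
  define q where "q k = (k + 1) * l k" for k
  define \<beta> where "\<beta> k = (1 - 1 / real (k + 2)) / a (l k)" for k
  have \<beta>B: "\<beta> k = B k (p k)" for k by (simp only: \<beta>_def B_def l_def)
  interpret W: excursion_weights a \<alpha> \<nu> i0 p c l q \<beta> base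
  proof (intro excursion_weights.intro excursion_weights_axioms.intro)
    show "regularly_varying_seq a \<alpha>" by unfold_locales
    show "real_distribution \<nu>" by (rule nu)
    show "l = (\<lambda>k. (k + 1) * p k)" "q = (\<lambda>k. (k + 1) * l k)"
      "\<beta> = (\<lambda>k. (1 - 1 / real (k + 2)) / a (l k))"
      "base = (\<lambda>i. if i0 \<le> i then c * \<alpha> / (real i * a i) else 0)"
      by (simp_all only: l_def[abs_def] q_def[abs_def] \<beta>_def[abs_def] base_def[abs_def])
    show "i0 \<ge> 2" by (simp add: i0_def)
    show pk: "k + 2 \<le> p k" "i0 \<le> p k" for k using p(1)[of k] by (auto simp: P_def)
    show "q k \<le> p (Suc k)" for k using p(2)[of k] by (simp only: q_def l_def)
    show "\<beta> k * measure \<nu> {real (i - 1) / real (l k)<..real i / real (l k)} < base i" if "p k < i" "i \<le> q k" for k i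
    proof -
      have "base i = c * \<alpha> / (real i * a i)" using that pk(2)[of k] by (simp add: base_def)
      then show ?thesis using p(1)[of k] that unfolding P_def \<beta>B l_def q_def by metis
    qed
    show "\<beta> k \<le> (1/2) ^ (k + 3) / (1 + (\<Sum>j\<le>k + 3. \<bar>a j\<bar>))" for k
      using p(1)[of k] unfolding P_def \<beta>B \<rho>_def by blast
    show "\<beta> (Suc k) \<le> \<beta> k / (2 * real (k + 2))" for k unfolding \<beta>B by (rule p(3))
  qed (fact nu c base_sum)+
  show thesis
  proof (rule that[of W.law])
    show "measure W.law {(k, m). n \<le> k} > 0" for n using W.tail_pos[of n] by (simp add: W.tail_def)
    show "\<exists>m0. \<forall>m\<ge>m0. pmf W.law (0, m) > 0"
      by (intro exI[of _ "i0 + 1"]) (auto simp: W.pmf_law intro!: W.\<theta>_0_pos)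
    show "\<exists>\<kappa>>0. \<exists>N. \<forall>n\<ge>N. \<kappa> / (real n)\<^sup>2 \<le> measure W.law {(k, m). k + m + 1 = n}"
    proof -
      \<comment> \<open>Since a n \<le> n eventually, the density c * \<alpha> / (n * a n) is at
        least c * \<alpha> / n^2, which gives \<kappa> = c * \<alpha>.\<close>
      have "\<forall>\<^sub>F n in sequentially. a n / real n < 1" by (rule order_tendstoD(2)[OF a_over_n_tendsto_0]) simp
      then obtain N where N: "\<And>n. n \<ge> N \<Longrightarrow> a n / real n < 1" unfolding eventually_sequentially by blast
      have "c * \<alpha> / (real n)\<^sup>2 \<le> measure W.law {(k, m). k + m + 1 = n}" if "n \<ge> max N i0" for n
      proof -
        have n: "n \<ge> N" "n \<ge> i0" "n \<ge> 2" using that by (auto simp: i0_def)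
        have an: "a n > 0" "real n > 0" using n a_pos[of n] by auto
        then have "a n \<le> real n" using N[OF n(1)] by (simp add: field_simps)
        then have "real n * a n \<le> (real n)\<^sup>2" using an by (simp add: power2_eq_square)
        then have "c * \<alpha> / (real n)\<^sup>2 \<le> c * \<alpha> / (real n * a n)"
          using an c alpha by (intro divide_left_mono) auto
        also have "\<dots> = base n" using n by (simp add: base_def)
        also have "\<dots> \<le> W.rlaw n" using n W.low_bounds by (simp add: W.rlaw_def)
        finally show ?thesis by (simp only: W.law_return)
      qed
      then show ?thesis using c alpha by (intro exI[of _ "c * \<alpha>"] conjI exI[of _ "max N i0"]) auto
    qed
    show "(\<lambda>n. a n * measure W.law {(k, m). n < k + m + 1}) \<longlonglongrightarrow> sin (pi * \<alpha>) / (pi * \<alpha>)"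
      using W.return_tail_asymp by (simp only: c_def)
    show "(\<lambda>n. measure W.law {(k, m). n \<le> k \<and>
        scaling a (measure W.law {(k, m). n \<le> k}) * real (k + m + 1) \<le> x} / measure W.law {(k, m). n \<le> k}) \<longlonglongrightarrow> cdf \<nu> x"
      if "isCont (cdf \<nu>) x" for x
      using W.conditional_law[OF that] by (simp only: W.tail_def)
  qed
qed

section \<open>The transfer operator and pointwise dual ergodicity\<close>

locale measure_preserving_system = sigma_finite_measure M for M :: "'a measure" +
  fixes T :: "'a \<Rightarrow> 'a"
  assumes mpt: "measure_preserving_map M T"
begin

abbreviation "op \<equiv> transfer_operator M T"

lemma T_measurable [measurable]: "T \<in> M \<rightarrow>\<^sub>M M"
  and distr_T: "distr M M T = M"
  using mpt by (auto simp: measure_preserving_map_def)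

lemma T_funpow_measurable [measurable]: "T ^^ k \<in> M \<rightarrow>\<^sub>M M"
  by (induction k) (auto intro: measurable_comp[of _ M M])

definition bounded_test :: "('a \<Rightarrow> real) \<Rightarrow> bool" where
  "bounded_test u \<longleftrightarrow> u \<in> borel_measurable M \<and> (\<exists>C. \<forall>x\<in>space M. \<bar>u x\<bar> \<le> C)"

lemma bounded_test_indicator: "A \<in> sets M \<Longrightarrow> bounded_test (indicator A)"
  by (auto simp: bounded_test_def intro!: exI[of _ 1] split: split_indicator)

lemma bounded_test_const: "bounded_test (\<lambda>_. c)"
  by (auto simp: bounded_test_def)

lemma bounded_test_comp: "bounded_test u \<Longrightarrow> bounded_test (\<lambda>x. u ((T ^^ k) x))"
  unfolding bounded_test_def
  using measurable_space[OF T_funpow_measurable[of k]] by (auto intro: measurable_compose[OF T_funpow_measurable])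

lemma integrable_mult_test:
  assumes "integrable M f" "bounded_test u"
  shows "integrable M (\<lambda>x. f x * u x)"
proof -
  obtain C where C: "\<And>x. x \<in> space M \<Longrightarrow> \<bar>u x\<bar> \<le> C" using assms by (auto simp: bounded_test_def)
  have [measurable]: "f \<in> borel_measurable M" "u \<in> borel_measurable M"
    using assms by (auto simp: bounded_test_def)
  show ?thesis
  proof (rule Bochner_Integration.integrable_bound)
    show "integrable M (\<lambda>x. C * f x)" using assms by simp
    show "AE x in M. norm (f x * u x) \<le> norm (C * f x)"
    proof (rule AE_I2)
      fix x assume "x \<in> space M"
      then have "\<bar>u x\<bar> \<le> \<bar>C\<bar>" using C by force
      then show "norm (f x * u x) \<le> norm (C * f x)"
        using mult_right_mono[of "\<bar>u x\<bar>" "\<bar>C\<bar>" "\<bar>f x\<bar>"] by (simp add: abs_mult mult.commute)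
    qed
  qed measurable
qed

text \<open>The dual function is the Radon-Nikodym derivative of the image under T of the measure
  with density f; invariance of M makes that image absolutely continuous.\<close>

lemma dual_exists_nonneg:
  assumes f: "integrable M f" "\<And>x. 0 \<le> f x"
  shows "\<exists>g. integrable M g \<and> (\<forall>u. bounded_test u \<longrightarrow> (LINT x|M. f x * u (T x)) = (LINT x|M. g x * u x))"
proof -
  have [measurable]: "f \<in> borel_measurable M" using f by simp
  define N where "N = distr (density M (\<lambda>x. ennreal (f x))) M T"
  have setsN: "sets N = sets M" by (simp add: N_def)
  have ac: "absolutely_continuous M N"
    unfolding absolutely_continuous_def
  proof
    fix A assume A: "A \<in> null_sets M"
    then have [measurable]: "A \<in> sets M" by auto
    have "emeasure M (T -` A \<inter> space M) = emeasure (distr M M T) A" by (simp add: emeasure_distr)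
    then have nul: "T -` A \<inter> space M \<in> null_sets M" using A by (simp add: distr_T null_sets_def)
    have "emeasure N A = (\<integral>\<^sup>+x. ennreal (f x) * indicator (T -` A \<inter> space M) x \<partial>M)"
      unfolding N_def by (subst emeasure_distr) (simp_all add: emeasure_density)
    also have "\<dots> = 0"
      by (subst nn_integral_0_iff_AE) (use AE_not_in[OF nul] in \<open>auto elim!: eventually_mono\<close>)
    finally show "A \<in> null_sets N" by (simp add: null_sets_def setsN)
  qed
  define r where "r = RN_deriv M N"
  have [measurable]: "r \<in> borel_measurable M" by (simp add: r_def)
  have dens: "density M r = N" unfolding r_def by (rule density_RN_deriv[OF ac setsN])
  have "(\<integral>\<^sup>+x. r x \<partial>M) = emeasure N (space M)"
    unfolding dens[symmetric] by (subst emeasure_density) (auto intro!: nn_integral_cong)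
  also have "\<dots> = (\<integral>\<^sup>+x. ennreal (f x) \<partial>M)"
    unfolding N_def using measurable_space[OF T_measurable]
    by (subst emeasure_distr) (auto simp: emeasure_density intro!: nn_integral_cong split: split_indicator)
  also have fin: "\<dots> < \<infinity>" using f by (simp add: integrable_iff_bounded)
  finally have rfin: "(\<integral>\<^sup>+x. r x \<partial>M) < \<infinity>" .
  then have "AE x in M. r x \<noteq> \<infinity>" by (intro nn_integral_PInf_AE) auto
  then have req: "AE x in M. r x = ennreal (enn2real (r x))"
    by eventually_elim (simp add: less_top)
  define g where "g x = enn2real (r x)" for x
  have [measurable]: "g \<in> borel_measurable M" unfolding g_def by measurable
  have densg: "density M (\<lambda>x. ennreal (g x)) = N"
    unfolding dens[symmetric] by (rule density_cong) (use req in \<open>auto simp: g_def\<close>)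
  have "(\<integral>\<^sup>+x. ennreal (norm (g x)) \<partial>M) = (\<integral>\<^sup>+x. r x \<partial>M)"
    by (rule nn_integral_cong_AE) (use req in \<open>auto simp: g_def\<close>)
  then have gint: "integrable M g" using rfin by (auto simp: integrable_iff_bounded)
  have "(LINT x|M. f x * u (T x)) = (LINT x|M. g x * u x)" if u: "bounded_test u" for u
  proof -
    have [measurable]: "u \<in> borel_measurable M" using u by (simp add: bounded_test_def)
    have "(LINT x|M. g x * u x) = (LINT x|density M (\<lambda>x. ennreal (g x)). u x)"
      by (subst integral_density) (auto simp: g_def)
    also have "\<dots> = (LINT x|density M (\<lambda>x. ennreal (f x)). u (T x))"
      unfolding densg N_def by (subst integral_distr) auto
    also have "\<dots> = (LINT x|M. f x * u (T x))"
      by (subst integral_density) (auto simp: f)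
    finally show ?thesis by simp
  qed
  then show ?thesis using gint by blast
qed

text \<open>\<open>transfer_operator\<close> is defined by a choice of version, so all that is known
  about it comes from these two properties. Existence for signed f follows by splitting it into
  positive and negative part.\<close>

lemma transfer_spec:
  fixes u :: "'a \<Rightarrow> real"
  assumes f: "integrable M f"
  shows "integrable M (op f)"
    and "bounded_test u \<Longrightarrow> (LINT x|M. f x * u (T x)) = (LINT x|M. op f x * u x)"
proof -
  let ?P = "\<lambda>g. integrable M g \<and> (\<forall>u\<in>borel_measurable M. (\<exists>C. \<forall>x\<in>space M. \<bar>u x\<bar> \<le> C) \<longrightarrow>
           (LINT x|M. f x * u (T x)) = (LINT x|M. g x * u x))"
  obtain g1 where g1: "integrable M g1"
    "\<And>u. bounded_test u \<Longrightarrow> (LINT x|M. max 0 (f x) * u (T x)) = (LINT x|M. g1 x * u x)"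
    using dual_exists_nonneg[of "\<lambda>x. max 0 (f x)"] f by auto
  obtain g2 where g2: "integrable M g2"
    "\<And>u. bounded_test u \<Longrightarrow> (LINT x|M. max 0 (- f x) * u (T x)) = (LINT x|M. g2 x * u x)"
    using dual_exists_nonneg[of "\<lambda>x. max 0 (- f x)"] f by auto
  have "?P (\<lambda>x. g1 x - g2 x)"
  proof (intro conjI ballI impI)
    show "integrable M (\<lambda>x. g1 x - g2 x)" using g1 g2 by simp
    fix u :: "'a \<Rightarrow> real" assume "u \<in> borel_measurable M" "\<exists>C. \<forall>x\<in>space M. \<bar>u x\<bar> \<le> C"
    then have u: "bounded_test u" by (simp add: bounded_test_def)
    have uT: "bounded_test (\<lambda>x. u (T x))" using bounded_test_comp[OF u, of 1] by simp
    have "(LINT x|M. f x * u (T x)) = (LINT x|M. max 0 (f x) * u (T x) - max 0 (- f x) * u (T x))"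
      by (intro Bochner_Integration.integral_cong) (auto simp: max_def left_diff_distrib)
    also have "\<dots> = (LINT x|M. max 0 (f x) * u (T x)) - (LINT x|M. max 0 (- f x) * u (T x))"
      using f by (intro Bochner_Integration.integral_diff integrable_mult_test uT) auto
    also have "\<dots> = (LINT x|M. g1 x * u x) - (LINT x|M. g2 x * u x)" using g1 g2 u by simp
    also have "\<dots> = (LINT x|M. g1 x * u x - g2 x * u x)"
      using g1 g2 u by (intro Bochner_Integration.integral_diff[symmetric] integrable_mult_test) auto
    finally show "(LINT x|M. f x * u (T x)) = (LINT x|M. (g1 x - g2 x) * u x)" by (simp add: left_diff_distrib)
  qed
  then have P: "?P (op f)" unfolding transfer_operator_def by (rule someI[where P = ?P])
  then show "integrable M (op f)" by blast
  show "bounded_test u \<Longrightarrow> (LINT x|M. f x * u (T x)) = (LINT x|M. op f x * u x)"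
    using P by (auto simp: bounded_test_def)
qed

lemma iter_integrable: "integrable M f \<Longrightarrow> integrable M ((op ^^ k) f)"
  by (induction k) (auto intro: transfer_spec)

lemma iter_dual:
  assumes "integrable M f" "bounded_test u"
  shows "(LINT x|M. (op ^^ k) f x * u x) = (LINT x|M. f x * u ((T ^^ k) x))"
  using assms(2)
proof (induction k arbitrary: u)
  case (Suc k)
  have uT: "bounded_test (\<lambda>x. u (T x))" using bounded_test_comp[OF Suc.prems, of 1] by simp
  have "(LINT x|M. (op ^^ Suc k) f x * u x) = (LINT x|M. (op ^^ k) f x * u (T x))"
    using transfer_spec(2)[OF iter_integrable[OF assms(1)] Suc.prems] by simp
  also have "\<dots> = (LINT x|M. f x * u (T ((T ^^ k) x)))" by (rule Suc.IH[OF uT])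
  finally show ?case by simp
qed simp

text \<open>Testing against the sign of the difference produces its L1 norm.\<close>

lemma AE_eq_of_test_integrals:
  assumes g: "integrable M g" "integrable M g'"
    and eq: "\<And>u. bounded_test u \<Longrightarrow> (LINT x|M. g x * u x) = (LINT x|M. g' x * u x)"
  shows "AE x in M. g x = g' x"
proof -
  have [measurable]: "g \<in> borel_measurable M" "g' \<in> borel_measurable M" using g by auto
  define u where "u x = sgn (g x - g' x)" for x
  have u: "bounded_test u"
    unfolding bounded_test_def u_def by (auto intro!: exI[of _ 1] simp: sgn_if)
  have "(LINT x|M. \<bar>g x - g' x\<bar>) = (LINT x|M. g x * u x - g' x * u x)"
    by (intro Bochner_Integration.integral_cong) (auto simp: u_def sgn_if)
  also have "\<dots> = (LINT x|M. g x * u x) - (LINT x|M. g' x * u x)"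
    by (intro Bochner_Integration.integral_diff integrable_mult_test g u)
  also have "\<dots> = 0" using eq[OF u] by simp
  finally have "AE x in M. \<bar>g x - g' x\<bar> = 0"
    using g by (subst (asm) integral_nonneg_eq_0_iff_AE) auto
  then show ?thesis by eventually_elim simp
qed

text \<open>The chosen version may differ between inputs that agree only a.e., so identities cannot
  be pushed through iterates of \<open>op\<close> by rewriting. Duality against u composed with T^k
  characterizes the k-th iterate directly.\<close>

lemma iter_AE_eqI:
  assumes "integrable M f" "integrable M g"
    and "\<And>u. bounded_test u \<Longrightarrow> (LINT x|M. f x * u ((T ^^ k) x)) = (LINT x|M. g x * u x)"
  shows "AE x in M. (op ^^ k) f x = g x"
  using assms by (intro AE_eq_of_test_integrals iter_integrable) (simp_all add: iter_dual)

lemma transfer_AE_eqI: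
  assumes "integrable M f" "integrable M g"
    and "\<And>u. bounded_test u \<Longrightarrow> (LINT x|M. f x * u (T x)) = (LINT x|M. g x * u x)"
  shows "AE x in M. op f x = g x"
  using iter_AE_eqI[of f g 1] assms by simp

lemma iter_linear:
  assumes f: "integrable M f" and g: "integrable M g"
  shows "AE x in M. (op ^^ k) (\<lambda>x. c * f x + d * g x) x = c * (op ^^ k) f x + d * (op ^^ k) g x"
proof (rule iter_AE_eqI)
  show "integrable M (\<lambda>x. c * f x + d * g x)" using f g by simp
  show "integrable M (\<lambda>x. c * (op ^^ k) f x + d * (op ^^ k) g x)" using f g by (simp add: iter_integrable)
  fix u assume u: "bounded_test u"
  note uk = bounded_test_comp[OF u, of k]
  have "(LINT x|M. (c * f x + d * g x) * u ((T ^^ k) x))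
      = (LINT x|M. c * (f x * u ((T ^^ k) x)) + d * (g x * u ((T ^^ k) x)))"
    by (simp add: algebra_simps)
  also have "\<dots> = c * (LINT x|M. f x * u ((T ^^ k) x)) + d * (LINT x|M. g x * u ((T ^^ k) x))"
    using integrable_mult_test[OF f uk] integrable_mult_test[OF g uk] by simp
  also have "\<dots> = c * (LINT x|M. (op ^^ k) f x * u x) + d * (LINT x|M. (op ^^ k) g x * u x)"
    using f g u by (simp add: iter_dual)
  also have "\<dots> = (LINT x|M. c * ((op ^^ k) f x * u x) + d * ((op ^^ k) g x * u x))"
    using integrable_mult_test[OF iter_integrable[OF f] u] integrable_mult_test[OF iter_integrable[OF g] u] by simp
  also have "\<dots> = (LINT x|M. (c * (op ^^ k) f x + d * (op ^^ k) g x) * u x)" by (simp add: algebra_simps)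
  finally show "(LINT x|M. (c * f x + d * g x) * u ((T ^^ k) x))
      = (LINT x|M. (c * (op ^^ k) f x + d * (op ^^ k) g x) * u x)" .
qed

lemma iter_nonneg:
  assumes f: "integrable M f" and f0: "AE x in M. 0 \<le> f x"
  shows "AE x in M. 0 \<le> (op ^^ k) f x"
proof -
  let ?g = "(op ^^ k) f"
  have [measurable]: "f \<in> borel_measurable M" "?g \<in> borel_measurable M"
    using f iter_integrable[OF f] by auto
  define A where "A = {x\<in>space M. ?g x < 0}"
  have A: "A \<in> sets M" unfolding A_def by measurable
  note u = bounded_test_indicator[OF A]
  have "0 \<le> (LINT x|M. f x * indicator A ((T ^^ k) x))"
    by (rule integral_nonneg_AE) (use f0 in \<open>auto elim!: eventually_mono\<close>)
  also have "\<dots> = (LINT x|M. ?g x * indicator A x)" by (simp add: iter_dual[OF f u])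
  finally have "(LINT x|M. - (?g x * indicator A x)) \<le> 0" by simp
  moreover have nn: "0 \<le> - (?g x * indicator A x)" for x
    by (auto simp: A_def indicator_def mult_nonpos_nonneg)
  ultimately have "(LINT x|M. - (?g x * indicator A x)) = 0"
    by (intro antisym Bochner_Integration.integral_nonneg) auto
  then have "AE x in M. - (?g x * indicator A x) = 0"
    using integrable_mult_test[OF iter_integrable[OF f] u] nn
    by (subst (asm) integral_nonneg_eq_0_iff_AE) auto
  then show ?thesis using AE_space by eventually_elim (auto simp: A_def indicator_def split: if_splits)
qed

lemma iter_mono:
  assumes f: "integrable M f" and g: "integrable M g" and le: "AE x in M. f x \<le> g x"
  shows "AE x in M. (op ^^ k) f x \<le> (op ^^ k) g x"
proof -
  have "AE x in M. 0 \<le> (op ^^ k) (\<lambda>x. 1 * g x + (-1) * f x) x"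
    using f g le by (intro iter_nonneg) auto
  then show ?thesis using iter_linear[OF g f, of k 1 "-1"] by eventually_elim simp
qed

lemma iter_abs:
  assumes f: "integrable M f"
  shows "AE x in M. \<bar>(op ^^ k) f x\<bar> \<le> (op ^^ k) (\<lambda>x. \<bar>f x\<bar>) x"
proof -
  have "AE x in M. (op ^^ k) f x \<le> (op ^^ k) (\<lambda>x. \<bar>f x\<bar>) x" using f by (intro iter_mono) auto
  moreover have "AE x in M. (op ^^ k) (\<lambda>x. (-1) * f x + 0 * f x) x \<le> (op ^^ k) (\<lambda>x. \<bar>f x\<bar>) x"
    using f by (intro iter_mono) auto
  ultimately show ?thesis using iter_linear[OF f f, of k "-1" 0] by eventually_elim auto
qed

lemma iter_integral: "integrable M f \<Longrightarrow> (LINT x|M. (op ^^ k) f x) = (LINT x|M. f x)"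
  using iter_dual[OF _ bounded_test_const[of 1]] by simp

section \<open>Hopf's maximal inequality for dual sums\<close>

definition dual_sum :: "nat \<Rightarrow> ('a \<Rightarrow> real) \<Rightarrow> 'a \<Rightarrow> real" where
  "dual_sum n f x = (\<Sum>k<n. (op ^^ k) f x)"

lemma dual_sum_integrable: "integrable M f \<Longrightarrow> integrable M (dual_sum n f)"
  unfolding dual_sum_def[abs_def] by (intro Bochner_Integration.integrable_sum iter_integrable)

lemma dual_sum_Suc: "dual_sum (Suc n) f x = f x + dual_sum n (op f) x"
  by (simp add: dual_sum_def sum.lessThan_Suc_shift funpow_swap1 del: sum.lessThan_Suc)

lemma dual_sum_linear:
  assumes f: "integrable M f" and g: "integrable M g"
  shows "AE x in M. \<forall>n. dual_sum n (\<lambda>x. c * f x + d * g x) x = c * dual_sum n f x + d * dual_sum n g x"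
proof -
  have "AE x in M. \<forall>k. (op ^^ k) (\<lambda>x. c * f x + d * g x) x = c * (op ^^ k) f x + d * (op ^^ k) g x"
    using iter_linear[OF f g] by (simp add: AE_all_countable)
  then show ?thesis
    by eventually_elim (simp add: dual_sum_def sum.distrib sum_distrib_left)
qed

lemma transfer_dual_sum:
  assumes f: "integrable M f"
  shows "AE x in M. op (dual_sum n f) x = dual_sum n (op f) x"
proof (rule transfer_AE_eqI)
  show "integrable M (dual_sum n f)" "integrable M (dual_sum n (op f))"
    using f by (auto intro: dual_sum_integrable transfer_spec)
  fix u assume u: "bounded_test u"
  have uT: "bounded_test (\<lambda>x. u (T x))" using bounded_test_comp[OF u, of 1] by simp
  have "(LINT x|M. dual_sum n f x * u (T x)) = (\<Sum>k<n. LINT x|M. (op ^^ k) f x * u (T x))"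
    unfolding dual_sum_def sum_distrib_right
    by (intro Bochner_Integration.integral_sum integrable_mult_test iter_integrable f uT)
  also have "\<dots> = (\<Sum>k<n. LINT x|M. (op ^^ k) (op f) x * u x)"
    using transfer_spec(2)[OF iter_integrable[OF f] u] by (simp add: funpow_swap1)
  also have "\<dots> = (LINT x|M. dual_sum n (op f) x * u x)"
    unfolding dual_sum_def sum_distrib_right
    by (intro Bochner_Integration.integral_sum[symmetric] integrable_mult_test iter_integrable transfer_spec f u)
  finally show "(LINT x|M. dual_sum n f x * u (T x)) = (LINT x|M. dual_sum n (op f) x * u x)" .
qed

primrec dual_max :: "nat \<Rightarrow> ('a \<Rightarrow> real) \<Rightarrow> 'a \<Rightarrow> real" where
  "dual_max 0 f = (\<lambda>x. 0)"
| "dual_max (Suc n) f = (\<lambda>x. max (dual_max n f x) (dual_sum (Suc n) f x))"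

lemma dual_max_integrable: "integrable M f \<Longrightarrow> integrable M (dual_max n f)"
  by (induction n) (auto intro: dual_sum_integrable)

lemma dual_max_nonneg: "0 \<le> dual_max n f x"
  by (induction n) (auto simp: le_max_iff_disj)

lemma dual_sum_le_max: "k \<le> n \<Longrightarrow> dual_sum k f x \<le> dual_max n f x"
  by (induction n) (auto simp: le_Suc_eq le_max_iff_disj dual_sum_def)

lemma dual_max_pos_attained:
  "0 < dual_max n f x \<Longrightarrow> \<exists>k<n. dual_max n f x = dual_sum (Suc k) f x"
  by (induction n) (auto simp: max_def less_Suc_eq split: if_splits)

text \<open>Garsia's argument. Where the maximum m is positive it equals f +
  \<open>dual_sum k (op f)\<close> for some k < n, which is at most f + op m; elsewhere m = 0 \<le>
  op m. Integrating the resulting bound on m - op m gives the claim, because op preserves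
  integrals.\<close>

lemma maximal_inequality:
  assumes f: "integrable M f"
  shows "0 \<le> (LINT x|M. f x * indicator {x\<in>space M. 0 < dual_max n f x} x)"
proof -
  let ?m = "dual_max n f"
  let ?E = "{x\<in>space M. 0 < ?m x}"
  have mi: "integrable M ?m" by (rule dual_max_integrable[OF f])
  have [measurable]: "?m \<in> borel_measurable M" using mi by auto
  have E: "?E \<in> sets M" by measurable
  note u = bounded_test_indicator[OF E]
  have opm: "integrable M (op ?m)" by (rule transfer_spec(1)[OF mi])
  have "AE x in M. \<forall>k\<in>{..<n}. dual_sum k (op f) x \<le> op ?m x"
  proof (rule AE_finite_allI)
    fix k assume "k \<in> {..<n}"
    then have "AE x in M. (op ^^ 1) (dual_sum k f) x \<le> (op ^^ 1) ?m x"
      using f mi by (intro iter_mono dual_sum_integrable) (auto intro: dual_sum_le_max less_imp_le)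
    then show "AE x in M. dual_sum k (op f) x \<le> op ?m x"
      using transfer_dual_sum[OF f, of k] by eventually_elim simp
  qed simp
  moreover have "AE x in M. 0 \<le> (op ^^ 1) ?m x"
    using mi by (intro iter_nonneg) (auto intro: dual_max_nonneg)
  ultimately have "AE x in M. ?m x - op ?m x \<le> f x * indicator ?E x"
    using AE_space
  proof eventually_elim
    case (elim x)
    show ?case
    proof (cases "0 < ?m x")
      case True
      then obtain k where k: "k < n" "?m x = dual_sum (Suc k) f x" using dual_max_pos_attained by blast
      then have "?m x \<le> f x + op ?m x" using elim by (simp add: dual_sum_Suc)
      then show ?thesis using True elim by simp
    next
      case False
      then have "?m x = 0" using dual_max_nonneg[of n f x] by simp
      then show ?thesis using False elim by simp
    qed
  qed
  then have "(LINT x|M. ?m x - op ?m x) \<le> (LINT x|M. f x * indicator ?E x)"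
    by (intro integral_mono_AE integrable_mult_test[OF f u] Bochner_Integration.integrable_diff mi opm)
  moreover have "(LINT x|M. ?m x - op ?m x) = 0"
    using mi opm iter_integral[OF mi, of 1] by simp
  ultimately show ?thesis by simp
qed

text \<open>A weak-type bound relative to a reference function g, because constants need not be
  integrable on an infinite measure space. It is the maximal inequality for |f| - l * g, with the
  number of terms sent to infinity.\<close>

lemma maximal_weak_bound:
  assumes f: "integrable M f" and g: "integrable M g" and g0: "AE x in M. 0 \<le> g x" and "0 < l"
    and E_def: "E = {x\<in>space M. \<exists>n. 0 < dual_sum n (\<lambda>x. \<bar>f x\<bar> - l * g x) x}"
  shows "E \<in> sets M" "l * (LINT x|M. g x * indicator E x) \<le> (LINT x|M. \<bar>f x\<bar>)"
proof -
  let ?h = "\<lambda>x. \<bar>f x\<bar> - l * g x"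
  have h: "integrable M ?h" using f g by simp
  have [measurable]: "dual_sum n ?h \<in> borel_measurable M" for n using dual_sum_integrable[OF h] by auto
  show E: "E \<in> sets M" unfolding E_def by measurable
  define A where "A n = {x\<in>space M. 0 < dual_max n ?h x}" for n
  have [measurable]: "dual_max n ?h \<in> borel_measurable M" for n using dual_max_integrable[OF h] by auto
  have A: "A n \<in> sets M" for n unfolding A_def by measurable
  have inc: "incseq A"
  proof (rule incseq_SucI)
    show "A n \<subseteq> A (Suc n)" for n by (auto simp: A_def less_max_iff_disj)
  qed
  have un: "(\<Union>n. A n) = E"
  proof
    show "(\<Union>n. A n) \<subseteq> E" using dual_max_pos_attained by (force simp: A_def E_def)
    show "E \<subseteq> (\<Union>n. A n)"
      using dual_sum_le_max[OF order_refl] by (force simp: A_def E_def intro: less_le_trans)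
  qed
  have bd: "l * (LINT x|M. g x * indicator (A n) x) \<le> (LINT x|M. \<bar>f x\<bar>)" for n
  proof -
    note u = bounded_test_indicator[OF A[of n]]
    have "0 \<le> (LINT x|M. ?h x * indicator (A n) x)"
      using maximal_inequality[OF h, of n] by (simp only: A_def)
    also have "\<dots> = (LINT x|M. \<bar>f x\<bar> * indicator (A n) x - l * (g x * indicator (A n) x))"
      by (simp add: algebra_simps)
    also have "\<dots> = (LINT x|M. \<bar>f x\<bar> * indicator (A n) x) - l * (LINT x|M. g x * indicator (A n) x)"
      using f g by (subst Bochner_Integration.integral_diff) (auto intro!: integrable_mult_test u)
    also have "(LINT x|M. \<bar>f x\<bar> * indicator (A n) x) \<le> (LINT x|M. \<bar>f x\<bar>)"
      using f by (intro integral_mono integrable_mult_test u) (auto simp: indicator_def)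
    finally show ?thesis by simp
  qed
  have "(\<lambda>n. LINT x|M. g x * indicator (A n) x) \<longlonglongrightarrow> (LINT x|M. g x * indicator E x)"
  proof (rule integral_dominated_convergence[where w = "\<lambda>x. \<bar>g x\<bar>"])
    show "AE x in M. (\<lambda>n. g x * indicator (A n) x) \<longlonglongrightarrow> g x * indicator E x"
      unfolding un[symmetric] by (intro AE_I2 tendsto_mult tendsto_const LIMSEQ_indicator_incseq inc)
  qed (use g A E in \<open>auto simp: indicator_def\<close>)
  then have "(\<lambda>n. l * (LINT x|M. g x * indicator (A n) x)) \<longlonglongrightarrow> l * (LINT x|M. g x * indicator E x)"
    by (intro tendsto_intros)
  then show "l * (LINT x|M. g x * indicator E x) \<le> (LINT x|M. \<bar>f x\<bar>)"
    by (rule LIMSEQ_le_const2) (use bd in blast)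
qed

end

section \<open>Functions whose normalized dual sums converge\<close>

locale dual_ergodic_candidate = measure_preserving_system +
  fixes a :: "nat \<Rightarrow> real"
  assumes a_top: "filterlim a at_top sequentially"
    and a_Suc: "(\<lambda>n. a (Suc n) / a n) \<longlonglongrightarrow> 1"
begin

definition dual_convergent :: "('a \<Rightarrow> real) \<Rightarrow> bool" where
  "dual_convergent f \<longleftrightarrow> integrable M f \<and> (AE x in M. (\<lambda>n. dual_sum n f x / a n) \<longlonglongrightarrow> (LINT y|M. f y))"

lemma dual_convergent_integrable: "dual_convergent f \<Longrightarrow> integrable M f"
  by (simp add: dual_convergent_def)

lemma dual_convergent_linear:
  assumes f: "dual_convergent f" and g: "dual_convergent g"
  shows "dual_convergent (\<lambda>x. c * f x + d * g x)"
proof -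
  have i: "integrable M f" "integrable M g" using f g by (auto simp: dual_convergent_def)
  have "AE x in M. (\<lambda>n. dual_sum n f x / a n) \<longlonglongrightarrow> (LINT y|M. f y)"
    "AE x in M. (\<lambda>n. dual_sum n g x / a n) \<longlonglongrightarrow> (LINT y|M. g y)"
    using f g by (auto simp: dual_convergent_def)
  then have "AE x in M. (\<lambda>n. dual_sum n (\<lambda>x. c * f x + d * g x) x / a n) \<longlonglongrightarrow> (LINT y|M. c * f y + d * g y)"
    using dual_sum_linear[OF i, of c d]
  proof eventually_elim
    case (elim x)
    have "(\<lambda>n. c * (dual_sum n f x / a n) + d * (dual_sum n g x / a n)) \<longlonglongrightarrow> c * (LINT y|M. f y) + d * (LINT y|M. g y)"
      by (intro tendsto_intros elim)
    then show ?case using elim i by (simp add: add_divide_distrib)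
  qed
  then show ?thesis using i by (simp add: dual_convergent_def)
qed

lemma dual_convergent_AE_cong:
  assumes f: "dual_convergent f" and g: "integrable M g" and eq: "AE x in M. f x = g x"
  shows "dual_convergent g"
proof -
  have i: "integrable M f" using f by (simp add: dual_convergent_def)
  have "AE x in M. (op ^^ k) f x = (op ^^ k) g x" for k
  proof (rule iter_AE_eqI[OF i iter_integrable[OF g]])
    fix u assume u: "bounded_test u"
    have "(LINT x|M. f x * u ((T ^^ k) x)) = (LINT x|M. g x * u ((T ^^ k) x))"
      using integrable_mult_test[OF i bounded_test_comp[OF u, of k]]
        integrable_mult_test[OF g bounded_test_comp[OF u, of k]] eq
      by (intro integral_cong_AE) (auto elim: eventually_mono)
    then show "(LINT x|M. f x * u ((T ^^ k) x)) = (LINT x|M. (op ^^ k) g x * u x)"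
      by (simp add: iter_dual[OF g u])
  qed
  then have "AE x in M. \<forall>k. (op ^^ k) f x = (op ^^ k) g x" by (simp add: AE_all_countable)
  moreover have "AE x in M. (\<lambda>n. dual_sum n f x / a n) \<longlonglongrightarrow> (LINT y|M. f y)"
    using f by (simp add: dual_convergent_def)
  moreover have "(LINT y|M. f y) = (LINT y|M. g y)" using i g eq by (intro integral_cong_AE) auto
  ultimately have "AE x in M. (\<lambda>n. dual_sum n g x / a n) \<longlonglongrightarrow> (LINT y|M. g y)"
    by (auto elim!: eventually_elim2 simp: dual_sum_def)
  then show ?thesis using g by (simp add: dual_convergent_def)
qed

lemma a_pos_eventually: "\<forall>\<^sub>F n in sequentially. 0 < a n"
  using a_top by (simp add: filterlim_at_top_dense)

lemma inverse_a: "(\<lambda>n. inverse (a n)) \<longlonglongrightarrow> 0"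
  by (rule tendsto_inverse_0_at_top[OF a_top])

text \<open>The dual sums of f and of op f differ by f and one index shift, and a (Suc n) / a n
  tends to 1. The implication from op f back to f lets convergence pass from short words to longer
  ones.\<close>

lemma dual_convergent_transfer_iff:
  assumes f: "integrable M f"
  shows "dual_convergent (op f) \<longleftrightarrow> dual_convergent f"
proof -
  have ratio: "(\<lambda>n. a n / a (Suc n)) \<longlonglongrightarrow> 1"
    using tendsto_inverse[OF a_Suc] by simp
  have aS: "\<forall>\<^sub>F n in sequentially. 0 < a n \<and> 0 < a (Suc n)"
    using eventually_conj[OF a_pos_eventually, of "\<lambda>n. 0 < a (Suc n)"] a_pos_eventually
    by (simp add: eventually_sequentially_Suc[of "\<lambda>n. 0 < a n"])
  have "((\<lambda>n. dual_sum n (op f) x / a n) \<longlonglongrightarrow> L) \<longleftrightarrow> ((\<lambda>n. dual_sum n f x / a n) \<longlonglongrightarrow> L)" for x L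
  proof
    assume l: "(\<lambda>n. dual_sum n (op f) x / a n) \<longlonglongrightarrow> L"
    have "(\<lambda>n. f x * inverse (a (Suc n)) + (dual_sum n (op f) x / a n) * (a n / a (Suc n))) \<longlonglongrightarrow> f x * 0 + L * 1"
      by (intro tendsto_intros l ratio LIMSEQ_Suc[OF inverse_a])
    moreover have "\<forall>\<^sub>F n in sequentially. f x * inverse (a (Suc n)) + (dual_sum n (op f) x / a n) * (a n / a (Suc n))
        = dual_sum (Suc n) f x / a (Suc n)"
      using aS
    proof eventually_elim
      case (elim n)
      then have "(dual_sum n (op f) x / a n) * (a n / a (Suc n)) = dual_sum n (op f) x / a (Suc n)" by simp
      then show ?case by (simp only: dual_sum_Suc add_divide_distrib divide_inverse[of "f x"])
    qed
    ultimately have "(\<lambda>n. dual_sum (Suc n) f x / a (Suc n)) \<longlonglongrightarrow> f x * 0 + L * 1" by (rule Lim_transform_eventually)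
    then have "(\<lambda>n. dual_sum (Suc n) f x / a (Suc n)) \<longlonglongrightarrow> L" by simp
    then show "(\<lambda>n. dual_sum n f x / a n) \<longlonglongrightarrow> L" by (rule LIMSEQ_imp_Suc)
  next
    assume "(\<lambda>n. dual_sum n f x / a n) \<longlonglongrightarrow> L"
    then have l: "(\<lambda>n. dual_sum (Suc n) f x / a (Suc n)) \<longlonglongrightarrow> L" by (rule LIMSEQ_Suc)
    have "(\<lambda>n. (dual_sum (Suc n) f x / a (Suc n)) * (a (Suc n) / a n) - f x * inverse (a n)) \<longlonglongrightarrow> L * 1 - f x * 0"
      by (intro tendsto_intros l a_Suc inverse_a)
    moreover have "\<forall>\<^sub>F n in sequentially. (dual_sum (Suc n) f x / a (Suc n)) * (a (Suc n) / a n) - f x * inverse (a n)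
        = dual_sum n (op f) x / a n"
      using aS
    proof eventually_elim
      case (elim n)
      then have "(dual_sum (Suc n) f x / a (Suc n)) * (a (Suc n) / a n) = dual_sum (Suc n) f x / a n" by simp
      then show ?case by (simp only: dual_sum_Suc add_divide_distrib divide_inverse[of "f x"])
    qed
    ultimately have "(\<lambda>n. dual_sum n (op f) x / a n) \<longlonglongrightarrow> L * 1 - f x * 0" by (rule Lim_transform_eventually)
    then show "(\<lambda>n. dual_sum n (op f) x / a n) \<longlonglongrightarrow> L" by simp
  qed
  then show ?thesis
    unfolding dual_convergent_def using f transfer_spec(1)[OF f] iter_integral[OF f, of 1] by simp
qed

lemma dual_convergent_iter: "dual_convergent f \<Longrightarrow> dual_convergent ((op ^^ j) f)"
  by (induction j) (auto simp: dual_convergent_transfer_iff dual_convergent_integrable)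

text \<open>On the set where \<open>op\<^sup>j e > 0\<close>, the maximal inequality dominates the ergodic averages of an error
  by those of \<open>op\<^sup>j e\<close>, whose limit is known.\<close>

lemma dual_convergent_closed:
  assumes e: "dual_convergent e" "AE x in M. 0 \<le> e x" "AE x in M. \<exists>j. 0 < (op ^^ j) e x"
    and f: "integrable M f"
    and approx: "\<And>r. r > 0 \<Longrightarrow> \<exists>g. dual_convergent g \<and> (LINT x|M. \<bar>f x - g x\<bar>) < r"
  shows "dual_convergent f"
proof -
  have ei: "integrable M e" using e by (simp add: dual_convergent_def)
  define I where "I = (LINT x|M. e x)"
  have I0: "0 \<le> I" unfolding I_def using e(2) by (rule integral_nonneg_AE)
  have main: "AE x in M. 0 < (op ^^ j) e x \<longrightarrow>
      (\<forall>\<^sub>F n in sequentially. \<bar>dual_sum n f x / a n - (LINT y|M. f y)\<bar> < 4 * \<epsilon>)" if eps: "\<epsilon> > 0" for j \<epsilon>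
  proof -
    define g where "g = (op ^^ j) e"
    have gc: "dual_convergent g" unfolding g_def by (rule dual_convergent_iter[OF e(1)])
    have gi: "integrable M g" using gc by (rule dual_convergent_integrable)
    have g0: "AE x in M. 0 \<le> g x" unfolding g_def by (rule iter_nonneg[OF ei e(2)])
    have gI: "(LINT x|M. g x) = I" unfolding g_def I_def by (rule iter_integral[OF ei])
    \<comment> \<open>Makes l * I < \<epsilon>, even when I = 0.\<close>
    define l where "l = \<epsilon> / (I + 1)"
    have l: "0 < l" "l * I < \<epsilon>" using eps I0 by (auto simp: l_def field_simps)
    have "\<forall>m. \<exists>h. dual_convergent h \<and> (LINT x|M. \<bar>f x - h x\<bar>) < min \<epsilon> (1 / real (Suc m))"
      using eps by (intro allI approx) auto
    then obtain h where h: "\<And>m. dual_convergent (h m)" "\<And>m. (LINT x|M. \<bar>f x - h m x\<bar>) < min \<epsilon> (1 / real (Suc m))"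
      by metis
    have hi: "integrable M (h m)" for m using h(1) by (rule dual_convergent_integrable)
    have di: "integrable M (\<lambda>x. f x - h m x)" for m using f hi by simp
    define E where "E m = {x\<in>space M. \<exists>n. 0 < dual_sum n (\<lambda>x. \<bar>f x - h m x\<bar> - l * g x) x}" for m
    have E: "E m \<in> sets M" "l * (LINT x|M. g x * indicator (E m) x) \<le> (LINT x|M. \<bar>f x - h m x\<bar>)" for m
      using maximal_weak_bound[OF di gi g0 l(1), of "E m" m] by (auto simp: E_def)
    \<comment> \<open>The integral of g over E m is at most 1 / (l * (m + 1)), so g vanishes a.e. on
      the intersection F. Almost every point with g > 0 therefore escapes some E m, and for that m
      the dual sums of |f - h m| are bounded by l times those of g at all times.\<close>
    define F where "F = (\<Inter>m. E m)"
    have F: "F \<in> sets M" unfolding F_def using E(1) by auto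
    have "l * (LINT x|M. g x * indicator F x) \<le> 1 / real (Suc m)" for m
    proof -
      have "(LINT x|M. g x * indicator F x) \<le> (LINT x|M. g x * indicator (E m) x)"
        using g0 by (intro integral_mono_AE integrable_mult_test gi bounded_test_indicator F E)
          (auto elim!: eventually_mono simp: F_def indicator_def)
      then have "l * (LINT x|M. g x * indicator F x) \<le> l * (LINT x|M. g x * indicator (E m) x)"
        using l by simp
      also have "\<dots> \<le> 1 / real (Suc m)" using E(2)[of m] h(2)[of m] by simp
      finally show ?thesis .
    qed
    then have "l * (LINT x|M. g x * indicator F x) \<le> 0"
      by (intro LIMSEQ_le_const[OF LIMSEQ_Suc[OF lim_1_over_n]]) auto
    then have "(LINT x|M. g x * indicator F x) \<le> 0" using l by (simp add: mult_le_0_iff)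
    moreover have gF0: "AE x in M. 0 \<le> g x * indicator F x" using g0 by eventually_elim simp
    ultimately have "(LINT x|M. g x * indicator F x) = 0" by (intro antisym integral_nonneg_AE)
    then have gF: "AE x in M. g x * indicator F x = 0"
      using integrable_mult_test[OF gi bounded_test_indicator[OF F]] gF0
      by (subst (asm) integral_nonneg_eq_0_iff_AE) auto
    have lin1: "AE x in M. \<forall>m n. dual_sum n (\<lambda>x. \<bar>f x - h m x\<bar> - l * g x) x
        = dual_sum n (\<lambda>x. \<bar>f x - h m x\<bar>) x - l * dual_sum n g x"
    proof -
      have "AE x in M. \<forall>n. dual_sum n (\<lambda>x. \<bar>f x - h m x\<bar> - l * g x) x
        = dual_sum n (\<lambda>x. \<bar>f x - h m x\<bar>) x - l * dual_sum n g x" for m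
        using dual_sum_linear[OF _ gi, of "\<lambda>x. \<bar>f x - h m x\<bar>" 1 "- l"] di by simp
      then show ?thesis by (simp add: AE_all_countable)
    qed
    have lin2: "AE x in M. \<forall>m n. \<bar>dual_sum n f x - dual_sum n (h m) x\<bar> \<le> dual_sum n (\<lambda>x. \<bar>f x - h m x\<bar>) x"
    proof -
      have "AE x in M. \<forall>n. \<bar>dual_sum n f x - dual_sum n (h m) x\<bar> \<le> dual_sum n (\<lambda>x. \<bar>f x - h m x\<bar>) x" for m
      proof -
        have "AE x in M. \<forall>k. \<bar>(op ^^ k) (\<lambda>x. f x - h m x) x\<bar> \<le> (op ^^ k) (\<lambda>x. \<bar>f x - h m x\<bar>) x"
          using iter_abs[OF di] by (simp add: AE_all_countable)
        moreover have "AE x in M. \<forall>k. (op ^^ k) (\<lambda>x. f x - h m x) x = (op ^^ k) f x - (op ^^ k) (h m) x"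
          using iter_linear[OF f hi, of _ 1 "-1" m] by (simp add: AE_all_countable)
        ultimately show ?thesis
        proof eventually_elim
          case (elim x)
          have "\<bar>dual_sum n f x - dual_sum n (h m) x\<bar> \<le> dual_sum n (\<lambda>x. \<bar>f x - h m x\<bar>) x" for n
          proof -
            have "\<bar>dual_sum n f x - dual_sum n (h m) x\<bar> = \<bar>\<Sum>k<n. (op ^^ k) f x - (op ^^ k) (h m) x\<bar>"
              by (simp add: dual_sum_def sum_subtractf)
            also have "\<dots> \<le> (\<Sum>k<n. \<bar>(op ^^ k) f x - (op ^^ k) (h m) x\<bar>)" by (rule sum_abs)
            also have "\<dots> \<le> dual_sum n (\<lambda>x. \<bar>f x - h m x\<bar>) x"
              unfolding dual_sum_def using elim by (intro sum_mono) metis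
            finally show ?thesis .
          qed
          then show ?case by blast
        qed
      qed
      then show ?thesis by (simp add: AE_all_countable)
    qed
    have conv_h: "AE x in M. \<forall>m. (\<lambda>n. dual_sum n (h m) x / a n) \<longlonglongrightarrow> (LINT y|M. h m y)"
      using h(1) by (simp add: AE_all_countable dual_convergent_def)
    have conv_g: "AE x in M. (\<lambda>n. dual_sum n g x / a n) \<longlonglongrightarrow> I"
      using gc gI by (simp add: dual_convergent_def)
    show ?thesis using gF lin1 lin2 conv_h conv_g AE_space
    proof eventually_elim
      case (elim x)
      show ?case
      proof
        assume "0 < (op ^^ j) e x"
        then have "x \<notin> F" using elim by (auto simp: g_def indicator_def)
        then obtain m where m: "x \<notin> E m" unfolding F_def by blast
        have dom: "\<bar>dual_sum n f x - dual_sum n (h m) x\<bar> \<le> l * dual_sum n g x" for n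
        proof -
          have "dual_sum n (\<lambda>x. \<bar>f x - h m x\<bar> - l * g x) x \<le> 0" using m elim by (auto simp: E_def not_less)
          then have "dual_sum n (\<lambda>x. \<bar>f x - h m x\<bar>) x \<le> l * dual_sum n g x" using elim by simp
          then show ?thesis using elim order_trans by blast
        qed
        have hf: "\<bar>(LINT y|M. h m y) - (LINT y|M. f y)\<bar> < \<epsilon>"
        proof -
          have "\<bar>(LINT y|M. f y) - (LINT y|M. h m y)\<bar> = \<bar>LINT y|M. f y - h m y\<bar>"
            using f hi by simp
          also have "\<dots> \<le> (LINT y|M. \<bar>f y - h m y\<bar>)" using integral_norm_bound[of M "\<lambda>y. f y - h m y"] by simp
          also have "\<dots> < \<epsilon>" using h(2)[of m] by simp
          finally show ?thesis by (simp add: abs_minus_commute)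
        qed
        have hm: "(\<lambda>n. dual_sum n (h m) x / a n) \<longlonglongrightarrow> (LINT y|M. h m y)" using elim by blast
        have "\<forall>\<^sub>F n in sequentially. \<bar>dual_sum n (h m) x / a n - (LINT y|M. h m y)\<bar> < \<epsilon>"
          using tendstoD[OF hm eps] by (simp add: dist_real_def)
        moreover have "(\<lambda>n. l * (dual_sum n g x / a n)) \<longlonglongrightarrow> l * I" by (intro tendsto_intros) (use elim in blast)
        then have "\<forall>\<^sub>F n in sequentially. l * (dual_sum n g x / a n) < \<epsilon>"
          by (rule order_tendstoD(2)) (rule l)
        ultimately show "\<forall>\<^sub>F n in sequentially. \<bar>dual_sum n f x / a n - (LINT y|M. f y)\<bar> < 4 * \<epsilon>"
          using a_pos_eventually
        proof eventually_elim
          case (elim n)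
          have "\<bar>dual_sum n f x / a n - dual_sum n (h m) x / a n\<bar> = \<bar>dual_sum n f x - dual_sum n (h m) x\<bar> / a n"
            using elim by (simp add: diff_divide_distrib[symmetric])
          also have "\<dots> \<le> (l * dual_sum n g x) / a n" using elim dom by (intro divide_right_mono) auto
          finally show ?case using elim hf by simp
        qed
      qed
    qed
  qed
  have "AE x in M. \<forall>j i. 0 < (op ^^ j) e x \<longrightarrow>
      (\<forall>\<^sub>F n in sequentially. \<bar>dual_sum n f x / a n - (LINT y|M. f y)\<bar> < 4 * (1 / real (Suc i)))"
    unfolding AE_all_countable by (intro allI main) simp
  then have "AE x in M. (\<lambda>n. dual_sum n f x / a n) \<longlonglongrightarrow> (LINT y|M. f y)"
    using e(3)
  proof eventually_elim
    case (elim x)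
    then obtain j where j: "0 < (op ^^ j) e x" by blast
    show ?case
    proof (rule tendstoI)
      fix r :: real assume "0 < r"
      then obtain i where i: "1 / real (Suc i) < r / 4" using nat_approx_posE[of "r / 4"] by auto
      have "\<forall>\<^sub>F n in sequentially. \<bar>dual_sum n f x / a n - (LINT y|M. f y)\<bar> < 4 * (1 / real (Suc i))"
        using elim j by blast
      then show "\<forall>\<^sub>F n in sequentially. dist (dual_sum n f x / a n) (LINT y|M. f y) < r"
        by eventually_elim (use i in \<open>simp add: dist_real_def\<close>)
    qed
  qed
  then show ?thesis using f by (simp add: dual_convergent_def)
qed

text \<open>The sum of the measures is the integral over C of the dual sums of the indicator of B.
  These tend to infinity a.e., being about a n times the measure of B, so by Fatou's lemma the
  integrals are unbounded.\<close>

lemma visits_unbounded: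
  assumes B: "dual_convergent (indicator B)" "B \<in> sets M" "0 < measure M B"
    and C: "C \<in> sets M" "emeasure M C < \<infinity>" "0 < emeasure M C"
  shows "\<exists>n. K < (\<Sum>k<n. measure M (B \<inter> ((T ^^ k) -` C \<inter> space M)))"
proof (rule ccontr)
  assume neg: "\<not> ?thesis"
  let ?S = "\<lambda>n. dual_sum n (indicator B)"
  have Bi: "integrable M (indicator B :: 'a \<Rightarrow> real)" using B(1) by (rule dual_convergent_integrable)
  have [measurable]: "?S n \<in> borel_measurable M" for n using dual_sum_integrable[OF Bi] by auto
  have bd: "(\<integral>\<^sup>+x. ennreal (?S n x) * indicator C x \<partial>M) \<le> ennreal K" for n
  proof -
    have S0: "AE x in M. 0 \<le> ?S n x"
    proof -
      have "AE x in M. \<forall>k. 0 \<le> (op ^^ k) (indicator B) x"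
        using iter_nonneg[OF Bi] by (simp add: AE_all_countable)
      then show ?thesis by eventually_elim (simp add: dual_sum_def sum_nonneg)
    qed
    have "(\<integral>\<^sup>+x. ennreal (?S n x) * indicator C x \<partial>M) = (\<integral>\<^sup>+x. ennreal (?S n x * indicator C x) \<partial>M)"
      by (intro nn_integral_cong) (auto simp: indicator_def)
    also have "\<dots> = ennreal (LINT x|M. ?S n x * indicator C x)"
      using S0 by (intro nn_integral_eq_integral integrable_mult_test dual_sum_integrable Bi bounded_test_indicator C)
        (auto elim!: eventually_mono)
    also have "(LINT x|M. ?S n x * indicator C x) = (\<Sum>k<n. LINT x|M. (op ^^ k) (indicator B) x * indicator C x)"
      unfolding dual_sum_def sum_distrib_right
      by (intro Bochner_Integration.integral_sum integrable_mult_test iter_integrable Bi bounded_test_indicator C)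
    also have "\<dots> = (\<Sum>k<n. measure M (B \<inter> ((T ^^ k) -` C \<inter> space M)))"
    proof (rule sum.cong[OF refl])
      fix k
      have "(LINT x|M. (op ^^ k) (indicator B) x * indicator C x) = (LINT x|M. indicator B x * indicator C ((T ^^ k) x))"
        by (rule iter_dual[OF Bi bounded_test_indicator[OF C(1)]])
      also have "\<dots> = (LINT x|M. indicator (B \<inter> ((T ^^ k) -` C \<inter> space M)) x)"
        by (intro Bochner_Integration.integral_cong) (auto simp: indicator_def)
      also have "\<dots> = measure M (B \<inter> ((T ^^ k) -` C \<inter> space M))"
        by (simp add: inf_assoc)
      finally show "(LINT x|M. (op ^^ k) (indicator B) x * indicator C x) = measure M (B \<inter> ((T ^^ k) -` C \<inter> space M))" .
    qed
    also have "ennreal \<dots> \<le> ennreal K" using neg by (intro ennreal_leI) (auto simp: not_less)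
    finally show ?thesis .
  qed
  have "AE x in M. (\<lambda>n. ?S n x / a n) \<longlonglongrightarrow> measure M B"
    using B sets.sets_into_space[OF B(2)] by (simp add: dual_convergent_def Int_absorb2)
  then have inf: "AE x in M. liminf (\<lambda>n. ennreal (?S n x) * indicator C x) = \<infinity> * indicator C x"
  proof eventually_elim
    case (elim x)
    have top: "filterlim (\<lambda>n. (?S n x / a n) * a n) at_top sequentially"
      by (rule filterlim_tendsto_pos_mult_at_top[OF elim B(3) a_top])
    have "\<forall>\<^sub>F n in sequentially. (?S n x / a n) * a n = ?S n x"
      using a_pos_eventually by eventually_elim simp
    from filterlim_cong[OF refl refl this, THEN iffD1, OF top]
    have "(\<lambda>n. ennreal (?S n x)) \<longlonglongrightarrow> \<infinity>" by (simp add: ennreal_tendsto_top_eq_at_top)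
    then have "liminf (\<lambda>n. ennreal (?S n x)) = \<infinity>" by (intro lim_imp_Liminf) auto
    then show ?case by (cases "x \<in> C") (auto simp: Liminf_const)
  qed
  have "(\<integral>\<^sup>+x. \<infinity> * indicator C x \<partial>M) = (\<integral>\<^sup>+x. liminf (\<lambda>n. ennreal (?S n x) * indicator C x) \<partial>M)"
    by (rule nn_integral_cong_AE) (use inf in \<open>auto elim!: eventually_mono\<close>)
  also have "\<dots> \<le> liminf (\<lambda>n. \<integral>\<^sup>+x. ennreal (?S n x) * indicator C x \<partial>M)"
    using C by (intro nn_integral_liminf) auto
  also have "\<dots> \<le> ennreal K" using bd by (intro Liminf_le) auto
  finally have "\<infinity> * emeasure M C \<le> ennreal K"
    by (subst (asm) nn_integral_cmult_indicator[OF C(1)])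
  then show False using C by (auto simp: ennreal_top_mult top_unique split: if_splits)
qed

lemma finite_positive_subset:
  assumes A: "A \<in> sets M" "emeasure M A \<noteq> 0"
  obtains B where "B \<in> sets M" "B \<subseteq> A" "emeasure M B < \<infinity>" "0 < emeasure M B"
proof -
  obtain F :: "nat \<Rightarrow> 'a set" where F: "range F \<subseteq> sets M" "(\<Union>i. F i) = space M" "\<And>i. emeasure M (F i) \<noteq> \<infinity>"
    using sigma_finite by metis
  have "\<exists>i. emeasure M (A \<inter> F i) \<noteq> 0"
  proof (rule ccontr)
    assume "\<not> ?thesis"
    then have "(\<Union>i. A \<inter> F i) \<in> null_sets M" using A F by (intro null_sets_UN) (auto simp: null_sets_def)
    moreover have "(\<Union>i. A \<inter> F i) = A" using F(2) sets.sets_into_space[OF A(1)] by auto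
    ultimately show False using A by auto
  qed
  then obtain i where i: "emeasure M (A \<inter> F i) \<noteq> 0" by blast
  have "emeasure M (A \<inter> F i) \<le> emeasure M (F i)" using A F by (intro emeasure_mono) auto
  then show thesis using i F A
    by (intro that[of "A \<inter> F i"]) (auto simp: less_top[symmetric] top_unique zero_less_iff_neq_zero)
qed

text \<open>Conservativity and ergodicity come for free: a wandering set of positive measure, or an
  invariant set that is neither null nor of null complement, would yield sets of finite positive
  measure with bounded visit sums, against \<open>visits_unbounded\<close>.\<close>

theorem pointwise_dual_ergodicI:
  assumes conv: "\<And>f. integrable M f \<Longrightarrow> dual_convergent f"
  shows "pointwise_dual_ergodic M T a"
  unfolding pointwise_dual_ergodic_def
proof (intro conjI allI impI)
  have ind: "dual_convergent (indicator B)" "0 < measure M B"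
    if "B \<in> sets M" "emeasure M B < \<infinity>" "0 < emeasure M B" for B
    using that by (auto intro!: conv simp: measure_def enn2real_positive_iff integrable_indicator_iff Int_absorb2 sets.sets_into_space)
  show "sigma_finite_measure M" by unfold_locales
  show "measure_preserving_map M T" by (rule mpt)
  show "conservative M T"
    unfolding conservative_def
  proof (intro ballI impI, rule ccontr)
    fix A assume A: "A \<in> sets M" and dj: "disjoint_family (\<lambda>n. (T ^^ n) -` A \<inter> space M)" and "emeasure M A \<noteq> 0"
    then obtain B where B: "B \<in> sets M" "B \<subseteq> A" "emeasure M B < \<infinity>" "0 < emeasure M B"
      using finite_positive_subset by metis
    have "(\<Sum>k<n. measure M (B \<inter> ((T ^^ k) -` B \<inter> space M))) \<le> measure M B" for n
    proof (cases n)
      case (Suc n')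
      have "measure M (B \<inter> ((T ^^ Suc k) -` B \<inter> space M)) = 0" for k
      proof -
        have "((T ^^ 0) -` A \<inter> space M) \<inter> ((T ^^ Suc k) -` A \<inter> space M) = {}"
          using dj unfolding disjoint_family_on_def by blast
        then have "B \<inter> ((T ^^ Suc k) -` B \<inter> space M) = {}" using B(2) sets.sets_into_space[OF B(1)] by auto
        then show ?thesis by (simp only: measure_empty)
      qed
      moreover have "B \<inter> ((T ^^ 0) -` B \<inter> space M) = B" using sets.sets_into_space[OF B(1)] by auto
      ultimately show ?thesis unfolding Suc sum.lessThan_Suc_shift by (simp only:) simp
    qed simp
    then show False using visits_unbounded[OF ind(1) B(1) ind(2) B(1,3,4), of "measure M B"] B
      by (auto simp: not_less[symmetric])
  qed
  show "ergodic M T"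
    unfolding ergodic_def
  proof (intro ballI impI, rule ccontr)
    fix A assume A: "A \<in> sets M" "T -` A \<inter> space M = A" and "\<not> (emeasure M A = 0 \<or> emeasure M (space M - A) = 0)"
    then have ne: "emeasure M A \<noteq> 0" "emeasure M (space M - A) \<noteq> 0" by auto
    obtain B where B: "B \<in> sets M" "B \<subseteq> A" "emeasure M B < \<infinity>" "0 < emeasure M B"
      using finite_positive_subset[OF A(1) ne(1)] by metis
    obtain C where C: "C \<in> sets M" "C \<subseteq> space M - A" "emeasure M C < \<infinity>" "0 < emeasure M C"
      using finite_positive_subset[OF _ ne(2)] A(1) by (metis sets.compl_sets)
    have inv: "(T ^^ k) x \<in> A" if "x \<in> A" for k x
      using that
    proof (induction k)
      case (Suc k)
      then have "(T ^^ k) x \<in> T -` A \<inter> space M" using A(2) by simp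
      then show ?case by simp
    qed simp
    have "B \<inter> ((T ^^ k) -` C \<inter> space M) = {}" for k using inv B(2) C(2) by auto
    then have "(\<Sum>k<n. measure M (B \<inter> ((T ^^ k) -` C \<inter> space M))) = 0" for n by simp
    then show False using visits_unbounded[OF ind(1) B(1) ind(2) C(1,3,4), of 0] B by auto
  qed
  fix f :: "'a \<Rightarrow> real" assume "integrable M f"
  from conv[OF this] show "AE x in M. (\<lambda>n. (\<Sum>k<n. (op ^^ k) f x) / a n) \<longlonglongrightarrow> (LINT y|M. f y)"
    by (simp add: dual_convergent_def dual_sum_def)
qed

end

section \<open>Markov measures on shift spaces\<close>

lemma infsum_ennreal_eq_suminf: "(\<Sum>\<^sub>\<infinity>n. f n) = (\<Sum>n. f n)" for f :: "nat \<Rightarrow> ennreal"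
proof -
  have "f summable_on UNIV" by (rule nonneg_summable_on_complete) simp
  then show ?thesis by (intro sums_unique has_sum_imp_sums has_sum_infsum)
qed

lemma infsum_ennreal_eq_nn_integral:
  fixes f :: "'b \<Rightarrow> ennreal"
  assumes "countable A"
  shows "infsum f A = (\<integral>\<^sup>+x. f x \<partial>count_space A)"
proof (cases "finite A")
  case True
  then show ?thesis by (simp add: nn_integral_count_space_finite)
next
  case False
  have b: "bij_betw (from_nat_into A) UNIV A" by (rule bij_betw_from_nat_into[OF assms False])
  have "infsum f A = (\<Sum>\<^sub>\<infinity>n. f (from_nat_into A n))" by (rule infsum_reindex_bij_betw[OF b, symmetric])
  also have "\<dots> = (\<integral>\<^sup>+n. f (from_nat_into A n) \<partial>count_space UNIV)"
    by (simp add: infsum_ennreal_eq_suminf nn_integral_count_space_nat)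
  also have "\<dots> = (\<integral>\<^sup>+x. f x \<partial>count_space A)" by (rule nn_integral_bij_count_space[OF b])
  finally show ?thesis .
qed

lemma cylinder_map: "cylinder \<Omega> (map x [0..<n]) = {y\<in>\<Omega>. \<forall>i<n. y i = x i}"
  by (auto simp: cylinder_def)

text \<open>Balls and cylinders refine each other: the ball of radius \<eta>^n lies in the cylinder
  of length n, and this cylinder lies in every ball about the same point of radius r > \<eta>^n.
  From here on the metric enters only through this description.\<close>

lemma openin_shift_topology_iff:
  assumes "0 < \<eta>" "\<eta> < 1"
  shows "openin (shift_topology \<eta> \<Omega>) U \<longleftrightarrow> U \<subseteq> \<Omega> \<and> (\<forall>x\<in>U. \<exists>n. cylinder \<Omega> (map x [0..<n]) \<subseteq> U)"
proof -
  interpret Metric_space \<Omega> "seq_dist \<eta>" using assms by (rule Metric_space_seq_dist)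
  have ball_sub: "mball x (\<eta> ^ n) \<subseteq> cylinder \<Omega> (map x [0..<n])" for x n
  proof
    fix y assume y: "y \<in> mball x (\<eta> ^ n)"
    have "x i = y i" if "i < n" for i
    proof (rule ccontr)
      assume ne: "x i \<noteq> y i"
      have "(LEAST n. x n \<noteq> y n) \<le> n"
        using Least_le[of "\<lambda>n. x n \<noteq> y n" i, OF ne] that by linarith
      then have "\<eta> ^ n \<le> \<eta> ^ (LEAST n. x n \<noteq> y n)" using assms by (intro power_decreasing) auto
      moreover have "x \<noteq> y" using ne by blast
      ultimately show False using y by (simp add: seq_dist_def)
    qed
    then show "y \<in> cylinder \<Omega> (map x [0..<n])" using y by (simp add: cylinder_map)
  qed
  have sub_ball: "cylinder \<Omega> (map x [0..<n]) \<subseteq> mball x r" if "x \<in> \<Omega>" "\<eta> ^ n < r" for x n r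
  proof
    fix y assume "y \<in> cylinder \<Omega> (map x [0..<n])"
    then have y: "y \<in> \<Omega>" "\<And>i. i < n \<Longrightarrow> y i = x i" by (auto simp: cylinder_map)
    have "0 < \<eta> ^ n" using assms by simp
    then have r: "0 < r" using that by linarith
    have "seq_dist \<eta> x y < r"
    proof (cases "x = y")
      case False
      then have "\<exists>i. x i \<noteq> y i" by (simp add: fun_eq_iff)
      then have "x (LEAST n. x n \<noteq> y n) \<noteq> y (LEAST n. x n \<noteq> y n)" by (rule LeastI_ex)
      then have "n \<le> (LEAST n. x n \<noteq> y n)" using y(2)[of "LEAST n. x n \<noteq> y n"] by (auto simp: not_le[symmetric])
      then have "\<eta> ^ (LEAST n. x n \<noteq> y n) \<le> \<eta> ^ n" using assms by (intro power_decreasing) auto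
      then show ?thesis using False that by (simp add: seq_dist_def)
    qed (use r in \<open>simp add: seq_dist_def\<close>)
    then show "y \<in> mball x r" using y that by simp
  qed
  show ?thesis
    unfolding openin_mtopology
  proof (intro iffI conjI ballI allI impI; elim conjE)
    fix x assume "U \<subseteq> \<Omega>" and o: "\<forall>x. x \<in> U \<longrightarrow> (\<exists>r>0. mball x r \<subseteq> U)" and x: "x \<in> U"
    then obtain r where r: "r > 0" "mball x r \<subseteq> U" by blast
    obtain n where "\<eta> ^ n < r" using real_arch_pow_inv[OF r(1) assms(2)] by blast
    then have "cylinder \<Omega> (map x [0..<n]) \<subseteq> U" using sub_ball[of x n r] r x \<open>U \<subseteq> \<Omega>\<close> by blast
    then show "\<exists>n. cylinder \<Omega> (map x [0..<n]) \<subseteq> U" by blast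
  next
    fix x assume "\<forall>x\<in>U. \<exists>n. cylinder \<Omega> (map x [0..<n]) \<subseteq> U" "x \<in> U"
    then obtain n where "cylinder \<Omega> (map x [0..<n]) \<subseteq> U" by blast
    then have "mball x (\<eta> ^ n) \<subseteq> U" using ball_sub by blast
    moreover have "0 < \<eta> ^ n" using assms by simp
    ultimately show "\<exists>r>0. mball x r \<subseteq> U" by blast
  qed auto
qed

context
  fixes \<eta> :: real and \<Omega> :: "(nat \<Rightarrow> 'v :: countable) set"
  assumes eta: "0 < \<eta>" "\<eta> < 1"
begin

lemma openin_cylinder: "openin (shift_topology \<eta> \<Omega>) (cylinder \<Omega> w)"
  unfolding openin_shift_topology_iff[OF eta]
proof (intro conjI ballI)
  fix x assume "x \<in> cylinder \<Omega> w"
  then have "cylinder \<Omega> (map x [0..<length w]) \<subseteq> cylinder \<Omega> w"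
    by (auto simp: cylinder_map) (auto simp: cylinder_def)
  then show "\<exists>n. cylinder \<Omega> (map x [0..<n]) \<subseteq> cylinder \<Omega> w" by blast
qed (auto simp: cylinder_def)

lemma open_Pow: "{U. openin (shift_topology \<eta> \<Omega>) U} \<subseteq> Pow \<Omega>"
  by (auto simp: openin_shift_topology_iff[OF eta])

lemma space_shift_borel: "space (shift_borel \<eta> \<Omega>) = \<Omega>"
  unfolding shift_borel_def by (simp add: space_measure_of open_Pow)

lemma sets_shift_borel_open: "sets (shift_borel \<eta> \<Omega>) = sigma_sets \<Omega> {U. openin (shift_topology \<eta> \<Omega>) U}"
  unfolding shift_borel_def by (simp add: sets_measure_of open_Pow)

lemma sets_cylinder: "cylinder \<Omega> w \<in> sets (shift_borel \<eta> \<Omega>)"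
  unfolding sets_shift_borel_open using openin_cylinder by auto

lemma open_countable_union_cylinders:
  assumes "openin (shift_topology \<eta> \<Omega>) U"
  shows "U = (\<Union>w\<in>{w. cylinder \<Omega> w \<subseteq> U}. cylinder \<Omega> w)"
proof
  show "U \<subseteq> (\<Union>w\<in>{w. cylinder \<Omega> w \<subseteq> U}. cylinder \<Omega> w)"
  proof
    fix x assume x: "x \<in> U"
    have U: "U \<subseteq> \<Omega>" "\<forall>x\<in>U. \<exists>n. cylinder \<Omega> (map x [0..<n]) \<subseteq> U"
      using assms unfolding openin_shift_topology_iff[OF eta] by blast+
    then obtain n where n: "cylinder \<Omega> (map x [0..<n]) \<subseteq> U" using x by blast
    have "x \<in> \<Omega>" using U x by blast
    then have "x \<in> cylinder \<Omega> (map x [0..<n])" by (simp add: cylinder_map)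
    then show "x \<in> (\<Union>w\<in>{w. cylinder \<Omega> w \<subseteq> U}. cylinder \<Omega> w)" using n by blast
  qed
qed auto

text \<open>An open set is the union of the cylinders it contains, a countable union because there
  are only countably many words over a countable alphabet.\<close>

lemma sets_shift_borel_cylinders: "sets (shift_borel \<eta> \<Omega>) = sigma_sets \<Omega> (range (cylinder \<Omega>))"
  unfolding sets_shift_borel_open
proof (rule sigma_sets_eqI)
  fix U assume "U \<in> {U. openin (shift_topology \<eta> \<Omega>) U}"
  then have U: "U = (\<Union>w\<in>{w. cylinder \<Omega> w \<subseteq> U}. cylinder \<Omega> w)" using open_countable_union_cylinders by auto
  show "U \<in> sigma_sets \<Omega> (range (cylinder \<Omega>))"
    by (subst U) (intro sigma_sets_UNION, auto)
next
  fix U assume "U \<in> range (cylinder \<Omega>)"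
  then show "U \<in> sigma_sets \<Omega> {U. openin (shift_topology \<eta> \<Omega>) U}" using openin_cylinder by auto
qed

lemma measurable_coordinate: "(\<lambda>y. y i) \<in> shift_borel \<eta> \<Omega> \<rightarrow>\<^sub>M count_space UNIV"
proof (rule measurable_count_space_eq2_countable[THEN iffD2])
  show "(\<lambda>y. y i) \<in> space (shift_borel \<eta> \<Omega>) \<rightarrow> UNIV \<and>
      (\<forall>v\<in>UNIV. (\<lambda>y. y i) -` {v} \<inter> space (shift_borel \<eta> \<Omega>) \<in> sets (shift_borel \<eta> \<Omega>))"
  proof (intro conjI ballI)
    fix v
    have "openin (shift_topology \<eta> \<Omega>) ((\<lambda>y. y i) -` {v} \<inter> \<Omega>)"
      unfolding openin_shift_topology_iff[OF eta]
    proof (intro conjI ballI)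
      fix x assume "x \<in> (\<lambda>y. y i) -` {v} \<inter> \<Omega>"
      then have "cylinder \<Omega> (map x [0..<Suc i]) \<subseteq> (\<lambda>y. y i) -` {v} \<inter> \<Omega>" by (auto simp: cylinder_map simp del: upt_Suc)
      then show "\<exists>n. cylinder \<Omega> (map x [0..<n]) \<subseteq> (\<lambda>y. y i) -` {v} \<inter> \<Omega>" by blast
    qed auto
    then show "(\<lambda>y. y i) -` {v} \<inter> space (shift_borel \<eta> \<Omega>) \<in> sets (shift_borel \<eta> \<Omega>)"
      by (simp add: space_shift_borel sets_shift_borel_open)
  qed auto
qed

lemma measurable_into_shift_borel:
  assumes X: "\<And>z. z \<in> space N \<Longrightarrow> X z \<in> \<Omega>" and coord: "\<And>i. (\<lambda>z. X z i) \<in> N \<rightarrow>\<^sub>M count_space UNIV"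
  shows "X \<in> N \<rightarrow>\<^sub>M shift_borel \<eta> \<Omega>"
proof (rule measurable_sigma_sets[OF sets_shift_borel_cylinders])
  show "range (cylinder \<Omega>) \<subseteq> Pow \<Omega>" by (auto simp: cylinder_def)
  show "X \<in> space N \<rightarrow> \<Omega>" using X by auto
  fix U assume "U \<in> range (cylinder \<Omega>)"
  then obtain w where w: "U = cylinder \<Omega> w" by auto
  have "X -` U \<inter> space N = {z\<in>space N. \<forall>i<length w. X z i = w ! i}" using X by (auto simp: w cylinder_def)
  also have "\<dots> \<in> sets N"
  proof -
    have [measurable]: "(\<lambda>z. X z i) \<in> N \<rightarrow>\<^sub>M count_space UNIV" for i by (rule coord)
    show ?thesis by measurable
  qed
  finally show "X -` U \<inter> space N \<in> sets N" .
qed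

end

section \<open>Stationary Markov measures given by a flow with equal row and column sums\<close>

locale markov_flow =
  fixes Q :: "nat \<Rightarrow> nat \<Rightarrow> real" and \<pi> :: "nat \<Rightarrow> real" and \<eta> :: real
  assumes Q_nonneg: "\<And>v w. 0 \<le> Q v w" and \<pi>_pos: "\<And>v. 0 < \<pi> v"
    and row: "\<And>v. (\<Sum>w. ennreal (Q v w)) = ennreal (\<pi> v)"
    and col: "\<And>w. (\<Sum>v. ennreal (Q v w)) = ennreal (\<pi> w)"
    and eta: "0 < \<eta>" "\<eta> < 1"
begin

definition "adm v w \<longleftrightarrow> 0 < Q v w"
definition "Om = shift_space UNIV adm"
abbreviation "BB \<equiv> shift_borel \<eta> Om"
definition "\<phi> y = ln (Q (y 0) (y 1) / \<pi> (y 1))" for y :: "nat \<Rightarrow> nat"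
definition "step_pmf v = embed_pmf (\<lambda>w. Q v w / \<pi> v)"

lemma Om_iff: "x \<in> Om \<longleftrightarrow> (\<forall>n. adm (x n) (x (Suc n)))"
  by (auto simp: Om_def shift_space_def)

lemma cons_in_Om: "case_nat v x \<in> Om \<longleftrightarrow> x \<in> Om \<and> adm v (x 0)"
  by (auto simp: Om_iff split: nat.split dest: spec[of _ 0] spec[of _ "Suc _"])

lemma shift_in_Om: "x \<in> Om \<Longrightarrow> left_shift x \<in> Om"
  by (auto simp: Om_iff left_shift_def)

lemma adm_imp: "adm v w \<Longrightarrow> 0 < Q v w" "\<not> adm v w \<Longrightarrow> Q v w = 0"
  using Q_nonneg[of v w] by (auto simp: adm_def)

lemma pmf_step_pmf: "pmf (step_pmf v) w = Q v w / \<pi> v"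
  unfolding step_pmf_def
proof (rule pmf_embed_pmf)
  show "0 \<le> Q v w / \<pi> v" for w using Q_nonneg \<pi>_pos[of v] by (simp add: less_imp_le)
  have "(\<integral>\<^sup>+w. ennreal (Q v w / \<pi> v) \<partial>count_space UNIV) = (\<integral>\<^sup>+w. ennreal (Q v w) * ennreal (1 / \<pi> v) \<partial>count_space UNIV)"
    using Q_nonneg \<pi>_pos[of v] by (simp add: ennreal_mult[symmetric])
  also have "\<dots> = ennreal (\<pi> v) * ennreal (1 / \<pi> v)"
    by (simp add: nn_integral_multc nn_integral_count_space_nat row)
  also have "\<dots> = 1" using \<pi>_pos[of v] by (simp add: ennreal_mult[symmetric])
  finally show "(\<integral>\<^sup>+w. ennreal (Q v w / \<pi> v) \<partial>count_space UNIV) = 1" .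
qed

lemma adm_exists: "\<exists>w. adm v w"
proof -
  obtain w where "w \<in> set_pmf (step_pmf v)" using set_pmf_not_empty[of "step_pmf v"] by blast
  then have "Q v w \<noteq> 0" by (auto simp: set_pmf_iff pmf_step_pmf)
  then show ?thesis using adm_imp(2) by blast
qed

definition "dflt v = (SOME w. adm v w)"
text \<open>A sampled successor may be inadmissible on a null event. Replacing it by a fixed
  admissible state puts every trajectory, not just almost every one, into the shift space.\<close>

definition "next_state v s = (if adm v (s v) then s v else dflt v)" for s :: "nat \<Rightarrow> nat"

lemma adm_next_state: "adm v (next_state v s)"
  using someI_ex[OF adm_exists] by (auto simp: next_state_def dflt_def)

text \<open>One step is driven by a random map that assigns a successor to every state at once. An
  i.i.d. sequence of such maps drives the chain from any starting state, so existence reduces to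
  product measures.\<close>

definition "stepM = PiM UNIV (\<lambda>v. measure_pmf (step_pmf v))"

primrec traj :: "nat \<Rightarrow> (nat \<Rightarrow> nat \<Rightarrow> nat) \<Rightarrow> nat \<Rightarrow> nat" where
  "traj v \<omega> 0 = v"
| "traj v \<omega> (Suc n) = next_state (traj v \<omega> n) (\<omega> n)"

lemma traj_cons: "traj v (case_nat s \<omega>) = case_nat v (traj (next_state v s) \<omega>)"
proof
  fix n
  show "traj v (case_nat s \<omega>) n = case_nat v (traj (next_state v s) \<omega>) n"
  proof (cases n)
    case (Suc m)
    have "traj v (case_nat s \<omega>) (Suc m) = traj (next_state v s) \<omega> m" by (induction m) auto
    then show ?thesis using Suc by simp
  qed simp
qed

lemma traj_in_Om: "traj v \<omega> \<in> Om"
  by (simp add: Om_iff adm_next_state)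

lemma prob_stepM: "prob_space stepM"
  unfolding stepM_def by (intro prob_space_PiM measure_pmf.prob_space_axioms)

end

sublocale markov_flow \<subseteq> seq: sequence_space stepM
  using prob_stepM by (simp add: sequence_space_def product_prob_space_def product_prob_space_axioms_def
      product_sigma_finite_def prob_space_imp_sigma_finite)

context markov_flow
begin

abbreviation "SS \<equiv> PiM (UNIV :: nat set) (\<lambda>_. stepM)"

lemma measurable_next_state [measurable]: "next_state v \<in> stepM \<rightarrow>\<^sub>M count_space UNIV"
proof -
  have "(\<lambda>s. s v) \<in> stepM \<rightarrow>\<^sub>M count_space UNIV"
    unfolding stepM_def using measurable_component_singleton[of v UNIV "\<lambda>v. measure_pmf (step_pmf v)"] by simp
  then have "(\<lambda>s. (\<lambda>w. if adm v w then w else dflt v) (s v)) \<in> stepM \<rightarrow>\<^sub>M count_space UNIV"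
    by (rule measurable_compose) simp
  then show ?thesis by (simp add: next_state_def[abs_def])
qed

lemma measurable_traj_coordinate: "(\<lambda>\<omega>. traj v \<omega> n) \<in> SS \<rightarrow>\<^sub>M count_space UNIV"
proof (induction n)
  case (Suc n)
  have "(\<lambda>\<omega>. next_state (traj v \<omega> n) (\<omega> n)) \<in> SS \<rightarrow>\<^sub>M count_space UNIV"
  proof (rule measurable_compose_countable[OF _ Suc])
    fix i
    have "(\<lambda>\<omega>. \<omega> n) \<in> SS \<rightarrow>\<^sub>M stepM" by measurable
    then show "(\<lambda>\<omega>. next_state i (\<omega> n)) \<in> SS \<rightarrow>\<^sub>M count_space UNIV" by (rule measurable_compose) measurable
  qed
  then show ?case by simp
qed simp

lemma measurable_traj [measurable]: "traj v \<in> SS \<rightarrow>\<^sub>M BB"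
  by (intro measurable_into_shift_borel eta traj_in_Om measurable_traj_coordinate)

lemma measurable_traj_pair: "(\<lambda>(v, \<omega>). traj v \<omega>) \<in> density (count_space UNIV) (\<lambda>v. ennreal (\<pi> v)) \<Otimes>\<^sub>M SS \<rightarrow>\<^sub>M BB"
proof -
  have "(\<lambda>z. traj (fst z) (snd z)) \<in> density (count_space UNIV) (\<lambda>v. ennreal (\<pi> v)) \<Otimes>\<^sub>M SS \<rightarrow>\<^sub>M BB"
  proof (rule measurable_compose_countable[where g = fst])
    show "fst \<in> density (count_space UNIV) (\<lambda>v. ennreal (\<pi> v)) \<Otimes>\<^sub>M SS \<rightarrow>\<^sub>M count_space UNIV"
      using measurable_fst[of "density (count_space UNIV) (\<lambda>v. ennreal (\<pi> v))" SS]
      by (simp cong: measurable_cong_sets)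
    show "(\<lambda>z. traj i (snd z)) \<in> density (count_space UNIV) (\<lambda>v. ennreal (\<pi> v)) \<Otimes>\<^sub>M SS \<rightarrow>\<^sub>M BB" for i
      by (rule measurable_compose[OF measurable_snd measurable_traj])
  qed
  then show ?thesis by (simp add: case_prod_beta')
qed

definition "\<mu> = distr (density (count_space UNIV) (\<lambda>v. ennreal (\<pi> v)) \<Otimes>\<^sub>M SS) BB (\<lambda>(v, \<omega>). traj v \<omega>)"

lemma sets_\<mu> [simp, measurable_cong]: "sets \<mu> = sets BB" and space_\<mu> [simp]: "space \<mu> = Om"
  by (simp_all add: \<mu>_def space_shift_borel eta)

lemma measurable_coord [measurable]: "(\<lambda>y. y i) \<in> BB \<rightarrow>\<^sub>M count_space UNIV"
  by (rule measurable_coordinate[OF eta])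

definition "EE v f = (\<integral>\<^sup>+\<omega>. f (traj v \<omega>) \<partial>SS)" for f :: "(nat \<Rightarrow> nat) \<Rightarrow> ennreal"

lemma nn_integral_\<mu>:
  assumes [measurable]: "f \<in> borel_measurable BB"
  shows "(\<integral>\<^sup>+x. f x \<partial>\<mu>) = (\<Sum>v. ennreal (\<pi> v) * EE v f)"
proof -
  let ?D = "density (count_space UNIV) (\<lambda>v. ennreal (\<pi> v))"
  note [measurable] = measurable_traj_pair
  have "(\<integral>\<^sup>+x. f x \<partial>\<mu>) = (\<integral>\<^sup>+z. f (case z of (v, \<omega>) \<Rightarrow> traj v \<omega>) \<partial>(?D \<Otimes>\<^sub>M SS))"
    unfolding \<mu>_def by (rule nn_integral_distr) measurable
  also have "\<dots> = (\<integral>\<^sup>+v. \<integral>\<^sup>+\<omega>. f (traj v \<omega>) \<partial>SS \<partial>?D)"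
    by (subst seq.P.nn_integral_fst[symmetric]) simp_all
  also have "\<dots> = (\<integral>\<^sup>+v. ennreal (\<pi> v) * EE v f \<partial>count_space UNIV)"
    unfolding EE_def[symmetric] by (subst nn_integral_density) auto
  finally show ?thesis by (simp add: nn_integral_count_space_nat)
qed

lemma nn_integral_next_state: "(\<integral>\<^sup>+s. g (next_state v s) \<partial>stepM) = (\<Sum>w. ennreal (Q v w / \<pi> v) * g w)"
proof -
  have comp: "distr stepM (measure_pmf (step_pmf v)) (\<lambda>s. s v) = measure_pmf (step_pmf v)"
    unfolding stepM_def by (intro distr_PiM_component measure_pmf.prob_space_axioms) simp
  have m: "(\<lambda>s. s v) \<in> stepM \<rightarrow>\<^sub>M measure_pmf (step_pmf v)" unfolding stepM_def by measurable
  have "(\<integral>\<^sup>+s. g (next_state v s) \<partial>stepM) = (\<integral>\<^sup>+s. (\<lambda>w. g (if adm v w then w else dflt v)) (s v) \<partial>stepM)"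
    by (simp add: next_state_def)
  also have "\<dots> = (\<integral>\<^sup>+w. g (if adm v w then w else dflt v) \<partial>distr stepM (measure_pmf (step_pmf v)) (\<lambda>s. s v))"
    by (rule nn_integral_distr[symmetric, OF m]) simp
  also have "\<dots> = (\<integral>\<^sup>+w. ennreal (Q v w / \<pi> v) * g (if adm v w then w else dflt v) \<partial>count_space UNIV)"
    unfolding comp nn_integral_measure_pmf by (simp add: pmf_step_pmf)
  also have "\<dots> = (\<integral>\<^sup>+w. ennreal (Q v w / \<pi> v) * g w \<partial>count_space UNIV)"
    by (intro nn_integral_cong) (auto simp: adm_imp(2))
  finally show ?thesis by (simp add: nn_integral_count_space_nat)
qed

text \<open>Markov property at the first step, from splitting an i.i.d. sequence into its head and
  its tail.\<close>

lemma EE_step: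
  assumes [measurable]: "f \<in> borel_measurable BB"
  shows "EE v f = (\<Sum>w. ennreal (Q v w / \<pi> v) * EE w (\<lambda>y. f (case_nat v y)))"
proof -
  have cn: "(\<lambda>(s, \<omega>). case_nat s \<omega>) \<in> stepM \<Otimes>\<^sub>M SS \<rightarrow>\<^sub>M SS" by measurable
  have "EE v f = (\<integral>\<^sup>+\<omega>. f (traj v \<omega>) \<partial>distr (stepM \<Otimes>\<^sub>M SS) SS (\<lambda>(s, \<omega>). case_nat s \<omega>))"
    by (simp add: EE_def seq.PiM_iter)
  also have "\<dots> = (\<integral>\<^sup>+z. f (traj v (case z of (s, \<omega>) \<Rightarrow> case_nat s \<omega>)) \<partial>(stepM \<Otimes>\<^sub>M SS))"
    by (rule nn_integral_distr[OF cn]) measurable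
  also have "\<dots> = (\<integral>\<^sup>+s. \<integral>\<^sup>+\<omega>. f (traj v (case (s, \<omega>) of (s, \<omega>) \<Rightarrow> case_nat s \<omega>)) \<partial>SS \<partial>stepM)"
    by (rule seq.P.nn_integral_fst[symmetric]) (rule measurable_compose[OF cn], measurable)
  also have "\<dots> = (\<integral>\<^sup>+s. EE (next_state v s) (\<lambda>y. f (case_nat v y)) \<partial>stepM)"
    by (simp add: traj_cons EE_def)
  also have "\<dots> = (\<Sum>w. ennreal (Q v w / \<pi> v) * EE w (\<lambda>y. f (case_nat v y)))"
    by (rule nn_integral_next_state[of "\<lambda>u. EE u (\<lambda>y. f (case_nat v y))"])
  finally show ?thesis .
qed

lemma ruelle_eq:
  assumes x: "x \<in> Om"
  shows "ruelle_operator Om \<phi> f x = (\<Sum>v. ennreal (Q v (x 0) / \<pi> (x 0)) * f (case_nat v x))"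
proof -
  have eq: "{y\<in>Om. left_shift y = x} = (\<lambda>v. case_nat v x) ` {v. adm v (x 0)}"
  proof (intro equalityI subsetI)
    fix y assume y: "y \<in> {y\<in>Om. left_shift y = x}"
    then have yx: "y = case_nat (y 0) x" by (auto simp: left_shift_def fun_eq_iff split: nat.split)
    then have "adm (y 0) (x 0)" using y cons_in_Om[of "y 0" x] by simp
    then show "y \<in> (\<lambda>v. case_nat v x) ` {v. adm v (x 0)}" using yx by blast
  qed (use x cons_in_Om in \<open>auto simp: left_shift_def\<close>)
  have inj: "inj_on (\<lambda>v. case_nat v x) {v. adm v (x 0)}"
    by (rule inj_onI) (metis nat.case(1))
  have "ruelle_operator Om \<phi> f x = infsum (\<lambda>v. ennreal (exp (\<phi> (case_nat v x))) * f (case_nat v x)) {v. adm v (x 0)}"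
    unfolding ruelle_operator_def eq by (subst infsum_reindex[OF inj]) (simp add: o_def)
  also have "\<dots> = (\<Sum>\<^sub>\<infinity>v. ennreal (Q v (x 0) / \<pi> (x 0)) * f (case_nat v x))"
    by (rule infsum_cong_neutral) (use \<pi>_pos[of "x 0"] in \<open>auto simp: \<phi>_def adm_imp\<close>)
  finally show ?thesis by (simp add: infsum_ennreal_eq_suminf)
qed

text \<open>Prepending a symbol can leave the shift space, so inadmissible cases are sent to an
  arbitrary fixed trajectory; there the transition weight is 0.\<close>

lemma measurable_cons:
  "(\<lambda>x. if adm v (x 0) then case_nat v x else traj 0 undefined) \<in> BB \<rightarrow>\<^sub>M BB"
proof (rule measurable_into_shift_borel[OF eta])
  show "(if adm v (z 0) then case_nat v z else traj 0 undefined) \<in> Om" if "z \<in> space BB" for z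
    using that by (auto simp: cons_in_Om traj_in_Om space_shift_borel eta)
  fix i
  have "(\<lambda>z. if adm v (z 0) then case_nat v z i else traj 0 undefined i) \<in> BB \<rightarrow>\<^sub>M count_space UNIV"
  proof (rule measurable_If)
    show "(\<lambda>z. case_nat v z i) \<in> BB \<rightarrow>\<^sub>M count_space UNIV" by (cases i) auto
    show "{z \<in> space BB. adm v (z 0)} \<in> sets BB" by measurable
  qed simp
  then show "(\<lambda>z. (if adm v (z 0) then case_nat v z else traj 0 undefined) i) \<in> BB \<rightarrow>\<^sub>M count_space UNIV"
    by (simp add: if_distrib[of "\<lambda>f. f i"])
qed

lemma ruelle_measurable:
  assumes [measurable]: "f \<in> borel_measurable BB"
  shows "ruelle_operator Om \<phi> f \<in> borel_measurable BB"
proof -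
  let ?c = "\<lambda>v x. if adm v (x 0) then case_nat v x else traj 0 undefined"
  have [measurable]: "(\<lambda>x. f (?c v x)) \<in> borel_measurable BB" for v
    by (rule measurable_compose[OF measurable_cons]) measurable
  have [measurable]: "(\<lambda>x. ennreal (Q v (x 0) / \<pi> (x 0))) \<in> borel_measurable BB" for v
    by (rule measurable_compose[OF measurable_coord]) simp
  have "(\<lambda>x. \<Sum>v. ennreal (Q v (x 0) / \<pi> (x 0)) * f (?c v x)) \<in> borel_measurable BB" by measurable
  moreover have "ruelle_operator Om \<phi> f x = (\<Sum>v. ennreal (Q v (x 0) / \<pi> (x 0)) * f (?c v x))" if "x \<in> space BB" for x
  proof -
    have "ennreal (Q v (x 0) / \<pi> (x 0)) * f (case_nat v x) = ennreal (Q v (x 0) / \<pi> (x 0)) * f (?c v x)" for v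
      by (auto simp: adm_imp(2))
    then show ?thesis using that by (simp add: ruelle_eq space_shift_borel eta)
  qed
  ultimately show ?thesis by (simp cong: measurable_cong)
qed

text \<open>Eigenmeasure equation with eigenvalue 1. On the left \<pi> w cancels the denominator of
  the backward weight, on the right \<pi> v that of the forward weight, and both sides become the
  same double sum of Q v w times an expectation from w.\<close>

lemma nn_integral_ruelle:
  assumes f: "f \<in> borel_measurable BB"
  shows "(\<integral>\<^sup>+x. ruelle_operator Om \<phi> f x \<partial>\<mu>) = (\<integral>\<^sup>+x. f x \<partial>\<mu>)"
proof -
  have mm: "(\<lambda>\<omega>. if adm v w then f (case_nat v (traj w \<omega>)) else 0) \<in> borel_measurable SS" for v w
  proof (cases "adm v w")
    case True
    have "(\<lambda>\<omega>. f ((\<lambda>x. if adm v (x 0) then case_nat v x else traj 0 undefined) (traj w \<omega>))) \<in> borel_measurable SS"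
      by (rule measurable_compose[OF measurable_compose[OF measurable_traj measurable_cons] f])
    then show ?thesis using True by simp
  qed simp
  have E: "EE w (ruelle_operator Om \<phi> f) = (\<Sum>v. ennreal (Q v w / \<pi> w) * EE w (\<lambda>y. f (case_nat v y)))" for w
  proof -
    have "EE w (ruelle_operator Om \<phi> f) = (\<integral>\<^sup>+\<omega>. (\<Sum>v. ennreal (Q v w / \<pi> w) * f (case_nat v (traj w \<omega>))) \<partial>SS)"
      by (simp add: EE_def ruelle_eq traj_in_Om)
    also have "\<dots> = (\<integral>\<^sup>+\<omega>. (\<Sum>v. ennreal (Q v w / \<pi> w) * (if adm v w then f (case_nat v (traj w \<omega>)) else 0)) \<partial>SS)"
      by (intro nn_integral_cong arg_cong[where f = suminf] ext) (auto simp: adm_imp(2))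
    also have "\<dots> = (\<Sum>v. \<integral>\<^sup>+\<omega>. ennreal (Q v w / \<pi> w) * (if adm v w then f (case_nat v (traj w \<omega>)) else 0) \<partial>SS)"
      by (rule nn_integral_suminf) (use mm in measurable)
    also have "\<dots> = (\<Sum>v. ennreal (Q v w / \<pi> w) * EE w (\<lambda>y. f (case_nat v y)))"
    proof (intro arg_cong[where f = suminf] ext)
      fix v
      have "(\<integral>\<^sup>+\<omega>. ennreal (Q v w / \<pi> w) * (if adm v w then f (case_nat v (traj w \<omega>)) else 0) \<partial>SS)
          = ennreal (Q v w / \<pi> w) * (\<integral>\<^sup>+\<omega>. (if adm v w then f (case_nat v (traj w \<omega>)) else 0) \<partial>SS)"
        by (rule nn_integral_cmult[OF mm])
      then show "(\<integral>\<^sup>+\<omega>. ennreal (Q v w / \<pi> w) * (if adm v w then f (case_nat v (traj w \<omega>)) else 0) \<partial>SS)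
          = ennreal (Q v w / \<pi> w) * EE w (\<lambda>y. f (case_nat v y))"
        by (cases "adm v w") (auto simp: adm_imp(2) EE_def)
    qed
    finally show ?thesis .
  qed
  have m1: "ennreal (\<pi> w) * (ennreal (Q v w / \<pi> w) * c) = ennreal (Q v w) * c"
    "ennreal (\<pi> v) * (ennreal (Q v w / \<pi> v) * c) = ennreal (Q v w) * c" for v w c
    using \<pi>_pos[of w] \<pi>_pos[of v] Q_nonneg[of v w]
    by (simp_all add: mult.assoc[symmetric] ennreal_mult[symmetric] less_imp_le)
  have "(\<integral>\<^sup>+x. ruelle_operator Om \<phi> f x \<partial>\<mu>) = (\<Sum>w. ennreal (\<pi> w) * (\<Sum>v. ennreal (Q v w / \<pi> w) * EE w (\<lambda>y. f (case_nat v y))))"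
    by (simp add: nn_integral_\<mu> ruelle_measurable f E)
  also have "\<dots> = (\<Sum>w. \<Sum>v. ennreal (Q v w) * EE w (\<lambda>y. f (case_nat v y)))"
    by (simp add: ennreal_suminf_cmult[symmetric] m1)
  also have "\<dots> = (\<integral>\<^sup>+w. (\<Sum>v. ennreal (Q v w) * EE w (\<lambda>y. f (case_nat v y))) \<partial>count_space UNIV)"
    by (simp add: nn_integral_count_space_nat)
  also have "\<dots> = (\<Sum>v. \<integral>\<^sup>+w. ennreal (Q v w) * EE w (\<lambda>y. f (case_nat v y)) \<partial>count_space UNIV)"
    by (rule nn_integral_suminf) simp
  also have "\<dots> = (\<Sum>v. \<Sum>w. ennreal (Q v w) * EE w (\<lambda>y. f (case_nat v y)))"
    by (simp add: nn_integral_count_space_nat)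
  also have "\<dots> = (\<Sum>v. ennreal (\<pi> v) * EE v f)"
    by (subst EE_step[OF f]) (simp add: ennreal_suminf_cmult[symmetric] m1)
  also have "\<dots> = (\<integral>\<^sup>+x. f x \<partial>\<mu>)" by (simp add: nn_integral_\<mu> f)
  finally show ?thesis .
qed

lemma measurable_shift [measurable]: "left_shift \<in> BB \<rightarrow>\<^sub>M BB"
proof (rule measurable_into_shift_borel[OF eta])
  show "left_shift z \<in> Om" if "z \<in> space BB" for z
    using that by (auto intro: shift_in_Om simp: space_shift_borel eta)
  show "(\<lambda>z. left_shift z i) \<in> BB \<rightarrow>\<^sub>M count_space UNIV" for i by (simp add: left_shift_def)
qed

lemma left_shift_cons: "left_shift (case_nat v x) = x"
  by (simp add: left_shift_def)

text \<open>The function u composed with the shift is constant on the preimages of a point, so it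
  factors out of the Ruelle operator. This makes the Ruelle operator a version of the transfer
  operator of \<mu>.\<close>

lemma nn_integral_dual:
  assumes [measurable]: "f \<in> borel_measurable BB" "u \<in> borel_measurable BB"
  shows "(\<integral>\<^sup>+x. f x * u (left_shift x) \<partial>\<mu>) = (\<integral>\<^sup>+x. ruelle_operator Om \<phi> f x * u x \<partial>\<mu>)"
proof -
  have "(\<integral>\<^sup>+x. f x * u (left_shift x) \<partial>\<mu>) = (\<integral>\<^sup>+x. ruelle_operator Om \<phi> (\<lambda>x. f x * u (left_shift x)) x \<partial>\<mu>)"
    by (rule nn_integral_ruelle[symmetric]) measurable
  also have "\<dots> = (\<integral>\<^sup>+x. ruelle_operator Om \<phi> f x * u x \<partial>\<mu>)"
    by (rule nn_integral_cong)
      (simp add: ruelle_eq left_shift_cons mult.assoc[symmetric] ennreal_suminf_multc)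
  finally show ?thesis .
qed

lemma ruelle_one: "x \<in> Om \<Longrightarrow> ruelle_operator Om \<phi> (\<lambda>_. 1) x = 1"
proof -
  assume x: "x \<in> Om"
  have "ruelle_operator Om \<phi> (\<lambda>_. 1) x = (\<Sum>v. ennreal (Q v (x 0)) * ennreal (1 / \<pi> (x 0)))"
    using Q_nonneg \<pi>_pos[of "x 0"] by (simp add: ruelle_eq x ennreal_mult[symmetric])
  also have "\<dots> = ennreal (\<pi> (x 0)) * ennreal (1 / \<pi> (x 0))" by (simp add: ennreal_suminf_multc col)
  also have "\<dots> = 1" using \<pi>_pos[of "x 0"] by (simp add: ennreal_mult[symmetric])
  finally show ?thesis .
qed

text \<open>Duality applied to the constant 1, which the column sums make a fixed point of the
  Ruelle operator.\<close>

lemma \<mu>_preserved: "measure_preserving_map \<mu> left_shift"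
proof -
  have "distr \<mu> \<mu> left_shift = \<mu>"
  proof (rule measure_eqI)
    fix A assume "A \<in> sets (distr \<mu> \<mu> left_shift)"
    then have A [measurable]: "A \<in> sets BB" by simp
    have "emeasure (distr \<mu> \<mu> left_shift) A = (\<integral>\<^sup>+x. indicator A x \<partial>distr \<mu> \<mu> left_shift)"
      by simp
    also have "\<dots> = (\<integral>\<^sup>+x. indicator A (left_shift x) \<partial>\<mu>)"
      by (rule nn_integral_distr) measurable
    also have "\<dots> = (\<integral>\<^sup>+x. ruelle_operator Om \<phi> (\<lambda>_. 1) x * indicator A x \<partial>\<mu>)"
      using nn_integral_dual[of "\<lambda>_. 1" "indicator A"] by simp
    also have "\<dots> = (\<integral>\<^sup>+x. indicator A x \<partial>\<mu>)" by (rule nn_integral_cong) (simp add: ruelle_one)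
    finally show "emeasure (distr \<mu> \<mu> left_shift) A = emeasure \<mu> A" by simp
  qed simp
  then show ?thesis by (simp add: measure_preserving_map_def cong: measurable_cong_sets)
qed

lemma EE_first:
  assumes "\<And>x. x 0 = v \<Longrightarrow> x \<in> Om \<Longrightarrow> f x = g x"
  shows "EE v f = EE v g"
  unfolding EE_def by (intro nn_integral_cong assms traj_in_Om) simp

lemma EE_const: "EE v (\<lambda>_. c) = c"
  by (simp add: EE_def seq.P.emeasure_space_1)

lemma emeasure_state: "emeasure \<mu> {y\<in>Om. y 0 = v} = ennreal (\<pi> v)"
proof -
  have m: "{y\<in>Om. y 0 = v} \<in> sets BB"
  proof -
    have "{y\<in>space BB. y 0 = v} \<in> sets BB" by measurable
    then show ?thesis by (simp add: space_shift_borel eta)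
  qed
  have "emeasure \<mu> {y\<in>Om. y 0 = v} = (\<integral>\<^sup>+x. indicator {y\<in>Om. y 0 = v} x \<partial>\<mu>)" using m by simp
  also have "\<dots> = (\<Sum>w. ennreal (\<pi> w) * EE w (indicator {y\<in>Om. y 0 = v}))" using m by (intro nn_integral_\<mu>) simp
  also have "\<dots> = (\<Sum>w. if w = v then ennreal (\<pi> v) else 0)"
  proof (intro arg_cong[where f = suminf] ext)
    fix w
    have "EE w (indicator {y\<in>Om. y 0 = v}) = EE w (\<lambda>_. if w = v then 1 else 0)"
      by (rule EE_first) auto
    then show "ennreal (\<pi> w) * EE w (indicator {y\<in>Om. y 0 = v}) = (if w = v then ennreal (\<pi> v) else 0)"
      by (simp add: EE_const)
  qed
  also have "\<dots> = ennreal (\<pi> v)" using suminf_finite[of "{v}" "\<lambda>w. if w = v then ennreal (\<pi> v) else 0"] by simp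
  finally show ?thesis .
qed

lemma sigma_finite_\<mu>: "sigma_finite_measure \<mu>"
proof
  show "\<exists>A. countable A \<and> A \<subseteq> sets \<mu> \<and> \<Union> A = space \<mu> \<and> (\<forall>a\<in>A. emeasure \<mu> a \<noteq> \<infinity>)"
  proof (intro exI[of _ "range (\<lambda>v. {y\<in>Om. y 0 = v})"] conjI)
    have "{y\<in>space BB. y 0 = v} \<in> sets BB" for v by measurable
    then show "range (\<lambda>v. {y\<in>Om. y 0 = v}) \<subseteq> sets \<mu>" by (auto simp: space_shift_borel eta)
  qed (auto simp: emeasure_state)
qed

end

lemma suminf_delta: "(\<Sum>u::nat. if u = v then c else 0) = (c :: ennreal)"
proof -
  have "(\<Sum>u. if u = v then c else 0) = (\<Sum>u\<in>{v}. if u = v then c else 0)"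
    by (rule suminf_finite) auto
  then show ?thesis by simp
qed

lemma funpow_left_shift: "(left_shift ^^ n) x = (\<lambda>i. x (i + n))"
  by (induction n) (simp_all add: left_shift_def)

lemma birkhoff_sum_Suc: "birkhoff_sum (Suc n) f x = f x + birkhoff_sum n f (left_shift x)"
  by (simp add: birkhoff_sum_def sum.lessThan_Suc_shift funpow_swap1 del: sum.lessThan_Suc)

section \<open>Cylinders, periodic points and pressure\<close>

context markov_flow
begin

lemma cylinder_Cons: "cylinder Om (v # ws) = {y\<in>Om. y 0 = v \<and> left_shift y \<in> cylinder Om ws}"
proof -
  have "(\<forall>i<Suc n. P i) \<longleftrightarrow> P 0 \<and> (\<forall>i<n. P (Suc i))" for P :: "nat \<Rightarrow> bool" and n
    using less_Suc_eq_0_disj by auto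
  then show ?thesis using shift_in_Om by (auto simp: cylinder_def left_shift_def)
qed

lemma sets_cyl [measurable]: "cylinder Om w \<in> sets BB"
  by (rule sets_cylinder[OF eta])

lemma cylinder_state: "cylinder Om [v] = {y\<in>Om. y 0 = v}"
  by (auto simp: cylinder_def)

lemma ruelle_cylinder:
  assumes x: "x \<in> Om"
  shows "ruelle_operator Om \<phi> (indicator (cylinder Om (v # w # ws))) x
    = ennreal (Q v w / \<pi> w) * indicator (cylinder Om (w # ws)) x"
proof -
  have "ruelle_operator Om \<phi> (indicator (cylinder Om (v # w # ws))) x
      = (\<Sum>u. if u = v then ennreal (Q v w / \<pi> w) * indicator (cylinder Om (w # ws)) x else 0)"
    unfolding ruelle_eq[OF x]
  proof (intro arg_cong[where f = suminf] ext)
    fix u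
    show "ennreal (Q u (x 0) / \<pi> (x 0)) * indicator (cylinder Om (v # w # ws)) (case_nat u x)
        = (if u = v then ennreal (Q v w / \<pi> w) * indicator (cylinder Om (w # ws)) x else 0)"
      using x adm_imp(2)[of v w]
      by (auto simp: cylinder_Cons[of v] cons_in_Om left_shift_cons indicator_def cylinder_Cons[of w])
  qed
  then show ?thesis by (simp only: suminf_delta)
qed

lemma emeasure_cylinder_Cons:
  "emeasure \<mu> (cylinder Om (v # w # ws)) = ennreal (Q v w / \<pi> w) * emeasure \<mu> (cylinder Om (w # ws))"
proof -
  have "emeasure \<mu> (cylinder Om (v # w # ws)) = (\<integral>\<^sup>+x. ruelle_operator Om \<phi> (indicator (cylinder Om (v # w # ws))) x \<partial>\<mu>)"
    by (subst nn_integral_ruelle) simp_all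
  also have "\<dots> = (\<integral>\<^sup>+x. ennreal (Q v w / \<pi> w) * indicator (cylinder Om (w # ws)) x \<partial>\<mu>)"
    by (rule nn_integral_cong) (simp add: ruelle_cylinder)
  also have "\<dots> = ennreal (Q v w / \<pi> w) * emeasure \<mu> (cylinder Om (w # ws))"
    by (simp add: nn_integral_cmult_indicator)
  finally show ?thesis .
qed

lemma emeasure_cylinder_birkhoff:
  "x \<in> Om \<Longrightarrow> emeasure \<mu> (cylinder Om (map x [0..<Suc n])) = ennreal (exp (birkhoff_sum n \<phi> x) * \<pi> (x n))"
proof (induction n arbitrary: x)
  case 0
  then show ?case by (simp add: cylinder_state emeasure_state birkhoff_sum_def)
next
  case (Suc n)
  have a: "adm (x 0) (x 1)" using Suc.prems by (auto simp: Om_iff)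
  have "map x [0..<Suc (Suc n)] = x 0 # map (left_shift x) [0..<Suc n]"
    by (simp add: left_shift_def map_upt_Suc del: upt_Suc)
  moreover have "map (left_shift x) [0..<Suc n] = x 1 # map (left_shift (left_shift x)) [0..<n]"
    by (simp add: left_shift_def map_upt_Suc del: upt_Suc)
  ultimately have "emeasure \<mu> (cylinder Om (map x [0..<Suc (Suc n)]))
      = ennreal (Q (x 0) (x 1) / \<pi> (x 1)) * emeasure \<mu> (cylinder Om (map (left_shift x) [0..<Suc n]))"
    by (simp add: emeasure_cylinder_Cons del: upt_Suc)
  also have "ennreal (Q (x 0) (x 1) / \<pi> (x 1)) = ennreal (exp (\<phi> x))"
    using adm_imp(1)[OF a] \<pi>_pos[of "x 1"] by (simp add: \<phi>_def)
  also have "emeasure \<mu> (cylinder Om (map (left_shift x) [0..<Suc n]))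
      = ennreal (exp (birkhoff_sum n \<phi> (left_shift x)) * \<pi> (x (Suc n)))"
    using Suc.IH[OF shift_in_Om[OF Suc.prems]] by (simp add: left_shift_def)
  also have "ennreal (exp (\<phi> x)) * ennreal (exp (birkhoff_sum n \<phi> (left_shift x)) * \<pi> (x (Suc n)))
      = ennreal (exp (birkhoff_sum (Suc n) \<phi> x) * \<pi> (x (Suc n)))"
    using \<pi>_pos[of "x (Suc n)"] by (simp add: ennreal_mult[symmetric] birkhoff_sum_Suc exp_add mult.assoc)
  finally show ?case .
qed

text \<open>A periodic point is determined by its first period, whose cylinder has measure \<open>exp (S_n \<phi>) * \<pi> v\<close>;
  these cylinders partition the set of points that visit \<open>v\<close> at times \<open>0\<close> and \<open>n\<close>.\<close>

lemma periodic_sum: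
  assumes n: "n \<ge> 1" and R: "\<And>x y. (\<And>i. i < n \<Longrightarrow> x i = y i) \<Longrightarrow> R x = R y"
  shows "(\<Sum>\<^sub>\<infinity>x\<in>{x \<in> cylinder Om [v]. (left_shift ^^ n) x = x \<and> R x}. ennreal (exp (birkhoff_sum n \<phi> x))) * ennreal (\<pi> v)
    = emeasure \<mu> {y\<in>Om. y 0 = v \<and> y n = v \<and> R y}"
proof -
  let ?P = "{x \<in> cylinder Om [v]. (left_shift ^^ n) x = x \<and> R x}"
  let ?C = "\<lambda>x. cylinder Om (map x [0..<Suc n])"
  have per: "x (i + n) = x i" if "x \<in> ?P" for x i
    using that by (auto simp: funpow_left_shift fun_eq_iff)
  have per_mod: "x i = x (i mod n)" if "x \<in> ?P" for x i
  proof (induction i rule: less_induct)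
    case (less i)
    show ?case
    proof (cases "i < n")
      case False
      then have "x i = x (i - n)" using per[OF that, of "i - n"] by simp
      also have "\<dots> = x ((i - n) mod n)" using False n by (intro less) auto
      also have "(i - n) mod n = i mod n" using False by (simp add: le_mod_geq)
      finally show ?thesis .
    qed simp
  qed
  have det: "x = y" if "x \<in> ?P" "y \<in> ?P" "\<And>i. i < n \<Longrightarrow> x i = y i" for x y
  proof
    fix i
    show "x i = y i" using per_mod[OF that(1), of i] per_mod[OF that(2), of i] that(3)[of "i mod n"] n by simp
  qed
  have "inj_on (\<lambda>x. map x [0..<n]) ?P"
    by (rule inj_onI, rule det) (auto simp: map_eq_conv)
  then have cP: "countable ?P" by (rule countable_image_inj_on[OF countableI_type])
  have dj: "disjoint_family_on ?C ?P"
    unfolding disjoint_family_on_def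
  proof (intro ballI impI, rule ccontr)
    fix x y assume xy: "x \<in> ?P" "y \<in> ?P" "x \<noteq> y" and "?C x \<inter> ?C y \<noteq> {}"
    then obtain z where "z \<in> ?C x" "z \<in> ?C y" by blast
    then have "\<And>i. i < n \<Longrightarrow> x i = y i" by (auto simp: cylinder_map simp del: upt_Suc)
    then show False using det xy by blast
  qed
  have un: "(\<Union>x\<in>?P. ?C x) = {y\<in>Om. y 0 = v \<and> y n = v \<and> R y}"
  proof (intro equalityI subsetI)
    fix y assume "y \<in> (\<Union>x\<in>?P. ?C x)"
    then obtain x where x: "x \<in> ?P" and y: "y \<in> Om" "\<And>i. i < Suc n \<Longrightarrow> y i = x i"
      by (auto simp: cylinder_map simp del: upt_Suc)
    have "x n = x 0" using per[OF x, of 0] by simp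
    moreover have "x 0 = v" "R x" using x by (auto simp: cylinder_def)
    moreover have "R y = R x" by (rule R) (use y in auto)
    ultimately show "y \<in> {y\<in>Om. y 0 = v \<and> y n = v \<and> R y}" using y(2)[of 0] y(2)[of n] y(1) by simp
  next
    fix y assume y: "y \<in> {y\<in>Om. y 0 = v \<and> y n = v \<and> R y}"
    define x where "x i = y (i mod n)" for i
    have xn: "x i = y i" if "i < n" for i using that by (simp add: x_def)
    have "adm (x i) (x (Suc i))" for i
    proof -
      have a: "adm (y (i mod n)) (y (Suc (i mod n)))" using y by (simp add: Om_iff)
      show ?thesis
      proof (cases "Suc (i mod n) = n")
        case True
        then have "x (Suc i) = y n" using y by (simp add: x_def mod_Suc)
        then show ?thesis using a True by (simp add: x_def)
      next
        case False
        then show ?thesis using a by (simp add: x_def mod_Suc)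
      qed
    qed
    then have "x \<in> Om" by (simp add: Om_iff)
    moreover have "R x = R y" by (rule R) (simp add: xn)
    moreover have "(left_shift ^^ n) x = x" by (simp add: funpow_left_shift x_def fun_eq_iff)
    ultimately have "x \<in> ?P" using y n by (simp add: cylinder_state x_def)
    moreover have "y i = x i" if "i < Suc n" for i
      using that xn[of i] y n by (cases "i = n") (auto simp: x_def)
    then have "y \<in> ?C x" using y by (simp add: cylinder_map del: upt_Suc)
    ultimately show "y \<in> (\<Union>x\<in>?P. ?C x)" by blast
  qed
  have "(\<Sum>\<^sub>\<infinity>x\<in>?P. ennreal (exp (birkhoff_sum n \<phi> x))) * ennreal (\<pi> v)
      = (\<integral>\<^sup>+x. ennreal (exp (birkhoff_sum n \<phi> x)) * ennreal (\<pi> v) \<partial>count_space ?P)"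
    by (simp add: infsum_ennreal_eq_nn_integral[OF cP] nn_integral_multc)
  also have "\<dots> = (\<integral>\<^sup>+x. emeasure \<mu> (?C x) \<partial>count_space ?P)"
  proof (rule nn_integral_cong)
    fix x assume "x \<in> space (count_space ?P)"
    then have x: "x \<in> ?P" by simp
    then have "x n = v" "x \<in> Om" using per[OF x, of 0] by (auto simp: cylinder_def)
    then show "ennreal (exp (birkhoff_sum n \<phi> x)) * ennreal (\<pi> v) = emeasure \<mu> (?C x)"
      using \<pi>_pos[of v] by (simp add: emeasure_cylinder_birkhoff ennreal_mult[symmetric] del: upt_Suc)
  qed
  also have "\<dots> = emeasure \<mu> (\<Union>x\<in>?P. ?C x)"
    by (rule emeasure_UN_countable[symmetric, OF _ cP dj]) simp
  finally show ?thesis by (simp only: un)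
qed

definition "pp n v w = EE v (\<lambda>y. if y n = w then 1 else 0)"

lemma pp_0: "pp 0 v w = (if v = w then 1 else 0)"
proof -
  have "pp 0 v w = EE v (\<lambda>_. if v = w then 1 else 0)" unfolding pp_def by (rule EE_first) simp
  then show ?thesis by (simp add: EE_const)
qed

lemma pp_Suc: "pp (Suc n) v w = (\<Sum>u. ennreal (Q v u / \<pi> v) * pp n u w)"
  unfolding pp_def by (subst EE_step) simp_all

lemma pp_le_1: "pp n v w \<le> 1"
proof -
  have "pp n v w \<le> EE v (\<lambda>_. 1)" unfolding pp_def EE_def by (intro nn_integral_mono) simp
  then show ?thesis by (simp add: EE_const)
qed

lemma pp_mult_le: "pp m v u * pp n u w \<le> pp (m + n) v w"
proof (induction m arbitrary: v)
  case (Suc m)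
  have "pp (Suc m) v u * pp n u w = (\<Sum>s. ennreal (Q v s / \<pi> v) * (pp m s u * pp n u w))"
    unfolding pp_Suc by (simp only: ennreal_suminf_multc[symmetric] mult.assoc)
  also have "\<dots> \<le> (\<Sum>s. ennreal (Q v s / \<pi> v) * pp (m + n) s w)"
    by (intro suminf_le mult_left_mono Suc) auto
  finally show ?case by (simp add: pp_Suc)
qed (simp add: pp_0)

lemma pp_pos_imp_relpow: "0 < pp n v w \<Longrightarrow> (v, w) \<in> {(b, c). b \<in> UNIV \<and> c \<in> UNIV \<and> adm b c} ^^ n"
proof (induction n arbitrary: v)
  case 0
  then show ?case by (simp add: pp_0 split: if_splits)
next
  case (Suc n)
  have "\<exists>u. ennreal (Q v u / \<pi> v) * pp n u w \<noteq> 0"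
  proof (rule ccontr)
    assume "\<not> ?thesis"
    then have "pp (Suc n) v w = (\<Sum>u. 0)" unfolding pp_Suc by (intro arg_cong[where f = suminf] ext) blast
    then show False using Suc.prems by simp
  qed
  then obtain u where ne: "ennreal (Q v u / \<pi> v) * pp n u w \<noteq> 0" by blast
  then have u: "0 < pp n u w" by (simp add: zero_less_iff_neq_zero)
  have "Q v u \<noteq> 0" using ne by (intro notI) simp
  then have "adm v u" using adm_imp(2) by blast
  then show ?case using Suc.IH[OF u] by (intro relpow_Suc_I2[of v u]) auto
qed

lemma emeasure_pair: "emeasure \<mu> {y\<in>Om. y 0 = v \<and> y n = w} = ennreal (\<pi> v) * pp n v w"
proof -
  have m: "{y\<in>Om. y 0 = v \<and> y n = w} \<in> sets BB"
  proof -
    have "{y\<in>space BB. y 0 = v \<and> y n = w} \<in> sets BB" by measurable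
    then show ?thesis by (simp add: space_shift_borel eta)
  qed
  let ?f = "indicator {y\<in>Om. y 0 = v \<and> y n = w} :: _ \<Rightarrow> ennreal"
  have "emeasure \<mu> {y\<in>Om. y 0 = v \<and> y n = w} = (\<integral>\<^sup>+x. ?f x \<partial>\<mu>)" using m by simp
  also have "\<dots> = (\<Sum>u. ennreal (\<pi> u) * EE u ?f)" using m by (intro nn_integral_\<mu>) simp
  also have "\<dots> = (\<Sum>u. if u = v then ennreal (\<pi> v) * pp n v w else 0)"
  proof (intro arg_cong[where f = suminf] ext)
    fix u
    have "EE u ?f = (if u = v then pp n v w else 0)"
    proof (cases "u = v")
      case True
      then have "EE u ?f = pp n v w" unfolding pp_def by (simp only:, intro EE_first) auto
      then show ?thesis using True by simp
    next
      case False
      then have "EE u ?f = EE u (\<lambda>_. 0)" by (intro EE_first) auto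
      then show ?thesis using False by (simp add: EE_const)
    qed
    then show "ennreal (\<pi> u) * EE u ?f = (if u = v then ennreal (\<pi> v) * pp n v w else 0)" by simp
  qed
  also have "\<dots> = ennreal (\<pi> v) * pp n v w"
    by (rule suminf_delta)
  finally show ?thesis .
qed

lemma ennreal_\<pi>_cancel: "x * ennreal (\<pi> v) = ennreal (\<pi> v) * y \<Longrightarrow> x = y"
  using \<pi>_pos[of v] by (simp add: mult.commute[of x] ennreal_mult_cancel_left)

text \<open>Around a closed loop the factors \<pi> telescope, so backward and forward weights have
  the same product and the partition sum is a return probability of the chain.\<close>

lemma partition_sum_eq:
  assumes "n \<ge> 1"
  shows "partition_sum Om \<phi> n v = pp n v v"
proof (rule ennreal_\<pi>_cancel)
  show "partition_sum Om \<phi> n v * ennreal (\<pi> v) = ennreal (\<pi> v) * pp n v v"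
    using periodic_sum[of n "\<lambda>_. True" v] assms by (simp add: partition_sum_def emeasure_pair)
qed

lemma shift_visits: "x \<in> Om \<Longrightarrow> (left_shift ^^ k) x \<in> cylinder Om [v] \<longleftrightarrow> x k = v"
proof -
  assume "x \<in> Om"
  then have "(left_shift ^^ k) x \<in> Om" by (induction k) (auto intro: shift_in_Om)
  then show ?thesis by (auto simp: cylinder_state funpow_left_shift)
qed

lemma return_time_Least:
  assumes x: "x \<in> Om" and k: "k \<ge> 1" "x k = v"
  shows "return_time left_shift (cylinder Om [v]) x = enat (LEAST k. 1 \<le> k \<and> x k = v)"
proof -
  let ?L = "LEAST k. 1 \<le> k \<and> x k = v"
  have L: "1 \<le> ?L \<and> x ?L = v" using k by (intro LeastI[of "\<lambda>k. 1 \<le> k \<and> x k = v"]) auto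
  show ?thesis
    unfolding return_time_def shift_visits[OF x]
  proof (rule antisym)
    show "Inf {enat n |n. n \<ge> 1 \<and> x n = v} \<le> enat ?L" using L by (intro Inf_lower) auto
    show "enat ?L \<le> Inf {enat n |n. n \<ge> 1 \<and> x n = v}" by (intro Inf_greatest) (auto intro: Least_le)
  qed
qed

lemma return_time_infinite:
  assumes x: "x \<in> Om" and "\<And>k. k \<ge> 1 \<Longrightarrow> x k \<noteq> v"
  shows "return_time left_shift (cylinder Om [v]) x = \<infinity>"
proof -
  have e: "{enat n |n. n \<ge> 1 \<and> x n = v} = {}" using assms(2) by auto
  show ?thesis unfolding return_time_def shift_visits[OF x] e by (simp add: top_enat_def)
qed

lemma return_time_eq_iff:
  assumes x: "x \<in> Om"
  shows "return_time left_shift (cylinder Om [v]) x = enat n \<longleftrightarrow> 1 \<le> n \<and> x n = v \<and> (\<forall>i. 1 \<le> i \<and> i < n \<longrightarrow> x i \<noteq> v)"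
proof
  assume r: "return_time left_shift (cylinder Om [v]) x = enat n"
  then have "\<exists>k\<ge>1. x k = v" using return_time_infinite[OF x, of v] by fastforce
  then obtain k where k: "k \<ge> 1" "x k = v" by blast
  have n: "n = (LEAST k. 1 \<le> k \<and> x k = v)" using return_time_Least[OF x k] r by simp
  have "1 \<le> n \<and> x n = v" unfolding n using k by (intro LeastI[of "\<lambda>k. 1 \<le> k \<and> x k = v"]) auto
  moreover have "x i \<noteq> v" if "1 \<le> i" "i < n" for i
    using not_less_Least[of i "\<lambda>k. 1 \<le> k \<and> x k = v"] that n by auto
  ultimately show "1 \<le> n \<and> x n = v \<and> (\<forall>i. 1 \<le> i \<and> i < n \<longrightarrow> x i \<noteq> v)" by blast
next
  assume n: "1 \<le> n \<and> x n = v \<and> (\<forall>i. 1 \<le> i \<and> i < n \<longrightarrow> x i \<noteq> v)"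
  have "(LEAST k. 1 \<le> k \<and> x k = v) = n" by (rule Least_equality) (use n in \<open>auto simp: not_less[symmetric]\<close>)
  then show "return_time left_shift (cylinder Om [v]) x = enat n" using return_time_Least[OF x, of n v] n by simp
qed

text \<open>For a point of period n in [v] the return time is n exactly if v does not occur strictly
  in between, and this condition reads only the first n symbols, as \<open>periodic_sum\<close>
  requires.\<close>

lemma first_return_sum_eq:
  assumes n: "n \<ge> 1"
  shows "first_return_sum Om \<phi> n v * ennreal (\<pi> v)
    = emeasure \<mu> {y\<in>Om. y 0 = v \<and> y n = v \<and> (\<forall>i. 1 \<le> i \<and> i < n \<longrightarrow> y i \<noteq> v)}"
proof -
  let ?R = "\<lambda>y :: nat \<Rightarrow> nat. \<forall>i. 1 \<le> i \<and> i < n \<longrightarrow> y i \<noteq> v"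
  have "{x \<in> cylinder Om [v]. (left_shift ^^ n) x = x \<and> return_time left_shift (cylinder Om [v]) x = enat n}
      = {x \<in> cylinder Om [v]. (left_shift ^^ n) x = x \<and> ?R x}"
  proof (rule Collect_cong, rule conj_cong[OF refl], rule conj_cong[OF refl])
    fix x assume x: "x \<in> cylinder Om [v]" "(left_shift ^^ n) x = x"
    then have "x n = v" by (auto simp: cylinder_def funpow_left_shift fun_eq_iff dest: spec[of _ 0])
    then show "return_time left_shift (cylinder Om [v]) x = enat n \<longleftrightarrow> ?R x"
      using x n by (subst return_time_eq_iff) (auto simp: cylinder_def)
  qed
  then show ?thesis unfolding first_return_sum_def
    using periodic_sum[OF n, of ?R v] by auto
qed

text \<open>\<phi> depends on two coordinates, so an n-step Birkhoff sum depends on the first n + 1,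
  and all Walters constants with k \<ge> 1 vanish.\<close>

lemma walters_\<phi>: "walters Om \<phi>"
proof -
  have z: "walters_constant Om \<phi> k = 0" if "k \<ge> 1" for k
  proof -
    have "variation Om (n + k) (birkhoff_sum n \<phi>) = 0" for n
    proof -
      have "birkhoff_sum n \<phi> x = birkhoff_sum n \<phi> y" if "\<forall>i<n + k. x i = y i" for x y :: "nat \<Rightarrow> nat"
        unfolding birkhoff_sum_def using that \<open>k \<ge> 1\<close>
        by (intro sum.cong) (auto simp: \<phi>_def funpow_left_shift)
      then show ?thesis unfolding variation_def by (intro antisym SUP_least) auto
    qed
    then show ?thesis unfolding walters_constant_def by (auto intro!: antisym SUP_least)
  qed
  have "\<forall>\<^sub>F k in sequentially. walters_constant Om \<phi> k = 0"
    using eventually_ge_at_top[of 1] by eventually_elim (rule z)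
  then show ?thesis unfolding walters_def using z by (auto intro: tendsto_eventually)
qed

lemma \<phi>_measurable: "\<phi> \<in> borel_measurable BB"
proof -
  have "(\<lambda>y. (y 0, y 1)) \<in> BB \<rightarrow>\<^sub>M count_space UNIV \<Otimes>\<^sub>M count_space UNIV" by measurable
  then have "(\<lambda>y. (y 0, y 1)) \<in> BB \<rightarrow>\<^sub>M count_space UNIV" by (simp add: pair_measure_countable)
  from measurable_compose[OF this, of "\<lambda>(v, w). ln (Q v w / \<pi> w)" borel] show ?thesis
    by (simp add: \<phi>_def[abs_def])
qed

text \<open>Return probabilities are at most 1 and decay at most polynomially, so their exponential
  growth rate is 0.\<close>

lemma pressure_zero:
  assumes low: "\<And>v. \<exists>\<kappa>>0. \<exists>N. \<forall>n\<ge>N. ennreal (\<kappa> / (real n)\<^sup>2) \<le> pp n v v"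
  shows "has_gurevich_pressure UNIV Om \<phi> 0" "gurevich_pressure UNIV Om \<phi> = 0" "growth_rate UNIV Om \<phi> = 1"
proof -
  show G: "has_gurevich_pressure UNIV Om \<phi> 0"
    unfolding has_gurevich_pressure_def
  proof
    fix v
    obtain \<kappa> N where k: "\<kappa> > 0" "\<And>n. n \<ge> N \<Longrightarrow> ennreal (\<kappa> / (real n)\<^sup>2) \<le> pp n v v" using low by blast
    define r where "r n = enn2real (pp n v v)" for n
    have pr: "pp n v v = ennreal (r n)" for n
      using pp_le_1[of n v v] unfolding r_def by (intro ennreal_enn2real[symmetric]) (auto simp: less_top[symmetric] top_unique)
    have r0: "0 \<le> r n" for n by (simp add: r_def)
    have r1: "r n \<le> 1" "0 \<le> r n" for n using pp_le_1[of n v v] r0[of n] unfolding pr by simp_all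
    have rl: "\<kappa> / (real n)\<^sup>2 \<le> r n" if "n \<ge> N" for n
      using k(2)[OF that] r1 by (simp add: pr)
    have "(\<lambda>n. ln (r n) / real n) \<longlonglongrightarrow> 0"
    proof (rule tendsto_sandwich[of "\<lambda>n. ln \<kappa> / real n - 2 * (ln (real n) / real n)" _ _ "\<lambda>_. 0"])
      show "\<forall>\<^sub>F n in sequentially. ln \<kappa> / real n - 2 * (ln (real n) / real n) \<le> ln (r n) / real n"
        using eventually_ge_at_top[of "max N 1"]
      proof eventually_elim
        case (elim n)
        have "ln (\<kappa> / (real n)\<^sup>2) \<le> ln (r n)" using rl[of n] elim k by (intro ln_mono) auto
        moreover have "ln (\<kappa> / (real n)\<^sup>2) = ln \<kappa> - 2 * ln (real n)"
          using elim k by (simp add: ln_div ln_realpow)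
        ultimately have "(ln \<kappa> - 2 * ln (real n)) / real n \<le> ln (r n) / real n" by (intro divide_right_mono) auto
        then show ?case by (simp add: diff_divide_distrib)
      qed
      show "\<forall>\<^sub>F n in sequentially. ln (r n) / real n \<le> 0"
        using eventually_ge_at_top[of "max N 1"]
      proof eventually_elim
        case (elim n)
        have "0 < \<kappa> / (real n)\<^sup>2" using elim k by simp
        then have "0 < r n" using rl[of n] elim by simp
        then show ?case using r1[of n] by (simp add: divide_nonpos_nonneg)
      qed
      have "(\<lambda>n. ln \<kappa> / real n - 2 * (ln (real n) / real n)) \<longlonglongrightarrow> 0 - 2 * 0"
        by (intro tendsto_intros lim_const_over_n lim_ln_over_n)
      then show "(\<lambda>n. ln \<kappa> / real n - 2 * (ln (real n) / real n)) \<longlonglongrightarrow> 0" by simp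
    qed simp
    then have "(\<lambda>n. ereal (ln (r n) / real n)) \<longlonglongrightarrow> 0" by (simp add: zero_ereal_def)
    moreover have "\<forall>\<^sub>F n in sequentially. ereal (ln (r n) / real n) = ext_ln (partition_sum Om \<phi> n v) / ereal (real n)"
      using eventually_ge_at_top[of "max N 1"]
    proof eventually_elim
      case (elim n)
      have "0 < \<kappa> / (real n)\<^sup>2" using elim k by simp
      then have "0 < r n" using rl[of n] elim by simp
      then show ?case using elim by (simp add: partition_sum_eq pr ext_ln_def ennreal_eq_0_iff)
    qed
    ultimately show "(\<lambda>n. ext_ln (partition_sum Om \<phi> n v) / ereal (real n)) \<longlonglongrightarrow> 0"
      by (rule Lim_transform_eventually)
  qed
  show g: "gurevich_pressure UNIV Om \<phi> = 0"
    unfolding gurevich_pressure_def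
  proof (rule the_equality)
    fix P assume "has_gurevich_pressure UNIV Om \<phi> P"
    then show "P = 0" using G LIMSEQ_unique unfolding has_gurevich_pressure_def by blast
  qed (rule G)
  show "growth_rate UNIV Om \<phi> = 1" by (simp add: growth_rate_def g)
qed

lemma cylinder_finite:
  assumes "w \<noteq> []"
  shows "emeasure \<mu> (cylinder Om w) < \<infinity>"
proof -
  obtain v ws where w: "w = v # ws" using assms by (cases w) auto
  have "cylinder Om w \<subseteq> cylinder Om [v]" by (auto simp: w cylinder_Cons[of v ws] cylinder_state)
  then have "emeasure \<mu> (cylinder Om w) \<le> emeasure \<mu> (cylinder Om [v])" by (intro emeasure_mono) simp_all
  also have "\<dots> < \<infinity>" by (simp add: cylinder_state emeasure_state)
  finally show ?thesis .
qed

lemma rpf_one: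
  assumes gr: "growth_rate UNIV Om \<phi> = 1" and cons: "conservative \<mu> left_shift" and inf: "emeasure \<mu> (space \<mu>) = \<infinity>"
  shows "null_recurrent_rpf \<eta> UNIV Om \<phi> (\<lambda>_. 1) \<mu>"
  unfolding null_recurrent_rpf_def gr Let_def
proof (intro conjI allI ballI impI)
  show "continuous_map (shift_topology \<eta> Om) euclideanreal (\<lambda>_. 1)" by simp
  show "emeasure \<mu> (cylinder Om w) < \<infinity>" if "w \<noteq> []" for w using that by (rule cylinder_finite)
  show "(\<integral>\<^sup>+x. ruelle_operator Om \<phi> f x \<partial>\<mu>) = ennreal 1 * (\<integral>\<^sup>+x. f x \<partial>\<mu>)" if "f \<in> borel_measurable \<mu>" for f
    using that nn_integral_ruelle[of f] by (simp cong: measurable_cong_sets)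
  show "(\<integral>\<^sup>+x. ennreal 1 \<partial>\<mu>) = \<infinity>" using inf by simp
qed (use cons ruelle_one in auto)

end

section \<open>From indicators of states to all integrable functions\<close>

locale markov_flow_normalized = markov_flow + 
  fixes a :: "nat \<Rightarrow> real"
  assumes a_top: "filterlim a at_top sequentially"
    and a_Suc: "(\<lambda>n. a (Suc n) / a n) \<longlonglongrightarrow> 1"

sublocale markov_flow_normalized \<subseteq> dual: dual_ergodic_candidate \<mu> left_shift a
  using sigma_finite_\<mu> \<mu>_preserved a_top a_Suc
  by (simp add: dual_ergodic_candidate_def measure_preserving_system_def
      measure_preserving_system_axioms_def dual_ergodic_candidate_axioms_def)

context markov_flow_normalized
begin

text \<open>The abstract operator is matched with the Ruelle operator on nonnegative functions,
  where duality holds in [0, \<infinity>] without integrability questions; a signed test function is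
  split afterwards.\<close>

lemma transfer_ruelle:
  assumes f: "integrable \<mu> f" "\<And>x. 0 \<le> f x" and g [measurable]: "g \<in> borel_measurable BB" and g0: "\<And>x. 0 \<le> g x"
    and eq: "\<And>x. x \<in> Om \<Longrightarrow> ruelle_operator Om \<phi> (\<lambda>x. ennreal (f x)) x = ennreal (g x)"
  shows "integrable \<mu> g" "AE x in \<mu>. dual.op f x = g x"
proof -
  have [measurable]: "f \<in> borel_measurable BB" using f by (simp cong: measurable_cong_sets add: borel_measurable_integrable)
  have dual: "(\<integral>\<^sup>+x. ennreal (f x) * u (left_shift x) \<partial>\<mu>) = (\<integral>\<^sup>+x. ennreal (g x) * u x \<partial>\<mu>)"
    if [measurable]: "u \<in> borel_measurable BB" for u
  proof -
    have "(\<integral>\<^sup>+x. ennreal (f x) * u (left_shift x) \<partial>\<mu>) = (\<integral>\<^sup>+x. ruelle_operator Om \<phi> (\<lambda>x. ennreal (f x)) x * u x \<partial>\<mu>)"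
      by (rule nn_integral_dual) measurable
    also have "\<dots> = (\<integral>\<^sup>+x. ennreal (g x) * u x \<partial>\<mu>)" by (rule nn_integral_cong) (simp add: eq)
    finally show ?thesis .
  qed
  have "(\<integral>\<^sup>+x. ennreal (norm (g x)) \<partial>\<mu>) = (\<integral>\<^sup>+x. ennreal (norm (f x)) \<partial>\<mu>)"
    using dual[of "\<lambda>_. 1"] f g0 by simp
  then show gi: "integrable \<mu> g" using f(1) by (simp add: integrable_iff_bounded)
  have nn: "(LINT x|\<mu>. f x * u (left_shift x)) = (LINT x|\<mu>. g x * u x)"
    if [measurable]: "u \<in> borel_measurable BB" and u0: "\<And>x. 0 \<le> u x" for u
  proof -
    have "(LINT x|\<mu>. f x * u (left_shift x)) = enn2real (\<integral>\<^sup>+x. ennreal (f x * u (left_shift x)) \<partial>\<mu>)"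
      by (rule integral_eq_nn_integral) (auto simp: f u0)
    also have "\<dots> = enn2real (\<integral>\<^sup>+x. ennreal (g x * u x) \<partial>\<mu>)"
      using dual[of "\<lambda>x. ennreal (u x)"] by (simp add: ennreal_mult f g0 u0)
    also have "\<dots> = (LINT x|\<mu>. g x * u x)"
      by (rule integral_eq_nn_integral[symmetric]) (auto simp: g0 u0)
    finally show ?thesis .
  qed
  show "AE x in \<mu>. dual.op f x = g x"
  proof (rule dual.transfer_AE_eqI[OF f(1) gi])
    fix u assume u: "dual.bounded_test u"
    then have um [measurable]: "u \<in> borel_measurable BB" by (simp add: dual.bounded_test_def cong: measurable_cong_sets)
    have b: "dual.bounded_test (\<lambda>x. max 0 (u x))" "dual.bounded_test (\<lambda>x. max 0 (- u x))"
    proof -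
      obtain C where C: "\<And>x. x \<in> space \<mu> \<Longrightarrow> \<bar>u x\<bar> \<le> C" using u by (auto simp: dual.bounded_test_def)
      have le: "\<bar>max 0 t\<bar> \<le> \<bar>t\<bar>" "\<bar>max 0 (- t)\<bar> \<le> \<bar>t\<bar>" for t :: real by (auto simp: max_def)
      show "dual.bounded_test (\<lambda>x. max 0 (u x))" "dual.bounded_test (\<lambda>x. max 0 (- u x))"
        unfolding dual.bounded_test_def
        by (intro conjI exI[of _ C] ballI order_trans[OF le(1) C] order_trans[OF le(2) C]; measurable)+
    qed
    have d: "(LINT x|\<mu>. h x * v x) = (LINT x|\<mu>. h x * max 0 (v x)) - (LINT x|\<mu>. h x * max 0 (- v x))"
      if "integrable \<mu> (\<lambda>x. h x * max 0 (v x))" "integrable \<mu> (\<lambda>x. h x * max 0 (- v x))" for h v :: "(nat \<Rightarrow> nat) \<Rightarrow> real"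
    proof -
      have "(LINT x|\<mu>. h x * v x) = (LINT x|\<mu>. h x * max 0 (v x) - h x * max 0 (- v x))"
        by (intro Bochner_Integration.integral_cong) (auto simp: max_def)
      then show ?thesis using that by simp
    qed
    show "(LINT x|\<mu>. f x * u (left_shift x)) = (LINT x|\<mu>. g x * u x)"
      using d[of f "\<lambda>x. u (left_shift x)"] d[of g u] nn[of "\<lambda>x. max 0 (u x)"] nn[of "\<lambda>x. max 0 (- u x)"]
        dual.integrable_mult_test[OF f(1) dual.bounded_test_comp[OF b(1), of 1]]
        dual.integrable_mult_test[OF f(1) dual.bounded_test_comp[OF b(2), of 1]]
        dual.integrable_mult_test[OF gi b(1)] dual.integrable_mult_test[OF gi b(2)] by simp
  qed
qed

lemma state_measurable: "(\<lambda>x. F (x 0)) \<in> borel_measurable BB"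
  by (rule measurable_compose[OF measurable_coord]) simp

text \<open>On functions of the current state the transfer operator moves densities with respect to
  \<pi> one step forward, which in terms of the flow is a weighted column sum.\<close>

lemma transfer_state:
  assumes F: "integrable \<mu> (\<lambda>x. F (x 0))" "\<And>v. 0 \<le> F v" and G: "\<And>v. 0 \<le> G v"
    and eq: "\<And>w. (\<Sum>v. ennreal (Q v w * F v)) = ennreal (\<pi> w * G w)"
  shows "integrable \<mu> (\<lambda>x. G (x 0))" "AE x in \<mu>. dual.op (\<lambda>x. F (x 0)) x = G (x 0)"
proof -
  have r: "ruelle_operator Om \<phi> (\<lambda>x. ennreal (F (x 0))) x = ennreal (G (x 0))" if "x \<in> Om" for x
  proof -
    let ?w = "x 0"
    have "ruelle_operator Om \<phi> (\<lambda>x. ennreal (F (x 0))) x = (\<Sum>v. ennreal (Q v ?w * F v) * ennreal (1 / \<pi> ?w))"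
      using Q_nonneg F(2) \<pi>_pos[of ?w] by (simp add: ruelle_eq that ennreal_mult[symmetric] less_imp_le)
    also have "\<dots> = ennreal (\<pi> ?w * G ?w) * ennreal (1 / \<pi> ?w)" by (simp add: ennreal_suminf_multc eq)
    also have "\<dots> = ennreal (G ?w)" using \<pi>_pos[of ?w] G by (simp add: ennreal_mult[symmetric] less_imp_le)
    finally show ?thesis .
  qed
  show "integrable \<mu> (\<lambda>x. G (x 0))" "AE x in \<mu>. dual.op (\<lambda>x. F (x 0)) x = G (x 0)"
    using transfer_ruelle[OF F(1) F(2) state_measurable G r] by auto
qed

lemma integrable_indicator_finite:
  assumes "A \<in> sets BB" "emeasure \<mu> A < \<infinity>"
  shows "integrable \<mu> (indicator A :: _ \<Rightarrow> real)"
proof -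
  have "A \<subseteq> space \<mu>" using sets.sets_into_space[of A \<mu>] assms by simp
  then show ?thesis using assms by (subst integrable_indicator_iff) (auto simp: Int_absorb2)
qed

lemma transfer_cylinder:
  "AE x in \<mu>. dual.op (indicator (cylinder Om (v # w # ws))) x = Q v w / \<pi> w * indicator (cylinder Om (w # ws)) x"
proof (rule transfer_ruelle(2))
  show "integrable \<mu> (indicator (cylinder Om (v # w # ws)) :: _ \<Rightarrow> real)"
    by (intro integrable_indicator_finite cylinder_finite) auto
  show "0 \<le> Q v w / \<pi> w * indicator (cylinder Om (w # ws)) x" for x
    using Q_nonneg \<pi>_pos[of w] by (simp add: less_imp_le)
  show "ruelle_operator Om \<phi> (\<lambda>x. ennreal (indicator (cylinder Om (v # w # ws)) x)) x
      = ennreal (Q v w / \<pi> w * indicator (cylinder Om (w # ws)) x)" if "x \<in> Om" for x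
    using ruelle_cylinder[OF that, of v w ws] Q_nonneg \<pi>_pos[of w]
    by (simp add: ennreal_indicator ennreal_mult' less_imp_le split: split_indicator)
qed simp_all

text \<open>Cylinders follow by induction on the word, since the transfer operator strips the first
  symbol up to a constant. Disjoint unions follow from closedness in L1, all Borel sets inside one
  [v] from the pi-lambda theorem, sets of finite measure by splitting over states, and integrable
  functions by approximation.\<close>

lemma dual_convergent_all:
  assumes e: "dual.dual_convergent e" "AE x in \<mu>. 0 \<le> e x" "AE x in \<mu>. \<exists>j. 0 < (dual.op ^^ j) e x"
    and state: "\<And>v. dual.dual_convergent (indicator (cylinder Om [v]))"
    and f: "integrable \<mu> f"
  shows "dual.dual_convergent f"
proof -
  note closed = dual.dual_convergent_closed[OF e]
  have lin: "dual.dual_convergent (\<lambda>x. c * f x + d * g x)"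
    if "dual.dual_convergent f" "dual.dual_convergent g" for f g c d
    by (rule dual.dual_convergent_linear[OF that])
  have zero: "dual.dual_convergent (\<lambda>_. 0)" using lin[OF state state, of 0 0 0 0] by simp
  have cyl: "dual.dual_convergent (indicator (cylinder Om (v # ws)))" for v ws
  proof (induction ws arbitrary: v)
    case (Cons w ws)
    have i: "integrable \<mu> (indicator (cylinder Om (v # w # ws)) :: _ \<Rightarrow> real)"
      by (intro integrable_indicator_finite cylinder_finite) auto
    have "dual.dual_convergent (\<lambda>x. Q v w / \<pi> w * indicator (cylinder Om (w # ws)) x + 0 * indicator (cylinder Om (w # ws)) x)"
      by (intro lin Cons)
    then have "dual.dual_convergent (\<lambda>x. Q v w / \<pi> w * indicator (cylinder Om (w # ws)) x)" by simp
    then have "dual.dual_convergent (dual.op (indicator (cylinder Om (v # w # ws))))"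
      by (rule dual.dual_convergent_AE_cong[OF _ dual.transfer_spec(1)[OF i]])
        (use transfer_cylinder[of v w ws] in \<open>auto elim!: eventually_mono\<close>)
    then show ?case by (simp only: dual.dual_convergent_transfer_iff[OF i])
  qed (rule state)
  have disj_union: "dual.dual_convergent (indicator (\<Union>i. A i))"
    if A: "\<And>i. A i \<in> sets BB" "disjoint_family A" "emeasure \<mu> (\<Union>i. A i) < \<infinity>"
      and g: "\<And>i. dual.dual_convergent (indicator (A i))" for A :: "nat \<Rightarrow> _"
  proof (rule closed)
    have fin: "emeasure \<mu> (A i) < \<infinity>" for i
      using A by (intro le_less_trans[OF emeasure_mono A(3)]) auto
    show "integrable \<mu> (indicator (\<Union>i. A i) :: _ \<Rightarrow> real)" using A by (intro integrable_indicator_finite) auto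
    fix r :: real assume "0 < r"
    have s: "(\<lambda>i. measure \<mu> (A i)) sums measure \<mu> (\<Union>i. A i)"
      using A by (intro measure_UNION) auto
    from suminf_exist_split[OF \<open>0 < r\<close> sums_summable[OF s]]
    obtain n where n: "norm (\<Sum>i. measure \<mu> (A (i + n))) < r" by blast
    have partial: "dual.dual_convergent (\<lambda>x. \<Sum>i<m. indicator (A i) x)" for m
    proof (induction m)
      case (Suc m)
      from lin[OF this g, of 1 1 m] show ?case by simp
    qed (simp add: zero)
    have eq: "\<bar>indicator (\<Union>i. A i) x - (\<Sum>i<n. indicator (A i) x)\<bar> = (indicator (\<Union>i. A (i + n)) x :: real)" for x
    proof (cases "\<exists>i. x \<in> A i")
      case True
      then obtain i where i: "x \<in> A i" by blast
      have only: "x \<in> A j \<longleftrightarrow> j = i" for j using A(2) i by (auto simp: disjoint_family_on_def)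
      have "(\<Sum>j<n. indicator (A j) x) = (\<Sum>j<n. if j = i then 1 else 0 :: real)"
        by (intro sum.cong) (auto simp: only indicator_def)
      moreover have "(\<exists>j. j + n = i) \<longleftrightarrow> \<not> i < n" by (auto simp: le_iff_add not_less add.commute)
      ultimately show ?thesis by (auto simp: indicator_def only)
    qed (auto simp: indicator_def)
    have "(LINT x|\<mu>. \<bar>indicator (\<Union>i. A i) x - (\<Sum>i<n. indicator (A i) x)\<bar>) = measure \<mu> (\<Union>i. A (i + n))"
    proof -
      have "(\<Union>i. A (i + n)) \<subseteq> space \<mu>" using A(1) sets.sets_into_space[of _ \<mu>] by fastforce
      then show ?thesis unfolding eq by (simp add: Int_absorb2)
    qed
    also have "\<dots> = (\<Sum>i. measure \<mu> (A (i + n)))"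
    proof (rule sums_unique, rule measure_UNION)
      show "disjoint_family (\<lambda>i. A (i + n))" using A(2) by (auto simp: disjoint_family_on_def)
      have "emeasure \<mu> (\<Union>i. A (i + n)) \<le> emeasure \<mu> (\<Union>i. A i)" using A(1) by (intro emeasure_mono) auto
      then show "emeasure \<mu> (\<Union>i. A (i + n)) \<noteq> \<infinity>" using A(3) by (auto simp: top_unique)
    qed (use A in auto)
    also have "\<dots> < r" using n by simp
    finally show "\<exists>g. dual.dual_convergent g \<and> (LINT x|\<mu>. \<bar>indicator (\<Union>i. A i) x - g x\<bar>) < r"
      using partial by blast
  qed
  \<comment> \<open>Restricting to [v] keeps every set in the induction of finite measure, so
    complements stay integrable.\<close>
  have sub: "dual.dual_convergent (indicator (A \<inter> cylinder Om [v]))" if "A \<in> sets BB" for A v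
  proof -
    have "Int_stable (insert {} (range (cylinder Om)))"
    proof (rule Int_stableI)
      have key: "cylinder Om w \<inter> cylinder Om w' \<in> insert {} (range (cylinder Om))" if "length w \<le> length w'" for w w' :: "nat list"
      proof (cases "cylinder Om w \<inter> cylinder Om w' = {}")
        case False
        then obtain z where z: "z \<in> cylinder Om w" "z \<in> cylinder Om w'" by blast
        have "cylinder Om w' \<subseteq> cylinder Om w" using z that by (auto simp: cylinder_def)
        then have "cylinder Om w \<inter> cylinder Om w' = cylinder Om w'" by blast
        then show ?thesis by auto
      qed simp
      fix a b assume "a \<in> insert {} (range (cylinder Om))" "b \<in> insert {} (range (cylinder Om))"
      then show "a \<inter> b \<in> insert {} (range (cylinder Om))"
      proof (elim insertE imageE)
        fix w w' assume "a = cylinder Om w" "b = cylinder Om w'"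
        then show ?thesis using key[of w w'] key[of w' w] by (cases "length w \<le> length w'") (auto simp: Int_commute)
      qed auto
    qed
    moreover have "insert {} (range (cylinder Om)) \<subseteq> Pow Om" by (auto simp: cylinder_def)
    moreover have "A \<in> sigma_sets Om (insert {} (range (cylinder Om)))"
    proof -
      have "A \<in> sigma_sets Om (range (cylinder Om))" using that sets_shift_borel_cylinders[OF eta, of Om] by simp
      then show ?thesis using sigma_sets_mono'[of "range (cylinder Om)" "insert {} (range (cylinder Om))" Om] by blast
    qed
    ultimately show ?thesis
    proof (induction rule: sigma_sets_induct_disjoint)
      case (basic B)
      then consider "B = {}" | "B = Om" | ws u where "B = cylinder Om (u # ws)"
      proof -
        assume r: "B = {} \<Longrightarrow> thesis" "B = Om \<Longrightarrow> thesis" "\<And>u ws. B = cylinder Om (u # ws) \<Longrightarrow> thesis"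
        show thesis
        proof (cases "B = {}")
          case False
          then obtain w where w: "B = cylinder Om w" using basic by auto
          show thesis
          proof (cases w)
            case Nil
            then show thesis using w r(2) by (simp add: cylinder_def)
          qed (use w r(3) in blast)
        qed (rule r(1))
      qed
      then show ?case
      proof cases
        case 1
        then show ?thesis using zero by (simp add: indicator_def)
      next
        case 2
        then have "B \<inter> cylinder Om [v] = cylinder Om [v]" by (auto simp: cylinder_def)
        then show ?thesis using state by simp
      next
        case 3
        show ?thesis
        proof (cases "u = v")
          case True
          then have "B \<inter> cylinder Om [v] = cylinder Om (u # ws)" using 3 by (auto simp: cylinder_Cons[of v ws] cylinder_state)
          then show ?thesis using cyl by simp
        next
          case False
          then have "B \<inter> cylinder Om [v] = {}" using 3 by (auto simp: cylinder_Cons[of u ws] cylinder_state)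
          then show ?thesis using zero by (simp add: indicator_def)
        qed
      qed
    next
      case empty
      then show ?case using zero by (simp add: indicator_def)
    next
      case (compl B)
      have "indicator ((Om - B) \<inter> cylinder Om [v]) = (\<lambda>x. 1 * indicator (cylinder Om [v]) x + (-1) * indicator (B \<inter> cylinder Om [v]) x :: real)"
        by (auto simp: indicator_def fun_eq_iff cylinder_def)
      then show ?case using lin[OF state compl(2), of 1 v "-1"] by simp
    next
      case (union B)
      have sB: "B i \<in> sets BB" for i
      proof -
        have "insert {} (range (cylinder Om)) \<subseteq> sets BB" using sets_cyl by blast
        from sets.sigma_sets_subset[OF this]
        have "sigma_sets Om (insert {} (range (cylinder Om))) \<subseteq> sets BB" by (simp add: space_shift_borel eta)
        then show ?thesis using union(2) by auto
      qed
      have e: "(\<Union>i. B i) \<inter> cylinder Om [v] = (\<Union>i. B i \<inter> cylinder Om [v])" by blast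
      show ?case unfolding e
      proof (rule disj_union)
        show "disjoint_family (\<lambda>i. B i \<inter> cylinder Om [v])" using union(1) by (auto simp: disjoint_family_on_def)
        show "emeasure \<mu> (\<Union>i. B i \<inter> cylinder Om [v]) < \<infinity>"
          by (rule le_less_trans[OF emeasure_mono cylinder_finite[of "[v]"]]) auto
      qed (use sB union(3) in auto)
    qed
  qed
  have sets_ok: "dual.dual_convergent (indicator A)" if A: "A \<in> sets BB" "emeasure \<mu> A < \<infinity>" for A
  proof -
    have "A = (\<Union>v. A \<inter> cylinder Om [v])"
      using sets.sets_into_space[OF A(1)] by (auto simp: cylinder_state space_shift_borel eta)
    moreover have "dual.dual_convergent (indicator (\<Union>v. A \<inter> cylinder Om [v]))"
    proof (rule disj_union)
      show "disjoint_family (\<lambda>v. A \<inter> cylinder Om [v])" by (auto simp: disjoint_family_on_def cylinder_state)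
      show "emeasure \<mu> (\<Union>v. A \<inter> cylinder Om [v]) < \<infinity>"
        by (rule le_less_trans[OF emeasure_mono A(2)]) (use A in auto)
    qed (use A sub in auto)
    ultimately show ?thesis by simp
  qed
  show ?thesis using f
  proof (induction rule: integrable_induct)
    case (base A c)
    have "dual.dual_convergent (indicator A)" using base by (intro sets_ok) auto
    from lin[OF this this, of c 0] show ?case by (simp add: mult.commute)
  next
    case (add f g)
    from lin[OF add(3,4), of 1 1] show ?case by simp
  next
    case (lim f s)
    show ?case
    proof (rule closed[OF lim(4)])
      fix r :: real assume "0 < r"
      have "(\<lambda>i. LINT x|\<mu>. \<bar>f x - s i x\<bar>) \<longlonglongrightarrow> (LINT x|\<mu>. 0)"
      proof (rule integral_dominated_convergence[where w = "\<lambda>x. 3 * \<bar>f x\<bar>"])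
        show "AE x in \<mu>. (\<lambda>i. \<bar>f x - s i x\<bar>) \<longlonglongrightarrow> 0"
        proof (rule AE_I2)
          fix x assume "x \<in> space \<mu>"
          from tendsto_rabs[OF tendsto_diff[OF tendsto_const lim(2)[OF this], of "f x"]]
          show "(\<lambda>i. \<bar>f x - s i x\<bar>) \<longlonglongrightarrow> 0" by simp
        qed
        show "AE x in \<mu>. norm \<bar>f x - s i x\<bar> \<le> 3 * \<bar>f x\<bar>" for i
          using lim(3)[of _ i] by (intro AE_I2) force
        show "(\<lambda>x. \<bar>f x - s i x\<bar>) \<in> borel_measurable \<mu>" for i using lim(1)[of i] lim(4) by auto
        show "integrable \<mu> (\<lambda>x. 3 * \<bar>f x\<bar>)" using lim(4) by simp
      qed simp
      then have "\<forall>\<^sub>F i in sequentially. (LINT x|\<mu>. \<bar>f x - s i x\<bar>) < r"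
        by (rule order_tendstoD(2)) (use \<open>0 < r\<close> in simp)
      then obtain i where "(LINT x|\<mu>. \<bar>f x - s i x\<bar>) < r" unfolding eventually_sequentially by blast
      then show "\<exists>g. dual.dual_convergent g \<and> (LINT x|\<mu>. \<bar>f x - g x\<bar>) < r" using lim(5)[of i] by blast
    qed
  qed
qed

end

section \<open>The excursion chain\<close>

text \<open>The states will be coded by natural numbers, descent states by even and the other ray
  states by odd ones; sums over all states then split accordingly.\<close>

lemma suminf_even_odd: "(\<Sum>n. g n) = (\<Sum>m. g (2 * m)) + (\<Sum>j. g (2 * j + 1))" for g :: "nat \<Rightarrow> ennreal"
proof -
  have ev: "bij_betw (\<lambda>m. 2 * m) (UNIV :: nat set) {n. even n}"
    by (rule bij_betwI[where g = "\<lambda>n. n div 2"]) auto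
  have od: "bij_betw (\<lambda>m. 2 * m + 1) (UNIV :: nat set) {n. odd n}"
    by (rule bij_betwI[where g = "\<lambda>n. n div 2"]) auto
  have "(\<Sum>n. g n) = infsum g ({n. even n} \<union> {n. odd n})"
  proof -
    have "{n. even n} \<union> {n. odd n} = (UNIV :: nat set)" by auto
    then show ?thesis by (simp add: infsum_ennreal_eq_suminf)
  qed
  also have "\<dots> = infsum g {n. even n} + infsum g {n. odd n}"
    by (intro infsum_Un_disjoint nonneg_summable_on_complete) auto
  also have "infsum g {n. even n} = (\<Sum>m. g (2 * m))"
    by (subst infsum_reindex_bij_betw[OF ev, symmetric]) (rule infsum_ennreal_eq_suminf)
  also have "infsum g {n. odd n} = (\<Sum>j. g (2 * j + 1))"
    by (subst infsum_reindex_bij_betw[OF od, symmetric]) (rule infsum_ennreal_eq_suminf)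
  finally show ?thesis .
qed

text \<open>The ray \<open>S\<close> is climbed from the base state \<open>0\<close>; leaving it at \<open>S k\<close> for \<open>D m\<close>, the chain descends
  deterministically to \<open>D 0 = S 0 = 0\<close>.\<close>

definition S :: "nat \<Rightarrow> nat" where "S k = (if k = 0 then 0 else 2 * k - 1)"
definition D :: "nat \<Rightarrow> nat" where "D m = 2 * m"

lemma S_0 [simp]: "S 0 = 0" and D_0 [simp]: "D 0 = 0"
  by (simp_all add: S_def D_def)

lemma S_Suc: "S (Suc j) = 2 * j + 1"
  by (simp add: S_def)

lemma S_inj [simp]: "S j = S k \<longleftrightarrow> j = k"
  by (cases j; cases k) (auto simp: S_def)

lemma D_inj [simp]: "D j = D k \<longleftrightarrow> j = k"
  by (simp add: D_def)

lemma S_neq_D [simp]: "S (Suc j) \<noteq> D m" "D m \<noteq> S (Suc j)"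
  unfolding S_Suc D_def by presburger+

lemma S_eq_0_iff [simp]: "S k = 0 \<longleftrightarrow> k = 0" and D_eq_0_iff [simp]: "D m = 0 \<longleftrightarrow> m = 0"
  by (simp_all add: S_def D_def)

lemma state_cases [case_names ray descent]:
  obtains k where "v = S k" | m where "v = D (Suc m)"
proof (cases "even v")
  case True
  then obtain m where "v = 2 * m" by blast
  then show thesis using that(1)[of 0] that(2)[of "m - 1"] by (cases m) (auto simp: D_def)
next
  case False
  then obtain j where "v = 2 * j + 1" using oddE by blast
  then have "v = S (Suc j)" by (simp add: S_Suc)
  then show thesis using that by blast
qed

lemma state_cases' [case_names descent ray]:
  obtains m where "v = D m" | j where "v = S (Suc j)"
proof (cases v rule: state_cases)
  case (ray k)
  then show thesis using that(1)[of 0] that(2) by (cases k) auto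
qed (rule that(1))

lemma suminf_states: "(\<Sum>v. g v) = (\<Sum>m. g (D m)) + (\<Sum>j. g (S (Suc j)))" for g :: "nat \<Rightarrow> ennreal"
  by (subst suminf_even_odd) (simp add: D_def S_Suc)

lemma suminf_split_0: "(\<Sum>n. g n) = g 0 + (\<Sum>n. g (Suc n))" for g :: "nat \<Rightarrow> ennreal"
proof -
  have "(\<lambda>n. g (Suc n)) sums (\<Sum>n. g (Suc n))" by (intro summable_sums summableI)
  then have "g sums ((\<Sum>n. g (Suc n)) + g 0)" by (rule sums_Suc)
  then show ?thesis by (simp add: sums_iff add.commute)
qed

lemma suminf_states': "(\<Sum>v. g v) = (\<Sum>k. g (S k)) + (\<Sum>m. g (D (Suc m)))" for g :: "nat \<Rightarrow> ennreal"
  by (simp add: suminf_states[of g] suminf_split_0[of "\<lambda>m. g (D m)"] suminf_split_0[of "\<lambda>k. g (S k)"] ac_simps)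

locale excursion_chain = regularly_varying_seq a \<alpha> for a \<alpha> +
  fixes w :: "(nat \<times> nat) pmf" and \<eta> :: real
  assumes eta01: "0 < \<eta>" "\<eta> < 1"
    and exit_pos: "\<And>n. measure w {(k, m). n \<le> k} > 0"
    and jump_pos: "\<exists>m0. \<forall>m\<ge>m0. pmf w (0, m) > 0"
    and return_lower: "\<exists>\<kappa>>0. \<exists>N. \<forall>n\<ge>N. \<kappa> / (real n)\<^sup>2 \<le> measure w {(k, m). k + m + 1 = n}"
    and return_tail: "(\<lambda>n. a n * measure w {(k, m). n < k + m + 1}) \<longlonglongrightarrow> sin (pi * \<alpha>) / (pi * \<alpha>)"
begin

definition "\<theta> k m = pmf w (k, m)"
definition "b n = measure w {(k, m). n \<le> k}"
definition "d n = measure w {(k, m). n \<le> m}"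
definition "ret n = measure w {(k, m). k + m + 1 = n}"
definition "ret_tail n = measure w {(k, m). n < k + m + 1}"
text \<open>The probability that the first excursion from state 0 is at D m at time i: it enters the
  descent at D m' at time k + 1 and reaches D m after m' - m further steps.\<close>

definition "hit m i = measure w {(k, m'). m \<le> m' \<and> k + m' + 1 = i + m}"

text \<open>The expected number of visits to v during one excursion, the usual invariant measure of
  a recurrent chain normalized to mass 1 at state 0.\<close>

definition "wt v = (if even v then d (v div 2) else b ((v + 1) div 2))"
text \<open>A state that is 0 or odd is S ((v + 1) div 2), the other even ones are D (v div 2).
  State 0 thus follows the ray rule as a source and the descent rule as a target.\<close>

definition "Q v s = (if v = 0 \<or> odd v
   then (if even s then \<theta> ((v + 1) div 2) (s div 2)
         else if (s + 1) div 2 = (v + 1) div 2 + 1 then b ((s + 1) div 2) else 0)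
   else (if s + 2 = v then d (v div 2) else 0))" for v s :: nat

lemma b_0: "b 0 = 1" and d_0: "d 0 = 1"
  by (simp_all add: b_def d_def measure_pmf.prob_space[simplified] case_prod_beta')

lemma wt_S: "wt (S k) = b k" and wt_D: "wt (D m) = d m"
  by (cases k) (simp_all add: wt_def S_def D_def b_0 d_0)

lemma Q_S_D: "Q (S k) (D m) = \<theta> k m"
  by (cases k) (simp_all add: Q_def S_def D_def)

lemma Q_S_S: "Q (S k) (S (Suc j)) = (if j = k then b (Suc k) else 0)"
  by (cases k) (auto simp: Q_def S_def)

lemma Q_D_D: "Q (D (Suc m)) (D j) = (if j = m then d (Suc m) else 0)"
  by (auto simp: Q_def D_def)

lemma Q_D_S: "Q (D (Suc m)) (S (Suc j)) = 0"
proof -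
  have "S (Suc j) + 2 \<noteq> D (Suc m)" unfolding S_Suc D_def by presburger
  then show ?thesis by (simp add: Q_def D_def)
qed

lemma b_pos: "b n > 0"
  using exit_pos by (simp add: b_def)

lemma \<theta>_nonneg: "0 \<le> \<theta> k m"
  by (simp add: \<theta>_def)

lemma d_pos: "d m > 0"
proof -
  obtain m0 where m0: "\<And>m. m \<ge> m0 \<Longrightarrow> pmf w (0, m) > 0" using jump_pos by blast
  have "0 < pmf w (0, max m m0)" by (rule m0) simp
  also have "\<dots> = measure w {(0, max m m0)}" by (simp add: measure_pmf_single)
  also have "\<dots> \<le> d m" unfolding d_def by (intro measure_pmf.finite_measure_mono) auto
  finally show ?thesis .
qed

lemma sum_\<theta>_row: "(\<Sum>m. ennreal (\<theta> k m)) = ennreal (measure w {(k', m). k' = k})"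
proof -
  have e: "{(k', m). k' = k} = (\<Union>m. {(k, m)})" by auto
  have "emeasure w (\<Union>m. {(k, m)}) = (\<Sum>m. emeasure w {(k, m)})"
    by (intro suminf_emeasure[symmetric]) (auto simp: disjoint_family_on_def)
  then show ?thesis unfolding e measure_pmf.emeasure_eq_measure[symmetric] by (simp add: \<theta>_def emeasure_pmf_single)
qed

lemma sum_\<theta>_col: "(\<Sum>k. ennreal (\<theta> k m)) = ennreal (measure w {(k, m'). m' = m})"
proof -
  have e: "{(k, m'). m' = m} = (\<Union>k. {(k, m)})" by auto
  have "emeasure w (\<Union>k. {(k, m)}) = (\<Sum>k. emeasure w {(k, m)})"
    by (intro suminf_emeasure[symmetric]) (auto simp: disjoint_family_on_def)
  then show ?thesis unfolding e measure_pmf.emeasure_eq_measure[symmetric] by (simp add: \<theta>_def emeasure_pmf_single)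
qed

lemma b_rec: "b k = measure w {(k', m). k' = k} + b (Suc k)"
proof -
  have "{(k', m). k \<le> k'} = {(k', m). k' = k} \<union> {(k', m::nat). Suc k \<le> k'}" by auto
  then show ?thesis unfolding b_def by (simp only:) (intro measure_pmf.finite_measure_Union, auto)
qed

lemma d_rec: "d m = measure w {(k, m'). m' = m} + d (Suc m)"
proof -
  have "{(k, m'). m \<le> m'} = {(k, m'). m' = m} \<union> {(k::nat, m'). Suc m \<le> m'}" by auto
  then show ?thesis unfolding d_def by (simp only:) (intro measure_pmf.finite_measure_Union, auto)
qed

text \<open>Row sums balance by \<open>b_rec\<close>, as the mass at S k either leaves the ray or
  climbs; column sums balance by \<open>d_rec\<close>, as D m is entered from the ray or from D (Suc
  m).\<close>

lemma markov: "markov_flow Q wt \<eta>"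
proof
  show "0 \<le> Q v w" for v w by (simp add: Q_def \<theta>_def b_def d_def)
  show "0 < wt v" for v by (simp add: wt_def b_pos d_pos)
  show "(\<Sum>w. ennreal (Q v w)) = ennreal (wt v)" for v
  proof (cases v rule: state_cases)
    case (ray k)
    have "(\<Sum>w. ennreal (Q v w)) = ennreal (measure w {(k', m). k' = k}) + (\<Sum>j. if j = k then ennreal (b (Suc k)) else 0)"
      unfolding ray suminf_states[of "\<lambda>s. ennreal (Q (S k) s)"] Q_S_D Q_S_S sum_\<theta>_row
      by (intro arg_cong2[where f = "(+)"] refl arg_cong[where f = suminf] ext) auto
    also have "\<dots> = ennreal (b k)"
      unfolding suminf_delta b_rec[of k] using b_pos[of "Suc k"] by simp
    finally show ?thesis by (simp add: ray wt_S)
  next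
    case (descent m)
    have "(\<Sum>w. ennreal (Q v w)) = (\<Sum>j. if j = m then ennreal (d (Suc m)) else 0) + (\<Sum>j :: nat. 0)"
      unfolding descent suminf_states[of "\<lambda>s. ennreal (Q (D (Suc m)) s)"] Q_D_D Q_D_S
      by (intro arg_cong2[where f = "(+)"] refl arg_cong[where f = suminf] ext) auto
    also have "\<dots> = ennreal (wt v)" by (simp add: suminf_delta descent wt_D)
    finally show ?thesis .
  qed
  show "(\<Sum>v. ennreal (Q v u)) = ennreal (wt u)" for u
  proof (cases u rule: state_cases')
    case (descent m)
    have "(\<Sum>v. ennreal (Q v u)) = ennreal (measure w {(k, m'). m' = m}) + (\<Sum>j. if j = m then ennreal (d (Suc m)) else 0)"
      unfolding descent suminf_states'[of "\<lambda>v. ennreal (Q v (D m))"] Q_S_D Q_D_D sum_\<theta>_col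
      by (intro arg_cong2[where f = "(+)"] refl arg_cong[where f = suminf] ext) auto
    also have "\<dots> = ennreal (d m)"
      unfolding suminf_delta d_rec[of m] using d_pos[of "Suc m"] by simp
    finally show ?thesis by (simp add: descent wt_D)
  next
    case (ray j)
    have "(\<Sum>v. ennreal (Q v u)) = (\<Sum>k. if k = j then ennreal (b (Suc j)) else 0)"
    proof -
      have "(\<Sum>k. ennreal (if j = k then b (Suc k) else 0)) = (\<Sum>k. if k = j then ennreal (b (Suc j)) else 0)"
        by (intro arg_cong[where f = suminf] ext) auto
      then show ?thesis unfolding ray suminf_states'[of "\<lambda>v. ennreal (Q v (S (Suc j)))"] Q_S_S Q_D_S by simp
    qed
    also have "\<dots> = ennreal (wt u)" unfolding suminf_delta by (simp add: ray wt_S)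
    finally show ?thesis .
  qed
qed (use eta01 in auto)

lemma a_Suc_ratio: "(\<lambda>n. a (n + j) / a n) \<longlonglongrightarrow> 1"
proof -
  have "(\<lambda>n. real (n + j) / real n) \<longlonglongrightarrow> 1"
  proof -
    have "(\<lambda>n. 1 + real j / real n) \<longlonglongrightarrow> 1 + 0"
      by (intro tendsto_add tendsto_const lim_const_over_n)
    moreover have "\<forall>\<^sub>F n in sequentially. 1 + real j / real n = real (n + j) / real n"
      using eventually_ge_at_top[of 1] by eventually_elim (simp add: field_simps)
    ultimately show ?thesis using Lim_transform_eventually by fastforce
  qed
  from tendsto_ratio[OF this] show ?thesis by simp
qed

end

sublocale excursion_chain \<subseteq> markov_flow_normalized Q wt \<eta> a
  using markov filterlim_a a_Suc_ratio[of 1]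
  by (simp add: markov_flow_normalized_def markov_flow_normalized_axioms_def)

section \<open>The renewal sequence and the evolution of the chain from state 0\<close>

context excursion_chain
begin

fun u :: "nat \<Rightarrow> real" where
  "u 0 = 1"
| "u (Suc n) = (\<Sum>i\<le>n. ret (Suc i) * u (n - i))"

lemma u_nonneg: "0 \<le> u n"
  by (induction n rule: less_induct) (case_tac x, auto simp: ret_def intro!: sum_nonneg mult_nonneg_nonneg)

lemma ret_tail_rec: "ret_tail n = ret (Suc n) + ret_tail (Suc n)"
proof -
  have "{(k, m). n < k + m + 1} = {(k, m). k + m + 1 = Suc n} \<union> {(k, m). Suc n < k + m + 1}" by auto
  then show ?thesis unfolding ret_def ret_tail_def
    by (simp only:) (intro measure_pmf.finite_measure_Union, auto)
qed

lemma ret_tail_0: "ret_tail 0 = 1"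
  by (simp add: ret_tail_def measure_pmf.prob_space[simplified] case_prod_beta')

text \<open>Decomposition by the last visit to state 0 up to time n.\<close>

lemma renewal_identity: "(\<Sum>k\<le>n. u k * ret_tail (n - k)) = 1"
proof (induction n)
  case (Suc n)
  have rev: "(\<Sum>k\<le>n. u k * ret (Suc (n - k))) = u (Suc n)"
    unfolding u.simps(2) by (rule sum.reindex_bij_witness[of _ "\<lambda>i. n - i" "\<lambda>i. n - i"]) auto
  have "(\<Sum>k\<le>Suc n. u k * ret_tail (Suc n - k)) = u (Suc n) + (\<Sum>k\<le>n. u k * ret_tail (Suc (n - k)))"
    by (simp add: ret_tail_0 Suc_diff_le)
  also have "(\<Sum>k\<le>n. u k * ret_tail (Suc (n - k))) = (\<Sum>k\<le>n. u k * ret_tail (n - k) - u k * ret (Suc (n - k)))"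
  proof (rule sum.cong[OF refl])
    fix k
    show "u k * ret_tail (Suc (n - k)) = u k * ret_tail (n - k) - u k * ret (Suc (n - k))"
      using ret_tail_rec[of "n - k"] by (simp add: algebra_simps)
  qed
  also have "\<dots> = 1 - u (Suc n)" by (simp only: sum_subtractf Suc rev)
  finally show ?case by simp
qed (simp add: ret_tail_0)

lemma ret_tail_nonneg: "0 \<le> ret_tail n"
  by (simp add: ret_tail_def)

lemma u_le_1: "u n \<le> 1"
proof -
  have "u n * ret_tail (n - n) \<le> (\<Sum>k\<le>n. u k * ret_tail (n - k))"
    by (rule member_le_sum[of n "{..n}" "\<lambda>k. u k * ret_tail (n - k)"])
      (auto intro!: mult_nonneg_nonneg u_nonneg ret_tail_nonneg)
  then show ?thesis by (simp add: renewal_identity ret_tail_0)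
qed

definition "U n = (\<Sum>k<n. u k)"

lemma U_mono: "m \<le> n \<Longrightarrow> U m \<le> U n"
  unfolding U_def by (intro sum_mono2) (auto intro: u_nonneg)

lemma U_nonneg: "0 \<le> U n"
  unfolding U_def by (intro sum_nonneg u_nonneg)

text \<open>A fixed shift of the index does not change the asymptotics, by regular variation. The
  shift is needed because S j is occupied exactly j steps after a visit to state 0.\<close>

lemma U_asymp_shift: "(\<lambda>n. U (n - j) / a n) \<longlonglongrightarrow> 1"
proof -
  have "(\<lambda>n. (\<Sum>k\<le>n. u k) / a n) \<longlonglongrightarrow> 1"
    using renewal_partial_sums[of ret_tail u] return_tail renewal_identity u_nonneg u_le_1 ret_tail_nonneg
    by (simp add: ret_tail_def[abs_def])
  then have "(\<lambda>n. U (Suc n) / a n) \<longlonglongrightarrow> 1" by (simp add: U_def lessThan_Suc_atMost)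
  then have "(\<lambda>n. (U (Suc n) / a n) * inverse (a (n + Suc j) / a n)) \<longlonglongrightarrow> 1 * inverse 1"
    by (intro tendsto_mult tendsto_inverse a_Suc_ratio) auto
  then have "(\<lambda>n. (U (Suc n) / a n) * inverse (a (n + Suc j) / a n)) \<longlonglongrightarrow> 1" by simp
  moreover have "\<forall>\<^sub>F n in sequentially. (U (Suc n) / a n) * inverse (a (n + Suc j) / a n) = U (n + Suc j - j) / a (n + Suc j)"
    using eventually_ge_at_top[of 1]
  proof eventually_elim
    case (elim n)
    then show ?case using a_pos[of n] by (simp add: divide_inverse)
  qed
  ultimately have "(\<lambda>n. U (n + Suc j - j) / a (n + Suc j)) \<longlonglongrightarrow> 1" by (rule Lim_transform_eventually)
  then show ?thesis by (rule LIMSEQ_offset[where k = "Suc j"])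
qed

lemma hit_sums: "hit m sums d m"
proof -
  have e: "{(k :: nat, m'). m \<le> m'} = (\<Union>i. {(k, m'). m \<le> m' \<and> k + m' + 1 = i + m})"
  proof (intro equalityI subsetI)
    fix x assume "x \<in> {(k :: nat, m'). m \<le> m'}"
    then obtain k m' where x: "x = (k, m')" "m \<le> m'" by auto
    then have "x \<in> {(k, m'). m \<le> m' \<and> k + m' + 1 = (k + m' + 1 - m) + m}" by auto
    then show "x \<in> (\<Union>i. {(k, m'). m \<le> m' \<and> k + m' + 1 = i + m})" by blast
  qed auto
  have "(\<lambda>i. measure w {(k, m'). m \<le> m' \<and> k + m' + 1 = i + m}) sums measure w (\<Union>i. {(k, m'). m \<le> m' \<and> k + m' + 1 = i + m})"
    by (intro measure_pmf.finite_measure_UNION) (auto simp: disjoint_family_on_def)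
  then show ?thesis unfolding d_def hit_def[abs_def] e .
qed

lemma hit_0: "hit m 0 = 0"
proof -
  have "{(k, m'). m \<le> m' \<and> k + m' + 1 = 0 + m} = {}" by auto
  then show ?thesis unfolding hit_def by (simp only: measure_empty)
qed

text \<open>D m is entered either from D (Suc m) or by leaving the ray at S i, which happens at time
  i + 1.\<close>

lemma hit_rec: "hit m (Suc i) = hit (Suc m) i + \<theta> i m"
proof -
  have "{(k, m'). m \<le> m' \<and> k + m' + 1 = Suc i + m} = {(k, m'). Suc m \<le> m' \<and> k + m' + 1 = i + Suc m} \<union> {(i, m)}"
    by auto
  then have "hit m (Suc i) = measure w ({(k, m'). Suc m \<le> m' \<and> k + m' + 1 = i + Suc m} \<union> {(i, m)})"
    unfolding hit_def by (simp only:)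
  also have "\<dots> = hit (Suc m) i + measure w {(i, m)}"
    unfolding hit_def by (intro measure_pmf.finite_measure_Union) auto
  finally show ?thesis by (simp add: \<theta>_def measure_pmf_single)
qed

lemma hit_nonneg: "0 \<le> hit m i"
  by (simp add: hit_def)

text \<open>For m > 0 the probability of being at D m at time n, decomposed by the starting time n -
  i of the current excursion.\<close>

definition "h n m = (\<Sum>i\<le>n. hit m i * u (n - i))"

lemma h_rec: "h (Suc n) m = h n (Suc m) + (\<Sum>k\<le>n. \<theta> k m * u (n - k))"
proof -
  have "h (Suc n) m = hit m 0 * u (Suc n) + (\<Sum>i\<le>n. hit m (Suc i) * u (n - i))"
    unfolding h_def by (subst sum.atMost_Suc_shift) simp
  also have "\<dots> = (\<Sum>i\<le>n. hit (Suc m) i * u (n - i) + \<theta> i m * u (n - i))"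
    by (simp add: hit_0 hit_rec distrib_right)
  finally show ?thesis by (simp add: h_def sum.distrib)
qed

lemma h_0: "h (Suc n) 0 = u (Suc n)"
proof -
  have "hit 0 i = ret i" for i by (simp add: hit_def ret_def)
  moreover have "ret 0 = 0" using hit_0[of 0] \<open>\<And>i. hit 0 i = ret i\<close> by simp
  ultimately show ?thesis unfolding h_def by (subst sum.atMost_Suc_shift) simp
qed

lemma h_nonneg: "0 \<le> h n m"
  unfolding h_def by (intro sum_nonneg mult_nonneg_nonneg hit_nonneg u_nonneg)

text \<open>The density with respect to \<open>wt\<close> of the law at time \<open>n\<close> of the chain started at \<open>0\<close>.\<close>

definition "dens n v = (if v = 0 \<or> odd v then (if (v + 1) div 2 \<le> n then u (n - (v + 1) div 2) else 0)
   else h n (v div 2) / d (v div 2))"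

lemma dens_S: "dens n (S k) = (if k \<le> n then u (n - k) else 0)"
  by (cases k) (simp_all add: dens_def S_def)

lemma dens_D: "dens n (D (Suc m)) = h n (Suc m) / d (Suc m)"
  by (simp add: dens_def D_def)

lemma dens_nonneg: "0 \<le> dens n v"
  using d_pos[of "v div 2"] by (auto simp: dens_def u_nonneg h_nonneg less_imp_le)

lemma dens_0: "dens 0 v = (if v = 0 then 1 else 0)"
  by (cases v rule: state_cases) (auto simp: dens_S dens_D h_def hit_0)

text \<open>One step of the chain forward: into the descent this is \<open>h_rec\<close>, along the
  ray it shifts the time index of u.\<close>

lemma dens_step: "(\<Sum>v. ennreal (Q v s * dens n v)) = ennreal (wt s * dens (Suc n) s)"
proof (cases s rule: state_cases')
  case (descent m)
  have "(\<Sum>v. ennreal (Q v s * dens n v)) = (\<Sum>k. ennreal (\<theta> k m * (if k \<le> n then u (n - k) else 0)))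
      + (\<Sum>j. if j = m then ennreal (d (Suc m) * (h n (Suc m) / d (Suc m))) else 0)"
    unfolding descent suminf_states'[of "\<lambda>v. ennreal (Q v (D m) * dens n v)"] Q_S_D Q_D_D dens_S dens_D
    by (intro arg_cong2[where f = "(+)"] refl arg_cong[where f = suminf] ext) auto
  also have "(\<Sum>k. ennreal (\<theta> k m * (if k \<le> n then u (n - k) else 0))) = (\<Sum>k\<le>n. ennreal (\<theta> k m * u (n - k)))"
    by (subst suminf_finite[of "{..n}"]) auto
  also have "\<dots> = ennreal (\<Sum>k\<le>n. \<theta> k m * u (n - k))"
    by (intro sum_ennreal mult_nonneg_nonneg \<theta>_nonneg u_nonneg)
  also have "(\<Sum>j. if j = m then ennreal (d (Suc m) * (h n (Suc m) / d (Suc m))) else 0) = ennreal (h n (Suc m))"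
    unfolding suminf_delta using d_pos[of "Suc m"] by simp
  also have "ennreal (\<Sum>k\<le>n. \<theta> k m * u (n - k)) + ennreal (h n (Suc m)) = ennreal (h (Suc n) m)"
    unfolding h_rec by (subst ennreal_plus[symmetric]) (auto intro!: sum_nonneg mult_nonneg_nonneg \<theta>_nonneg u_nonneg h_nonneg simp: add.commute)
  also have "h (Suc n) m = wt s * dens (Suc n) s"
  proof (cases m)
    case 0
    then show ?thesis using dens_S[of "Suc n" 0] wt_D[of 0] by (simp add: descent h_0 d_0 del: u.simps)
  next
    case (Suc m')
    then show ?thesis using d_pos[of m] by (simp add: descent wt_D dens_D)
  qed
  finally show ?thesis .
next
  case (ray j)
  have "(\<Sum>v. ennreal (Q v s * dens n v)) = (\<Sum>k. if k = j then ennreal (b (Suc j) * dens n (S j)) else 0)"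
  proof -
    have "(\<Sum>k. ennreal ((if j = k then b (Suc k) else 0) * dens n (S k))) = (\<Sum>k. if k = j then ennreal (b (Suc j) * dens n (S j)) else 0)"
      by (intro arg_cong[where f = suminf] ext) auto
    then show ?thesis unfolding ray suminf_states'[of "\<lambda>v. ennreal (Q v (S (Suc j)) * dens n v)"] Q_S_S Q_D_S by simp
  qed
  also have "\<dots> = ennreal (wt s * dens (Suc n) s)"
    unfolding suminf_delta by (simp add: ray wt_S dens_S)
  finally show ?thesis .
qed

lemma nn_integral_state: "(\<integral>\<^sup>+x. F (x 0) \<partial>\<mu>) = (\<Sum>v. ennreal (wt v) * F v)" for F :: "nat \<Rightarrow> ennreal"
proof -
  have "(\<lambda>x. F (x 0)) \<in> borel_measurable BB" by (rule measurable_compose[OF measurable_coord]) simp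
  then have "(\<integral>\<^sup>+x. F (x 0) \<partial>\<mu>) = (\<Sum>v. ennreal (wt v) * EE v (\<lambda>x. F (x 0)))" by (rule nn_integral_\<mu>)
  also have "EE v (\<lambda>x. F (x 0)) = F v" for v
  proof -
    have "EE v (\<lambda>x. F (x 0)) = EE v (\<lambda>_. F v)" by (rule EE_first) simp
    then show ?thesis by (simp add: EE_const)
  qed
  then have "(\<Sum>v. ennreal (wt v) * EE v (\<lambda>x. F (x 0))) = (\<Sum>v. ennreal (wt v) * F v)" by simp
  finally show ?thesis .
qed

lemma integrable_state_indicator: "integrable \<mu> (\<lambda>x. if x 0 = v then c else 0 :: real)"
proof -
  have "integrable \<mu> (\<lambda>x. c * indicator (cylinder Om [v]) x)"
    by (intro integrable_mult_right integrable_indicator_finite cylinder_finite sets_cyl) auto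
  moreover have "c * indicator (cylinder Om [v]) x = (if x 0 = v then c else 0)" if "x \<in> space \<mu>" for x
    using that by (auto simp: cylinder_state indicator_def)
  ultimately show ?thesis by (rule Bochner_Integration.integrable_cong[OF refl, THEN iffD1, rotated])
qed

lemma integral_state_indicator: "(LINT x|\<mu>. (if x 0 = v then c else 0 :: real)) = c * wt v"
proof -
  have "(LINT x|\<mu>. (if x 0 = v then c else 0)) = (LINT x|\<mu>. c * indicator (cylinder Om [v]) x)"
    by (intro Bochner_Integration.integral_cong) (auto simp: cylinder_state indicator_def)
  also have "\<dots> = c * measure \<mu> (cylinder Om [v])"
  proof -
    have "cylinder Om [v] \<subseteq> space \<mu>" by (auto simp: cylinder_def)
    then show ?thesis by (simp add: Int_absorb2)
  qed
  also have "measure \<mu> (cylinder Om [v]) = wt v"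
    using \<pi>_pos[of v] by (simp add: measure_def cylinder_state emeasure_state)
  finally show ?thesis .
qed

lemma dens_integrable: "integrable \<mu> (\<lambda>x. dens n (x 0))"
  and transfer_dens: "AE x in \<mu>. dual.op (\<lambda>x. dens n (x 0)) x = dens (Suc n) (x 0)"
proof -
  have i: "integrable \<mu> (\<lambda>x. dens n (x 0))" for n
  proof (induction n)
    case 0
    then show ?case unfolding dens_0 by (rule integrable_state_indicator)
  next
    case (Suc n)
    show ?case by (rule transfer_state(1)[OF Suc dens_nonneg dens_nonneg dens_step])
  qed
  then show "integrable \<mu> (\<lambda>x. dens n (x 0))" .
  show "AE x in \<mu>. dual.op (\<lambda>x. dens n (x 0)) x = dens (Suc n) (x 0)"
    by (rule transfer_state(2)[OF i dens_nonneg dens_nonneg dens_step])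
qed

lemma iter_dens: "AE x in \<mu>. (dual.op ^^ k) (\<lambda>x. dens 0 (x 0)) x = dens k (x 0)"
proof (induction k)
  case (Suc k)
  have i: "integrable \<mu> ((dual.op ^^ k) (\<lambda>x. dens 0 (x 0)))" by (intro dual.iter_integrable dens_integrable)
  have "AE x in \<mu>. dual.op ((dual.op ^^ k) (\<lambda>x. dens 0 (x 0))) x = dual.op (\<lambda>x. dens k (x 0)) x"
  proof (rule dual.transfer_AE_eqI[OF i dual.transfer_spec(1)[OF dens_integrable]])
    fix f assume f: "dual.bounded_test f"
    have fT: "dual.bounded_test (\<lambda>x. f (left_shift x))" using dual.bounded_test_comp[OF f, of 1] by simp
    have "(LINT x|\<mu>. (dual.op ^^ k) (\<lambda>x. dens 0 (x 0)) x * f (left_shift x)) = (LINT x|\<mu>. dens k (x 0) * f (left_shift x))"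
      using dual.integrable_mult_test[OF i fT] dual.integrable_mult_test[OF dens_integrable[of k] fT] Suc
      by (intro integral_cong_AE) (auto elim: eventually_mono)
    also have "\<dots> = (LINT x|\<mu>. dual.op (\<lambda>x. dens k (x 0)) x * f x)"
      by (rule dual.transfer_spec(2)[OF dens_integrable f])
    finally show "(LINT x|\<mu>. (dual.op ^^ k) (\<lambda>x. dens 0 (x 0)) x * f (left_shift x))
        = (LINT x|\<mu>. dual.op (\<lambda>x. dens k (x 0)) x * f x)" .
  qed
  then show ?case using transfer_dens[of k] by eventually_elim simp
qed simp

lemma sum_h: "(\<Sum>k<n. h k m) = (\<Sum>i<n. hit m i * U (n - i))"
proof (induction n)
  case (Suc n)
  have "(\<Sum>i<Suc n. hit m i * U (Suc n - i)) = (\<Sum>i<Suc n. hit m i * U (n - i) + hit m i * u (n - i))"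
    by (rule sum.cong[OF refl]) (simp add: Suc_diff_le U_def distrib_left)
  also have "\<dots> = (\<Sum>i<n. hit m i * U (n - i)) + h n m"
    by (simp add: sum.distrib h_def lessThan_Suc_atMost[symmetric] U_def)
  finally show ?case using Suc by simp
qed simp

text \<open>The invariant density is the constant 1, so every state has the same limit. On the ray
  the sum is a shifted U; on the descent U is convolved with \<open>hit m\<close>, whose total mass
  d m cancels against the normalization of the density.\<close>

lemma sum_dens_asymp: "(\<lambda>n. (\<Sum>k<n. dens k v) / a n) \<longlonglongrightarrow> 1"
proof (cases v rule: state_cases)
  case (ray j)
  have "(\<Sum>k<n. dens k v) = U (n - j)" for n
  proof (induction n)
    case (Suc n)
    show ?case
    proof (cases "j \<le> n")
      case True
      then show ?thesis using Suc by (simp add: ray dens_S Suc_diff_le U_def)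
    next
      case False
      then show ?thesis using Suc by (simp add: ray dens_S U_def)
    qed
  qed (simp add: U_def)
  then show ?thesis using U_asymp_shift by simp
next
  case (descent m')
  define m where "m = Suc m'"
  have dp: "d m > 0" by (rule d_pos)
  have "dens k v = h k m / d m" for k by (simp only: descent dens_D m_def)
  then have e: "(\<Sum>k<n. dens k v) = (\<Sum>i<n. hit m i * U (n - i)) / d m" for n
    by (simp add: sum_divide_distrib[symmetric] sum_h)
  have part: "(\<Sum>i<N. hit m i) \<le> d m" for N
    using sum_le_suminf[OF sums_summable[OF hit_sums], of "{..<N}" m] hit_nonneg sums_unique[OF hit_sums, of m] by simp
  have apos: "\<forall>\<^sub>F n in sequentially. 0 < a n"
    using eventually_ge_at_top[of 1] by eventually_elim (rule a_pos)
  have "(\<lambda>n. (\<Sum>i<n. hit m i * U (n - i)) / a n) \<longlonglongrightarrow> d m"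
  proof (rule order_tendstoI)
    fix r assume "r < d m"
    have "(\<lambda>N. \<Sum>i<N. hit m i) \<longlonglongrightarrow> d m" using hit_sums[of m] by (simp add: sums_def)
    from order_tendstoD(1)[OF this \<open>r < d m\<close>]
    obtain N where N: "r < (\<Sum>i<N. hit m i)" unfolding eventually_sequentially by blast
    have "(\<lambda>n. (\<Sum>i<N. hit m i) * (U (n - N) / a n)) \<longlonglongrightarrow> (\<Sum>i<N. hit m i) * 1"
      by (intro tendsto_mult tendsto_const U_asymp_shift)
    then have "\<forall>\<^sub>F n in sequentially. r < (\<Sum>i<N. hit m i) * (U (n - N) / a n)"
      by (rule order_tendstoD(1)) (use N in simp)
    then show "\<forall>\<^sub>F n in sequentially. r < (\<Sum>i<n. hit m i * U (n - i)) / a n"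
      using apos eventually_ge_at_top[of N]
    proof eventually_elim
      case (elim n)
      have "(\<Sum>i<N. hit m i) * U (n - N) = (\<Sum>i<N. hit m i * U (n - N))" by (rule sum_distrib_right)
      also have "\<dots> \<le> (\<Sum>i<N. hit m i * U (n - i))"
        by (intro sum_mono mult_left_mono U_mono hit_nonneg) auto
      also have "\<dots> \<le> (\<Sum>i<n. hit m i * U (n - i))"
        using elim by (intro sum_mono2) (auto intro!: mult_nonneg_nonneg hit_nonneg U_nonneg)
      finally have "(\<Sum>i<N. hit m i) * U (n - N) / a n \<le> (\<Sum>i<n. hit m i * U (n - i)) / a n"
        using elim by (intro divide_right_mono) auto
      then show ?case using elim by simp
    qed
  next
    fix r assume "d m < r"
    have "(\<lambda>n. d m * (U (n - 0) / a n)) \<longlonglongrightarrow> d m * 1"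
      by (intro tendsto_mult tendsto_const U_asymp_shift)
    then have "\<forall>\<^sub>F n in sequentially. d m * (U n / a n) < r"
      by (intro order_tendstoD(2)) (use \<open>d m < r\<close> in simp_all)
    then show "\<forall>\<^sub>F n in sequentially. (\<Sum>i<n. hit m i * U (n - i)) / a n < r"
      using apos
    proof eventually_elim
      case (elim n)
      have "(\<Sum>i<n. hit m i * U (n - i)) \<le> (\<Sum>i<n. hit m i * U n)"
        by (intro sum_mono mult_left_mono U_mono hit_nonneg) auto
      also have "\<dots> = (\<Sum>i<n. hit m i) * U n" by (rule sum_distrib_right[symmetric])
      also have "\<dots> \<le> d m * U n" by (intro mult_right_mono part U_nonneg)
      finally have "(\<Sum>i<n. hit m i * U (n - i)) / a n \<le> d m * U n / a n"
        using elim by (intro divide_right_mono) auto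
      then show ?case using elim by simp
    qed
  qed
  then have "(\<lambda>n. (\<Sum>i<n. hit m i * U (n - i)) / a n / d m) \<longlonglongrightarrow> d m / d m"
    by (intro tendsto_divide tendsto_const) (use dp in auto)
  then show ?thesis using dp by (simp add: e divide_divide_eq_left mult.commute)
qed

lemma dual_convergent_base: "dual.dual_convergent (\<lambda>x. dens 0 (x 0))"
proof -
  have "AE x in \<mu>. \<forall>k. (dual.op ^^ k) (\<lambda>x. dens 0 (x 0)) x = dens k (x 0)"
    using iter_dens by (simp add: AE_all_countable)
  then have "AE x in \<mu>. (\<lambda>n. dual.dual_sum n (\<lambda>x. dens 0 (x 0)) x / a n) \<longlonglongrightarrow> 1"
    by eventually_elim (simp add: dual.dual_sum_def sum_dens_asymp)
  moreover have "(LINT x|\<mu>. dens 0 (x 0)) = 1"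
    unfolding dens_0 integral_state_indicator using wt_S[of 0] by (simp add: b_0)
  ultimately show ?thesis using dens_integrable by (simp add: dual.dual_convergent_def)
qed

text \<open>Every state has positive density at some time, so the comparison by the maximal
  inequality reaches almost every point.\<close>

lemma base_positive: "AE x in \<mu>. \<exists>j. 0 < (dual.op ^^ j) (\<lambda>x. dens 0 (x 0)) x"
proof -
  have ex: "\<exists>j. 0 < dens j v" for v
  proof (cases v rule: state_cases)
    case (ray k)
    then show ?thesis by (intro exI[of _ k]) (simp add: dens_S)
  next
    case (descent m)
    have "\<exists>i. hit (Suc m) i \<noteq> 0"
    proof (rule ccontr)
      assume "\<not> ?thesis"
      then have "hit (Suc m) = (\<lambda>_. 0)" by auto
      then have "d (Suc m) = 0" using hit_sums[of "Suc m"] sums_unique2[OF sums_zero] by metis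
      then show False using d_pos[of "Suc m"] by simp
    qed
    then obtain i where i: "0 < hit (Suc m) i" using hit_nonneg[of "Suc m"] by (metis order_le_less)
    have "hit (Suc m) i * u (i - i) \<le> h i (Suc m)"
      unfolding h_def by (rule member_le_sum[of i "{..i}" "\<lambda>j. hit (Suc m) j * u (i - j)"])
        (auto intro!: mult_nonneg_nonneg hit_nonneg u_nonneg)
    then have "0 < h i (Suc m)" using i by simp
    then show ?thesis using d_pos[of "Suc m"] by (intro exI[of _ i]) (simp add: descent dens_D)
  qed
  have "AE x in \<mu>. \<forall>k. (dual.op ^^ k) (\<lambda>x. dens 0 (x 0)) x = dens k (x 0)"
    using iter_dens by (simp add: AE_all_countable)
  then show ?thesis by eventually_elim (use ex in simp)
qed

abbreviation "charge v c \<equiv> (\<lambda>x :: nat \<Rightarrow> nat. if x 0 = v then c else 0 :: real)"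

lemma dual_convergent_scale: "dual.dual_convergent f \<Longrightarrow> dual.dual_convergent (\<lambda>x. c * f x)"
  using dual.dual_convergent_linear[of f f c 0] by simp

lemma charge_scale: "dual.dual_convergent (charge v 1) \<Longrightarrow> dual.dual_convergent (charge v c)"
proof -
  assume "dual.dual_convergent (charge v 1)"
  then have "dual.dual_convergent (\<lambda>x. c * charge v 1 x)" by (rule dual_convergent_scale)
  moreover have "(\<lambda>x. c * charge v 1 x) = charge v c" by auto
  ultimately show ?thesis by (simp only:)
qed

text \<open>The descent is deterministic, so the transfer operator maps the indicator of D (Suc m)
  to a multiple of that of D m, and convergence is pulled back.\<close>

lemma dual_convergent_D: "dual.dual_convergent (charge (D m) 1)"
proof (induction m)
  case 0
  have "(\<lambda>x. dens 0 (x 0)) = charge 0 1" by (simp add: dens_0)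
  then show ?case using dual_convergent_base by simp
next
  case (Suc m)
  let ?F = "\<lambda>v. if v = D (Suc m) then 1 else 0 :: real" and ?G = "\<lambda>s. if s = D m then d (Suc m) / d m else 0"
  have i: "integrable \<mu> (charge (D (Suc m)) 1)" by (rule integrable_state_indicator)
  have eq: "(\<Sum>v. ennreal (Q v s * ?F v)) = ennreal (wt s * ?G s)" for s
  proof -
    have "(\<Sum>v. ennreal (Q v s * ?F v)) = (\<Sum>v. if v = D (Suc m) then ennreal (Q (D (Suc m)) s) else 0)"
      by (intro arg_cong[where f = suminf] ext) auto
    also have "\<dots> = ennreal (Q (D (Suc m)) s)" by (rule suminf_delta)
    also have "Q (D (Suc m)) s = wt s * ?G s"
      using d_pos[of m] by (cases s rule: state_cases') (auto simp: Q_D_D Q_D_S wt_D)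
    finally show ?thesis .
  qed
  have "AE x in \<mu>. dual.op (charge (D (Suc m)) 1) x = charge (D m) (d (Suc m) / d m) x"
    using transfer_state(2)[of ?F ?G, OF i _ _ eq] d_pos by (simp add: less_imp_le)
  then have "AE x in \<mu>. charge (D m) (d (Suc m) / d m) x = dual.op (charge (D (Suc m)) 1) x" by eventually_elim simp
  from dual.dual_convergent_AE_cong[OF charge_scale[OF Suc] dual.transfer_spec(1)[OF i] this]
  show ?case by (simp only: dual.dual_convergent_transfer_iff[OF i])
qed

text \<open>This function is the part of the transferred indicator of S k that leaves the ray. It
  can spread over infinitely many descent states and is then reached only as an L1 limit;
  \<open>?R N\<close> is the remainder from D N on.\<close>

lemma dual_convergent_jump: "dual.dual_convergent (\<lambda>x. if even (x 0) then \<theta> k (x 0 div 2) / d (x 0 div 2) else 0)"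
proof -
  let ?H = "\<lambda>v. if even v then \<theta> k (v div 2) / d (v div 2) else 0"
  let ?R = "\<lambda>N v. if even v \<and> N \<le> v div 2 then \<theta> k (v div 2) / d (v div 2) else 0"
  have sth: "summable (\<theta> k)"
    by (rule summable_suminf_not_top[OF \<theta>_nonneg]) (simp add: sum_\<theta>_row)
  have R0: "0 \<le> ?R N v" for N v using d_pos[of "v div 2"] \<theta>_nonneg by (simp add: less_imp_le)
  have int: "(\<integral>\<^sup>+x. ennreal (?R N (x 0)) \<partial>\<mu>) = ennreal (\<Sum>m. \<theta> k (m + N))" for N
  proof -
    have "(\<integral>\<^sup>+x. ennreal (?R N (x 0)) \<partial>\<mu>) = (\<Sum>v. ennreal (wt v) * ennreal (?R N v))" by (rule nn_integral_state)
    also have "\<dots> = (\<Sum>m. ennreal (if N \<le> m then \<theta> k m else 0))"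
    proof -
      have "ennreal (wt (D m)) * ennreal (?R N (D m)) = ennreal (if N \<le> m then \<theta> k m else 0)" for m
      proof -
        have "even (D m)" "D m div 2 = m" by (simp_all add: D_def)
        then show ?thesis using d_pos[of m] \<theta>_nonneg[of k m] by (simp add: wt_D ennreal_mult[symmetric] less_imp_le)
      qed
      moreover have "ennreal (wt (S (Suc j))) * ennreal (?R N (S (Suc j))) = 0" for j by (simp add: S_Suc)
      ultimately show ?thesis
        unfolding suminf_states[of "\<lambda>v. ennreal (wt v) * ennreal (?R N v)"] by (simp only: suminf_zero add_0_right)
    qed
    also have "\<dots> = ennreal (\<Sum>m. if N \<le> m then \<theta> k m else 0)"
      by (intro suminf_ennreal2 summable_comparison_test'[OF sth, of 0]) (auto simp: \<theta>_nonneg)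
    also have "(\<Sum>m. if N \<le> m then \<theta> k m else 0) = (\<Sum>m. \<theta> k (m + N))"
      by (subst suminf_split_initial_segment[where k = N])
        (auto intro!: summable_comparison_test'[OF sth, of 0] simp: \<theta>_nonneg)
    finally show ?thesis .
  qed
  have Rm: "(\<lambda>x. ?R N (x 0)) \<in> borel_measurable \<mu>" for N
    using state_measurable[of "?R N"] by (simp cong: measurable_cong_sets)
  have Ri: "integrable \<mu> (\<lambda>x. ?R N (x 0))" and RL: "(LINT x|\<mu>. ?R N (x 0)) = (\<Sum>m. \<theta> k (m + N))" for N
  proof -
    have "(\<integral>\<^sup>+x. ennreal (norm (?R N (x 0))) \<partial>\<mu>) = (\<integral>\<^sup>+x. ennreal (?R N (x 0)) \<partial>\<mu>)"
      by (rule nn_integral_cong) (simp only: real_norm_def abs_of_nonneg[OF R0])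
    then show "integrable \<mu> (\<lambda>x. ?R N (x 0))" using int[of N] Rm[of N] by (simp only: integrable_iff_bounded) simp
    have "(LINT x|\<mu>. ?R N (x 0)) = enn2real (\<integral>\<^sup>+x. ennreal (?R N (x 0)) \<partial>\<mu>)"
      by (rule integral_eq_nn_integral) (use Rm R0 in auto)
    also have "\<dots> = (\<Sum>m. \<theta> k (m + N))"
      unfolding int by (intro enn2real_ennreal suminf_nonneg \<theta>_nonneg) (use sth in \<open>simp add: summable_iff_shift\<close>)
    finally show "(LINT x|\<mu>. ?R N (x 0)) = (\<Sum>m. \<theta> k (m + N))" .
  qed
  have partial: "dual.dual_convergent (\<lambda>x. ?H (x 0) - ?R N (x 0))" for N
  proof (induction N)
    case 0
    have "(\<lambda>x :: nat \<Rightarrow> nat. ?H (x 0) - ?R 0 (x 0)) = (\<lambda>x. 0 * dens 0 (x 0))" by auto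
    then show ?case using dual_convergent_scale[OF dual_convergent_base, of 0] by simp
  next
    case (Suc N)
    have "(\<lambda>x :: nat \<Rightarrow> nat. ?H (x 0) - ?R (Suc N) (x 0)) = (\<lambda>x. 1 * (?H (x 0) - ?R N (x 0)) + (\<theta> k N / d N) * charge (D N) 1 x)"
      by (auto simp: D_def fun_eq_iff not_less_eq_eq)
    then show ?case using dual.dual_convergent_linear[OF Suc dual_convergent_D[of N], of 1 "\<theta> k N / d N"] by simp
  qed
  have "(\<lambda>x :: nat \<Rightarrow> nat. ?H (x 0)) = (\<lambda>x. ?R 0 (x 0))" by auto
  then have Hi: "integrable \<mu> (\<lambda>x. ?H (x 0))" using Ri[of 0] by (simp only:)
  show ?thesis
  proof (rule dual.dual_convergent_closed[OF dual_convergent_base _ base_positive Hi])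
    show "AE x in \<mu>. 0 \<le> dens 0 (x 0)" by (simp add: dens_nonneg)
    fix r :: real assume "0 < r"
    from suminf_exist_split[OF this sth] obtain N where N: "norm (\<Sum>m. \<theta> k (m + N)) < r" by blast
    have "(LINT x|\<mu>. \<bar>?H (x 0) - (?H (x 0) - ?R N (x 0))\<bar>) = (\<Sum>m. \<theta> k (m + N))"
      unfolding RL[symmetric] by (intro Bochner_Integration.integral_cong) (simp_all only: diff_diff_eq2 add_diff_cancel_left' abs_of_nonneg[OF R0])
    then show "\<exists>g. dual.dual_convergent g \<and> (LINT x|\<mu>. \<bar>?H (x 0) - g x\<bar>) < r"
      using partial[of N] N by (intro exI[of _ "\<lambda>x. ?H (x 0) - ?R N (x 0)"]) auto
  qed
qed

text \<open>Transferring the indicator of S k produces the jump part plus the indicator of S (Suc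
  k); the jump part is already known to converge and is subtracted.\<close>

lemma dual_convergent_S: "dual.dual_convergent (charge (S k) 1)"
proof (induction k)
  case 0
  then show ?case using dual_convergent_D[of 0] by simp
next
  case (Suc k)
  let ?F = "\<lambda>v. if v = S k then 1 else 0 :: real"
  let ?H = "\<lambda>v. if even v then \<theta> k (v div 2) / d (v div 2) else 0"
  let ?G = "\<lambda>v. ?H v + (if v = S (Suc k) then 1 else 0)"
  have i: "integrable \<mu> (charge (S k) 1)" by (rule integrable_state_indicator)
  have G0: "0 \<le> ?G v" for v using d_pos[of "v div 2"] \<theta>_nonneg by (simp add: less_imp_le)
  have eq: "(\<Sum>v. ennreal (Q v s * ?F v)) = ennreal (wt s * ?G s)" for s
  proof -
    have "(\<Sum>v. ennreal (Q v s * ?F v)) = (\<Sum>v. if v = S k then ennreal (Q (S k) s) else 0)"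
      by (intro arg_cong[where f = suminf] ext) auto
    also have "\<dots> = ennreal (Q (S k) s)" by (rule suminf_delta)
    also have "Q (S k) s = wt s * ?G s"
    proof (cases s rule: state_cases')
      case (descent m)
      then show ?thesis using d_pos[of m] by (simp add: Q_S_D wt_D) (simp add: D_def)
    next
      case (ray j)
      have "odd (S (Suc j))" by (simp add: S_Suc)
      then show ?thesis by (simp add: ray Q_S_S wt_S)
    qed
    finally show ?thesis .
  qed
  have op_eq: "AE x in \<mu>. dual.op (charge (S k) 1) x = ?G (x 0)"
    by (rule transfer_state(2)[of ?F ?G, OF i _ G0 eq]) simp
  have "dual.dual_convergent (dual.op (charge (S k) 1))" using Suc by (simp only: dual.dual_convergent_transfer_iff[OF i])
  from dual.dual_convergent_linear[OF this dual_convergent_jump[of k], of 1 "-1"]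
  show ?case
    by (rule dual.dual_convergent_AE_cong[OF _ integrable_state_indicator])
      (use op_eq in \<open>auto elim!: eventually_mono\<close>)
qed

theorem dual_ergodic: "pointwise_dual_ergodic \<mu> left_shift a"
proof (rule dual.pointwise_dual_ergodicI)
  fix f :: "(nat \<Rightarrow> nat) \<Rightarrow> real" assume "integrable \<mu> f"
  show "dual.dual_convergent f"
  proof (rule dual_convergent_all[OF dual_convergent_base _ base_positive _ \<open>integrable \<mu> f\<close>])
    show "AE x in \<mu>. 0 \<le> dens 0 (x 0)" by (simp add: dens_nonneg)
    fix v
    have "dual.dual_convergent (charge v 1)"
    proof (cases v rule: state_cases)
      case (ray k)
      then show ?thesis using dual_convergent_S by simp
    next
      case (descent m)
      then show ?thesis using dual_convergent_D by simp
    qed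
    then show "dual.dual_convergent (indicator (cylinder Om [v]))"
      by (rule dual.dual_convergent_AE_cong[OF _ integrable_indicator_finite[OF sets_cyl cylinder_finite]])
        (auto intro!: AE_I2 simp: cylinder_state indicator_def)
  qed
qed

end

section \<open>Mixing, excursion words and null recurrence\<close>

context excursion_chain
begin

lemma pp_step: "0 < Q v s \<Longrightarrow> 0 < pp 1 v s"
proof -
  assume q: "0 < Q v s"
  have "pp (Suc 0) v s = (\<Sum>r. if r = s then ennreal (Q v s / wt v) else 0)"
    unfolding pp_Suc pp_0 by (intro arg_cong[where f = suminf] ext) auto
  then show ?thesis using q \<pi>_pos[of v] by (simp add: suminf_delta)
qed

lemma pp_trans: "0 < pp i v s \<Longrightarrow> 0 < pp j s t \<Longrightarrow> 0 < pp (i + j) v t"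
  using pp_mult_le[of i v s j t] by (meson ennreal_zero_less_mult_iff order_less_le_trans)

lemma descend: "0 < pp j (D (m + j)) (D m)"
proof (induction j)
  case (Suc j)
  have "0 < pp 1 (D (Suc (m + j))) (D (m + j))" by (rule pp_step) (simp add: Q_D_D d_pos)
  from pp_trans[OF this Suc] show ?case by simp
qed (simp add: pp_0)

lemma climb: "0 < pp j (S k) (S (k + j))"
proof (induction j)
  case (Suc j)
  have "0 < pp 1 (S (k + j)) (S (Suc (k + j)))" by (rule pp_step) (simp add: Q_S_S b_pos)
  from pp_trans[OF Suc this] show ?case by simp
qed (simp add: pp_0)

lemma reach_base: "\<exists>i. 0 < pp i v 0"
proof (cases v rule: state_cases)
  case (ray k)
  have "measure w {(k', m). k \<le> k'} \<noteq> 0" using exit_pos[of k] by simp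
  then have "set_pmf w \<inter> {(k', m). k \<le> k'} \<noteq> {}" by (simp only: measure_pmf_zero_iff not_False_eq_True)
  then obtain k' m where k': "k \<le> k'" "(k', m) \<in> set_pmf w" by auto
  have "0 < pp (k' - k) (S k) (S k')" using climb[of "k' - k" k] k' by simp
  moreover have "0 < pp 1 (S k') (D m)" using k' by (intro pp_step) (simp add: Q_S_D \<theta>_def pmf_positive)
  moreover have "0 < pp m (D m) 0" using descend[of m 0] by simp
  ultimately show ?thesis unfolding ray by (meson pp_trans)
next
  case (descent m)
  show ?thesis using descend[of "Suc m" 0] by (auto simp: descent)
qed

lemma base_reach: "\<exists>j. 0 < pp j 0 v"
proof (cases v rule: state_cases)
  case (ray k)
  show ?thesis using climb[of k 0] by (auto simp: ray)
next
  case (descent m)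
  obtain m0 where m0: "\<And>m. m \<ge> m0 \<Longrightarrow> pmf w (0, m) > 0" using jump_pos by blast
  have "0 < pp 1 (S 0) (D (max m0 (Suc m)))" by (rule pp_step) (simp only: Q_S_D \<theta>_def, simp add: m0)
  moreover have "0 < pp (max m0 (Suc m) - Suc m) (D (max m0 (Suc m))) (D (Suc m))"
    using descend[of "max m0 (Suc m) - Suc m" "Suc m"] by (simp del: D_inj)
  ultimately have "0 < pp (1 + (max m0 (Suc m) - Suc m)) (S 0) (D (Suc m))" by (rule pp_trans)
  then show ?thesis by (auto simp: descent)
qed

primrec descent_word :: "nat \<Rightarrow> nat list" where
  "descent_word 0 = [0]"
| "descent_word (Suc m) = D (Suc m) # descent_word m"

primrec excursion_word :: "nat \<Rightarrow> nat \<Rightarrow> nat \<Rightarrow> nat list" where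
  "excursion_word 0 k m = S k # descent_word m"
| "excursion_word (Suc j) k m = S k # excursion_word j (Suc k) m"

lemma descent_word_Cons: "\<exists>ws. descent_word m = D m # ws"
  by (cases m) auto

lemma excursion_word_Cons: "\<exists>ws. excursion_word j k m = S k # ws"
  by (cases j) auto

lemma emeasure_descent_word: "emeasure \<mu> (cylinder Om (descent_word m)) = ennreal (d m)"
proof (induction m)
  case 0
  show ?case using emeasure_state[of 0] wt_D[of 0] by (simp add: cylinder_state)
next
  case (Suc m)
  obtain ws where ws: "descent_word m = D m # ws" using descent_word_Cons by blast
  have "emeasure \<mu> (cylinder Om (descent_word (Suc m))) = ennreal (Q (D (Suc m)) (D m) / wt (D m)) * ennreal (d m)"
    using Suc by (simp only: descent_word.simps ws emeasure_cylinder_Cons)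
  also have "\<dots> = ennreal (d (Suc m))"
    using d_pos[of m] d_pos[of "Suc m"] by (simp add: Q_D_D wt_D ennreal_mult[symmetric] less_imp_le)
  finally show ?case .
qed

lemma emeasure_excursion_word: "emeasure \<mu> (cylinder Om (excursion_word j k m)) = ennreal (\<theta> (k + j) m)"
proof (induction j arbitrary: k)
  case 0
  obtain ws where ws: "descent_word m = D m # ws" using descent_word_Cons by blast
  have "emeasure \<mu> (cylinder Om (excursion_word 0 k m)) = ennreal (Q (S k) (D m) / wt (D m)) * ennreal (d m)"
    using emeasure_descent_word[of m] by (simp only: excursion_word.simps ws emeasure_cylinder_Cons)
  also have "\<dots> = ennreal (\<theta> k m)"
    using d_pos[of m] \<theta>_nonneg[of k m] by (simp add: Q_S_D wt_D ennreal_mult[symmetric] less_imp_le)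
  finally show ?case by simp
next
  case (Suc j)
  obtain ws where ws: "excursion_word j (Suc k) m = S (Suc k) # ws" using excursion_word_Cons by blast
  have "emeasure \<mu> (cylinder Om (excursion_word (Suc j) k m)) = ennreal (Q (S k) (S (Suc k)) / wt (S (Suc k))) * ennreal (\<theta> (Suc k + j) m)"
    using Suc[of "Suc k"] by (simp only: excursion_word.simps ws emeasure_cylinder_Cons)
  also have "\<dots> = ennreal (\<theta> (k + Suc j) m)"
    using b_pos[of "Suc k"] by (simp add: Q_S_S wt_S)
  finally show ?case .
qed

lemma in_descent_word: "y \<in> cylinder Om (descent_word m) \<longleftrightarrow> y \<in> Om \<and> (\<forall>i<Suc m. y i = D (m - i))"
proof (induction m arbitrary: y)
  case 0
  show ?case by (auto simp: cylinder_state)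
next
  case (Suc m)
  show ?case
    unfolding descent_word.simps(2) cylinder_Cons All_less_Suc2[of "Suc m"]
    using Suc[of "left_shift y"] shift_in_Om[of y] by (auto simp: left_shift_def)
qed

lemma in_excursion_word: "y \<in> cylinder Om (excursion_word j k m) \<longleftrightarrow>
    y \<in> Om \<and> (\<forall>i<Suc j. y i = S (k + i)) \<and> (\<forall>i<Suc m. y (Suc j + i) = D (m - i))"
proof (induction j arbitrary: k y)
  case 0
  show ?case unfolding excursion_word.simps(1) cylinder_Cons
    using in_descent_word[of "left_shift y" m] shift_in_Om[of y] by (auto simp: left_shift_def)
next
  case (Suc j)
  show ?case unfolding excursion_word.simps(2) cylinder_Cons All_less_Suc2[of "Suc j"]
    using Suc[of "left_shift y" "Suc k"] shift_in_Om[of y] by (auto simp: left_shift_def)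
qed

definition "excursion p = cylinder Om (excursion_word (fst p) 0 (snd p))" for p :: "nat \<times> nat"

lemma excursion_iff: "y \<in> excursion (k, m) \<longleftrightarrow> y \<in> Om \<and> (\<forall>i\<le>k. y i = S i) \<and> (\<forall>i\<le>m. y (Suc k + i) = D (m - i))"
  by (simp add: excursion_def in_excursion_word less_Suc_eq_le)

lemma excursion_after: "y \<in> excursion (k, m) \<Longrightarrow> y (Suc k) = D m"
  unfolding excursion_iff by (metis add.right_neutral diff_zero le0)

lemma sets_excursion [measurable]: "excursion p \<in> sets BB"
  by (simp add: excursion_def sets_cyl)

lemma emeasure_excursion: "emeasure \<mu> (excursion p) = ennreal (pmf w p)"
  by (cases p) (simp add: excursion_def emeasure_excursion_word \<theta>_def)

lemma disjoint_excursion: "disjoint_family_on excursion Z"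
proof (unfold disjoint_family_on_def, intro ballI impI)
  fix p p' :: "nat \<times> nat" assume "p \<noteq> p'"
  obtain k m k' m' where p: "p = (k, m)" "p' = (k', m')" by (cases p; cases p')
  have False if y: "y \<in> excursion (k, m)" "y \<in> excursion (k', m')" for y
  proof (cases k k' rule: linorder_cases)
    case less
    then have "y (Suc k) = S (Suc k)" using y(2) unfolding excursion_iff by (meson Suc_leI)
    then show False using excursion_after[OF y(1)] by simp
  next
    case greater
    then have "y (Suc k') = S (Suc k')" using y(1) unfolding excursion_iff by (meson Suc_leI)
    then show False using excursion_after[OF y(2)] by simp
  next
    case equal
    then have "m = m'" using excursion_after[OF y(1)] excursion_after[OF y(2)] by simp
    then show False using equal \<open>p \<noteq> p'\<close> p by simp
  qed
  then show "excursion p \<inter> excursion p' = {}" unfolding p by blast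
qed

lemma emeasure_excursions: "emeasure \<mu> (\<Union>p\<in>Z. excursion p) = emeasure w Z"
proof -
  have "emeasure \<mu> (\<Union>p\<in>Z. excursion p) = (\<integral>\<^sup>+p. emeasure \<mu> (excursion p) \<partial>count_space Z)"
    by (rule emeasure_UN_countable) (auto simp: disjoint_excursion)
  then show ?thesis by (simp add: emeasure_excursion nn_integral_pmf)
qed

lemma wt_0: "wt 0 = 1"
  using wt_S[of 0] b_0 by simp

text \<open>The excursion cylinders are disjoint with total mass 1, which is the mass of
  [0].\<close>

lemma excursions_cover: "AE y in \<mu>. y 0 = 0 \<longrightarrow> (\<exists>p. y \<in> excursion p)"
proof -
  let ?C = "{y\<in>Om. y 0 = 0}" and ?X = "\<Union>p. excursion p"
  have sub: "?X \<subseteq> ?C"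
  proof
    fix y assume "y \<in> ?X"
    then obtain p where "y \<in> excursion p" by blast
    then show "y \<in> ?C" by (cases p) (auto simp: excursion_iff dest: spec[of _ 0])
  qed
  have [measurable]: "?X \<in> sets BB" by (intro sets.countable_UN) auto
  have C: "?C \<in> sets BB" using sets_cyl[of "[0]"] by (simp add: cylinder_state)
  have "emeasure \<mu> ?X = 1" unfolding emeasure_excursions by (simp add: measure_pmf.emeasure_space_1[simplified])
  then have "emeasure \<mu> (?C - ?X) = 0"
    using emeasure_Diff[of \<mu> ?X ?C] sub C by (simp add: emeasure_state wt_0)
  then show ?thesis
    by (intro AE_I[of _ _ "?C - ?X"]) (use C in auto)
qed

text \<open>Questions about one excursion become questions about the pair (K, M): it suffices to
  evaluate the event on each excursion cylinder.\<close>

lemma excursion_law: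
  assumes E: "E \<in> sets BB" and P: "\<And>k m y. y \<in> excursion (k, m) \<Longrightarrow> y \<in> E \<longleftrightarrow> P k m"
  shows "emeasure \<mu> (E \<inter> {y\<in>Om. y 0 = 0}) = emeasure w {(k, m). P k m}"
proof -
  have C: "{y\<in>Om. y 0 = 0} \<in> sets BB" using sets_cyl[of "[0]"] by (simp add: cylinder_state)
  have "emeasure \<mu> (E \<inter> {y\<in>Om. y 0 = 0}) = emeasure \<mu> (\<Union>p\<in>{(k, m). P k m}. excursion p)"
  proof (rule emeasure_eq_AE)
    show "AE y in \<mu>. y \<in> E \<inter> {y\<in>Om. y 0 = 0} \<longleftrightarrow> y \<in> (\<Union>p\<in>{(k, m). P k m}. excursion p)"
      using excursions_cover
    proof eventually_elim
      case (elim y)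
      show ?case
      proof
        assume y: "y \<in> E \<inter> {y\<in>Om. y 0 = 0}"
        then obtain k m where km: "y \<in> excursion (k, m)" using elim by auto
        then show "y \<in> (\<Union>p\<in>{(k, m). P k m}. excursion p)" using P[OF km] y by blast
      next
        assume "y \<in> (\<Union>p\<in>{(k, m). P k m}. excursion p)"
        then obtain k m where km: "P k m" "y \<in> excursion (k, m)" by auto
        moreover have "y \<in> Om" "y 0 = 0" using km(2) by (auto simp: excursion_iff dest: spec[of _ 0])
        ultimately show "y \<in> E \<inter> {y\<in>Om. y 0 = 0}" using P[OF km(2)] by blast
      qed
    qed
    show "E \<inter> {y \<in> Om. y 0 = 0} \<in> sets \<mu>" using E C by auto
    show "(\<Union>p\<in>{(k, m). P k m}. excursion p) \<in> sets \<mu>" by (intro sets.countable_UN') auto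
  qed
  then show ?thesis by (simp only: emeasure_excursions)
qed

abbreviation "rtime \<equiv> return_time left_shift (cylinder Om [0])"

lemma return_excursion:
  assumes y: "y \<in> excursion (k, m)"
  shows "rtime y = enat (k + m + 1)"
proof -
  have y': "y \<in> Om" "\<And>i. i \<le> k \<Longrightarrow> y i = S i" "\<And>i. i \<le> m \<Longrightarrow> y (Suc k + i) = D (m - i)"
    using y by (auto simp: excursion_iff)
  have "y (k + m + 1) = 0" using y'(3)[of m] by (simp add: add.commute add.left_commute)
  moreover have "y i \<noteq> 0" if "1 \<le> i" "i < k + m + 1" for i
  proof (cases "i \<le> k")
    case True
    then show ?thesis using y'(2)[of i] that by simp
  next
    case False
    then show ?thesis using y'(3)[of "i - Suc k"] that by simp
  qed
  ultimately show ?thesis using return_time_eq_iff[OF y'(1), of 0 "k + m + 1"] by simp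
qed

lemma return_measurable: "rtime \<in> BB \<rightarrow>\<^sub>M count_space UNIV"
proof -
  have fin: "rtime -` {enat n} \<inter> space BB \<in> sets BB" for n
  proof -
    have "rtime -` {enat n} \<inter> space BB = {y\<in>space BB. 1 \<le> n \<and> y n = 0 \<and> (\<forall>i<n. 1 \<le> i \<longrightarrow> y i \<noteq> 0)}"
      by (auto simp: return_time_eq_iff space_shift_borel eta)
    also have "\<dots> \<in> sets BB" by measurable
    finally show ?thesis .
  qed
  have "rtime -` {\<infinity>} \<inter> space BB = space BB - (\<Union>n. rtime -` {enat n} \<inter> space BB)"
  proof (intro set_eqI iffI)
    fix y assume "y \<in> space BB - (\<Union>n. rtime -` {enat n} \<inter> space BB)"
    then show "y \<in> rtime -` {\<infinity>} \<inter> space BB" by (cases "rtime y") auto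
  qed auto
  then have inf: "rtime -` {\<infinity>} \<inter> space BB \<in> sets BB"
    by (simp only:) (intro sets.Diff sets.top sets.countable_UN subsetI, use fin in auto)
  have "rtime -` {r} \<inter> space BB \<in> sets BB" for r using fin inf by (cases r) auto
  then show ?thesis by (simp add: measurable_count_space_eq2_countable)
qed

lemma first_return_ret:
  assumes "n \<ge> 1"
  shows "first_return_sum Om \<phi> n 0 = ennreal (ret n)" "ennreal (ret n) \<le> pp n 0 0"
proof -
  let ?E = "rtime -` {enat n} \<inter> Om"
  have "rtime -` {enat n} \<inter> space BB \<in> sets BB" by (rule measurable_sets[OF return_measurable]) simp
  then have E: "?E \<in> sets BB" by (simp add: space_shift_borel eta)
  have eq: "?E \<inter> {y\<in>Om. y 0 = 0} = {y\<in>Om. y 0 = 0 \<and> y n = 0 \<and> (\<forall>i. 1 \<le> i \<and> i < n \<longrightarrow> y i \<noteq> 0)}"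
    using assms by (auto simp: return_time_eq_iff)
  have "emeasure \<mu> (?E \<inter> {y\<in>Om. y 0 = 0}) = emeasure w {(k, m). k + m + 1 = n}"
    by (rule excursion_law[OF E]) (auto simp: return_excursion excursion_iff)
  then have e: "emeasure \<mu> {y\<in>Om. y 0 = 0 \<and> y n = 0 \<and> (\<forall>i. 1 \<le> i \<and> i < n \<longrightarrow> y i \<noteq> 0)} = ennreal (ret n)"
    unfolding eq by (simp only: ret_def measure_pmf.emeasure_eq_measure)
  then show "first_return_sum Om \<phi> n 0 = ennreal (ret n)"
    using first_return_sum_eq[OF assms, of 0] by (simp add: wt_0)
  have "{y\<in>Om. y 0 = 0 \<and> y n = 0} \<in> sets BB"
  proof -
    have "{y\<in>Om. y 0 = 0 \<and> y n = 0} = {y\<in>space BB. y 0 = 0 \<and> y n = 0}" by (simp add: space_shift_borel eta)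
    also have "\<dots> \<in> sets BB" by measurable
    finally show ?thesis .
  qed
  then have "ennreal (ret n) \<le> emeasure \<mu> {y\<in>Om. y 0 = 0 \<and> y n = 0}"
    unfolding e[symmetric] by (intro emeasure_mono) auto
  then show "ennreal (ret n) \<le> pp n 0 0" by (simp add: emeasure_pair wt_0)
qed

lemma pp_lower: "\<exists>c>0. \<exists>N. \<forall>n\<ge>N. ennreal (c / (real n)\<^sup>2) \<le> pp n v s"
proof -
  obtain i where i: "0 < pp i v 0" using reach_base by blast
  obtain j where j: "0 < pp j 0 s" using base_reach by blast
  obtain \<kappa> N where \<kappa>: "0 < \<kappa>" "\<And>n. n \<ge> N \<Longrightarrow> \<kappa> / (real n)\<^sup>2 \<le> ret n" using return_lower unfolding ret_def by metis
  have fin: "pp i v 0 \<noteq> \<top>" "pp j 0 s \<noteq> \<top>"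
    using pp_le_1[of i v 0] pp_le_1[of j 0 s] by (auto simp: top_unique)
  define p q where "p = enn2real (pp i v 0)" and "q = enn2real (pp j 0 s)"
  have pq: "0 < p" "0 < q" "pp i v 0 = ennreal p" "pp j 0 s = ennreal q"
    using i j fin by (auto simp: p_def q_def enn2real_positive_iff less_top[symmetric])
  have "ennreal (p * \<kappa> * q / (real n)\<^sup>2) \<le> pp n v s" if n: "n \<ge> N + i + j + 1" for n
  proof -
    define l where "l = n - i - j"
    have l: "l \<ge> N" "l \<ge> 1" "n = i + (l + j)" using n by (auto simp: l_def)
    have "\<kappa> / (real n)\<^sup>2 \<le> \<kappa> / (real l)\<^sup>2" using l \<kappa>(1) by (intro divide_left_mono power_mono) auto
    also have "\<dots> \<le> ret l" by (rule \<kappa>(2)) (rule l(1))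
    finally have "ennreal (\<kappa> / (real n)\<^sup>2) \<le> pp l 0 0" using first_return_ret(2)[OF l(2)] by (meson ennreal_leI order_trans)
    then have "ennreal p * (ennreal (\<kappa> / (real n)\<^sup>2) * ennreal q) \<le> pp i v 0 * (pp l 0 0 * pp j 0 s)"
      unfolding pq by (intro mult_left_mono mult_right_mono) auto
    also have "\<dots> \<le> pp i v 0 * pp (l + j) 0 s" by (intro mult_left_mono pp_mult_le) auto
    also have "\<dots> \<le> pp n v s" unfolding l(3) by (rule pp_mult_le)
    finally have "ennreal p * (ennreal (\<kappa> / (real n)\<^sup>2) * ennreal q) \<le> pp n v s" .
    moreover have "ennreal p * (ennreal (\<kappa> / (real n)\<^sup>2) * ennreal q) = ennreal (p * \<kappa> * q / (real n)\<^sup>2)"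
      using pq \<kappa>(1) by (simp add: ennreal_mult[symmetric] mult.assoc)
    ultimately show ?thesis by simp
  qed
  moreover have "0 < p * \<kappa> * q" using pq \<kappa>(1) by simp
  ultimately show ?thesis by blast
qed

lemmas pressure = pressure_zero[OF pp_lower]

lemma mixing: "topologically_mixing UNIV adm"
  unfolding topologically_mixing_def
proof (intro ballI)
  fix v s :: nat
  obtain c N where c: "0 < c" "\<And>n. n \<ge> N \<Longrightarrow> ennreal (c / (real n)\<^sup>2) \<le> pp n v s" using pp_lower[of v s] by metis
  have "(v, s) \<in> {(b, c). b \<in> UNIV \<and> c \<in> UNIV \<and> adm b c} ^^ n" if "n \<ge> Suc N" for n
  proof (rule pp_pos_imp_relpow)
    have "0 < ennreal (c / (real n)\<^sup>2)" using c(1) that by simp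
    also have "\<dots> \<le> pp n v s" by (rule c(2)) (use that in simp)
    finally show "0 < pp n v s" .
  qed
  then show "\<exists>N. \<forall>n\<ge>N. (v, s) \<in> {(b, c). b \<in> UNIV \<and> c \<in> UNIV \<and> adm b c} ^^ n" by blast
qed

lemma dual_convergent_state_0: "dual.dual_convergent (indicator (cylinder Om [0]))"
proof (rule dual.dual_convergent_AE_cong[OF dual_convergent_base integrable_indicator_finite[OF sets_cyl cylinder_finite]])
  show "AE x in \<mu>. dens 0 (x 0) = indicator (cylinder Om [0]) x"
    by (intro AE_I2) (auto simp: cylinder_state indicator_def dens_0)
qed simp

text \<open>Divergence of the Green function at 0 is the unboundedness of visits for B = C =
  [0].\<close>

lemma suminf_pp: "(\<Sum>n. pp (Suc n) 0 0) = \<top>"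
proof (rule ccontr)
  assume nt: "(\<Sum>n. pp (Suc n) 0 0) \<noteq> \<top>"
  let ?s = "\<Sum>n. pp n 0 0"
  have s: "?s \<noteq> \<top>" using nt by (simp add: suminf_split_0[of "\<lambda>n. pp n 0 0"] pp_0)
  let ?C = "cylinder Om [0]"
  have C: "emeasure \<mu> ?C = 1" by (simp add: cylinder_state emeasure_state wt_0)
  have "\<exists>n. enn2real ?s < (\<Sum>k<n. measure \<mu> (?C \<inter> ((left_shift ^^ k) -` ?C \<inter> space \<mu>)))"
    by (rule dual.visits_unbounded[OF dual_convergent_state_0]) (simp_all add: sets_cyl C measure_def)
  then obtain n where n: "enn2real ?s < (\<Sum>k<n. measure \<mu> (?C \<inter> ((left_shift ^^ k) -` ?C \<inter> space \<mu>)))" by blast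
  have m: "ennreal (measure \<mu> (?C \<inter> ((left_shift ^^ k) -` ?C \<inter> space \<mu>))) = pp k 0 0" for k
  proof -
    have "?C \<inter> ((left_shift ^^ k) -` ?C \<inter> space \<mu>) = {y\<in>Om. y 0 = 0 \<and> y k = 0}"
      using shift_visits[of _ k 0] by (auto simp: cylinder_state)
    then have e: "emeasure \<mu> (?C \<inter> ((left_shift ^^ k) -` ?C \<inter> space \<mu>)) = pp k 0 0" by (simp add: emeasure_pair wt_0)
    have "pp k 0 0 < \<top>" using pp_le_1[of k 0 0] by (rule le_less_trans) simp
    then show ?thesis unfolding measure_def e by simp
  qed
  have "ennreal (\<Sum>k<n. measure \<mu> (?C \<inter> ((left_shift ^^ k) -` ?C \<inter> space \<mu>))) = (\<Sum>k<n. pp k 0 0)"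
    unfolding m[symmetric] by (rule sum_ennreal[symmetric]) simp
  also have "\<dots> \<le> ?s" by (rule sum_le_suminf) auto
  also have "\<dots> = ennreal (enn2real ?s)" using s by (simp add: less_top[symmetric])
  finally show False using n by (simp add: ennreal_le_iff)
qed

text \<open>The mean return time is infinite by comparison of n * ret n with the harmonic
  series.\<close>

lemma suminf_return: "(\<Sum>n. ennreal (real (Suc n)) * ennreal (ret (Suc n))) = \<top>"
proof (rule ccontr)
  assume nt: "(\<Sum>n. ennreal (real (Suc n)) * ennreal (ret (Suc n))) \<noteq> \<top>"
  have r0: "0 \<le> ret n" for n by (simp add: ret_def)
  have "summable (\<lambda>n. real (Suc n) * ret (Suc n))"
    by (rule summable_suminf_not_top) (use nt r0 in \<open>simp_all add: ennreal_mult\<close>)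
  moreover obtain \<kappa> N where \<kappa>: "0 < \<kappa>" "\<And>n. n \<ge> N \<Longrightarrow> \<kappa> / (real n)\<^sup>2 \<le> ret n" using return_lower unfolding ret_def by metis
  have "norm (\<kappa> * inverse (real (Suc n))) \<le> real (Suc n) * ret (Suc n)" if "n \<ge> N" for n
  proof -
    have "norm (\<kappa> * inverse (real (Suc n))) = real (Suc n) * (\<kappa> / (real (Suc n))\<^sup>2)"
      using \<kappa>(1) by (simp add: power2_eq_square divide_simps)
    also have "\<dots> \<le> real (Suc n) * ret (Suc n)" by (intro mult_left_mono \<kappa>(2)) (use that in auto)
    finally show ?thesis .
  qed
  ultimately have "summable (\<lambda>n. \<kappa> * inverse (real (Suc n)))" by (rule summable_comparison_test')
  then have "summable (\<lambda>n. inverse (real (Suc n)))" using \<kappa>(1) by (simp only: summable_cmult_iff) simp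
  then have "summable (\<lambda>n. inverse (real n))" using summable_Suc_iff[of "\<lambda>n. inverse (real n)"] by simp
  then show False using not_summable_harmonic[where 'a = real] by simp
qed

lemma null_recurrence: "null_recurrent UNIV Om \<phi>"
proof -
  have "(\<Sum>n. partition_sum Om \<phi> (Suc n) 0) = \<infinity>"
    using suminf_pp by (simp add: partition_sum_eq)
  moreover have "(\<Sum>n. ennreal (real (Suc n)) * first_return_sum Om \<phi> (Suc n) 0) = \<infinity>"
    using suminf_return by (simp add: first_return_ret)
  ultimately show ?thesis unfolding null_recurrent_def
    by (auto simp: pressure simp del: of_nat_Suc intro!: exI[of _ 0])
qed

text \<open>If \<mu> were finite, the constant 1 would be integrable and fixed a.e. by the transfer
  operator, and dual ergodicity would make n / a n converge, against a n / n tending to 0.\<close>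

lemma infinite_mass: "emeasure \<mu> (space \<mu>) = \<infinity>"
proof (rule ccontr)
  assume "emeasure \<mu> (space \<mu>) \<noteq> \<infinity>"
  then interpret finite_measure \<mu> by (rule finite_measureI)
  let ?one = "\<lambda>_ :: nat \<Rightarrow> nat. 1 :: real"
  have inv: "(LINT x|\<mu>. t ((left_shift ^^ k) x)) = (LINT x|\<mu>. t x)" if "dual.bounded_test t" for t k
  proof (induction k)
    case (Suc k)
    have m: "(\<lambda>x. t ((left_shift ^^ k) x)) \<in> borel_measurable \<mu>"
      using dual.bounded_test_comp[OF that, of k] by (simp only: dual.bounded_test_def)
    have "(LINT x|\<mu>. t ((left_shift ^^ Suc k) x)) = (LINT x|\<mu>. t ((left_shift ^^ k) (left_shift x)))"
      by (simp add: funpow_swap1)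
    also have "\<dots> = (LINT x|distr \<mu> \<mu> left_shift. t ((left_shift ^^ k) x))"
      by (rule integral_distr[OF dual.T_measurable m, symmetric])
    also have "\<dots> = (LINT x|\<mu>. t x)" using Suc by (simp only: dual.distr_T)
    finally show ?case .
  qed simp
  have "AE x in \<mu>. (dual.op ^^ k) ?one x = 1" for k
    by (rule dual.iter_AE_eqI) (simp_all add: inv)
  then have "AE x in \<mu>. \<forall>k. (dual.op ^^ k) ?one x = 1" by (simp add: AE_all_countable)
  moreover have "AE x in \<mu>. (\<lambda>n. (\<Sum>k<n. (dual.op ^^ k) ?one x) / a n) \<longlonglongrightarrow> (LINT y|\<mu>. ?one y)"
  proof -
    have "integrable \<mu> ?one" by (rule integrable_const)
    then show ?thesis using dual_ergodic unfolding pointwise_dual_ergodic_def by blast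
  qed
  ultimately have "AE x in \<mu>. (\<lambda>n. real n / a n) \<longlonglongrightarrow> (LINT y|\<mu>. ?one y)"
    by eventually_elim simp
  \<comment> \<open>A statement that does not involve the point is true once it holds a.e. for a
    nonzero measure.\<close>
  moreover have "ae_filter \<mu> \<noteq> bot"
  proof -
    have "1 = emeasure \<mu> {y\<in>Om. y 0 = 0}" by (simp add: emeasure_state wt_0)
    also have "\<dots> \<le> emeasure \<mu> (space \<mu>)" by (rule emeasure_space)
    finally have "emeasure \<mu> (space \<mu>) \<noteq> 0" by (metis not_one_le_zero)
    then show ?thesis by (simp add: ae_filter_eq_bot_iff)
  qed
  ultimately have "(\<lambda>n. real n / a n) \<longlonglongrightarrow> (LINT y|\<mu>. ?one y)" by (metis eventually_const)
  then have "(\<lambda>n. real n / a n * (a n / real n)) \<longlonglongrightarrow> (LINT y|\<mu>. ?one y) * 0"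
    by (rule tendsto_mult[OF _ a_over_n_tendsto_0])
  moreover have "\<forall>\<^sub>F n in sequentially. real n / a n * (a n / real n) = 1"
    using eventually_ge_at_top[of 1]
  proof eventually_elim
    case (elim n)
    then show ?case using a_pos[of n] by simp
  qed
  ultimately have "(\<lambda>n :: nat. 1 :: real) \<longlonglongrightarrow> 0" using Lim_transform_eventually by fastforce
  then show False by (simp add: LIMSEQ_const_iff)
qed

lemma rpf: "null_recurrent_rpf \<eta> UNIV Om \<phi> (\<lambda>_. 1) \<mu>"
  using dual_ergodic by (intro rpf_one pressure infinite_mass) (auto simp: pointwise_dual_ergodic_def)

definition "never v = {y\<in>Om. y 0 = v \<and> (\<forall>n\<ge>1. y n \<noteq> 0)}"

lemma sets_never: "never v \<in> sets BB"
proof -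
  have "never v = {y\<in>space BB. y 0 = v \<and> (\<forall>n. n \<ge> 1 \<longrightarrow> y n \<noteq> 0)}" by (auto simp: never_def space_shift_borel eta)
  also have "\<dots> \<in> sets BB" by measurable
  finally show ?thesis .
qed

lemma adm_S: "adm v (S (Suc k)) \<Longrightarrow> v = S k"
  by (cases v rule: state_cases) (auto simp: adm_def Q_S_S Q_D_S split: if_splits)

lemma adm_D: "adm (D (Suc m)) v \<Longrightarrow> v = D m"
  by (cases v rule: state_cases') (auto simp: adm_def Q_D_D Q_D_S split: if_splits)

text \<open>From state 0 the excursions cover almost everything. The only predecessor of S (Suc k)
  is S k, so the shift preimage of \<open>never (S (Suc k))\<close> lies in
  \<open>never (S k)\<close>, and invariance of \<mu> carries nullity up the ray. From a descent
  state the return is certain.\<close>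

lemma never_null: "emeasure \<mu> (never v) = 0"
proof (cases v rule: state_cases)
  case (ray k)
  have "emeasure \<mu> (never (S k)) = 0"
  proof (induction k)
    case 0
    have "AE y in \<mu>. y \<notin> never 0"
      using excursions_cover
    proof eventually_elim
      case (elim y)
      show ?case
      proof
        assume y: "y \<in> never 0"
        then obtain k m where "y \<in> excursion (k, m)" using elim by (auto simp: never_def)
        then have "y (Suc k + m) = D (m - m)" unfolding excursion_iff by blast
        moreover have "y (Suc k + m) \<noteq> 0" using y unfolding never_def by simp
        ultimately show False by simp
      qed
    qed
    moreover have "{y\<in>space \<mu>. y \<in> never 0} = never 0" by (auto simp: never_def)
    ultimately show ?case using AE_iff_measurable[of "never 0" \<mu> "\<lambda>y. y \<notin> never 0"] sets_never by simp
  next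
    case (Suc k)
    have sub: "left_shift -` never (S (Suc k)) \<inter> space \<mu> \<subseteq> never (S k)"
    proof
      fix y assume y: "y \<in> left_shift -` never (S (Suc k)) \<inter> space \<mu>"
      then have y1: "y \<in> Om" "y 1 = S (Suc k)" and later: "\<And>n. n \<ge> 1 \<Longrightarrow> y (Suc n) \<noteq> 0"
        by (auto simp: never_def left_shift_def)
      have "adm (y 0) (S (Suc k))" using y1 by (simp only: Om_iff y1(2)[symmetric] One_nat_def)
      moreover have "y n \<noteq> 0" if "n \<ge> 1" for n
        using that y1(2) later[of "n - 1"] by (cases "n = 1") auto
      ultimately show "y \<in> never (S k)" using y1(1) adm_S by (simp add: never_def)
    qed
    have "emeasure \<mu> (never (S (Suc k))) = emeasure (distr \<mu> \<mu> left_shift) (never (S (Suc k)))"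
      by (simp only: dual.distr_T)
    also have "\<dots> = emeasure \<mu> (left_shift -` never (S (Suc k)) \<inter> space \<mu>)"
      by (rule emeasure_distr) (auto simp: sets_never dual.T_measurable)
    also have "\<dots> \<le> emeasure \<mu> (never (S k))" by (rule emeasure_mono[OF sub]) (simp add: sets_never)
    finally show ?case using Suc by simp
  qed
  then show ?thesis by (simp add: ray)
next
  case (descent m)
  have "y i = D (Suc m - i)" if "y \<in> Om" "y 0 = D (Suc m)" "i \<le> Suc m" for y i
    using that(3)
  proof (induction i)
    case (Suc i)
    have yi: "y i = D (Suc (m - i))" using Suc by (simp add: Suc_diff_le)
    have "adm (y i) (y (Suc i))" using that(1) by (simp add: Om_iff)
    then show ?case using adm_D unfolding yi by simp
  qed (use that in simp)
  then have "y (Suc m) = 0" if "y \<in> Om" "y 0 = D (Suc m)" for y using that by fastforce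
  then have "never v = {}" unfolding never_def descent by (smt (verit) One_nat_def Suc_le_mono empty_Collect_eq le0)
  then show ?thesis by simp
qed

lemma return_finite: "AE y in \<mu>. rtime y < \<infinity>"
proof -
  have "AE y in \<mu>. \<forall>v. y \<notin> never v"
    unfolding AE_all_countable using never_null sets_never by (auto intro!: AE_not_in simp: null_sets_def)
  moreover have "AE y in \<mu>. y \<in> Om" by (rule AE_I2) simp
  ultimately show ?thesis
  proof eventually_elim
    case (elim y)
    then obtain n where "n \<ge> 1" "y n = 0" by (auto simp: never_def)
    then show ?case using return_time_Least[OF elim(2), of n 0] by simp
  qed
qed

lemma S_in_Om: "S \<in> Om"
  by (simp add: Om_iff adm_def Q_S_S b_pos)

text \<open>The ray starts at 0 and never comes back, so the last visit has index 0 and the shift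
  power in the final statement is the identity.\<close>

lemma visits_ray: "{k. (left_shift ^^ k) S \<in> cylinder Om [0]} = {0}"
  by (auto simp: shift_visits[OF S_in_Om])

abbreviation "prefix_cyl n \<equiv> cylinder Om (map S [0..<n])"

text \<open>A word of n + 1 symbols S 0, ..., S n says that the exit index is at least n, hence the
  successor in the cylinder length.\<close>

lemma emeasure_prefix:
  "emeasure \<mu> (prefix_cyl (Suc n) \<inter> {y\<in>Om. R (rtime y)}) = emeasure w {(k, m). n \<le> k \<and> R (enat (k + m + 1))}"
proof -
  have "rtime -` {r. R r} \<inter> space BB \<in> sets BB" by (rule measurable_sets[OF return_measurable]) simp
  moreover have "rtime -` {r. R r} \<inter> space BB = {y\<in>Om. R (rtime y)}" by (auto simp: space_shift_borel eta)
  ultimately have E: "prefix_cyl (Suc n) \<inter> {y\<in>Om. R (rtime y)} \<in> sets BB" by (simp add: sets_cyl sets.Int)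
  have "y \<in> prefix_cyl (Suc n) \<longleftrightarrow> n \<le> k" if y: "y \<in> excursion (k, m)" for y k m
  proof
    assume p: "y \<in> prefix_cyl (Suc n)"
    show "n \<le> k"
    proof (rule ccontr)
      assume "\<not> n \<le> k"
      then have "y (Suc k) = S (Suc k)" using p by (simp add: cylinder_map del: upt_Suc)
      then show False using excursion_after[OF y] by simp
    qed
  next
    assume "n \<le> k"
    then show "y \<in> prefix_cyl (Suc n)" using y by (simp add: cylinder_map excursion_iff del: upt_Suc)
  qed
  moreover have "y \<in> Om" if "y \<in> excursion (k, m)" for y k m using that by (simp add: excursion_iff)
  ultimately have "emeasure \<mu> ((prefix_cyl (Suc n) \<inter> {y\<in>Om. R (rtime y)}) \<inter> {y\<in>Om. y 0 = 0})
      = emeasure w {(k, m). n \<le> k \<and> R (enat (k + m + 1))}"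
    by (intro excursion_law[OF E]) (simp add: return_excursion)
  moreover have "prefix_cyl (Suc n) \<subseteq> {y\<in>Om. y 0 = 0}"
    by (auto simp: cylinder_map simp del: upt_Suc dest: spec[of _ 0])
  then have "(prefix_cyl (Suc n) \<inter> {y\<in>Om. R (rtime y)}) \<inter> {y\<in>Om. y 0 = 0} = prefix_cyl (Suc n) \<inter> {y\<in>Om. R (rtime y)}"
    by blast
  ultimately show ?thesis by simp
qed

lemma emeasure_prefix_cyl: "emeasure \<mu> (prefix_cyl (Suc n)) = ennreal (b n)"
proof -
  have "prefix_cyl (Suc n) \<inter> {y\<in>Om. True} = prefix_cyl (Suc n)" by (auto simp: cylinder_def)
  then show ?thesis using emeasure_prefix[of n "\<lambda>_. True"] by (simp add: b_def measure_pmf.emeasure_eq_measure del: upt_Suc)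
qed

lemma return_law:
  "cdf (distr (uniform_measure \<mu> (prefix_cyl (Suc n))) borel
      (\<lambda>y. scaling a (measure \<mu> (prefix_cyl (Suc n))) * real_of_ereal (ereal_of_enat (rtime y)))) x
    = measure w {(k, m). n \<le> k \<and> scaling a (b n) * real (k + m + 1) \<le> x} / b n"
proof -
  have mb: "measure \<mu> (prefix_cyl (Suc n)) = b n"
    using b_pos[of n] by (simp add: measure_def emeasure_prefix_cyl del: upt_Suc)
  let ?R = "\<lambda>r. scaling a (b n) * real_of_ereal (ereal_of_enat r)"
  have me: "(\<lambda>y. ?R (rtime y)) \<in> borel_measurable BB"
    by (rule measurable_compose[OF return_measurable]) simp
  then have "(\<lambda>y. ?R (rtime y)) -` {..x} \<inter> space BB \<in> sets BB" by (rule measurable_sets) simp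
  moreover have "(\<lambda>y. ?R (rtime y)) -` {..x} \<inter> space BB = {y\<in>Om. ?R (rtime y) \<le> x}"
    by (auto simp: space_shift_borel eta)
  ultimately have E: "{y\<in>Om. ?R (rtime y) \<le> x} \<in> sets \<mu>" by simp
  have mu: "(\<lambda>y. ?R (rtime y)) \<in> borel_measurable (uniform_measure \<mu> (prefix_cyl (Suc n)))"
    using me by (simp add: measurable_cong_sets[OF sets_uniform_measure refl] cong: measurable_cong_sets)
  have "cdf (distr (uniform_measure \<mu> (prefix_cyl (Suc n))) borel (\<lambda>y. ?R (rtime y))) x
      = measure (uniform_measure \<mu> (prefix_cyl (Suc n))) {y\<in>Om. ?R (rtime y) \<le> x}"
    unfolding cdf_def by (subst measure_distr[OF mu]) (auto intro!: arg_cong2[where f = measure])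
  also have "\<dots> = measure \<mu> (prefix_cyl (Suc n) \<inter> {y\<in>Om. ?R (rtime y) \<le> x}) / b n"
    using b_pos[of n] by (subst measure_uniform_measure) (use E in \<open>simp_all add: emeasure_prefix_cyl mb del: upt_Suc\<close>)
  also have "measure \<mu> (prefix_cyl (Suc n) \<inter> {y\<in>Om. ?R (rtime y) \<le> x})
      = measure w {(k, m). n \<le> k \<and> scaling a (b n) * real (k + m + 1) \<le> x}"
    unfolding measure_def emeasure_prefix[of n "\<lambda>r. ?R r \<le> x"] by simp
  finally show ?thesis unfolding mb .
qed

end

theorem proposition5p2:
  fixes \<alpha> \<eta> :: real and \<nu> :: "real measure" and a :: "nat \<Rightarrow> real"
  assumes "0 < \<alpha>" and "\<alpha> < 1"
    and "0 < \<eta>" and "\<eta> < 1"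
    and "\<nu> \<in> limit_laws \<alpha>"
    and "\<forall>n\<ge>1. a n > 0"
    and "regularly_varying \<alpha> (step_extension a)"
  shows "\<exists>(V :: nat set) A \<phi> h m x.
    let \<Omega> = shift_space V A;
        \<mu> = density m (\<lambda>y. ennreal (h y));
        B = (\<lambda>n. cylinder \<Omega> (map x [0..<n]));
        C = cylinder \<Omega> [x 0];
        j = Max {k. (left_shift ^^ k) x \<in> C};
        r = (\<lambda>y. return_time left_shift C ((left_shift ^^ j) y))
    in infinite V \<and> topologically_mixing V A \<and>
       \<phi> \<in> borel_measurable (shift_borel \<eta> \<Omega>) \<and> walters \<Omega> \<phi> \<and>
       has_gurevich_pressure V \<Omega> \<phi> (gurevich_pressure V \<Omega> \<phi>) \<and>
       gurevich_pressure V \<Omega> \<phi> < \<infinity> \<and>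
       null_recurrent V \<Omega> \<phi> \<and>
       null_recurrent_rpf \<eta> V \<Omega> \<phi> h m \<and>
       pointwise_dual_ergodic \<mu> left_shift a \<and>
       x \<in> \<Omega> \<and> finite {k. (left_shift ^^ k) x \<in> C} \<and>
       (AE y in \<mu>. r y < \<infinity>) \<and>
       weak_conv_m
         (\<lambda>n. distr (uniform_measure \<mu> (B n)) borel
                (\<lambda>y. scaling a (measure \<mu> (B n)) * real_of_ereal (ereal_of_enat (r y))))
         \<nu>"
proof -
  interpret regularly_varying_seq a \<alpha> using assms by unfold_locales auto
  obtain w :: "(nat \<times> nat) pmf" where w:
    "\<And>n. measure w {(k, m). n \<le> k} > 0"
    "\<exists>m0. \<forall>m\<ge>m0. pmf w (0, m) > 0"
    "\<exists>\<kappa>>0. \<exists>N. \<forall>n\<ge>N. \<kappa> / (real n)\<^sup>2 \<le> measure w {(k, m). k + m + 1 = n}"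
    "(\<lambda>n. a n * measure w {(k, m). n < k + m + 1}) \<longlonglongrightarrow> sin (pi * \<alpha>) / (pi * \<alpha>)"
    and law: "\<And>x. isCont (cdf \<nu>) x \<Longrightarrow> (\<lambda>n. measure w {(k, m). n \<le> k \<and>
        scaling a (measure w {(k, m). n \<le> k}) * real (k + m + 1) \<le> x} / measure w {(k, m). n \<le> k}) \<longlonglongrightarrow> cdf \<nu> x"
    by (rule exists_excursion_law[OF \<open>\<nu> \<in> limit_laws \<alpha>\<close>]) (rule that)
  interpret excursion_chain a \<alpha> w \<eta>
    by (intro excursion_chain.intro excursion_chain_axioms.intro regularly_varying_seq_axioms w \<open>0 < \<eta>\<close> \<open>\<eta> < 1\<close>)
  have Om: "shift_space UNIV adm = Om" by (simp add: Om_def)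
  have dens: "density \<mu> (\<lambda>y. ennreal 1) = \<mu>" by (simp add: density_1)
  have weak: "weak_conv_m
      (\<lambda>n. distr (uniform_measure \<mu> (prefix_cyl n)) borel
        (\<lambda>y. scaling a (measure \<mu> (prefix_cyl n)) * real_of_ereal (ereal_of_enat (rtime y)))) \<nu>"
    unfolding weak_conv_m_def weak_conv_def
  proof (intro allI impI)
    fix x assume x: "isCont (cdf \<nu>) x"
    show "(\<lambda>n. cdf (distr (uniform_measure \<mu> (prefix_cyl n)) borel
        (\<lambda>y. scaling a (measure \<mu> (prefix_cyl n)) * real_of_ereal (ereal_of_enat (rtime y)))) x) \<longlonglongrightarrow> cdf \<nu> x"
      \<comment> \<open>Cylinders of length Suc n correspond to K \<ge> n; the shift also skips the
        empty word at n = 0, whose cylinder is the whole space.\<close>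
      by (rule LIMSEQ_imp_Suc, unfold return_law b_def, rule law, rule x)
  qed
  show ?thesis
    unfolding Let_def
  \<comment> \<open>The eigenfunction is the constant 1, so the eigenmeasure is itself the invariant
    measure, and the chosen point is the ray.\<close>
  proof (rule exI[of _ UNIV], rule exI[of _ adm], rule exI[of _ \<phi>], rule exI[of _ "\<lambda>_. 1"], rule exI[of _ \<mu>], rule exI[of _ S],
      unfold Om dens visits_ray Max_singleton funpow_0 S_0, intro conjI)
    show "has_gurevich_pressure UNIV Om \<phi> (gurevich_pressure UNIV Om \<phi>)" unfolding pressure(2) by (rule pressure(1))
    show "gurevich_pressure UNIV Om \<phi> < \<infinity>" unfolding pressure(2) by simp
  qed (rule infinite_UNIV_nat mixing \<phi>_measurable walters_\<phi> null_recurrence rpf dual_ergodic S_in_Om finite.intros return_finite weak)+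
qed

end
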